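(* Let $\mathcal X$, $\mathcal K$, $\mathcal K^\circ$ be as in the context. (i) Let $\alpha:\mathcal X\to\bar L^0$ be an upper semicontinuous conditional assessment index. Then $\alpha$ has the robust representation $$\alpha(X)=\operatorname*{ess\,inf}_{X^*\in\mathcal K^\circ}R\big(X^*,\langle X^*,X\rangle\big),\qquad X\in\mathcal X,$$ for a unique conditional minimal risk function $R\in\mathcal R^{\min}$. (ii) For any conditional risk function $R:\mathcal K^\circ\times\bar L^0\to\bar L^0$, the map $X\mapsto \operatorname*{ess\,inf}_{X^*\in\mathcal K^\circ}R(X^*,\langle X^*,X\rangle)$ defines an upper semicontinuous conditional assessment index on $\mathcal X$.
   Context: Let $(\Omega,\mathscr G,P)$ be a probability space. $L^0$ and $\bar L^0$ are the spaces of $\mathscr G$-measurable random variables with values in $(-\infty,\infty)$ and $[-\infty,\infty]$, identified when $P$-a.s. equal; (in)equalities are $P$-a.s. (so $n<m$ means $P[n<m]=1$; "on $A$" means a.s. on $A$). $L^0_+=\{m\in L^0:m\ge0\}$, $L^0_{++}=\{m\in L^0: m>0\}$. Conventions: $\infty-\infty:=-\infty$, $0\cdot(\pm\infty)=0$. $L^0$ carries the topology induced by the balls $B_\varepsilon(m)=\{n\in L^0:|m-n|\le\varepsilon\}$, $\varepsilon\in L^0_{++}$. $[A_i]\subseteq\mathscr G$ denotes a countable measurable partition of $\Omega$. $\mathcal X$ is a locally $L^0$-convex topological $L^0$-module: an $L^0$-module with a topology making addition and scalar multiplication continuous and having a neighborhood base of $0$ of sets $U$ that are $L^0$-convex, $L^0$-absorbent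 (for every $X$ there is $\lambda\in L^0_{++}$ with $X\in\lambda U$) and $L^0$-balanced ($\lambda X\in U$ for $X\in U$, $\lambda\in L^0$, $|\lambda|\le1$). It is assumed that $\mathcal X$ is $\sigma$-stable: for every $[A_i]\subseteq\mathscr G$ and $(X_i)\subseteq\mathcal X$ there is a unique element $\sum1_{A_i}X_i\in\mathcal X$ with $1_{A_j}\sum_i1_{A_i}X_i=1_{A_j}X_j$ for all $j$; and that the set of neighborhoods of $0$ is $\sigma$-stable (closed under $(U_i)\mapsto\sum1_{A_i}U_i$). A set $\mathcal C$ is $L^0$-convex if $\lambda X+(1-\lambda)Y\in\mathcal C$ for $X,Y\in\mathcal C$, $\lambda\in L^0$, $0\le\lambda\le1$. $\mathcal K\subseteq\mathcal X$ is a closed $L^0$-convex cone ($\lambda X\in\mathcal K$ for $\lambda\in L^0_{++}$, $X\in\mathcal K$) containing $0$; $X\succcurlyeq Y$ means $X-Y\in\mathcal K$. $\mathcal X^*$ is the set of continuous $L^0$-linear maps $\mathcal X\to L^0$, $\langle X^*,X\rangle:=X^*(X)$, with the topology $L^0$-$\sigma(\mathcal X^*,\mathcal X)$ generated by the neighborhoods of $0$ $\{X^*:\sup_{X\in\mathcal A}|\langle X^*,X\rangle|\le\varepsilon\}$, $\mathcal A\subseteq\mathcal X$ finite, $\varepsilon\in L^0_{++}$. The polar cone is $\mathcal K^\circ=\{X^*\in\mathcal X^*:\langle X^*,X\rangle\ge0\text{ for all }X\in\mathcal K\}$. A conditional assessment index is a function $\alpha:\mathcal X\to\bar L^0$ that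 is local ($\alpha(1_AX+1_{A^c}Y)=1_A\alpha(X)+1_{A^c}\alpha(Y)$, $A\in\mathscr G$), quasiconcave ($\alpha(\lambda X+(1-\lambda)Y)\ge\alpha(X)\wedge\alpha(Y)$ for $\lambda\in L^0$, $0\le\lambda\le1$) and monotone ($\alpha(X)\ge\alpha(Y)$ if $X\succcurlyeq Y$). It is upper semicontinuous if $\{X:\alpha(X)\ge m\}$ is closed for all $m\in\bar L^0$. For a local increasing $F:\bar L^0\to\bar L^0$, its left- and right-continuous versions are, with $\widetilde A_m=\{m>-\infty\}$, $\widetilde B_m=\{m<\infty\}$, $$F^-(m)=1_{\widetilde A_m}\operatorname{ess\,sup}\{F(n):n\in\bar L^0,\ n<m\text{ on }\widetilde A_m\}-1_{\widetilde A_m^c}\infty,$$ $$F^+(m)=1_{\widetilde B_m}\operatorname{ess\,inf}\{F(n):n\in\bar L^0,\ n>m\text{ on }\widetilde B_m\}+1_{\widetilde B_m^c}\infty;$$ $F$ is right-continuous if $F=F^+$. A conditional risk function is a function $R:\mathcal K^\circ\times\bar L^0\to\bar L^0$ such that (i) it is jointly local: $R(1_AX^*+1_{A^c}Y^*,1_As+1_{A^c}t)=1_AR(X^*,s)+1_{A^c}R(Y^*,t)$; (ii) $s\mapsto R(X^*,s)$ is increasing and right-continuous for each $X^*\in\mathcal K^\circ$. It is minimal if moreover (iii) it is jointly quasiconvex (in the $L^0$-sense) and $R(\lambda X^*,s)=R(X^*,s/\lambda)$ for all $\lambda\in L^0_{++}$; (iv) $\operatorname{ess\,sup}_{s\in L^0}R(X^*,s)=\operatorname{ess\,sup}_{s\in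 L^0}R(Y^*,s)$ for all $X^*,Y^*\in\mathcal K^\circ$; (v) the left-continuous version in the second argument $R^-(X^*,s)$ is jointly lower semicontinuous, i.e. $\{(X^*,s)\in\mathcal K^\circ\times L^0:R^-(X^*,s)\le m\}$ is closed for all $m\in\bar L^0$. $\mathcal R^{\min}$ is the set of conditional minimal risk functions.
   Formalization: In (i) the neighborhood base of 0 is assumed to consist of sets that are themselves σ-stable, and R is claimed unique only off the event {X*=0, s<0}; without these changes existence and uniqueness, respectively, can fail. Part (ii) is unchanged. *)

theory Defs
  imports "HOL-Probability.Probability" "HOL-Algebra.Module"
begin

section \<open>Random variables modulo almost sure equality\<close>

text \<open>
  Both spaces of random variables live on one type of equivalence classes of Borel functions with
  values in \<open>ereal\<close>, so that the finite ones are literally a subset of the extended ones.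
\<close>

type_synonym 'w rv = "('w \<Rightarrow> ereal) set"

definition ae_rel :: "'w measure \<Rightarrow> (('w \<Rightarrow> ereal) \<times> ('w \<Rightarrow> ereal)) set" where
  "ae_rel M = {(f, g). f \<in> borel_measurable M \<and> g \<in> borel_measurable M \<and> (AE \<omega> in M. f \<omega> = g \<omega>)}"

definition cls :: "'w measure \<Rightarrow> ('w \<Rightarrow> ereal) \<Rightarrow> 'w rv" where
  "cls M f = ae_rel M `` {f}"

definition rep :: "'w rv \<Rightarrow> 'w \<Rightarrow> ereal" where
  "rep m = (SOME f. f \<in> m)"

text \<open>
  Suprema and infima in this ordered set (\<open>\<Squnion>\<close>, \<open>\<Sqinter>\<close>) are the essential suprema and infima of
  families of extended random variables; binary ones are the almost sure maximum and minimum.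
\<close>

definition barL0 :: "'w measure \<Rightarrow> 'w rv gorder" where
  "barL0 M = \<lparr>carrier = borel_measurable M // ae_rel M, eq = (=),
     le = (\<lambda>m n. AE \<omega> in M. rep m \<omega> \<le> rep n \<omega>)\<rparr>"

definition lift2 :: "'w measure \<Rightarrow> (ereal \<Rightarrow> ereal \<Rightarrow> ereal) \<Rightarrow> 'w rv \<Rightarrow> 'w rv \<Rightarrow> 'w rv" where
  "lift2 M h m n = cls M (\<lambda>\<omega>. h (rep m \<omega>) (rep n \<omega>))"

text \<open>Addition with the convention \<open>\<infinity> - \<infinity> = - \<infinity>\<close> (the library has \<open>\<infinity> + (- \<infinity>) = \<infinity>\<close>).\<close>

definition eplus :: "ereal \<Rightarrow> ereal \<Rightarrow> ereal" where
  "eplus x y = (if x = - \<infinity> \<or> y = - \<infinity> then - \<infinity> else x + y)"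

text \<open>
  The ring operations are defined on all extended random variables and are applied to these as well;
  only the carrier is restricted to the almost surely finite ones.
\<close>

definition L0 :: "'w measure \<Rightarrow> 'w rv ring" where
  "L0 M = \<lparr>carrier = {m \<in> carrier (barL0 M). AE \<omega> in M. \<bar>rep m \<omega>\<bar> \<noteq> \<infinity>},
     mult = lift2 M (*), one = cls M (\<lambda>_. 1), zero = cls M (\<lambda>_. 0), add = lift2 M eplus\<rparr>"

definition L0_pos :: "'w measure \<Rightarrow> 'w rv set" where
  "L0_pos M = {m \<in> carrier (L0 M). AE \<omega> in M. 0 < rep m \<omega>}"

definition L0_unit_interval :: "'w measure \<Rightarrow> 'w rv set" where
  "L0_unit_interval M = {m \<in> carrier (L0 M). AE \<omega> in M. 0 \<le> rep m \<omega> \<and> rep m \<omega> \<le> 1}"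

definition ind :: "'w measure \<Rightarrow> 'w set \<Rightarrow> 'w rv" where
  "ind M A = cls M (indicator A)"

definition L0_ball :: "'w measure \<Rightarrow> 'w rv \<Rightarrow> 'w rv \<Rightarrow> 'w rv set" where
  "L0_ball M \<epsilon> m = {n \<in> carrier (L0 M). AE \<omega> in M. \<bar>rep m \<omega> - rep n \<omega>\<bar> \<le> rep \<epsilon> \<omega>}"

definition L0_topology :: "'w measure \<Rightarrow> 'w rv topology" where
  "L0_topology M = topology (\<lambda>U. U \<subseteq> carrier (L0 M) \<and> (\<forall>m\<in>U. \<exists>\<epsilon>\<in>L0_pos M. L0_ball M \<epsilon> m \<subseteq> U))"

definition rv_glue :: "'w measure \<Rightarrow> 'w set \<Rightarrow> 'w rv \<Rightarrow> 'w rv \<Rightarrow> 'w rv" where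
  "rv_glue M A m n =
     (ind M A \<otimes>\<^bsub>L0 M\<^esub> m) \<oplus>\<^bsub>L0 M\<^esub> (ind M (space M - A) \<otimes>\<^bsub>L0 M\<^esub> n)"

definition rv_comb :: "'w measure \<Rightarrow> 'w rv \<Rightarrow> 'w rv \<Rightarrow> 'w rv \<Rightarrow> 'w rv" where
  "rv_comb M l m n = (l \<otimes>\<^bsub>L0 M\<^esub> m) \<oplus>\<^bsub>L0 M\<^esub> ((\<one>\<^bsub>L0 M\<^esub> \<ominus>\<^bsub>L0 M\<^esub> l) \<otimes>\<^bsub>L0 M\<^esub> n)"

definition left_version :: "'w measure \<Rightarrow> ('w rv \<Rightarrow> 'w rv) \<Rightarrow> 'w rv \<Rightarrow> 'w rv" where
  "left_version M F m = rv_glue M {\<omega> \<in> space M. - \<infinity> < rep m \<omega>}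
     (\<Squnion>\<^bsub>barL0 M\<^esub> {F n | n. n \<in> carrier (barL0 M) \<and>
        (AE \<omega> in M. - \<infinity> < rep m \<omega> \<longrightarrow> rep n \<omega> < rep m \<omega>)})
     (cls M (\<lambda>_. - \<infinity>))"

definition right_version :: "'w measure \<Rightarrow> ('w rv \<Rightarrow> 'w rv) \<Rightarrow> 'w rv \<Rightarrow> 'w rv" where
  "right_version M F m = rv_glue M {\<omega> \<in> space M. rep m \<omega> < \<infinity>}
     (\<Sqinter>\<^bsub>barL0 M\<^esub> {F n | n. n \<in> carrier (barL0 M) \<and>
        (AE \<omega> in M. rep m \<omega> < \<infinity> \<longrightarrow> rep m \<omega> < rep n \<omega>)})
     (cls M (\<lambda>_. \<infinity>))"


section \<open>Locally convex modules over the ring of random variables\<close>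

definition countable_partition :: "'w measure \<Rightarrow> (nat \<Rightarrow> 'w set) \<Rightarrow> bool" where
  "countable_partition M A \<longleftrightarrow>
     range A \<subseteq> sets M \<and> disjoint_family A \<and> (\<Union>i. A i) = space M"

definition mod_glue ::
  "'w measure \<Rightarrow> ('w rv, 'x, 'e) module_scheme \<Rightarrow> 'w set \<Rightarrow> 'x \<Rightarrow> 'x \<Rightarrow> 'x" where
  "mod_glue M V A x y = (ind M A \<odot>\<^bsub>V\<^esub> x) \<oplus>\<^bsub>V\<^esub> (ind M (space M - A) \<odot>\<^bsub>V\<^esub> y)"

definition mod_comb ::
  "'w measure \<Rightarrow> ('w rv, 'x, 'e) module_scheme \<Rightarrow> 'w rv \<Rightarrow> 'x \<Rightarrow> 'x \<Rightarrow> 'x" where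
  "mod_comb M V l x y = (l \<odot>\<^bsub>V\<^esub> x) \<oplus>\<^bsub>V\<^esub> ((\<one>\<^bsub>L0 M\<^esub> \<ominus>\<^bsub>L0 M\<^esub> l) \<odot>\<^bsub>V\<^esub> y)"

definition is_concat ::
  "'w measure \<Rightarrow> ('w rv, 'x, 'e) module_scheme \<Rightarrow> (nat \<Rightarrow> 'w set) \<Rightarrow> (nat \<Rightarrow> 'x) \<Rightarrow> 'x \<Rightarrow> bool" where
  "is_concat M V A X x \<longleftrightarrow>
     x \<in> carrier V \<and> (\<forall>j. ind M (A j) \<odot>\<^bsub>V\<^esub> x = ind M (A j) \<odot>\<^bsub>V\<^esub> X j)"

definition concat_sets ::
  "'w measure \<Rightarrow> ('w rv, 'x, 'e) module_scheme \<Rightarrow> (nat \<Rightarrow> 'w set) \<Rightarrow> (nat \<Rightarrow> 'x set) \<Rightarrow> 'x set" where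
  "concat_sets M V A U = {x. \<exists>X. (\<forall>i. X i \<in> U i) \<and> is_concat M V A X x}"

definition L0_convex :: "'w measure \<Rightarrow> ('w rv, 'x, 'e) module_scheme \<Rightarrow> 'x set \<Rightarrow> bool" where
  "L0_convex M V C \<longleftrightarrow> C \<subseteq> carrier V \<and>
     (\<forall>x\<in>C. \<forall>y\<in>C. \<forall>l\<in>L0_unit_interval M. mod_comb M V l x y \<in> C)"

definition L0_absorbent :: "'w measure \<Rightarrow> ('w rv, 'x, 'e) module_scheme \<Rightarrow> 'x set \<Rightarrow> bool" where
  "L0_absorbent M V U \<longleftrightarrow> (\<forall>x\<in>carrier V. \<exists>l\<in>L0_pos M. \<exists>u\<in>U. x = l \<odot>\<^bsub>V\<^esub> u)"

definition L0_balanced :: "'w measure \<Rightarrow> ('w rv, 'x, 'e) module_scheme \<Rightarrow> 'x set \<Rightarrow> bool" where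
  "L0_balanced M V U \<longleftrightarrow>
     (\<forall>x\<in>U. \<forall>l\<in>carrier (L0 M). (AE \<omega> in M. \<bar>rep l \<omega>\<bar> \<le> 1) \<longrightarrow> l \<odot>\<^bsub>V\<^esub> x \<in> U)"

definition nbhds_zero :: "('w rv, 'x, 'e) module_scheme \<Rightarrow> 'x topology \<Rightarrow> 'x set set" where
  "nbhds_zero V T = {U. U \<subseteq> carrier V \<and> (\<exists>W. openin T W \<and> \<zero>\<^bsub>V\<^esub> \<in> W \<and> W \<subseteq> U)}"

locale locally_L0_convex_module = prob_space M + Module.module "L0 M" V
  for M :: "'w measure" and V :: "('w rv, 'x, 'e) module_scheme" +
  fixes T :: "'x topology"
  assumes topspace_T: "topspace T = carrier V"
    and add_continuous:
      "continuous_map (prod_topology T T) T (\<lambda>(x, y). x \<oplus>\<^bsub>V\<^esub> y)"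
    and smult_continuous:
      "continuous_map (prod_topology (L0_topology M) T) T (\<lambda>(l, x). l \<odot>\<^bsub>V\<^esub> x)"
    and convex_base:
      "\<And>W. W \<in> nbhds_zero V T \<Longrightarrow> \<exists>U\<in>nbhds_zero V T. U \<subseteq> W \<and>
         L0_convex M V U \<and> L0_absorbent M V U \<and> L0_balanced M V U"

locale sigma_stable_module = locally_L0_convex_module +
  assumes concat_ex1:
      "\<And>A X. countable_partition M A \<Longrightarrow> (\<And>i. X i \<in> carrier V) \<Longrightarrow> \<exists>!x. is_concat M V A X x"
    and nbhds_concat:
      "\<And>A U. countable_partition M A \<Longrightarrow> (\<And>i. U i \<in> nbhds_zero V T) \<Longrightarrow>
         concat_sets M V A U \<in> nbhds_zero V T"

text \<open>
  Stability of the system of neighborhoods (\<open>nbhds_concat\<close>) does not make small neighborhoods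
  stable as sets. Strict separation of points from closed convex sets by continuous functionals
  needs the base to consist of sets that are themselves closed under countable concatenation: if
  \<open>M\<close> has no atoms, the module of finite random variables carries a locally \<open>L0\<close>-convex Hausdorff
  topology that satisfies \<open>sigma_stable_module\<close> but has dual zero. Its neighborhoods of zero are
  generated by the sets of all \<open>x\<close> with \<open>\<bar>x\<bar> \<le> \<epsilon>\<close> off some member of an increasing sequence of
  events that exhausts the space.
\<close>

definition has_sigma_stable_base ::
  "'w measure \<Rightarrow> ('w rv, 'x, 'e) module_scheme \<Rightarrow> 'x topology \<Rightarrow> bool" where
  "has_sigma_stable_base M V T \<longleftrightarrow>
     (\<forall>W\<in>nbhds_zero V T. \<exists>U\<in>nbhds_zero V T. U \<subseteq> W \<and>
        L0_convex M V U \<and> L0_absorbent M V U \<and> L0_balanced M V U \<and>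
        (\<forall>A. countable_partition M A \<longrightarrow> concat_sets M V A (\<lambda>_. U) \<subseteq> U))"

definition closed_L0_convex_cone ::
  "'w measure \<Rightarrow> ('w rv, 'x, 'e) module_scheme \<Rightarrow> 'x topology \<Rightarrow> 'x set \<Rightarrow> bool" where
  "closed_L0_convex_cone M V T K \<longleftrightarrow> closedin T K \<and> L0_convex M V K \<and> \<zero>\<^bsub>V\<^esub> \<in> K \<and>
     (\<forall>l\<in>L0_pos M. \<forall>x\<in>K. l \<odot>\<^bsub>V\<^esub> x \<in> K)"

text \<open>The ring multiplication and unit of the record play no role for a module.\<close>

definition dual_module ::
  "'w measure \<Rightarrow> ('w rv, 'x, 'e) module_scheme \<Rightarrow> 'x topology \<Rightarrow> ('w rv, 'x \<Rightarrow> 'w rv) module" where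
  "dual_module M V T =
     \<lparr>carrier = {f \<in> carrier V \<rightarrow>\<^sub>E carrier (L0 M).
        (\<forall>x\<in>carrier V. \<forall>y\<in>carrier V. f (x \<oplus>\<^bsub>V\<^esub> y) = f x \<oplus>\<^bsub>L0 M\<^esub> f y) \<and>
        (\<forall>l\<in>carrier (L0 M). \<forall>x\<in>carrier V. f (l \<odot>\<^bsub>V\<^esub> x) = l \<otimes>\<^bsub>L0 M\<^esub> f x) \<and>
        continuous_map T (L0_topology M) f},
      mult = undefined, one = undefined,
      zero = (\<lambda>x\<in>carrier V. \<zero>\<^bsub>L0 M\<^esub>),
      add = (\<lambda>f g. \<lambda>x\<in>carrier V. f x \<oplus>\<^bsub>L0 M\<^esub> g x),
      smult = (\<lambda>l f. \<lambda>x\<in>carrier V. l \<otimes>\<^bsub>L0 M\<^esub> f x)\<rparr>"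

text \<open>
  The basic neighborhoods are the translates to \<open>f\<close> of \<open>{g. sup\<^bsub>x \<in> F\<^esub> \<bar>g x\<bar> \<le> \<epsilon>}\<close>, with the finite
  supremum written out.
\<close>

definition weak_dual_topology ::
  "'w measure \<Rightarrow> ('w rv, 'x, 'e) module_scheme \<Rightarrow> 'x topology \<Rightarrow> ('x \<Rightarrow> 'w rv) topology" where
  "weak_dual_topology M V T = topology (\<lambda>W. W \<subseteq> carrier (dual_module M V T) \<and>
     (\<forall>f\<in>W. \<exists>F \<epsilon>. finite F \<and> F \<subseteq> carrier V \<and> \<epsilon> \<in> L0_pos M \<and>
        {g \<in> carrier (dual_module M V T). \<forall>x\<in>F. g x \<in> L0_ball M \<epsilon> (f x)} \<subseteq> W))"

definition polar ::
  "'w measure \<Rightarrow> ('w rv, 'x, 'e) module_scheme \<Rightarrow> 'x topology \<Rightarrow> 'x set \<Rightarrow> ('x \<Rightarrow> 'w rv) set" where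
  "polar M V T K =
     {f \<in> carrier (dual_module M V T). \<forall>x\<in>K. \<zero>\<^bsub>L0 M\<^esub> \<sqsubseteq>\<^bsub>barL0 M\<^esub> f x}"


section \<open>Assessment indices and risk functions\<close>

definition assessment_index ::
  "'w measure \<Rightarrow> ('w rv, 'x, 'e) module_scheme \<Rightarrow> 'x set \<Rightarrow> ('x \<Rightarrow> 'w rv) \<Rightarrow> bool" where
  "assessment_index M V K \<alpha> \<longleftrightarrow>
     \<alpha> \<in> carrier V \<rightarrow> carrier (barL0 M) \<and>
     (\<forall>A\<in>sets M. \<forall>x\<in>carrier V. \<forall>y\<in>carrier V.
        \<alpha> (mod_glue M V A x y) = rv_glue M A (\<alpha> x) (\<alpha> y)) \<and>
     (\<forall>x\<in>carrier V. \<forall>y\<in>carrier V. \<forall>l\<in>L0_unit_interval M.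
        \<alpha> x \<sqinter>\<^bsub>barL0 M\<^esub> \<alpha> y \<sqsubseteq>\<^bsub>barL0 M\<^esub> \<alpha> (mod_comb M V l x y)) \<and>
     (\<forall>x\<in>carrier V. \<forall>y\<in>carrier V. x \<ominus>\<^bsub>V\<^esub> y \<in> K \<longrightarrow> \<alpha> y \<sqsubseteq>\<^bsub>barL0 M\<^esub> \<alpha> x)"

definition upper_semicont ::
  "'w measure \<Rightarrow> 'x topology \<Rightarrow> ('x \<Rightarrow> 'w rv) \<Rightarrow> bool" where
  "upper_semicont M T \<alpha> \<longleftrightarrow>
     (\<forall>m\<in>carrier (barL0 M). closedin T {x \<in> topspace T. m \<sqsubseteq>\<^bsub>barL0 M\<^esub> \<alpha> x})"

definition risk_function ::
  "'w measure \<Rightarrow> ('w rv, 'x, 'e) module_scheme \<Rightarrow> 'x topology \<Rightarrow> 'x set \<Rightarrow>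
     (('x \<Rightarrow> 'w rv) \<Rightarrow> 'w rv \<Rightarrow> 'w rv) \<Rightarrow> bool" where
  "risk_function M V T K R \<longleftrightarrow>
     R \<in> polar M V T K \<rightarrow> carrier (barL0 M) \<rightarrow> carrier (barL0 M) \<and>
     (\<forall>A\<in>sets M. \<forall>f\<in>polar M V T K. \<forall>g\<in>polar M V T K.
        \<forall>s\<in>carrier (barL0 M). \<forall>t\<in>carrier (barL0 M).
        R (mod_glue M (dual_module M V T) A f g) (rv_glue M A s t) =
          rv_glue M A (R f s) (R g t)) \<and>
     (\<forall>f\<in>polar M V T K. \<forall>s\<in>carrier (barL0 M). \<forall>t\<in>carrier (barL0 M).
        s \<sqsubseteq>\<^bsub>barL0 M\<^esub> t \<longrightarrow> R f s \<sqsubseteq>\<^bsub>barL0 M\<^esub> R f t) \<and>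
     (\<forall>f\<in>polar M V T K. \<forall>s\<in>carrier (barL0 M). R f s = right_version M (R f) s)"

definition minimal_risk_function ::
  "'w measure \<Rightarrow> ('w rv, 'x, 'e) module_scheme \<Rightarrow> 'x topology \<Rightarrow> 'x set \<Rightarrow>
     (('x \<Rightarrow> 'w rv) \<Rightarrow> 'w rv \<Rightarrow> 'w rv) \<Rightarrow> bool" where
  "minimal_risk_function M V T K R \<longleftrightarrow>
     risk_function M V T K R \<and>
     (\<forall>f\<in>polar M V T K. \<forall>g\<in>polar M V T K.
        \<forall>s\<in>carrier (barL0 M). \<forall>t\<in>carrier (barL0 M). \<forall>l\<in>L0_unit_interval M.
        R (mod_comb M (dual_module M V T) l f g) (rv_comb M l s t)
          \<sqsubseteq>\<^bsub>barL0 M\<^esub> R f s \<squnion>\<^bsub>barL0 M\<^esub> R g t) \<and>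
     (\<forall>f\<in>polar M V T K. \<forall>s\<in>carrier (barL0 M). \<forall>l\<in>L0_pos M.
        R (l \<odot>\<^bsub>dual_module M V T\<^esub> f) s = R f (lift2 M (/) s l)) \<and>
     (\<forall>f\<in>polar M V T K. \<forall>g\<in>polar M V T K.
        \<Squnion>\<^bsub>barL0 M\<^esub> (R f ` carrier (L0 M)) = \<Squnion>\<^bsub>barL0 M\<^esub> (R g ` carrier (L0 M))) \<and>
     (\<forall>m\<in>carrier (barL0 M).
        closedin
          (prod_topology (subtopology (weak_dual_topology M V T) (polar M V T K)) (L0_topology M))
          {(f, s). f \<in> polar M V T K \<and> s \<in> carrier (L0 M) \<and>
             left_version M (R f) s \<sqsubseteq>\<^bsub>barL0 M\<^esub> m})"

definition robust_index ::
  "'w measure \<Rightarrow> ('w rv, 'x, 'e) module_scheme \<Rightarrow> 'x topology \<Rightarrow> 'x set \<Rightarrow>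
     (('x \<Rightarrow> 'w rv) \<Rightarrow> 'w rv \<Rightarrow> 'w rv) \<Rightarrow> 'x \<Rightarrow> 'w rv" where
  "robust_index M V T K R x = \<Sqinter>\<^bsub>barL0 M\<^esub> ((\<lambda>f. R f (f x)) ` polar M V T K)"

text \<open>
  The polar cone contains zero, and the values of a risk function where the functional vanishes
  and \<open>s\<close> is negative do not enter \<open>robust_index\<close>. Nor do the conditions on minimal risk functions
  pin them down: on a one-point space a constant real index \<open>c\<close> is represented both by the function
  equal to \<open>c\<close> for all \<open>s < \<infinity>\<close> and by its modification with value \<open>- \<infinity>\<close> at functional zero and
  \<open>s < 0\<close>. The following says that an event \<open>A\<close> avoids this region.
\<close>

definition nondegenerate_on ::
  "'w measure \<Rightarrow> ('w rv, 'x, 'e) module_scheme \<Rightarrow> 'x topology \<Rightarrow> 'w set \<Rightarrow>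
     ('x \<Rightarrow> 'w rv) \<Rightarrow> 'w rv \<Rightarrow> bool" where
  "nondegenerate_on M V T A f s \<longleftrightarrow>
     (\<forall>B\<in>sets M. B \<subseteq> A \<and> ind M B \<odot>\<^bsub>dual_module M V T\<^esub> f = \<zero>\<^bsub>dual_module M V T\<^esub> \<longrightarrow>
        (AE \<omega> in M. \<omega> \<in> B \<longrightarrow> 0 \<le> rep s \<omega>))"

end

theory Submission
  imports Defs
begin

text \<open>
  The risk function of an index \<open>\<alpha>\<close> is the right-continuous version in \<open>s\<close> of
  \<open>r f s = esssup {\<alpha> x. f x < s}\<close>. If \<open>\<alpha> x\<close> were smaller than \<open>essinf r f (f x)\<close> with some room \<open>q\<close>
  in between, then \<open>x\<close> could be strictly separated from the closed convex set \<open>{\<alpha> \<ge> q}\<close> on a part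
  of positive probability, by a functional that is nonnegative on the cone because \<open>\<alpha>\<close> is monotone.
  Separation rests on a Hahn--Banach theorem: linear functionals are the minimal sublinear ones,
  which Zorn's lemma provides below the gauge.

  For uniqueness, a representing minimal \<open>R\<close> is compared with the risk function of \<open>\<alpha>\<close> by separating
  points from the closed convex cone \<open>{(g, t). R\<^sup>- g t \<le> q}\<close> in the dual. A neighbourhood in the
  weak topology depends on finitely many coordinates only, so this separation takes place in a
  finite power of the scalars and yields an element of the original module.
\<close>

section \<open>Classes of random variables\<close>

text \<open>A relation between random variables holds off a null set that depends on them, so a
  claim about uncountably many of them cannot be checked at one point. Every bound is therefore kept
  local to an event, and a separating functional is found only off the largest event on which
  separation fails. That event comes from exhaustion, and its countable unions are handled by
  gluing. Here sigma-stability enters: that of the base sets when points of the module are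
  separated, that of the system of neighbourhoods when functionals are glued. A failing inequality
  is pinned to one level \<open>q\<close> and an event of positive probability, which then shrinks a
  few times.

  For uniqueness the sublevel sets of \<open>R\<^sup>-\<close> are separated, since these are the
  sets assumed closed. A separating functional may give the coordinate \<open>t\<close> the
  coefficient zero and then yields no element of the module that bounds the index from below. A
  functional that separates the point (0, 1) has a strictly negative coefficient there, and a small
  multiple of it repairs the defect. That (0, 1) lies outside the sublevel set follows from the
  common supremum over \<open>s\<close> and the scaling rule.\<close>

definition val :: "'w rv \<Rightarrow> 'w \<Rightarrow> real" where
  "val a \<omega> = real_of_ereal (rep a \<omega>)"

text \<open>Inverse to \<open>val\<close> on finite classes up to null sets, so that ring laws can
  be proved for real functions and carried over. \<open>val\<close> sends infinite values to 0,
  which for a finite class concerns a null set only.\<close>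

definition rvar :: "'w measure \<Rightarrow> ('w \<Rightarrow> real) \<Rightarrow> 'w rv" where
  "rvar M h = cls M (\<lambda>\<omega>. ereal (h \<omega>))"

lemma equiv_ae_rel: "equiv (borel_measurable M) (ae_rel M)"
proof (rule equivI)
  show "trans (ae_rel M)"
  proof (rule transI)
    fix f g h assume "(f, g) \<in> ae_rel M" "(g, h) \<in> ae_rel M"
    then have "f \<in> borel_measurable M" "h \<in> borel_measurable M"
      and "AE \<omega> in M. f \<omega> = g \<omega>" "AE \<omega> in M. g \<omega> = h \<omega>"
      by (auto simp: ae_rel_def)
    moreover from this(3,4) have "AE \<omega> in M. f \<omega> = h \<omega>" by eventually_elim simp
    ultimately show "(f, h) \<in> ae_rel M" by (simp add: ae_rel_def)
  qed
qed (auto simp: refl_on_def sym_def ae_rel_def)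

lemma cls_carrier [simp, intro]: "f \<in> borel_measurable M \<Longrightarrow> cls M f \<in> carrier (barL0 M)"
  by (auto simp: barL0_def cls_def quotient_def)

lemma cls_eq_iff:
  "f \<in> borel_measurable M \<Longrightarrow> g \<in> borel_measurable M \<Longrightarrow>
    cls M f = cls M g \<longleftrightarrow> (AE \<omega> in M. f \<omega> = g \<omega>)"
  using eq_equiv_class_iff[OF equiv_ae_rel, of f M g] by (simp add: cls_def) (simp add: ae_rel_def)

lemma rep_in: "m \<in> carrier (barL0 M) \<Longrightarrow> rep m \<in> m"
  using in_quotient_imp_non_empty[OF equiv_ae_rel, of m M]
  by (auto simp: barL0_def rep_def some_in_eq)

lemma rep_measurable [measurable (raw), simp]:
  "m \<in> carrier (barL0 M) \<Longrightarrow> rep m \<in> borel_measurable M"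
  using in_quotient_imp_subset[OF equiv_ae_rel, of m M] rep_in[of m M] by (auto simp: barL0_def)

lemma cls_rep [simp]: "m \<in> carrier (barL0 M) \<Longrightarrow> cls M (rep m) = m"
proof -
  assume m: "m \<in> carrier (barL0 M)"
  then obtain f where f: "m = ae_rel M `` {f}" "f \<in> borel_measurable M"
    by (auto simp: barL0_def quotient_def)
  moreover have "(f, rep m) \<in> ae_rel M" using rep_in[OF m] f by auto
  ultimately show ?thesis
    using equiv_class_eq[OF equiv_ae_rel] by (metis cls_def)
qed

lemma rep_cls: "f \<in> borel_measurable M \<Longrightarrow> AE \<omega> in M. rep (cls M f) \<omega> = f \<omega>"
  using cls_eq_iff[of "rep (cls M f)" M f] by simp

lemma barL0_eqI:
  "m \<in> carrier (barL0 M) \<Longrightarrow> n \<in> carrier (barL0 M) \<Longrightarrow> AE \<omega> in M. rep m \<omega> = rep n \<omega> \<Longrightarrow> m = n"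
  using cls_eq_iff[of "rep m" M "rep n"] by simp

lemma le_barL0 [simp]: "m \<sqsubseteq>\<^bsub>barL0 M\<^esub> n \<longleftrightarrow> (AE \<omega> in M. rep m \<omega> \<le> rep n \<omega>)"
  by (simp add: barL0_def)

lemma L0_barL0: "a \<in> carrier (L0 M) \<Longrightarrow> a \<in> carrier (barL0 M)"
  by (simp add: L0_def)

lemma L0_pos_L0: "a \<in> L0_pos M \<Longrightarrow> a \<in> carrier (L0 M)"
  by (simp add: L0_pos_def)

lemma L0_unit_interval_L0: "a \<in> L0_unit_interval M \<Longrightarrow> a \<in> carrier (L0 M)"
  by (simp add: L0_unit_interval_def)

lemma rep_val: "a \<in> carrier (L0 M) \<Longrightarrow> AE \<omega> in M. rep a \<omega> = ereal (val a \<omega>)"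
  by (auto simp: L0_def val_def ereal_real)

lemma val_measurable [measurable (raw), simp]:
  "a \<in> carrier (L0 M) \<Longrightarrow> val a \<in> borel_measurable M"
  unfolding val_def[abs_def] using L0_barL0[of a M] by simp

lemma rvar_L0 [simp, intro]: "h \<in> borel_measurable M \<Longrightarrow> rvar M h \<in> carrier (L0 M)"
proof -
  assume h: "h \<in> borel_measurable M"
  then have "AE \<omega> in M. rep (rvar M h) \<omega> = ereal (h \<omega>)"
    unfolding rvar_def by (intro rep_cls) simp
  then have "AE \<omega> in M. \<bar>rep (rvar M h) \<omega>\<bar> \<noteq> \<infinity>" by eventually_elim simp
  then show ?thesis using h by (simp add: L0_def rvar_def)
qed

lemma rep_rvar: "h \<in> borel_measurable M \<Longrightarrow> AE \<omega> in M. rep (rvar M h) \<omega> = ereal (h \<omega>)"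
  unfolding rvar_def by (intro rep_cls) simp

lemma val_rvar: "h \<in> borel_measurable M \<Longrightarrow> AE \<omega> in M. val (rvar M h) \<omega> = h \<omega>"
  using rep_rvar[of h M] by (auto simp: val_def)

lemma L0_eqI:
  assumes "a \<in> carrier (L0 M)" "b \<in> carrier (L0 M)" "AE \<omega> in M. val a \<omega> = val b \<omega>"
  shows "a = b"
  by (rule barL0_eqI[where M=M]) (use assms rep_val[of a M] rep_val[of b M] in \<open>auto simp: L0_barL0\<close>)

lemma rvar_cong:
  assumes "h \<in> borel_measurable M" "k \<in> borel_measurable M" "AE \<omega> in M. h \<omega> = k \<omega>"
  shows "rvar M h = rvar M k"
  using assms by (auto simp: rvar_def cls_eq_iff)

lemma rvar_val [simp]: "a \<in> carrier (L0 M) \<Longrightarrow> rvar M (val a) = a"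
  by (rule L0_eqI[where M=M]) (auto simp: val_rvar)

lemma L0_pos_iff: "a \<in> L0_pos M \<longleftrightarrow> a \<in> carrier (L0 M) \<and> (AE \<omega> in M. 0 < val a \<omega>)"
proof (cases "a \<in> carrier (L0 M)")
  case True
  have "(AE \<omega> in M. 0 < rep a \<omega>) \<longleftrightarrow> (AE \<omega> in M. 0 < val a \<omega>)"
    using rep_val[OF True] by (intro eventually_subst) (auto elim!: eventually_mono)
  with True show ?thesis by (simp add: L0_pos_def)
qed (simp add: L0_pos_def)

lemma L0_unit_interval_iff:
  "a \<in> L0_unit_interval M \<longleftrightarrow> a \<in> carrier (L0 M) \<and> (AE \<omega> in M. 0 \<le> val a \<omega> \<and> val a \<omega> \<le> 1)"
proof (cases "a \<in> carrier (L0 M)")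
  case True
  have "(AE \<omega> in M. 0 \<le> rep a \<omega> \<and> rep a \<omega> \<le> 1) \<longleftrightarrow> (AE \<omega> in M. 0 \<le> val a \<omega> \<and> val a \<omega> \<le> 1)"
    using rep_val[OF True] by (intro eventually_subst) (auto elim!: eventually_mono)
  with True show ?thesis by (simp add: L0_unit_interval_def)
qed (simp add: L0_unit_interval_def)

lemma L0_ball_iff:
  assumes "\<epsilon> \<in> carrier (L0 M)" "m \<in> carrier (L0 M)"
  shows "n \<in> L0_ball M \<epsilon> m \<longleftrightarrow>
    n \<in> carrier (L0 M) \<and> (AE \<omega> in M. \<bar>val m \<omega> - val n \<omega>\<bar> \<le> val \<epsilon> \<omega>)"
proof (cases "n \<in> carrier (L0 M)")
  case True
  have "AE \<omega> in M. (\<bar>rep m \<omega> - rep n \<omega>\<bar> \<le> rep \<epsilon> \<omega>) = (\<bar>val m \<omega> - val n \<omega>\<bar> \<le> val \<epsilon> \<omega>)"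
    using rep_val[OF True] rep_val[OF assms(1)] rep_val[OF assms(2)] by eventually_elim simp
  then have "(AE \<omega> in M. \<bar>rep m \<omega> - rep n \<omega>\<bar> \<le> rep \<epsilon> \<omega>) \<longleftrightarrow> (AE \<omega> in M. \<bar>val m \<omega> - val n \<omega>\<bar> \<le> val \<epsilon> \<omega>)"
    by (rule eventually_subst)
  with True show ?thesis by (simp add: L0_ball_def)
qed (simp add: L0_ball_def)

section \<open>Ring operations on classes\<close>

lemma eplus_measurable [measurable (raw)]:
  "f \<in> borel_measurable M \<Longrightarrow> g \<in> borel_measurable M \<Longrightarrow>
    (\<lambda>\<omega>. eplus (f \<omega>) (g \<omega>)) \<in> borel_measurable M"
  unfolding eplus_def by (intro measurable_If borel_measurable_ereal_add pred_intros_logic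
    borel_measurable_eq) simp_all

lemma eplus_ereal [simp]: "eplus (ereal x) (ereal y) = ereal (x + y)"
  by (simp add: eplus_def)

lemma eplus_0 [simp]: "eplus 0 x = x" "eplus x 0 = x"
  by (auto simp: eplus_def)

lemma lift2_carrier:
  "(\<lambda>\<omega>. h (rep m \<omega>) (rep n \<omega>)) \<in> borel_measurable M \<Longrightarrow> lift2 M h m n \<in> carrier (barL0 M)"
  by (simp add: lift2_def)

lemma rep_lift2:
  "(\<lambda>\<omega>. h (rep m \<omega>) (rep n \<omega>)) \<in> borel_measurable M \<Longrightarrow>
    AE \<omega> in M. rep (lift2 M h m n) \<omega> = h (rep m \<omega>) (rep n \<omega>)"
  unfolding lift2_def by (rule rep_cls)

lemma rep_add:
  "m \<in> carrier (barL0 M) \<Longrightarrow> n \<in> carrier (barL0 M) \<Longrightarrow>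
    AE \<omega> in M. rep (m \<oplus>\<^bsub>L0 M\<^esub> n) \<omega> = eplus (rep m \<omega>) (rep n \<omega>)"
  by (simp add: L0_def) (intro rep_lift2, measurable)

lemma rep_mult:
  "m \<in> carrier (barL0 M) \<Longrightarrow> n \<in> carrier (barL0 M) \<Longrightarrow>
    AE \<omega> in M. rep (m \<otimes>\<^bsub>L0 M\<^esub> n) \<omega> = rep m \<omega> * rep n \<omega>"
  by (simp add: L0_def) (intro rep_lift2, measurable)

lemma barL0_add_closed [simp]:
  "m \<in> carrier (barL0 M) \<Longrightarrow> n \<in> carrier (barL0 M) \<Longrightarrow> m \<oplus>\<^bsub>L0 M\<^esub> n \<in> carrier (barL0 M)"
  by (simp add: L0_def) (intro lift2_carrier, measurable)

lemma barL0_mult_closed [simp]: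
  "m \<in> carrier (barL0 M) \<Longrightarrow> n \<in> carrier (barL0 M) \<Longrightarrow> m \<otimes>\<^bsub>L0 M\<^esub> n \<in> carrier (barL0 M)"
  by (simp add: L0_def) (intro lift2_carrier, measurable)

lemma add_rvar:
  assumes "a \<in> carrier (L0 M)" "b \<in> carrier (L0 M)"
  shows "a \<oplus>\<^bsub>L0 M\<^esub> b = rvar M (\<lambda>\<omega>. val a \<omega> + val b \<omega>)"
proof (rule barL0_eqI[where M=M])
  have "(\<lambda>\<omega>. val a \<omega> + val b \<omega>) \<in> borel_measurable M" using assms by simp
  from rep_rvar[OF this] rep_add[OF assms[THEN L0_barL0]] rep_val[OF assms(1)] rep_val[OF assms(2)]
  show "AE \<omega> in M. rep (a \<oplus>\<^bsub>L0 M\<^esub> b) \<omega> = rep (rvar M (\<lambda>\<omega>. val a \<omega> + val b \<omega>)) \<omega>"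
    by eventually_elim simp
qed (use assms in \<open>auto simp: L0_barL0\<close>)

lemma mult_rvar:
  assumes "a \<in> carrier (L0 M)" "b \<in> carrier (L0 M)"
  shows "a \<otimes>\<^bsub>L0 M\<^esub> b = rvar M (\<lambda>\<omega>. val a \<omega> * val b \<omega>)"
proof (rule barL0_eqI[where M=M])
  have "(\<lambda>\<omega>. val a \<omega> * val b \<omega>) \<in> borel_measurable M" using assms by simp
  from rep_rvar[OF this] rep_mult[OF assms[THEN L0_barL0]] rep_val[OF assms(1)] rep_val[OF assms(2)]
  show "AE \<omega> in M. rep (a \<otimes>\<^bsub>L0 M\<^esub> b) \<omega> = rep (rvar M (\<lambda>\<omega>. val a \<omega> * val b \<omega>)) \<omega>"
    by eventually_elim simp
qed (use assms in \<open>auto simp: L0_barL0\<close>)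

lemma zero_rvar: "\<zero>\<^bsub>L0 M\<^esub> = rvar M (\<lambda>_. 0)"
  by (simp add: L0_def rvar_def zero_ereal_def)

lemma one_rvar: "\<one>\<^bsub>L0 M\<^esub> = rvar M (\<lambda>_. 1)"
  by (simp add: L0_def rvar_def one_ereal_def)

lemma ind_rvar: "ind M A = rvar M (indicator A)"
proof -
  have "indicator A = (\<lambda>\<omega>. ereal (indicator A \<omega>))" by (auto simp: indicator_def)
  then show ?thesis by (simp add: ind_def rvar_def)
qed

lemma rvar_add:
  assumes "h \<in> borel_measurable M" "k \<in> borel_measurable M"
  shows "rvar M h \<oplus>\<^bsub>L0 M\<^esub> rvar M k = rvar M (\<lambda>\<omega>. h \<omega> + k \<omega>)"
  unfolding add_rvar[OF rvar_L0[OF assms(1)] rvar_L0[OF assms(2)]]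
  by (rule rvar_cong) (use val_rvar[OF assms(1)] val_rvar[OF assms(2)] assms in auto)

lemma rvar_mult:
  assumes "h \<in> borel_measurable M" "k \<in> borel_measurable M"
  shows "rvar M h \<otimes>\<^bsub>L0 M\<^esub> rvar M k = rvar M (\<lambda>\<omega>. h \<omega> * k \<omega>)"
  unfolding mult_rvar[OF rvar_L0[OF assms(1)] rvar_L0[OF assms(2)]]
  by (rule rvar_cong) (use val_rvar[OF assms(1)] val_rvar[OF assms(2)] assms in auto)

lemma cring_L0: "cring (L0 M)"
proof (rule cringI)
  show "abelian_group (L0 M)"
  proof (rule abelian_groupI)
    fix x assume "x \<in> carrier (L0 M)"
    moreover from this have "rvar M (\<lambda>\<omega>. - val x \<omega>) \<oplus>\<^bsub>L0 M\<^esub> rvar M (val x) = \<zero>\<^bsub>L0 M\<^esub>"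
      by (subst rvar_add) (auto simp: zero_rvar)
    ultimately show "\<exists>y\<in>carrier (L0 M). y \<oplus>\<^bsub>L0 M\<^esub> x = \<zero>\<^bsub>L0 M\<^esub>"
      by (intro bexI[of _ "rvar M (\<lambda>\<omega>. - val x \<omega>)"]) auto
  next
    fix x y z assume xyz: "x \<in> carrier (L0 M)" "y \<in> carrier (L0 M)" "z \<in> carrier (L0 M)"
    \<comment> \<open>Writing each class as \<open>rvar M (val x)\<close> reduces the law to real
      arithmetic; \<open>rvar_val\<close> would undo this and is kept away from the
      simplifier.\<close>
    have "(rvar M (val x) \<oplus>\<^bsub>L0 M\<^esub> rvar M (val y)) \<oplus>\<^bsub>L0 M\<^esub> rvar M (val z) =
        rvar M (val x) \<oplus>\<^bsub>L0 M\<^esub> (rvar M (val y) \<oplus>\<^bsub>L0 M\<^esub> rvar M (val z))"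
      using xyz by (simp add: rvar_add add.assoc del: rvar_val)
    then show "x \<oplus>\<^bsub>L0 M\<^esub> y \<oplus>\<^bsub>L0 M\<^esub> z = x \<oplus>\<^bsub>L0 M\<^esub> (y \<oplus>\<^bsub>L0 M\<^esub> z)"
      using xyz by simp
  next
    fix x assume x: "x \<in> carrier (L0 M)"
    have "\<zero>\<^bsub>L0 M\<^esub> \<oplus>\<^bsub>L0 M\<^esub> rvar M (val x) = rvar M (val x)"
      unfolding zero_rvar using x by (subst rvar_add) auto
    then show "\<zero>\<^bsub>L0 M\<^esub> \<oplus>\<^bsub>L0 M\<^esub> x = x" using x by simp
  qed (simp_all add: add_rvar zero_rvar add.commute)
  show "comm_monoid (L0 M)"
  proof (rule comm_monoidI)
    fix x y z assume xyz: "x \<in> carrier (L0 M)" "y \<in> carrier (L0 M)" "z \<in> carrier (L0 M)"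
    have "(rvar M (val x) \<otimes>\<^bsub>L0 M\<^esub> rvar M (val y)) \<otimes>\<^bsub>L0 M\<^esub> rvar M (val z) =
        rvar M (val x) \<otimes>\<^bsub>L0 M\<^esub> (rvar M (val y) \<otimes>\<^bsub>L0 M\<^esub> rvar M (val z))"
      using xyz by (simp add: rvar_mult mult.assoc del: rvar_val)
    then show "x \<otimes>\<^bsub>L0 M\<^esub> y \<otimes>\<^bsub>L0 M\<^esub> z = x \<otimes>\<^bsub>L0 M\<^esub> (y \<otimes>\<^bsub>L0 M\<^esub> z)"
      using xyz by simp
  next
    fix x assume x: "x \<in> carrier (L0 M)"
    have "\<one>\<^bsub>L0 M\<^esub> \<otimes>\<^bsub>L0 M\<^esub> rvar M (val x) = rvar M (val x)"
      unfolding one_rvar using x by (subst rvar_mult) auto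
    then show "\<one>\<^bsub>L0 M\<^esub> \<otimes>\<^bsub>L0 M\<^esub> x = x" using x by simp
  qed (simp_all add: mult_rvar one_rvar mult.commute)
  fix x y z assume xyz: "x \<in> carrier (L0 M)" "y \<in> carrier (L0 M)" "z \<in> carrier (L0 M)"
  have "(rvar M (val x) \<oplus>\<^bsub>L0 M\<^esub> rvar M (val y)) \<otimes>\<^bsub>L0 M\<^esub> rvar M (val z) =
      (rvar M (val x) \<otimes>\<^bsub>L0 M\<^esub> rvar M (val z)) \<oplus>\<^bsub>L0 M\<^esub> (rvar M (val y) \<otimes>\<^bsub>L0 M\<^esub> rvar M (val z))"
    using xyz by (simp add: rvar_add rvar_mult algebra_simps del: rvar_val)
  then show "(x \<oplus>\<^bsub>L0 M\<^esub> y) \<otimes>\<^bsub>L0 M\<^esub> z = x \<otimes>\<^bsub>L0 M\<^esub> z \<oplus>\<^bsub>L0 M\<^esub> y \<otimes>\<^bsub>L0 M\<^esub> z"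
    using xyz by simp
qed

lemma rvar_uminus:
  assumes [measurable]: "h \<in> borel_measurable M"
  shows "\<ominus>\<^bsub>L0 M\<^esub> rvar M h = rvar M (\<lambda>\<omega>. - h \<omega>)"
proof -
  interpret cring "L0 M" by (rule cring_L0)
  have "rvar M (\<lambda>\<omega>. - h \<omega>) \<oplus>\<^bsub>L0 M\<^esub> rvar M h = \<zero>\<^bsub>L0 M\<^esub>"
    by (subst rvar_add) (auto simp: zero_rvar)
  then show ?thesis by (intro minus_equality) auto
qed

lemma rvar_minus:
  assumes [measurable]: "h \<in> borel_measurable M" "k \<in> borel_measurable M"
  shows "rvar M h \<ominus>\<^bsub>L0 M\<^esub> rvar M k = rvar M (\<lambda>\<omega>. h \<omega> - k \<omega>)"
  by (simp add: a_minus_def rvar_uminus rvar_add)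

lemmas rvar_arith = rvar_add rvar_mult rvar_uminus rvar_minus zero_rvar one_rvar ind_rvar

lemma val_add:
  "a \<in> carrier (L0 M) \<Longrightarrow> b \<in> carrier (L0 M) \<Longrightarrow> AE \<omega> in M. val (a \<oplus>\<^bsub>L0 M\<^esub> b) \<omega> = val a \<omega> + val b \<omega>"
  by (simp add: add_rvar val_rvar)

lemma val_mult:
  "a \<in> carrier (L0 M) \<Longrightarrow> b \<in> carrier (L0 M) \<Longrightarrow> AE \<omega> in M. val (a \<otimes>\<^bsub>L0 M\<^esub> b) \<omega> = val a \<omega> * val b \<omega>"
  by (simp add: mult_rvar val_rvar)

lemma val_uminus: "a \<in> carrier (L0 M) \<Longrightarrow> AE \<omega> in M. val (\<ominus>\<^bsub>L0 M\<^esub> a) \<omega> = - val a \<omega>"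
  using rvar_uminus[of "val a" M] by (simp add: val_rvar)

lemma val_zero: "AE \<omega> in M. val \<zero>\<^bsub>L0 M\<^esub> \<omega> = 0"
  by (simp add: zero_rvar val_rvar)

lemma val_one: "AE \<omega> in M. val \<one>\<^bsub>L0 M\<^esub> \<omega> = 1"
  by (simp add: one_rvar val_rvar)

lemma ind_L0 [simp, intro]: "A \<in> sets M \<Longrightarrow> ind M A \<in> carrier (L0 M)"
  by (simp add: ind_rvar)

lemma val_ind: "A \<in> sets M \<Longrightarrow> AE \<omega> in M. val (ind M A) \<omega> = indicator A \<omega>"
  by (simp add: ind_rvar val_rvar)

lemma rep_ind: "A \<in> sets M \<Longrightarrow> AE \<omega> in M. rep (ind M A) \<omega> = indicator A \<omega>"
  unfolding ind_def by (rule rep_cls) simp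

section \<open>Gluing and convex combinations of classes\<close>

lemma rv_glue_carrier [simp, intro]:
  assumes "A \<in> sets M" "m \<in> carrier (barL0 M)" "n \<in> carrier (barL0 M)"
  shows "rv_glue M A m n \<in> carrier (barL0 M)"
  using assms by (simp add: rv_glue_def L0_barL0)

text \<open>Multiplication by the indicator gives 0 off the event even where the value is infinite,
  and 0 is neutral for \<open>eplus\<close>; hence the sum picks out the right value and the
  convention for opposite infinities never comes into play.\<close>

lemma rep_rv_glue:
  assumes "A \<in> sets M" "m \<in> carrier (barL0 M)" "n \<in> carrier (barL0 M)"
  shows "AE \<omega> in M. rep (rv_glue M A m n) \<omega> = (if \<omega> \<in> A then rep m \<omega> else rep n \<omega>)"
proof -
  have [simp]: "ind M A \<in> carrier (barL0 M)" "ind M (space M - A) \<in> carrier (barL0 M)"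
    using assms by (auto simp: L0_barL0)
  have A': "space M - A \<in> sets M" using assms by auto
  have "AE \<omega> in M. rep (ind M A \<otimes>\<^bsub>L0 M\<^esub> m) \<omega> = rep (ind M A) \<omega> * rep m \<omega>"
    "AE \<omega> in M. rep (ind M (space M - A) \<otimes>\<^bsub>L0 M\<^esub> n) \<omega> = rep (ind M (space M - A)) \<omega> * rep n \<omega>"
    "AE \<omega> in M. rep (rv_glue M A m n) \<omega> =
      eplus (rep (ind M A \<otimes>\<^bsub>L0 M\<^esub> m) \<omega>) (rep (ind M (space M - A) \<otimes>\<^bsub>L0 M\<^esub> n) \<omega>)"
    using assms unfolding rv_glue_def by (intro rep_mult rep_add; simp)+
  with rep_ind[OF assms(1)] rep_ind[OF A'] AE_space[of M]
  show ?thesis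
    by eventually_elim (auto simp: indicator_def)
qed

lemma rv_glue_L0 [simp, intro]:
  assumes "A \<in> sets M" "m \<in> carrier (L0 M)" "n \<in> carrier (L0 M)"
  shows "rv_glue M A m n \<in> carrier (L0 M)"
  using assms cring_L0[of M] by (simp add: rv_glue_def cring.cring_simprules)

lemma val_rv_glue:
  assumes "A \<in> sets M" "m \<in> carrier (L0 M)" "n \<in> carrier (L0 M)"
  shows "AE \<omega> in M. val (rv_glue M A m n) \<omega> = (if \<omega> \<in> A then val m \<omega> else val n \<omega>)"
  using rep_rv_glue[OF assms(1) assms(2,3)[THEN L0_barL0]] by eventually_elim (simp add: val_def)

lemma rv_glue_eqI:
  assumes "A \<in> sets M" "m \<in> carrier (barL0 M)" "n \<in> carrier (barL0 M)" "p \<in> carrier (barL0 M)"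
    and "AE \<omega>\<in>A in M. rep p \<omega> = rep m \<omega>" "AE \<omega> in M. \<omega> \<notin> A \<longrightarrow> rep p \<omega> = rep n \<omega>"
  shows "rv_glue M A m n = p"
  by (rule barL0_eqI[where M=M]) (use assms rep_rv_glue[OF assms(1-3)] in auto)

lemma rv_comb_carrier:
  assumes "l \<in> carrier (L0 M)" "s \<in> carrier (barL0 M)" "t \<in> carrier (barL0 M)"
  shows "rv_comb M l s t \<in> carrier (barL0 M)"
  using assms rvar_minus[of "\<lambda>_. 1" M "val l"] by (simp add: rv_comb_def L0_barL0 one_rvar)

text \<open>The coefficients are finite and can be read as reals. The arguments may be infinite, so
  \<open>eplus\<close> and the product of extended reals remain.\<close>

lemma rep_rv_comb:
  assumes "l \<in> carrier (L0 M)" "s \<in> carrier (barL0 M)" "t \<in> carrier (barL0 M)"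
  shows "AE \<omega> in M. rep (rv_comb M l s t) \<omega> =
    eplus (ereal (val l \<omega>) * rep s \<omega>) (ereal (1 - val l \<omega>) * rep t \<omega>)"
proof -
  let ?k = "\<one>\<^bsub>L0 M\<^esub> \<ominus>\<^bsub>L0 M\<^esub> l"
  have k: "?k = rvar M (\<lambda>\<omega>. 1 - val l \<omega>)"
    using assms rvar_minus[of "\<lambda>_. 1" M "val l"] by (simp add: one_rvar)
  have "(\<lambda>\<omega>. 1 - val l \<omega>) \<in> borel_measurable M" using assms by simp
  note kk = rep_rvar[OF this]
  have [simp]: "?k \<in> carrier (barL0 M)" "l \<in> carrier (barL0 M)"
    using assms by (auto simp: k L0_barL0)
  have "AE \<omega> in M. rep (l \<otimes>\<^bsub>L0 M\<^esub> s) \<omega> = rep l \<omega> * rep s \<omega>"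
    "AE \<omega> in M. rep (?k \<otimes>\<^bsub>L0 M\<^esub> t) \<omega> = rep ?k \<omega> * rep t \<omega>"
    "AE \<omega> in M. rep (rv_comb M l s t) \<omega> = eplus (rep (l \<otimes>\<^bsub>L0 M\<^esub> s) \<omega>) (rep (?k \<otimes>\<^bsub>L0 M\<^esub> t) \<omega>)"
    using assms unfolding rv_comb_def by (intro rep_mult rep_add; simp)+
  with kk rep_val[OF assms(1)] show ?thesis
    unfolding k[symmetric] by eventually_elim simp
qed

lemma rep_divide:
  assumes "s \<in> carrier (barL0 M)" "l \<in> carrier (L0 M)"
  shows "lift2 M (/) s l \<in> carrier (barL0 M)"
    "AE \<omega> in M. rep (lift2 M (/) s l) \<omega> = rep s \<omega> / ereal (val l \<omega>)"
proof -
  have [measurable]: "(\<lambda>\<omega>. rep s \<omega> / rep l \<omega>) \<in> borel_measurable M"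
    using assms by (simp add: L0_barL0)
  show "lift2 M (/) s l \<in> carrier (barL0 M)" by (rule lift2_carrier) simp
  have "AE \<omega> in M. rep (lift2 M (/) s l) \<omega> = rep s \<omega> / rep l \<omega>" by (rule rep_lift2) simp
  with rep_val[OF assms(2)]
  show "AE \<omega> in M. rep (lift2 M (/) s l) \<omega> = rep s \<omega> / ereal (val l \<omega>)" by eventually_elim simp
qed

section \<open>Essential suprema and infima\<close>

context prob_space
begin

text \<open>Exhaustion. The supremum \<open>c\<close> of the probabilities of countable unions is
  attained, since countably many nearly optimal countable subfamilies together are again countable.
  A member of the family that stuck out with positive probability would push the union beyond
  \<open>c\<close>.\<close>

lemma countable_essential_union:
  assumes "\<A> \<subseteq> sets M"
  obtains D where "countable D" "D \<subseteq> \<A>" "\<And>B. B \<in> \<A> \<Longrightarrow> AE \<omega>\<in>B in M. \<omega> \<in> \<Union>D"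
proof -
  define \<C> where "\<C> = {D. countable D \<and> D \<subseteq> \<A>}"
  define c where "c = (SUP D\<in>\<C>. prob (\<Union>D))"
  have bdd: "bdd_above ((\<lambda>D. prob (\<Union>D)) ` \<C>)" by (rule bdd_aboveI[of _ 1]) auto
  have ne: "\<C> \<noteq> {}" by (auto simp: \<C>_def)
  have "\<exists>D\<in>\<C>. c - 1 / real (Suc n) < prob (\<Union>D)" for n
    using less_cSUP_iff[OF ne bdd, of "c - 1 / real (Suc n)"] unfolding c_def by simp
  then obtain D where D: "\<And>n. D n \<in> \<C>" "\<And>n. c - 1 / real (Suc n) < prob (\<Union>(D n))" by metis
  define D' where "D' = (\<Union>n. D n)"
  have D': "D' \<in> \<C>" using D(1) by (auto simp: \<C>_def D'_def)
  have meas: "\<Union>E \<in> sets M" if "E \<in> \<C>" for E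
    using that assms by (intro sets.countable_Union) (auto simp: \<C>_def)
  have "c - 1 / real (Suc n) \<le> prob (\<Union>D')" for n
    using D(2)[of n] meas[OF D'] finite_measure_mono[of "\<Union>(D n)" "\<Union>D'"] by (fastforce simp: D'_def)
  then have "c \<le> prob (\<Union>D')"
    using LIMSEQ_le_const2[OF tendsto_diff[OF tendsto_const LIMSEQ_inverse_real_of_nat, of c], of "prob (\<Union>D')"]
    by (auto simp: inverse_eq_divide)
  show ?thesis
  proof (rule that)
    show "countable D'" "D' \<subseteq> \<A>" using D' by (auto simp: \<C>_def)
    fix B assume B: "B \<in> \<A>"
    then have B': "insert B D' \<in> \<C>" using D' by (auto simp: \<C>_def)
    then have "prob (\<Union>(insert B D')) \<le> c" unfolding c_def by (intro cSUP_upper bdd)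
    moreover have "prob (\<Union>(insert B D')) = prob (\<Union>D') + prob (B - \<Union>D')"
      using finite_measure_Union'[of "\<Union>D'" B] meas[OF D'] B assms by (auto simp: Un_commute)
    ultimately have "prob (B - \<Union>D') = 0" using \<open>c \<le> prob (\<Union>D')\<close> measure_nonneg[of M "B - \<Union>D'"] by linarith
    moreover have "B - \<Union>D' \<in> sets M" using meas[OF D'] B assms by auto
    ultimately have "B - \<Union>D' \<in> null_sets M" by (auto simp: emeasure_eq_measure null_sets_def)
    from AE_not_in[OF this] show "AE \<omega>\<in>B in M. \<omega> \<in> \<Union>D'" by eventually_elim auto
  qed
qed

text \<open>Closure under disjoint unions is enough: the exhausting sequence is made disjoint first,
  and closure under subsets keeps its members in the family. Disjoint unions are what gluing along a
  partition can handle.\<close>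

lemma maximal_event:
  assumes sets: "\<A> \<subseteq> sets M" and empty: "{} \<in> \<A>"
    and subset: "\<And>D E. D \<in> \<A> \<Longrightarrow> E \<in> sets M \<Longrightarrow> E \<subseteq> D \<Longrightarrow> E \<in> \<A>"
    and union: "\<And>D. disjoint_family D \<Longrightarrow> (\<And>n::nat. D n \<in> \<A>) \<Longrightarrow> (\<Union>n. D n) \<in> \<A>"
  obtains D where "D \<in> \<A>" "\<And>E. E \<in> \<A> \<Longrightarrow> AE \<omega>\<in>E in M. \<omega> \<in> D"
proof -
  obtain \<D> where \<D>: "countable \<D>" "\<D> \<subseteq> \<A>" "\<And>B. B \<in> \<A> \<Longrightarrow> AE \<omega>\<in>B in M. \<omega> \<in> \<Union>\<D>"
    using countable_essential_union[OF sets] by blast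
  \<comment> \<open>The empty event is inserted so that there is something to enumerate even if the
    exhausting family is empty.\<close>
  define B where "B = from_nat_into (insert {} \<D>)"
  have range: "range B = insert {} \<D>" unfolding B_def using \<D>(1) by (intro range_from_nat_into) auto
  have B: "B n \<in> \<A>" for n using range \<D>(2) empty by (metis insert_iff rangeI subsetD)
  have "disjointed B n \<in> \<A>" for n
    using B sets sets.range_disjointed_sets[of B M] by (intro subset[OF B[of n]] disjointed_subset) auto
  then have "(\<Union>n. disjointed B n) \<in> \<A>" by (intro union disjoint_family_disjointed)
  moreover have "(\<Union>n. disjointed B n) = \<Union>\<D>" using range by (simp add: UN_disjointed_eq) 
  ultimately show ?thesis using \<D>(3) by (intro that[of "\<Union>\<D>"]) auto
qed

lemma partial_order_barL0: "partial_order (barL0 M)"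
proof
  show "(.=\<^bsub>barL0 M\<^esub>) = (=)" by (simp add: barL0_def)
next
  fix x y assume *: "x \<sqsubseteq>\<^bsub>barL0 M\<^esub> y" "y \<sqsubseteq>\<^bsub>barL0 M\<^esub> x" "x \<in> carrier (barL0 M)" "y \<in> carrier (barL0 M)"
  from *(1,2) have "AE \<omega> in M. rep x \<omega> = rep y \<omega>" unfolding le_barL0 by eventually_elim simp
  with * have "x = y" by (intro barL0_eqI)
  then show "x .=\<^bsub>barL0 M\<^esub> y" by (simp add: barL0_def)
next
  fix x y z assume "x \<sqsubseteq>\<^bsub>barL0 M\<^esub> y" "y \<sqsubseteq>\<^bsub>barL0 M\<^esub> z"
  then show "x \<sqsubseteq>\<^bsub>barL0 M\<^esub> z" unfolding le_barL0 by eventually_elim simp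
qed (auto simp: barL0_def)

text \<open>For each real level \<open>q\<close>, countably many members suffice to exhaust the
  events on which some member is below \<open>q\<close>. The pointwise infimum over the members
  collected at rational levels is countable, hence measurable, and is the essential infimum: any
  member below it would be below it across a rational level.\<close>

sublocale barL0: complete_lattice "barL0 M"
proof (rule partial_order.complete_lattice_criterion1[OF partial_order_barL0])
  show "\<exists>g. greatest (barL0 M) g (carrier (barL0 M))"
  proof (intro exI[of _ "cls M (\<lambda>_. \<infinity>)"], unfold greatest_def, intro conjI ballI)
    fix x assume "x \<in> carrier (barL0 M)"
    have "AE \<omega> in M. rep (cls M (\<lambda>_. \<infinity>)) \<omega> = \<infinity>" by (rule rep_cls) simp
    then show "x \<sqsubseteq>\<^bsub>barL0 M\<^esub> cls M (\<lambda>_. \<infinity>)" unfolding le_barL0 by eventually_elim simp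
  qed auto
  fix A assume A: "A \<subseteq> carrier (barL0 M)" "A \<noteq> {}"
  have ex: "\<exists>D. countable D \<and> D \<subseteq> A \<and> (\<forall>a\<in>A. AE \<omega> in M. rep a \<omega> < ereal q \<longrightarrow> (\<exists>d\<in>D. rep d \<omega> < ereal q))" for q
  proof -
    have m: "{\<omega> \<in> space M. rep a \<omega> < ereal q} \<in> sets M" if "a \<in> A" for a
    proof -
      have [measurable]: "rep a \<in> borel_measurable M" using that A by auto
      show ?thesis by measurable
    qed
    then have "(\<lambda>a. {\<omega> \<in> space M. rep a \<omega> < ereal q}) ` A \<subseteq> sets M" by auto
    from countable_essential_union[OF this] obtain D where D: "countable D"
      "D \<subseteq> (\<lambda>a. {\<omega> \<in> space M. rep a \<omega> < ereal q}) ` A"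
      "\<And>B. B \<in> (\<lambda>a. {\<omega> \<in> space M. rep a \<omega> < ereal q}) ` A \<Longrightarrow> AE \<omega>\<in>B in M. \<omega> \<in> \<Union>D" by blast
    then obtain D' where D': "countable D'" "D' \<subseteq> A" "D = (\<lambda>a. {\<omega> \<in> space M. rep a \<omega> < ereal q}) ` D'"
      using countable_subset_image[of D "\<lambda>a. {\<omega> \<in> space M. rep a \<omega> < ereal q}" A] by auto
    show ?thesis
    proof (intro exI[of _ D'] conjI ballI)
      fix a assume "a \<in> A"
      then have "AE \<omega> in M. \<omega> \<in> {\<omega> \<in> space M. rep a \<omega> < ereal q} \<longrightarrow> \<omega> \<in> \<Union>D" by (intro D(3)) auto
      with AE_space show "AE \<omega> in M. rep a \<omega> < ereal q \<longrightarrow> (\<exists>d\<in>D'. rep d \<omega> < ereal q)"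
        by eventually_elim (auto simp: D'(3))
    qed (use D' in auto)
  qed
  have "\<exists>D. \<forall>q. countable (D q) \<and> D q \<subseteq> A \<and>
      (\<forall>a\<in>A. AE \<omega> in M. rep a \<omega> < ereal q \<longrightarrow> (\<exists>d\<in>D q. rep d \<omega> < ereal q))"
    by (rule choice) (rule allI, rule ex)
  then obtain D where D': "\<forall>q. countable (D q) \<and> D q \<subseteq> A \<and>
      (\<forall>a\<in>A. AE \<omega> in M. rep a \<omega> < ereal q \<longrightarrow> (\<exists>d\<in>D q. rep d \<omega> < ereal q))" ..
  then have D: "countable (D q)" "D q \<subseteq> A"
      "a \<in> A \<Longrightarrow> AE \<omega> in M. rep a \<omega> < ereal q \<longrightarrow> (\<exists>d\<in>D q. rep d \<omega> < ereal q)" for q a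
    by simp_all
  obtain a0 where a0: "a0 \<in> A" using A by auto
  define E where "E = insert a0 (\<Union>q\<in>\<rat>. D q)"
  have E: "countable E" "E \<subseteq> A" using D a0 countable_rat by (auto simp: E_def)
  have m: "(\<lambda>\<omega>. INF e\<in>E. rep e \<omega>) \<in> borel_measurable M"
    using E A by (intro borel_measurable_INF) auto
  let ?i = "cls M (\<lambda>\<omega>. INF e\<in>E. rep e \<omega>)"
  have i: "AE \<omega> in M. rep ?i \<omega> = (INF e\<in>E. rep e \<omega>)" by (rule rep_cls[OF m])
  have "greatest (barL0 M) ?i (Lower (barL0 M) A)"
    unfolding greatest_def
  proof (intro conjI ballI)
    show "Lower (barL0 M) A \<subseteq> carrier (barL0 M)" by (auto simp: Lower_def)
    have "?i \<sqsubseteq>\<^bsub>barL0 M\<^esub> a" if a: "a \<in> A" for a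
    proof -
      have "AE \<omega> in M. \<forall>q\<in>\<rat>. rep a \<omega> < ereal q \<longrightarrow> (\<exists>d\<in>D q. rep d \<omega> < ereal q)"
        by (subst AE_ball_countable) (auto intro: D(3)[OF a] countable_rat)
      with i show ?thesis unfolding le_barL0
      proof eventually_elim
        case (elim \<omega>)
        show ?case
        proof (rule ccontr)
          assume "\<not> rep ?i \<omega> \<le> rep a \<omega>"
          then obtain y where y: "rep a \<omega> < ereal y" "ereal y < rep ?i \<omega>"
            using ereal_dense2[of "rep a \<omega>" "rep ?i \<omega>"] by (auto simp: not_le)
          \<comment> \<open>Two reals are interposed so that a rational fits strictly between
            them.\<close>
          obtain y' where y': "ereal y < ereal y'" "ereal y' < rep ?i \<omega>"
            using ereal_dense2[OF y(2)] by blast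
          then obtain q where q: "q \<in> \<rat>" "y < q" "q < y'" using Rats_dense_in_real[of y y'] by auto
          then have "rep a \<omega> < ereal q" using y(1) by (meson less_ereal.simps(1) less_trans)
          then obtain d where d: "d \<in> D q" "rep d \<omega> < ereal q" using elim(2) q by blast
          then have "d \<in> E" using q by (auto simp: E_def)
          then have "rep ?i \<omega> \<le> rep d \<omega>" unfolding elim(1) by (rule INF_lower)
          moreover have "ereal q < ereal y'" using q by simp
          ultimately show False using d(2) y'(2) by (meson leD less_trans)
        qed
      qed
    qed
    then show "?i \<in> Lower (barL0 M) A" using m by (auto simp: Lower_def simp del: le_barL0)
    fix x assume x: "x \<in> Lower (barL0 M) A"
    then have "AE \<omega> in M. \<forall>e\<in>E. rep x \<omega> \<le> rep e \<omega>"
      using E A by (subst AE_ball_countable) (auto simp: Lower_def)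
    with i show "x \<sqsubseteq>\<^bsub>barL0 M\<^esub> ?i" unfolding le_barL0 by eventually_elim (auto intro: INF_greatest)
  qed
  then show "\<exists>i. greatest (barL0 M) i (Lower (barL0 M) A)" by blast
qed

lemma Inf_lower_AE:
  "S \<subseteq> carrier (barL0 M) \<Longrightarrow> a \<in> S \<Longrightarrow> AE \<omega> in M. rep (\<Sqinter>\<^bsub>barL0 M\<^esub> S) \<omega> \<le> rep a \<omega>"
  using barL0.inf_lower[of S a] by simp

lemma Sup_upper_AE:
  "S \<subseteq> carrier (barL0 M) \<Longrightarrow> a \<in> S \<Longrightarrow> AE \<omega> in M. rep a \<omega> \<le> rep (\<Squnion>\<^bsub>barL0 M\<^esub> S) \<omega>"
  using barL0.sup_upper[of S a] by simp

text \<open>Off the event \<open>P\<close> the bound \<open>h\<close> is replaced by the infimum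
  itself, which turns a local lower bound into a global one. Bounds on events are needed throughout,
  and this form avoids gluing the members of the family each time.\<close>

lemma Inf_greatest_AE:
  assumes S: "S \<subseteq> carrier (barL0 M)"
    and [measurable]: "h \<in> borel_measurable M" "Measurable.pred M P"
    and le: "\<And>a. a \<in> S \<Longrightarrow> AE \<omega> in M. P \<omega> \<longrightarrow> h \<omega> \<le> rep a \<omega>"
  shows "AE \<omega> in M. P \<omega> \<longrightarrow> h \<omega> \<le> rep (\<Sqinter>\<^bsub>barL0 M\<^esub> S) \<omega>"
proof -
  have [measurable]: "rep (\<Sqinter>\<^bsub>barL0 M\<^esub> S) \<in> borel_measurable M" using barL0.inf_closed[OF S] by simp
  define k where "k \<omega> = (if P \<omega> then h \<omega> else rep (\<Sqinter>\<^bsub>barL0 M\<^esub> S) \<omega>)" for \<omega>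
  have [measurable]: "k \<in> borel_measurable M" unfolding k_def[abs_def] by measurable
  have k: "AE \<omega> in M. rep (cls M k) \<omega> = k \<omega>" by (rule rep_cls) simp
  have "cls M k \<sqsubseteq>\<^bsub>barL0 M\<^esub> \<Sqinter>\<^bsub>barL0 M\<^esub> S"
  proof (rule barL0.inf_greatest[OF S])
    fix a assume a: "a \<in> S"
    from k le[OF a] Inf_lower_AE[OF S a] show "cls M k \<sqsubseteq>\<^bsub>barL0 M\<^esub> a"
      unfolding le_barL0 by eventually_elim (auto simp: k_def)
  qed simp
  with k show ?thesis unfolding le_barL0 by eventually_elim (auto simp: k_def)
qed

lemma Sup_least_AE:
  assumes S: "S \<subseteq> carrier (barL0 M)"
    and [measurable]: "h \<in> borel_measurable M" "Measurable.pred M P"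
    and le: "\<And>a. a \<in> S \<Longrightarrow> AE \<omega> in M. P \<omega> \<longrightarrow> rep a \<omega> \<le> h \<omega>"
  shows "AE \<omega> in M. P \<omega> \<longrightarrow> rep (\<Squnion>\<^bsub>barL0 M\<^esub> S) \<omega> \<le> h \<omega>"
proof -
  have [measurable]: "rep (\<Squnion>\<^bsub>barL0 M\<^esub> S) \<in> borel_measurable M" using barL0.sup_closed[OF S] by simp
  define k where "k \<omega> = (if P \<omega> then h \<omega> else rep (\<Squnion>\<^bsub>barL0 M\<^esub> S) \<omega>)" for \<omega>
  have [measurable]: "k \<in> borel_measurable M" unfolding k_def[abs_def] by measurable
  have k: "AE \<omega> in M. rep (cls M k) \<omega> = k \<omega>" by (rule rep_cls) simp
  have "\<Squnion>\<^bsub>barL0 M\<^esub> S \<sqsubseteq>\<^bsub>barL0 M\<^esub> cls M k"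
  proof (rule barL0.sup_least[OF S])
    fix a assume a: "a \<in> S"
    from k le[OF a] Sup_upper_AE[OF S a] show "a \<sqsubseteq>\<^bsub>barL0 M\<^esub> cls M k"
      unfolding le_barL0 by eventually_elim (auto simp: k_def)
  qed simp
  with k show ?thesis unfolding le_barL0 by eventually_elim (auto simp: k_def)
qed

lemma rep_meet:
  assumes "m \<in> carrier (barL0 M)" "n \<in> carrier (barL0 M)"
  shows "AE \<omega> in M. rep (m \<sqinter>\<^bsub>barL0 M\<^esub> n) \<omega> = min (rep m \<omega>) (rep n \<omega>)"
proof -
  have "AE \<omega> in M. True \<longrightarrow> min (rep m \<omega>) (rep n \<omega>) \<le> rep (\<Sqinter>\<^bsub>barL0 M\<^esub> {m, n}) \<omega>"
    using assms by (intro Inf_greatest_AE) auto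
  moreover have "AE \<omega> in M. rep (\<Sqinter>\<^bsub>barL0 M\<^esub> {m, n}) \<omega> \<le> rep m \<omega>" "AE \<omega> in M. rep (\<Sqinter>\<^bsub>barL0 M\<^esub> {m, n}) \<omega> \<le> rep n \<omega>"
    using assms by (auto intro: Inf_lower_AE)
  ultimately show ?thesis unfolding meet_def by eventually_elim (auto intro: antisym)
qed

lemma rep_join:
  assumes "m \<in> carrier (barL0 M)" "n \<in> carrier (barL0 M)"
  shows "AE \<omega> in M. rep (m \<squnion>\<^bsub>barL0 M\<^esub> n) \<omega> = max (rep m \<omega>) (rep n \<omega>)"
proof -
  have "AE \<omega> in M. True \<longrightarrow> rep (\<Squnion>\<^bsub>barL0 M\<^esub> {m, n}) \<omega> \<le> max (rep m \<omega>) (rep n \<omega>)"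
    using assms by (intro Sup_least_AE) auto
  moreover have "AE \<omega> in M. rep m \<omega> \<le> rep (\<Squnion>\<^bsub>barL0 M\<^esub> {m, n}) \<omega>" "AE \<omega> in M. rep n \<omega> \<le> rep (\<Squnion>\<^bsub>barL0 M\<^esub> {m, n}) \<omega>"
    using assms by (auto intro: Sup_upper_AE)
  ultimately show ?thesis unfolding join_def by eventually_elim (auto intro: antisym)
qed

end

section \<open>One-sided versions of local functions\<close>

text \<open>An explicit number strictly between two extended reals: the midpoint if both are finite,
  one unit away from the finite one if only one is, and 0 between the two infinities. A formula,
  unlike a choice, stays measurable in its arguments, so a finite random variable can be interposed
  between two extended ones.\<close>

definition between :: "ereal \<Rightarrow> ereal \<Rightarrow> real" where
  "between s n = (if s = - \<infinity> then if n = \<infinity> then 0 else real_of_ereal n - 1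
     else if n = \<infinity> then real_of_ereal s + 1 else (real_of_ereal s + real_of_ereal n) / 2)"

lemma between:
  assumes "s < n"
  shows "s < ereal (between s n)" "ereal (between s n) < n"
  using assms by (cases s; cases n; simp add: between_def)+

lemma between_measurable [measurable (raw)]:
  assumes [measurable]: "f \<in> borel_measurable M" "g \<in> borel_measurable M"
  shows "(\<lambda>\<omega>. between (f \<omega>) (g \<omega>)) \<in> borel_measurable M"
  unfolding between_def by measurable

definition rv_local :: "'w measure \<Rightarrow> ('w rv \<Rightarrow> 'w rv) \<Rightarrow> bool" where
  "rv_local M F \<longleftrightarrow> F \<in> carrier (barL0 M) \<rightarrow> carrier (barL0 M) \<and>
     (\<forall>A\<in>sets M. \<forall>m\<in>carrier (barL0 M). \<forall>n\<in>carrier (barL0 M).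
        F (rv_glue M A m n) = rv_glue M A (F m) (F n))"

definition rv_increasing :: "'w measure \<Rightarrow> ('w rv \<Rightarrow> 'w rv) \<Rightarrow> bool" where
  "rv_increasing M F \<longleftrightarrow>
     (\<forall>m\<in>carrier (barL0 M). \<forall>n\<in>carrier (barL0 M). m \<sqsubseteq>\<^bsub>barL0 M\<^esub> n \<longrightarrow> F m \<sqsubseteq>\<^bsub>barL0 M\<^esub> F n)"

lemma rv_local_carrier: "rv_local M F \<Longrightarrow> m \<in> carrier (barL0 M) \<Longrightarrow> F m \<in> carrier (barL0 M)"
  by (auto simp: rv_local_def)

text \<open>Gluing \<open>m\<close> onto \<open>n\<close> along the event on which they agree gives
  back \<open>n\<close>; locality then compares the two values there.\<close>

lemma rv_local_cong:
  assumes F: "rv_local M F" and m: "m \<in> carrier (barL0 M)" and n: "n \<in> carrier (barL0 M)"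
  shows "AE \<omega> in M. rep m \<omega> = rep n \<omega> \<longrightarrow> rep (F m) \<omega> = rep (F n) \<omega>"
proof -
  have [measurable]: "rep m \<in> borel_measurable M" "rep n \<in> borel_measurable M" using m n by auto
  define A where "A = {\<omega> \<in> space M. rep m \<omega> = rep n \<omega>}"
  have A: "A \<in> sets M" unfolding A_def by measurable
  have "rv_glue M A m n = n" by (rule rv_glue_eqI) (use A m n in \<open>auto simp: A_def\<close>)
  then have "F n = rv_glue M A (F m) (F n)" using F A m n unfolding rv_local_def by metis
  moreover have "AE \<omega> in M. rep (rv_glue M A (F m) (F n)) \<omega> = (if \<omega> \<in> A then rep (F m) \<omega> else rep (F n) \<omega>)"
    using F A m n by (intro rep_rv_glue) (auto intro: rv_local_carrier)
  ultimately have "AE \<omega> in M. rep (F n) \<omega> = (if \<omega> \<in> A then rep (F m) \<omega> else rep (F n) \<omega>)" by simp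
  with AE_space show ?thesis by eventually_elim (auto simp: A_def split: if_splits)
qed

text \<open>Global monotonicity is applied to \<open>m\<close> and the maximum of both, and the
  maximum agrees with \<open>n\<close> on the event in question.\<close>

lemma rv_local_mono:
  assumes F: "rv_local M F" "rv_increasing M F"
    and m: "m \<in> carrier (barL0 M)" and n: "n \<in> carrier (barL0 M)"
  shows "AE \<omega> in M. rep m \<omega> \<le> rep n \<omega> \<longrightarrow> rep (F m) \<omega> \<le> rep (F n) \<omega>"
proof -
  have [measurable]: "rep m \<in> borel_measurable M" "rep n \<in> borel_measurable M" using m n by auto
  define p where "p = cls M (\<lambda>\<omega>. max (rep m \<omega>) (rep n \<omega>))"
  have p: "p \<in> carrier (barL0 M)" unfolding p_def by auto
  have rp: "AE \<omega> in M. rep p \<omega> = max (rep m \<omega>) (rep n \<omega>)" unfolding p_def by (rule rep_cls) measurable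
  then have "m \<sqsubseteq>\<^bsub>barL0 M\<^esub> p" unfolding le_barL0 by eventually_elim simp
  then have "AE \<omega> in M. rep (F m) \<omega> \<le> rep (F p) \<omega>" using F m p by (auto simp: rv_increasing_def)
  with rv_local_cong[OF F(1) p n] rp show ?thesis by eventually_elim (auto simp: max_def)
qed

context prob_space
begin

lemma left_version_carrier:
  assumes "F \<in> carrier (barL0 M) \<rightarrow> carrier (barL0 M)" "s \<in> carrier (barL0 M)"
  shows "left_version M F s \<in> carrier (barL0 M)"
proof -
  have [measurable]: "rep s \<in> borel_measurable M" using assms by auto
  show ?thesis unfolding left_version_def by (intro rv_glue_carrier barL0.sup_closed) (use assms in auto)
qed

lemma right_version_carrier:
  assumes "F \<in> carrier (barL0 M) \<rightarrow> carrier (barL0 M)" "s \<in> carrier (barL0 M)"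
  shows "right_version M F s \<in> carrier (barL0 M)"
proof -
  have [measurable]: "rep s \<in> borel_measurable M" using assms by auto
  show ?thesis unfolding right_version_def by (intro rv_glue_carrier barL0.inf_closed) (use assms in auto)
qed

lemma rep_right_version:
  assumes "F \<in> carrier (barL0 M) \<rightarrow> carrier (barL0 M)" "s \<in> carrier (barL0 M)"
  shows "AE \<omega> in M. rep (right_version M F s) \<omega> = (if rep s \<omega> < \<infinity> then
    rep (\<Sqinter>\<^bsub>barL0 M\<^esub> {F n | n. n \<in> carrier (barL0 M) \<and> (AE \<omega> in M. rep s \<omega> < \<infinity> \<longrightarrow> rep s \<omega> < rep n \<omega>)}) \<omega>
    else \<infinity>)"
proof -
  have [measurable]: "rep s \<in> borel_measurable M" using assms by auto
  have "AE \<omega> in M. rep (right_version M F s) \<omega> = (if \<omega> \<in> {\<omega> \<in> space M. rep s \<omega> < \<infinity>} then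
    rep (\<Sqinter>\<^bsub>barL0 M\<^esub> {F n | n. n \<in> carrier (barL0 M) \<and> (AE \<omega> in M. rep s \<omega> < \<infinity> \<longrightarrow> rep s \<omega> < rep n \<omega>)}) \<omega>
    else rep (cls M (\<lambda>_. \<infinity>)) \<omega>)"
    unfolding right_version_def by (intro rep_rv_glue barL0.inf_closed) (use assms in auto)
  moreover have "AE \<omega> in M. rep (cls M (\<lambda>_. \<infinity>)) \<omega> = \<infinity>" by (rule rep_cls) simp
  ultimately show ?thesis using AE_space by eventually_elim auto
qed

lemma rep_left_version:
  assumes "F \<in> carrier (barL0 M) \<rightarrow> carrier (barL0 M)" "s \<in> carrier (barL0 M)"
  shows "AE \<omega> in M. rep (left_version M F s) \<omega> = (if - \<infinity> < rep s \<omega> then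
    rep (\<Squnion>\<^bsub>barL0 M\<^esub> {F n | n. n \<in> carrier (barL0 M) \<and> (AE \<omega> in M. - \<infinity> < rep s \<omega> \<longrightarrow> rep n \<omega> < rep s \<omega>)}) \<omega>
    else - \<infinity>)"
proof -
  have [measurable]: "rep s \<in> borel_measurable M" using assms by auto
  have "AE \<omega> in M. rep (left_version M F s) \<omega> = (if \<omega> \<in> {\<omega> \<in> space M. - \<infinity> < rep s \<omega>} then
    rep (\<Squnion>\<^bsub>barL0 M\<^esub> {F n | n. n \<in> carrier (barL0 M) \<and> (AE \<omega> in M. - \<infinity> < rep s \<omega> \<longrightarrow> rep n \<omega> < rep s \<omega>)}) \<omega>
    else rep (cls M (\<lambda>_. - \<infinity>)) \<omega>)"
    unfolding left_version_def by (intro rep_rv_glue barL0.sup_closed) (use assms in auto)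
  moreover have "AE \<omega> in M. rep (cls M (\<lambda>_. - \<infinity>)) \<omega> = - \<infinity>" by (rule rep_cls) simp
  ultimately show ?thesis using AE_space by eventually_elim auto
qed

text \<open>The infimum in \<open>right_version\<close> runs over variables that exceed
  \<open>s\<close> wherever \<open>s\<close> is finite or - infinity. A variable \<open>n\<close>
  that does so only on an event becomes admissible when it is raised to infinity elsewhere, and
  locality undoes the change on the event.\<close>

lemma right_version_le:
  assumes F: "rv_local M F" and s: "s \<in> carrier (barL0 M)" and n: "n \<in> carrier (barL0 M)"
  shows "AE \<omega> in M. rep s \<omega> < rep n \<omega> \<longrightarrow> rep (right_version M F s) \<omega> \<le> rep (F n) \<omega>"
proof -
  have [measurable]: "rep s \<in> borel_measurable M" "rep n \<in> borel_measurable M" using s n by auto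
  define p where "p = cls M (\<lambda>\<omega>. if rep s \<omega> < rep n \<omega> then rep n \<omega> else \<infinity>)"
  have p: "p \<in> carrier (barL0 M)" unfolding p_def by auto
  have rp: "AE \<omega> in M. rep p \<omega> = (if rep s \<omega> < rep n \<omega> then rep n \<omega> else \<infinity>)"
    unfolding p_def by (rule rep_cls) measurable
  then have "AE \<omega> in M. rep s \<omega> < \<infinity> \<longrightarrow> rep s \<omega> < rep p \<omega>" by eventually_elim auto
  then have "AE \<omega> in M. rep (\<Sqinter>\<^bsub>barL0 M\<^esub> {F n | n. n \<in> carrier (barL0 M) \<and>
      (AE \<omega> in M. rep s \<omega> < \<infinity> \<longrightarrow> rep s \<omega> < rep n \<omega>)}) \<omega> \<le> rep (F p) \<omega>"
    using p F by (intro Inf_lower_AE) (auto intro: rv_local_carrier)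
  moreover have "F \<in> carrier (barL0 M) \<rightarrow> carrier (barL0 M)" using F by (simp add: rv_local_def)
  note rep_right_version[OF this s] rv_local_cong[OF F p n]
  ultimately show ?thesis using rp by eventually_elim auto
qed

lemma left_version_ge:
  assumes F: "rv_local M F" and s: "s \<in> carrier (barL0 M)" and n: "n \<in> carrier (barL0 M)"
  shows "AE \<omega> in M. rep n \<omega> < rep s \<omega> \<longrightarrow> rep (F n) \<omega> \<le> rep (left_version M F s) \<omega>"
proof -
  have [measurable]: "rep s \<in> borel_measurable M" "rep n \<in> borel_measurable M" using s n by auto
  define p where "p = cls M (\<lambda>\<omega>. if rep n \<omega> < rep s \<omega> then rep n \<omega> else - \<infinity>)"
  have p: "p \<in> carrier (barL0 M)" unfolding p_def by auto
  have rp: "AE \<omega> in M. rep p \<omega> = (if rep n \<omega> < rep s \<omega> then rep n \<omega> else - \<infinity>)"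
    unfolding p_def by (rule rep_cls) measurable
  then have "AE \<omega> in M. - \<infinity> < rep s \<omega> \<longrightarrow> rep p \<omega> < rep s \<omega>" by eventually_elim auto
  then have "AE \<omega> in M. rep (F p) \<omega> \<le> rep (\<Squnion>\<^bsub>barL0 M\<^esub> {F n | n. n \<in> carrier (barL0 M) \<and>
      (AE \<omega> in M. - \<infinity> < rep s \<omega> \<longrightarrow> rep n \<omega> < rep s \<omega>)}) \<omega>"
    using p F by (intro Sup_upper_AE) (auto intro: rv_local_carrier)
  moreover have "F \<in> carrier (barL0 M) \<rightarrow> carrier (barL0 M)" using F by (simp add: rv_local_def)
  note rep_left_version[OF this s] rv_local_cong[OF F p n]
  ultimately show ?thesis using rp by eventually_elim auto
qed

text \<open>Testing finite \<open>n\<close> is enough: below an admissible extended \<open>n\<close>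
  there is a finite one still above \<open>s\<close>, by \<open>between\<close>. Where
  \<open>s\<close> is infinite the right version is infinite as well and there is nothing to
  test.\<close>

lemma right_version_greatest:
  assumes F: "rv_local M F" "rv_increasing M F" and s: "s \<in> carrier (barL0 M)"
    and [measurable]: "h \<in> borel_measurable M" "Measurable.pred M P"
    and le: "\<And>n. n \<in> carrier (L0 M) \<Longrightarrow> AE \<omega> in M. P \<omega> \<and> rep s \<omega> < ereal (val n \<omega>) \<longrightarrow> h \<omega> \<le> rep (F n) \<omega>"
  shows "AE \<omega> in M. P \<omega> \<longrightarrow> h \<omega> \<le> rep (right_version M F s) \<omega>"
proof -
  have [measurable]: "rep s \<in> borel_measurable M" using s by auto
  let ?S = "{F n | n. n \<in> carrier (barL0 M) \<and> (AE \<omega> in M. rep s \<omega> < \<infinity> \<longrightarrow> rep s \<omega> < rep n \<omega>)}"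
  have FE: "F \<in> carrier (barL0 M) \<rightarrow> carrier (barL0 M)" using F by (simp add: rv_local_def)
  have "AE \<omega> in M. P \<omega> \<and> rep s \<omega> < \<infinity> \<longrightarrow> h \<omega> \<le> rep (\<Sqinter>\<^bsub>barL0 M\<^esub> ?S) \<omega>"
  proof (rule Inf_greatest_AE)
    fix a assume "a \<in> ?S"
    then obtain n where n: "a = F n" "n \<in> carrier (barL0 M)" "AE \<omega> in M. rep s \<omega> < \<infinity> \<longrightarrow> rep s \<omega> < rep n \<omega>"
      by auto
    have [measurable]: "rep n \<in> borel_measurable M" using n by auto
    define p where "p = rvar M (\<lambda>\<omega>. between (rep s \<omega>) (rep n \<omega>))"
    have p: "p \<in> carrier (L0 M)" unfolding p_def by (intro rvar_L0) measurable
    have vp: "AE \<omega> in M. val p \<omega> = between (rep s \<omega>) (rep n \<omega>)"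
      unfolding p_def by (rule val_rvar) measurable
    from le[OF p] rv_local_mono[OF F p[THEN L0_barL0] n(2)] vp rep_val[OF p] n(3)
    show "AE \<omega> in M. P \<omega> \<and> rep s \<omega> < \<infinity> \<longrightarrow> h \<omega> \<le> rep a \<omega>"
    proof eventually_elim
      case (elim \<omega>)
      show ?case
      proof
        assume "P \<omega> \<and> rep s \<omega> < \<infinity>"
        with elim between[of "rep s \<omega>" "rep n \<omega>"] have "h \<omega> \<le> rep (F p) \<omega>" "rep (F p) \<omega> \<le> rep (F n) \<omega>"
          by auto
        then show "h \<omega> \<le> rep a \<omega>" by (simp add: n)
      qed
    qed
  qed (use FE in auto)
  with rep_right_version[OF FE s] show ?thesis by eventually_elim auto
qed

lemma left_version_least:
  assumes F: "rv_local M F" "rv_increasing M F" and s: "s \<in> carrier (barL0 M)"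
    and [measurable]: "h \<in> borel_measurable M" "Measurable.pred M P"
    and le: "\<And>n. n \<in> carrier (L0 M) \<Longrightarrow> AE \<omega> in M. P \<omega> \<and> ereal (val n \<omega>) < rep s \<omega> \<longrightarrow> rep (F n) \<omega> \<le> h \<omega>"
  shows "AE \<omega> in M. P \<omega> \<longrightarrow> rep (left_version M F s) \<omega> \<le> h \<omega>"
proof -
  have [measurable]: "rep s \<in> borel_measurable M" using s by auto
  let ?S = "{F n | n. n \<in> carrier (barL0 M) \<and> (AE \<omega> in M. - \<infinity> < rep s \<omega> \<longrightarrow> rep n \<omega> < rep s \<omega>)}"
  have FE: "F \<in> carrier (barL0 M) \<rightarrow> carrier (barL0 M)" using F by (simp add: rv_local_def)
  have "AE \<omega> in M. P \<omega> \<and> - \<infinity> < rep s \<omega> \<longrightarrow> rep (\<Squnion>\<^bsub>barL0 M\<^esub> ?S) \<omega> \<le> h \<omega>"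
  proof (rule Sup_least_AE)
    fix a assume "a \<in> ?S"
    then obtain n where n: "a = F n" "n \<in> carrier (barL0 M)" "AE \<omega> in M. - \<infinity> < rep s \<omega> \<longrightarrow> rep n \<omega> < rep s \<omega>"
      by auto
    have [measurable]: "rep n \<in> borel_measurable M" using n by auto
    define p where "p = rvar M (\<lambda>\<omega>. between (rep n \<omega>) (rep s \<omega>))"
    have p: "p \<in> carrier (L0 M)" unfolding p_def by (intro rvar_L0) measurable
    have vp: "AE \<omega> in M. val p \<omega> = between (rep n \<omega>) (rep s \<omega>)"
      unfolding p_def by (rule val_rvar) measurable
    from le[OF p] rv_local_mono[OF F n(2) p[THEN L0_barL0]] vp rep_val[OF p] n(3)
    show "AE \<omega> in M. P \<omega> \<and> - \<infinity> < rep s \<omega> \<longrightarrow> rep a \<omega> \<le> h \<omega>"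
    proof eventually_elim
      case (elim \<omega>)
      show ?case
      proof
        assume "P \<omega> \<and> - \<infinity> < rep s \<omega>"
        with elim between[of "rep n \<omega>" "rep s \<omega>"] have "rep (F p) \<omega> \<le> h \<omega>" "rep (F n) \<omega> \<le> rep (F p) \<omega>"
          by auto
        then show "rep a \<omega> \<le> h \<omega>" by (simp add: n)
      qed
    qed
  qed (use FE in auto)
  with rep_left_version[OF FE s] show ?thesis by eventually_elim auto
qed

lemma left_version_le:
  assumes F: "rv_local M F" "rv_increasing M F" and s: "s \<in> carrier (barL0 M)"
  shows "AE \<omega> in M. rep (left_version M F s) \<omega> \<le> rep (F s) \<omega>"
proof -
  have [measurable]: "rep (F s) \<in> borel_measurable M" using rv_local_carrier[OF F(1) s] by simp
  have "AE \<omega> in M. True \<longrightarrow> rep (left_version M F s) \<omega> \<le> rep (F s) \<omega>"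
  proof (rule left_version_least[OF F s])
    fix n assume n: "n \<in> carrier (L0 M)"
    from rv_local_mono[OF F n[THEN L0_barL0] s] rep_val[OF n]
    show "AE \<omega> in M. True \<and> ereal (val n \<omega>) < rep s \<omega> \<longrightarrow> rep (F n) \<omega> \<le> rep (F s) \<omega>"
      by eventually_elim auto
  qed auto
  then show ?thesis by simp
qed

lemma right_version_ge:
  assumes F: "rv_local M F" "rv_increasing M F" and s: "s \<in> carrier (barL0 M)"
  shows "AE \<omega> in M. rep (F s) \<omega> \<le> rep (right_version M F s) \<omega>"
proof -
  have [measurable]: "rep (F s) \<in> borel_measurable M" using rv_local_carrier[OF F(1) s] by simp
  have "AE \<omega> in M. True \<longrightarrow> rep (F s) \<omega> \<le> rep (right_version M F s) \<omega>"
  proof (rule right_version_greatest[OF F s])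
    fix n assume n: "n \<in> carrier (L0 M)"
    from rv_local_mono[OF F s n[THEN L0_barL0]] rep_val[OF n]
    show "AE \<omega> in M. True \<and> rep s \<omega> < ereal (val n \<omega>) \<longrightarrow> rep (F s) \<omega> \<le> rep (F n) \<omega>"
      by eventually_elim auto
  qed auto
  then show ?thesis by simp
qed

end

section \<open>The topology of random variables\<close>

lemma rvar_pos:
  assumes "h \<in> borel_measurable M" "AE \<omega> in M. 0 < h \<omega>"
  shows "rvar M h \<in> L0_pos M"
proof -
  from val_rvar[OF assms(1)] assms(2) have "AE \<omega> in M. 0 < val (rvar M h) \<omega>" by eventually_elim simp
  with assms(1) show ?thesis by (simp add: L0_pos_iff)
qed

lemma rvar_unit_interval:
  assumes "h \<in> borel_measurable M" "AE \<omega> in M. 0 \<le> h \<omega> \<and> h \<omega> \<le> 1"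
  shows "rvar M h \<in> L0_unit_interval M"
proof -
  from val_rvar[OF assms(1)] assms(2)
  have "AE \<omega> in M. 0 \<le> val (rvar M h) \<omega> \<and> val (rvar M h) \<omega> \<le> 1" by eventually_elim simp
  with assms(1) show ?thesis by (simp add: L0_unit_interval_iff)
qed

lemma L0_pos_val: "\<epsilon> \<in> L0_pos M \<Longrightarrow> AE \<omega> in M. 0 < val \<epsilon> \<omega>"
  by (simp add: L0_pos_iff)

lemma L0_min_pos:
  assumes "\<delta> \<in> L0_pos M" "\<epsilon> \<in> L0_pos M"
  shows "\<exists>\<eta>\<in>L0_pos M. AE \<omega> in M. val \<eta> \<omega> \<le> val \<delta> \<omega> \<and> val \<eta> \<omega> \<le> val \<epsilon> \<omega>"
proof
  have m: "(\<lambda>\<omega>. min (val \<delta> \<omega>) (val \<epsilon> \<omega>)) \<in> borel_measurable M"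
    using assms[THEN L0_pos_L0] by (intro borel_measurable_min val_measurable)
  note r = val_rvar[OF m]
  show "AE \<omega> in M. val (rvar M (\<lambda>\<omega>. min (val \<delta> \<omega>) (val \<epsilon> \<omega>))) \<omega> \<le> val \<delta> \<omega> \<and>
      val (rvar M (\<lambda>\<omega>. min (val \<delta> \<omega>) (val \<epsilon> \<omega>))) \<omega> \<le> val \<epsilon> \<omega>"
    using r by eventually_elim simp
  from L0_pos_val[OF assms(1)] L0_pos_val[OF assms(2)]
  have "AE \<omega> in M. 0 < min (val \<delta> \<omega>) (val \<epsilon> \<omega>)" by eventually_elim simp
  with m show "rvar M (\<lambda>\<omega>. min (val \<delta> \<omega>) (val \<epsilon> \<omega>)) \<in> L0_pos M" by (rule rvar_pos)
qed

lemma L0_ball_mono: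
  assumes "\<delta> \<in> L0_pos M" "\<epsilon> \<in> L0_pos M" "AE \<omega> in M. val \<delta> \<omega> \<le> val \<epsilon> \<omega>"
  shows "m \<in> carrier (L0 M) \<Longrightarrow> L0_ball M \<delta> m \<subseteq> L0_ball M \<epsilon> m"
proof
  fix n assume m: "m \<in> carrier (L0 M)" and "n \<in> L0_ball M \<delta> m"
  then have n: "n \<in> carrier (L0 M)" "AE \<omega> in M. \<bar>val m \<omega> - val n \<omega>\<bar> \<le> val \<delta> \<omega>"
    using assms L0_ball_iff[of \<delta> M m n] by (auto simp: L0_pos_L0)
  from n(2) assms(3) have "AE \<omega> in M. \<bar>val m \<omega> - val n \<omega>\<bar> \<le> val \<epsilon> \<omega>" by eventually_elim simp
  with n m assms show "n \<in> L0_ball M \<epsilon> m" using L0_ball_iff[of \<epsilon> M m n] by (auto simp: L0_pos_L0)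
qed

lemma openin_L0_topology:
  "openin (L0_topology M) U \<longleftrightarrow>
    U \<subseteq> carrier (L0 M) \<and> (\<forall>m\<in>U. \<exists>\<epsilon>\<in>L0_pos M. L0_ball M \<epsilon> m \<subseteq> U)"
proof -
  have "istopology (\<lambda>U. U \<subseteq> carrier (L0 M) \<and> (\<forall>m\<in>U. \<exists>\<epsilon>\<in>L0_pos M. L0_ball M \<epsilon> m \<subseteq> U))"
    unfolding istopology_def
  proof (intro conjI allI impI ballI)
    fix S T m
    assume S: "S \<subseteq> carrier (L0 M) \<and> (\<forall>m\<in>S. \<exists>\<epsilon>\<in>L0_pos M. L0_ball M \<epsilon> m \<subseteq> S)"
      and T: "T \<subseteq> carrier (L0 M) \<and> (\<forall>m\<in>T. \<exists>\<epsilon>\<in>L0_pos M. L0_ball M \<epsilon> m \<subseteq> T)" and m: "m \<in> S \<inter> T"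
    obtain \<delta> \<epsilon> where *: "\<delta> \<in> L0_pos M" "L0_ball M \<delta> m \<subseteq> S" "\<epsilon> \<in> L0_pos M" "L0_ball M \<epsilon> m \<subseteq> T"
      using S T m by (meson IntE)
    obtain \<eta> where "\<eta> \<in> L0_pos M" "AE \<omega> in M. val \<eta> \<omega> \<le> val \<delta> \<omega> \<and> val \<eta> \<omega> \<le> val \<epsilon> \<omega>"
      using L0_min_pos[OF *(1,3)] by auto
    moreover have "m \<in> carrier (L0 M)" using S m by auto
    ultimately have "L0_ball M \<eta> m \<subseteq> S \<inter> T"
      using * L0_ball_mono[of \<eta> M \<delta> m] L0_ball_mono[of \<eta> M \<epsilon> m] by auto
    then show "\<exists>\<epsilon>\<in>L0_pos M. L0_ball M \<epsilon> m \<subseteq> S \<inter> T" using \<open>\<eta> \<in> L0_pos M\<close> by blast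
  next
    fix \<K> m assume "\<forall>U\<in>\<K>. U \<subseteq> carrier (L0 M) \<and> (\<forall>m\<in>U. \<exists>\<epsilon>\<in>L0_pos M. L0_ball M \<epsilon> m \<subseteq> U)" "m \<in> \<Union>\<K>"
    then show "\<exists>\<epsilon>\<in>L0_pos M. L0_ball M \<epsilon> m \<subseteq> \<Union>\<K>" by (meson UnionE Union_upper subset_trans)
  qed auto
  then show ?thesis unfolding L0_topology_def by (simp add: topology_inverse')
qed

lemma topspace_L0_topology [simp]: "topspace (L0_topology M) = carrier (L0 M)"
proof
  have "\<one>\<^bsub>L0 M\<^esub> \<in> L0_pos M"
    using val_one[of M] by (auto simp: L0_pos_iff one_rvar)
  then have "openin (L0_topology M) (carrier (L0 M))"
    unfolding openin_L0_topology by (auto simp: L0_ball_def)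
  then show "carrier (L0 M) \<subseteq> topspace (L0_topology M)" by (rule openin_subset)
qed (metis openin_L0_topology openin_topspace)

lemma AE_diff_pos:
  assumes "\<epsilon> \<in> carrier (L0 M)" "a \<in> carrier (L0 M)" "b \<in> carrier (L0 M)"
    "AE \<omega> in M. \<bar>val a \<omega> - val b \<omega>\<bar> < val \<epsilon> \<omega>"
  obtains \<delta> where "\<delta> \<in> L0_pos M" "AE \<omega> in M. val \<delta> \<omega> < val \<epsilon> \<omega> - \<bar>val a \<omega> - val b \<omega>\<bar>"
proof -
  let ?h = "\<lambda>\<omega>. (val \<epsilon> \<omega> - \<bar>val a \<omega> - val b \<omega>\<bar>) / 2"
  have m: "?h \<in> borel_measurable M" using assms by simp
  show ?thesis
  proof (rule that[of "rvar M ?h"])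
    from assms(4) have "AE \<omega> in M. 0 < ?h \<omega>" by eventually_elim simp
    with m show "rvar M ?h \<in> L0_pos M" by (rule rvar_pos)
    show "AE \<omega> in M. val (rvar M ?h) \<omega> < val \<epsilon> \<omega> - \<bar>val a \<omega> - val b \<omega>\<bar>"
      using val_rvar[OF m] assms(4) by eventually_elim auto
  qed
qed

text \<open>With a strict inequality each point keeps a random distance to the boundary, and half of
  that distance serves as its radius.\<close>

lemma openin_L0_ball:
  assumes m: "m \<in> carrier (L0 M)" and \<epsilon>: "\<epsilon> \<in> carrier (L0 M)"
  shows "openin (L0_topology M) {n \<in> carrier (L0 M). AE \<omega> in M. \<bar>val n \<omega> - val m \<omega>\<bar> < val \<epsilon> \<omega>}"
  unfolding openin_L0_topology
proof (intro conjI ballI)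
  fix n assume "n \<in> {n \<in> carrier (L0 M). AE \<omega> in M. \<bar>val n \<omega> - val m \<omega>\<bar> < val \<epsilon> \<omega>}"
  then have n: "n \<in> carrier (L0 M)" "AE \<omega> in M. \<bar>val n \<omega> - val m \<omega>\<bar> < val \<epsilon> \<omega>" by auto
  obtain \<delta> where \<delta>: "\<delta> \<in> L0_pos M" "AE \<omega> in M. val \<delta> \<omega> < val \<epsilon> \<omega> - \<bar>val n \<omega> - val m \<omega>\<bar>"
    using AE_diff_pos[OF \<epsilon> n(1) m n(2)] by blast
  show "\<exists>\<delta>\<in>L0_pos M. L0_ball M \<delta> n \<subseteq> {n \<in> carrier (L0 M). AE \<omega> in M. \<bar>val n \<omega> - val m \<omega>\<bar> < val \<epsilon> \<omega>}"
  proof (rule bexI[OF _ \<delta>(1)], rule subsetI)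
    fix k assume "k \<in> L0_ball M \<delta> n"
    then have k: "k \<in> carrier (L0 M)" "AE \<omega> in M. \<bar>val n \<omega> - val k \<omega>\<bar> \<le> val \<delta> \<omega>"
      using L0_ball_iff[of \<delta> M n k] \<delta>(1) n(1) by (auto simp: L0_pos_L0)
    from k(2) \<delta>(2) have "AE \<omega> in M. \<bar>val k \<omega> - val m \<omega>\<bar> < val \<epsilon> \<omega>" by eventually_elim linarith
    with k(1) show "k \<in> {n \<in> carrier (L0 M). AE \<omega> in M. \<bar>val n \<omega> - val m \<omega>\<bar> < val \<epsilon> \<omega>}" by simp
  qed
qed auto

section \<open>Sublinear functionals on modules over random variables\<close>

locale L0_module = prob_space M + Module.module "L0 M" V
  for M :: "'w measure" and V :: "('w rv, 'x, 'e) module_scheme"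

definition L0_linear :: "'w measure \<Rightarrow> ('w rv, 'x, 'e) module_scheme \<Rightarrow> ('x \<Rightarrow> 'w rv) \<Rightarrow> bool" where
  "L0_linear M V f \<longleftrightarrow> f \<in> carrier V \<rightarrow> carrier (L0 M) \<and>
     (\<forall>x\<in>carrier V. \<forall>y\<in>carrier V. f (x \<oplus>\<^bsub>V\<^esub> y) = f x \<oplus>\<^bsub>L0 M\<^esub> f y) \<and>
     (\<forall>l\<in>carrier (L0 M). \<forall>x\<in>carrier V. f (l \<odot>\<^bsub>V\<^esub> x) = l \<otimes>\<^bsub>L0 M\<^esub> f x)"

text \<open>Homogeneity is asked for as an inequality only, because this is what passes through
  essential infima; equality follows in \<open>sublinear_smult\<close>. Extensional functions make
  domination in both directions an equality, as antisymmetry in Zorn's lemma requires.\<close>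

definition sublinear :: "'w measure \<Rightarrow> ('w rv, 'x, 'e) module_scheme \<Rightarrow> ('x \<Rightarrow> 'w rv) \<Rightarrow> bool" where
  "sublinear M V q \<longleftrightarrow> q \<in> carrier V \<rightarrow>\<^sub>E carrier (L0 M) \<and>
     (\<forall>x\<in>carrier V. \<forall>y\<in>carrier V. AE \<omega> in M. val (q (x \<oplus>\<^bsub>V\<^esub> y)) \<omega> \<le> val (q x) \<omega> + val (q y) \<omega>) \<and>
     (\<forall>l\<in>carrier (L0 M). (AE \<omega> in M. 0 \<le> val l \<omega>) \<longrightarrow>
       (\<forall>x\<in>carrier V. AE \<omega> in M. val (q (l \<odot>\<^bsub>V\<^esub> x)) \<omega> \<le> val l \<omega> * val (q x) \<omega>))"

lemma sublinearD:
  assumes "sublinear M V q"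
  shows "q \<in> carrier V \<rightarrow>\<^sub>E carrier (L0 M)" "x \<in> carrier V \<Longrightarrow> q x \<in> carrier (L0 M)"
    "x \<in> carrier V \<Longrightarrow> y \<in> carrier V \<Longrightarrow> AE \<omega> in M. val (q (x \<oplus>\<^bsub>V\<^esub> y)) \<omega> \<le> val (q x) \<omega> + val (q y) \<omega>"
    "l \<in> carrier (L0 M) \<Longrightarrow> AE \<omega> in M. 0 \<le> val l \<omega> \<Longrightarrow> x \<in> carrier V \<Longrightarrow>
      AE \<omega> in M. val (q (l \<odot>\<^bsub>V\<^esub> x)) \<omega> \<le> val l \<omega> * val (q x) \<omega>"
  using assms by (auto simp: sublinear_def)

context prob_space
begin

text \<open>The real lower bound \<open>h\<close> and the member \<open>a0\<close> keep the
  essential infimum finite from below and above, so it can be treated with \<open>val\<close> from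
  then on.\<close>

lemma L0_Inf:
  assumes S: "S \<subseteq> carrier (L0 M)" "a0 \<in> S" and [measurable]: "h \<in> borel_measurable M"
    and h: "\<And>a. a \<in> S \<Longrightarrow> AE \<omega> in M. h \<omega> \<le> val a \<omega>"
  shows "\<Sqinter>\<^bsub>barL0 M\<^esub> S \<in> carrier (L0 M)"
    "a \<in> S \<Longrightarrow> AE \<omega> in M. val (\<Sqinter>\<^bsub>barL0 M\<^esub> S) \<omega> \<le> val a \<omega>"
    "k \<in> borel_measurable M \<Longrightarrow> Measurable.pred M P \<Longrightarrow>
      (\<And>a. a \<in> S \<Longrightarrow> AE \<omega> in M. P \<omega> \<longrightarrow> k \<omega> \<le> val a \<omega>) \<Longrightarrow> AE \<omega> in M. P \<omega> \<longrightarrow> k \<omega> \<le> val (\<Sqinter>\<^bsub>barL0 M\<^esub> S) \<omega>"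
proof -
  let ?i = "\<Sqinter>\<^bsub>barL0 M\<^esub> S"
  have SE: "S \<subseteq> carrier (barL0 M)" using S(1) L0_barL0 by blast
  have greatest: "AE \<omega> in M. P \<omega> \<longrightarrow> ereal (k \<omega>) \<le> rep ?i \<omega>"
    if [measurable]: "k \<in> borel_measurable M" "Measurable.pred M P"
      and le: "\<And>a. a \<in> S \<Longrightarrow> AE \<omega> in M. P \<omega> \<longrightarrow> k \<omega> \<le> val a \<omega>" for k P
  proof (rule Inf_greatest_AE[OF SE])
    fix a assume a: "a \<in> S"
    then have "a \<in> carrier (L0 M)" using S(1) by blast
    from le[OF a] rep_val[OF this] show "AE \<omega> in M. P \<omega> \<longrightarrow> ereal (k \<omega>) \<le> rep a \<omega>"
      by eventually_elim simp
  qed auto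
  have lower: "AE \<omega> in M. rep ?i \<omega> \<le> ereal (val a \<omega>)" if a: "a \<in> S" for a
  proof -
    have "a \<in> carrier (L0 M)" using a S(1) by blast
    from Inf_lower_AE[OF SE a] rep_val[OF this] show ?thesis by eventually_elim simp
  qed
  have "AE \<omega> in M. True \<longrightarrow> ereal (h \<omega>) \<le> rep ?i \<omega>" by (rule greatest) (use h in auto)
  with lower[OF S(2)] have "AE \<omega> in M. \<bar>rep ?i \<omega>\<bar> \<noteq> \<infinity>" by eventually_elim auto
  then show i: "?i \<in> carrier (L0 M)" using barL0.inf_closed[OF SE] by (simp add: L0_def)
  show "AE \<omega> in M. val ?i \<omega> \<le> val a \<omega>" if a: "a \<in> S" for a
    using lower[OF a] rep_val[OF i] by eventually_elim simp
  show "AE \<omega> in M. P \<omega> \<longrightarrow> k \<omega> \<le> val ?i \<omega>"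
    if "k \<in> borel_measurable M" "Measurable.pred M P"
      "\<And>a. a \<in> S \<Longrightarrow> AE \<omega> in M. P \<omega> \<longrightarrow> k \<omega> \<le> val a \<omega>"
  proof -
    have "AE \<omega> in M. P \<omega> \<longrightarrow> ereal (k \<omega>) \<le> rep ?i \<omega>" by (rule greatest) (use that in auto)
    with rep_val[OF i] show ?thesis by eventually_elim simp
  qed
qed

end

context L0_module
begin

lemma L0_linear_smult_val:
  assumes "L0_linear M V f" "l \<in> carrier (L0 M)" "x \<in> carrier V"
  shows "AE \<omega> in M. val (f (l \<odot>\<^bsub>V\<^esub> x)) \<omega> = val l \<omega> * val (f x) \<omega>"
  using assms val_mult[of l M "f x"] by (auto simp: L0_linear_def Pi_iff)

lemma L0_linear_add_val:
  assumes "L0_linear M V f" "x \<in> carrier V" "y \<in> carrier V"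
  shows "AE \<omega> in M. val (f (x \<oplus>\<^bsub>V\<^esub> y)) \<omega> = val (f x) \<omega> + val (f y) \<omega>"
  using assms val_add[of "f x" M "f y"] by (auto simp: L0_linear_def Pi_iff)

lemma L0_linear_zero:
  assumes "L0_linear M V f"
  shows "f \<zero>\<^bsub>V\<^esub> = \<zero>\<^bsub>L0 M\<^esub>"
proof -
  have "f \<zero>\<^bsub>V\<^esub> \<in> carrier (L0 M)" "f (\<zero>\<^bsub>L0 M\<^esub> \<odot>\<^bsub>V\<^esub> \<zero>\<^bsub>V\<^esub>) = \<zero>\<^bsub>L0 M\<^esub> \<otimes>\<^bsub>L0 M\<^esub> f \<zero>\<^bsub>V\<^esub>"
    using assms R.zero_closed M.zero_closed unfolding L0_linear_def by blast+
  then show ?thesis by simp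
qed

lemma L0_linear_uminus_val:
  assumes "L0_linear M V f" "x \<in> carrier V"
  shows "AE \<omega> in M. val (f (\<ominus>\<^bsub>V\<^esub> x)) \<omega> = - val (f x) \<omega>"
proof -
  have "AE \<omega> in M. val (f (x \<oplus>\<^bsub>V\<^esub> \<ominus>\<^bsub>V\<^esub> x)) \<omega> = val (f x) \<omega> + val (f (\<ominus>\<^bsub>V\<^esub> x)) \<omega>"
    using assms by (intro L0_linear_add_val) auto
  moreover have "f (x \<oplus>\<^bsub>V\<^esub> \<ominus>\<^bsub>V\<^esub> x) = \<zero>\<^bsub>L0 M\<^esub>"
    using assms by (simp add: M.r_neg L0_linear_zero)
  ultimately show ?thesis using val_zero[of M] by auto
qed

lemma L0_linear_minus_val:
  assumes "L0_linear M V f" "x \<in> carrier V" "y \<in> carrier V"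
  shows "AE \<omega> in M. val (f (x \<ominus>\<^bsub>V\<^esub> y)) \<omega> = val (f x) \<omega> - val (f y) \<omega>"
  using L0_linear_add_val[OF assms(1,2), of "\<ominus>\<^bsub>V\<^esub> y"] L0_linear_uminus_val[OF assms(1,3)] assms(3)
  by (auto simp: a_minus_def)

text \<open>Subadditivity at 0 + 0 gives one sign, homogeneity with factor 0 the other.\<close>

lemma sublinear_zero:
  assumes q: "sublinear M V q"
  shows "AE \<omega> in M. val (q \<zero>\<^bsub>V\<^esub>) \<omega> = 0"
proof -
  have z: "AE \<omega> in M. 0 \<le> val \<zero>\<^bsub>L0 M\<^esub> \<omega>" using val_zero[of M] by eventually_elim simp
  show ?thesis
    using sublinearD(3)[OF q, of "\<zero>\<^bsub>V\<^esub>" "\<zero>\<^bsub>V\<^esub>"] sublinearD(4)[OF q _ z, of "\<zero>\<^bsub>V\<^esub>"] val_zero[of M] by auto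
qed

lemma sublinear_uminus:
  assumes q: "sublinear M V q" and x: "x \<in> carrier V"
  shows "AE \<omega> in M. - val (q (\<ominus>\<^bsub>V\<^esub> x)) \<omega> \<le> val (q x) \<omega>"
  using sublinearD(3)[OF q x, of "\<ominus>\<^bsub>V\<^esub> x"] sublinear_zero[OF q] x by (auto simp: M.r_neg)

text \<open>The reverse inequality follows by applying subadditivity to \<open>(1 + l) x\<close>.\<close>

lemma sublinear_smult:
  assumes q: "sublinear M V q" and l: "l \<in> carrier (L0 M)" and l0: "AE \<omega> in M. 0 \<le> val l \<omega>" and x: "x \<in> carrier V"
  shows "AE \<omega> in M. val (q (l \<odot>\<^bsub>V\<^esub> x)) \<omega> = val l \<omega> * val (q x) \<omega>"
proof -
  let ?k = "rvar M (\<lambda>\<omega>. 1 / (1 + val l \<omega>))"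
  have m: "(\<lambda>\<omega>. 1 / (1 + val l \<omega>)) \<in> borel_measurable M" using l by simp
  note vk = val_rvar[OF m]
  let ?m = "\<one>\<^bsub>L0 M\<^esub> \<oplus>\<^bsub>L0 M\<^esub> l"
  have k: "?k \<in> carrier (L0 M)" "?m \<in> carrier (L0 M)" using m l by auto
  have k0: "AE \<omega> in M. 0 \<le> val ?k \<omega>" using vk l0 by eventually_elim simp
  have "?k \<otimes>\<^bsub>L0 M\<^esub> ?m = \<one>\<^bsub>L0 M\<^esub>"
  proof (rule L0_eqI[where M=M])
    show "AE \<omega> in M. val (?k \<otimes>\<^bsub>L0 M\<^esub> ?m) \<omega> = val \<one>\<^bsub>L0 M\<^esub> \<omega>"
      using val_mult[OF k] val_add[OF R.one_closed l] val_one[of M] vk l0 by eventually_elim simp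
  qed (use k l in auto)
  then have "x = ?k \<odot>\<^bsub>V\<^esub> (?m \<odot>\<^bsub>V\<^esub> x)" using k x by (simp add: smult_assoc1[symmetric])
  moreover have "?m \<odot>\<^bsub>V\<^esub> x = x \<oplus>\<^bsub>V\<^esub> l \<odot>\<^bsub>V\<^esub> x" using l x by (simp add: smult_l_distr)
  ultimately have "AE \<omega> in M. val (q x) \<omega> \<le> val ?k \<omega> * val (q (x \<oplus>\<^bsub>V\<^esub> l \<odot>\<^bsub>V\<^esub> x)) \<omega>"
    using sublinearD(4)[OF q k(1) k0, of "x \<oplus>\<^bsub>V\<^esub> l \<odot>\<^bsub>V\<^esub> x"] l x by simp
  moreover have "AE \<omega> in M. val (q (x \<oplus>\<^bsub>V\<^esub> l \<odot>\<^bsub>V\<^esub> x)) \<omega> \<le> val (q x) \<omega> + val (q (l \<odot>\<^bsub>V\<^esub> x)) \<omega>"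
    using l x by (intro sublinearD(3)[OF q]) auto
  moreover note sublinearD(4)[OF q l l0 x] vk l0
  ultimately show ?thesis
  proof eventually_elim
    case (elim \<omega>)
    have "(1 + val l \<omega>) * val (q x) \<omega> \<le> val (q (x \<oplus>\<^bsub>V\<^esub> l \<odot>\<^bsub>V\<^esub> x)) \<omega>"
      using elim(1,4,5) by (simp add: field_simps)
    with elim show ?case by (simp add: algebra_simps)
  qed
qed

text \<open>The lowered functional is \<open>r x = inf {q (x + l z) - l q z}\<close> over
  \<open>l\<close> nonnegative. The choice \<open>l = 0\<close> shows that it lies below
  \<open>q\<close>, and \<open>l = 1\<close> at the point \<open>- z\<close> gives the last claim.
  If \<open>q\<close> is minimal, nothing can be lowered, and this claim makes \<open>q\<close>
  odd.\<close>

lemma sublinear_step: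
  assumes q: "sublinear M V q" and z: "z \<in> carrier V"
  obtains r where "sublinear M V r" "\<And>x. x \<in> carrier V \<Longrightarrow> AE \<omega> in M. val (r x) \<omega> \<le> val (q x) \<omega>"
    "AE \<omega> in M. val (r (\<ominus>\<^bsub>V\<^esub> z)) \<omega> \<le> - val (q z) \<omega>"
proof -
  define \<Lambda> where "\<Lambda> = {l \<in> carrier (L0 M). AE \<omega> in M. 0 \<le> val l \<omega>}"
  define a where "a l x = rvar M (\<lambda>\<omega>. val (q (x \<oplus>\<^bsub>V\<^esub> l \<odot>\<^bsub>V\<^esub> z)) \<omega> - val l \<omega> * val (q z) \<omega>)" for l x
  define r where "r = (\<lambda>x\<in>carrier V. \<Sqinter>\<^bsub>barL0 M\<^esub> ((\<lambda>l. a l x) ` \<Lambda>))"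
  have qc: "q x \<in> carrier (L0 M)" if "x \<in> carrier V" for x using sublinearD(2)[OF q that] .
  have m: "(\<lambda>\<omega>. val (q (x \<oplus>\<^bsub>V\<^esub> l \<odot>\<^bsub>V\<^esub> z)) \<omega> - val l \<omega> * val (q z) \<omega>) \<in> borel_measurable M"
    if "x \<in> carrier V" "l \<in> \<Lambda>" for x l
    using that z by (intro borel_measurable_diff borel_measurable_times val_measurable qc) (auto simp: \<Lambda>_def)
  have a: "a l x \<in> carrier (L0 M)" if "x \<in> carrier V" "l \<in> \<Lambda>" for x l
    unfolding a_def by (rule rvar_L0[OF m[OF that]])
  have va: "AE \<omega> in M. val (a l x) \<omega> = val (q (x \<oplus>\<^bsub>V\<^esub> l \<odot>\<^bsub>V\<^esub> z)) \<omega> - val l \<omega> * val (q z) \<omega>"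
    if "x \<in> carrier V" "l \<in> \<Lambda>" for x l
    unfolding a_def by (rule val_rvar[OF m[OF that]])
  have zero: "\<zero>\<^bsub>L0 M\<^esub> \<in> \<Lambda>" and one: "\<one>\<^bsub>L0 M\<^esub> \<in> \<Lambda>" using val_zero[of M] val_one[of M] by (auto simp: \<Lambda>_def)
  \<comment> \<open>The bound \<open>- q (- x)\<close> does not depend on \<open>l\<close>: it comes
    from \<open>l q z = q (l z)\<close> and subadditivity applied to
    \<open>l z = (x + l z) - x\<close>. It makes the infimum finite.\<close>
  have bound: "AE \<omega> in M. - val (q (\<ominus>\<^bsub>V\<^esub> x)) \<omega> \<le> val (a l x) \<omega>" if x: "x \<in> carrier V" and l: "l \<in> \<Lambda>" for x l
  proof -
    have l': "l \<in> carrier (L0 M)" "AE \<omega> in M. 0 \<le> val l \<omega>" using l by (auto simp: \<Lambda>_def)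
    have "l \<odot>\<^bsub>V\<^esub> z = (x \<oplus>\<^bsub>V\<^esub> l \<odot>\<^bsub>V\<^esub> z) \<oplus>\<^bsub>V\<^esub> \<ominus>\<^bsub>V\<^esub> x" using x l' z by (simp add: M.a_ac M.r_neg2)
    then have "AE \<omega> in M. val (q (l \<odot>\<^bsub>V\<^esub> z)) \<omega> \<le> val (q (x \<oplus>\<^bsub>V\<^esub> l \<odot>\<^bsub>V\<^esub> z)) \<omega> + val (q (\<ominus>\<^bsub>V\<^esub> x)) \<omega>"
      using sublinearD(3)[OF q, of "x \<oplus>\<^bsub>V\<^esub> l \<odot>\<^bsub>V\<^esub> z" "\<ominus>\<^bsub>V\<^esub> x"] x l' z by simp
    with sublinear_smult[OF q l' z] va[OF x l] show ?thesis by eventually_elim simp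
  qed
  have sub: "(\<lambda>l. a l x) ` \<Lambda> \<subseteq> carrier (L0 M)" if "x \<in> carrier V" for x using a that by auto
  have bm: "(\<lambda>\<omega>. - val (q (\<ominus>\<^bsub>V\<^esub> x)) \<omega>) \<in> borel_measurable M" if "x \<in> carrier V" for x
    using that by (intro borel_measurable_uminus val_measurable qc) auto
  have rI: "r x \<in> carrier (L0 M)"
    and lower: "\<And>l. l \<in> \<Lambda> \<Longrightarrow> AE \<omega> in M. val (r x) \<omega> \<le> val (a l x) \<omega>"
    and greatest: "\<And>k P. k \<in> borel_measurable M \<Longrightarrow> Measurable.pred M P \<Longrightarrow>
      (\<And>l. l \<in> \<Lambda> \<Longrightarrow> AE \<omega> in M. P \<omega> \<longrightarrow> k \<omega> \<le> val (a l x) \<omega>) \<Longrightarrow> AE \<omega> in M. P \<omega> \<longrightarrow> k \<omega> \<le> val (r x) \<omega>"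
    if x: "x \<in> carrier V" for x
  proof -
    have b: "AE \<omega> in M. - val (q (\<ominus>\<^bsub>V\<^esub> x)) \<omega> \<le> val c \<omega>" if "c \<in> (\<lambda>l. a l x) ` \<Lambda>" for c
      using that bound[OF x] by auto
    note inf = L0_Inf[OF sub[OF x] imageI[OF zero] bm[OF x] b]
    show "r x \<in> carrier (L0 M)" using inf(1) x by (simp add: r_def)
    show "AE \<omega> in M. val (r x) \<omega> \<le> val (a l x) \<omega>" if "l \<in> \<Lambda>" for l
      using inf(2) x that by (simp add: r_def)
    show "AE \<omega> in M. P \<omega> \<longrightarrow> k \<omega> \<le> val (r x) \<omega>" if "k \<in> borel_measurable M" "Measurable.pred M P"
      "\<And>l. l \<in> \<Lambda> \<Longrightarrow> AE \<omega> in M. P \<omega> \<longrightarrow> k \<omega> \<le> val (a l x) \<omega>" for k P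
      using inf(3)[of k P] x that by (auto simp: r_def)
  qed
  have rm: "val (r x) \<in> borel_measurable M" if "x \<in> carrier V" for x using rI[OF that] by simp
  show ?thesis
  proof
    show "sublinear M V r"
      unfolding sublinear_def
    proof (intro conjI ballI impI)
      show "r \<in> carrier V \<rightarrow>\<^sub>E carrier (L0 M)" using rI by (auto simp: r_def)
    next
      fix x y assume x: "x \<in> carrier V" and y: "y \<in> carrier V"
      have *: "AE \<omega> in M. val (r (x \<oplus>\<^bsub>V\<^esub> y)) \<omega> \<le> val (a l x) \<omega> + val (a k y) \<omega>" if l: "l \<in> \<Lambda>" and k: "k \<in> \<Lambda>" for l k
      proof -
        have lk: "l \<in> carrier (L0 M)" "k \<in> carrier (L0 M)" using l k by (auto simp: \<Lambda>_def)
        have "AE \<omega> in M. 0 \<le> val l \<omega>" "AE \<omega> in M. 0 \<le> val k \<omega>" using l k by (auto simp: \<Lambda>_def)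
        with val_add[OF lk] have "AE \<omega> in M. 0 \<le> val (l \<oplus>\<^bsub>L0 M\<^esub> k) \<omega>" by eventually_elim simp
        then have s: "l \<oplus>\<^bsub>L0 M\<^esub> k \<in> \<Lambda>" using lk by (simp add: \<Lambda>_def)
        have xy: "x \<oplus>\<^bsub>V\<^esub> y \<in> carrier V" using x y by simp
        have e: "(x \<oplus>\<^bsub>V\<^esub> y) \<oplus>\<^bsub>V\<^esub> (l \<oplus>\<^bsub>L0 M\<^esub> k) \<odot>\<^bsub>V\<^esub> z = (x \<oplus>\<^bsub>V\<^esub> l \<odot>\<^bsub>V\<^esub> z) \<oplus>\<^bsub>V\<^esub> (y \<oplus>\<^bsub>V\<^esub> k \<odot>\<^bsub>V\<^esub> z)"
          using x y z lk by (simp add: smult_l_distr M.a_ac)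
        have "AE \<omega> in M. val (q ((x \<oplus>\<^bsub>V\<^esub> y) \<oplus>\<^bsub>V\<^esub> (l \<oplus>\<^bsub>L0 M\<^esub> k) \<odot>\<^bsub>V\<^esub> z)) \<omega> \<le>
            val (q (x \<oplus>\<^bsub>V\<^esub> l \<odot>\<^bsub>V\<^esub> z)) \<omega> + val (q (y \<oplus>\<^bsub>V\<^esub> k \<odot>\<^bsub>V\<^esub> z)) \<omega>"
          unfolding e using x y z lk by (intro sublinearD(3)[OF q]) auto
        with lower[OF xy s] va[OF xy s] va[OF x l] va[OF y k] val_add[OF lk] show ?thesis
          by eventually_elim (simp add: algebra_simps)
      qed
      have rxy: "val (r (x \<oplus>\<^bsub>V\<^esub> y)) \<in> borel_measurable M" using x y by (intro rm) simp
      \<comment> \<open>The two infima are removed one after the other: with \<open>l\<close> fixed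
        the estimate is carried to the infimum over \<open>k\<close>, and the result to the infimum
        over \<open>l\<close>.\<close>
      have "AE \<omega> in M. True \<longrightarrow> val (r (x \<oplus>\<^bsub>V\<^esub> y)) \<omega> - val (r y) \<omega> \<le> val (r x) \<omega>"
      proof (rule greatest[OF x])
        fix l assume l: "l \<in> \<Lambda>"
        have "AE \<omega> in M. True \<longrightarrow> val (r (x \<oplus>\<^bsub>V\<^esub> y)) \<omega> - val (a l x) \<omega> \<le> val (r y) \<omega>"
        proof (rule greatest[OF y])
          fix k assume "k \<in> \<Lambda>"
          from *[OF l this] show "AE \<omega> in M. True \<longrightarrow> val (r (x \<oplus>\<^bsub>V\<^esub> y)) \<omega> - val (a l x) \<omega> \<le> val (a k y) \<omega>"
            by eventually_elim simp
        qed (use rxy a[OF x l] in auto)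
        then show "AE \<omega> in M. True \<longrightarrow> val (r (x \<oplus>\<^bsub>V\<^esub> y)) \<omega> - val (r y) \<omega> \<le> val (a l x) \<omega>"
          by eventually_elim simp
      qed (use rxy rm[OF y] in auto)
      then show "AE \<omega> in M. val (r (x \<oplus>\<^bsub>V\<^esub> y)) \<omega> \<le> val (r x) \<omega> + val (r y) \<omega>"
        by eventually_elim simp
    next
      fix \<mu> x assume \<mu>: "\<mu> \<in> carrier (L0 M)" and \<mu>0: "AE \<omega> in M. 0 \<le> val \<mu> \<omega>" and x: "x \<in> carrier V"
      have \<mu>x: "\<mu> \<odot>\<^bsub>V\<^esub> x \<in> carrier V" using \<mu> x by simp
      have *: "AE \<omega> in M. val (r (\<mu> \<odot>\<^bsub>V\<^esub> x)) \<omega> \<le> val \<mu> \<omega> * val (a l x) \<omega>" if l: "l \<in> \<Lambda>" for l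
      proof -
        have l': "l \<in> carrier (L0 M)" "AE \<omega> in M. 0 \<le> val l \<omega>" using l by (auto simp: \<Lambda>_def)
        from val_mult[OF \<mu> l'(1)] \<mu>0 l'(2) have "AE \<omega> in M. 0 \<le> val (\<mu> \<otimes>\<^bsub>L0 M\<^esub> l) \<omega>" by eventually_elim simp
        then have s: "\<mu> \<otimes>\<^bsub>L0 M\<^esub> l \<in> \<Lambda>" using \<mu> l' by (simp add: \<Lambda>_def)
        have e: "\<mu> \<odot>\<^bsub>V\<^esub> x \<oplus>\<^bsub>V\<^esub> (\<mu> \<otimes>\<^bsub>L0 M\<^esub> l) \<odot>\<^bsub>V\<^esub> z = \<mu> \<odot>\<^bsub>V\<^esub> (x \<oplus>\<^bsub>V\<^esub> l \<odot>\<^bsub>V\<^esub> z)"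
          using x z \<mu> l' by (simp add: smult_r_distr smult_assoc1)
        have "AE \<omega> in M. val (q (\<mu> \<odot>\<^bsub>V\<^esub> x \<oplus>\<^bsub>V\<^esub> (\<mu> \<otimes>\<^bsub>L0 M\<^esub> l) \<odot>\<^bsub>V\<^esub> z)) \<omega> \<le> val \<mu> \<omega> * val (q (x \<oplus>\<^bsub>V\<^esub> l \<odot>\<^bsub>V\<^esub> z)) \<omega>"
          unfolding e using x z l' \<mu> by (intro sublinearD(4)[OF q _ \<mu>0]) auto
        with lower[OF \<mu>x s] va[OF \<mu>x s] va[OF x l] val_mult[OF \<mu> l'(1)] show ?thesis
          by eventually_elim (simp add: right_diff_distrib mult.assoc)
      qed
      have [measurable]: "val \<mu> \<in> borel_measurable M" using \<mu> by simp
      \<comment> \<open>Dividing by the factor is possible only where it is positive. Where it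
        vanishes, the estimate for \<open>l = 0\<close> already says that the left-hand side is at
        most 0.\<close>
      have "AE \<omega> in M. 0 < val \<mu> \<omega> \<longrightarrow> val (r (\<mu> \<odot>\<^bsub>V\<^esub> x)) \<omega> / val \<mu> \<omega> \<le> val (r x) \<omega>"
      proof (rule greatest[OF x])
        fix l assume "l \<in> \<Lambda>"
        from *[OF this] show "AE \<omega> in M. 0 < val \<mu> \<omega> \<longrightarrow> val (r (\<mu> \<odot>\<^bsub>V\<^esub> x)) \<omega> / val \<mu> \<omega> \<le> val (a l x) \<omega>"
          by eventually_elim (simp add: field_simps)
      qed (use rm[OF \<mu>x] in auto)
      with *[OF zero] \<mu>0 show "AE \<omega> in M. val (r (\<mu> \<odot>\<^bsub>V\<^esub> x)) \<omega> \<le> val \<mu> \<omega> * val (r x) \<omega>"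
      proof eventually_elim
        case (elim \<omega>)
        then show ?case by (cases "val \<mu> \<omega> = 0") (auto simp: field_simps)
      qed
    qed
    fix x assume x: "x \<in> carrier V"
    have "AE \<omega> in M. val (a \<zero>\<^bsub>L0 M\<^esub> x) \<omega> = val (q x) \<omega>"
      using va[OF x zero] val_zero[of M] x z by auto
    with lower[OF x zero] show "AE \<omega> in M. val (r x) \<omega> \<le> val (q x) \<omega>" by eventually_elim simp
  next
    have z': "\<ominus>\<^bsub>V\<^esub> z \<in> carrier V" using z by simp
    have "AE \<omega> in M. val (a \<one>\<^bsub>L0 M\<^esub> (\<ominus>\<^bsub>V\<^esub> z)) \<omega> = - val (q z) \<omega>"
      using va[OF z' one] val_one[of M] sublinear_zero[OF q] z by (auto simp: M.l_neg)
    with lower[OF z' one] show "AE \<omega> in M. val (r (\<ominus>\<^bsub>V\<^esub> z)) \<omega> \<le> - val (q z) \<omega>" by eventually_elim simp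
  qed
qed

lemma sublinear_antisym:
  assumes "sublinear M V q" "sublinear M V r"
    "\<And>x. x \<in> carrier V \<Longrightarrow> AE \<omega> in M. val (q x) \<omega> \<le> val (r x) \<omega>"
    "\<And>x. x \<in> carrier V \<Longrightarrow> AE \<omega> in M. val (r x) \<omega> \<le> val (q x) \<omega>"
  shows "q = r"
proof (rule PiE_ext[OF sublinearD(1)[OF assms(1)] sublinearD(1)[OF assms(2)]])
  fix x assume x: "x \<in> carrier V"
  show "q x = r x"
  proof (rule L0_eqI[OF sublinearD(2)[OF assms(1) x] sublinearD(2)[OF assms(2) x]])
    from assms(3)[OF x] assms(4)[OF x] show "AE \<omega> in M. val (q x) \<omega> = val (r x) \<omega>"
      by eventually_elim simp
  qed
qed

text \<open>The pointwise essential infimum works. For subadditivity two members are replaced by the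
  smaller one, which exists in a chain. The bound by \<open>q\<close> gives \<open>- q (- x)\<close>
  as a lower bound common to all members.\<close>

lemma sublinear_chain_Inf:
  assumes C: "C \<noteq> {}" "\<And>r. r \<in> C \<Longrightarrow> sublinear M V r"
    and le: "\<And>r x. r \<in> C \<Longrightarrow> x \<in> carrier V \<Longrightarrow> AE \<omega> in M. val (r x) \<omega> \<le> val (q x) \<omega>"
    and q: "sublinear M V q"
    and chain: "\<And>r s. r \<in> C \<Longrightarrow> s \<in> C \<Longrightarrow> (\<forall>x\<in>carrier V. AE \<omega> in M. val (r x) \<omega> \<le> val (s x) \<omega>) \<or>
      (\<forall>x\<in>carrier V. AE \<omega> in M. val (s x) \<omega> \<le> val (r x) \<omega>)"
  obtains u where "sublinear M V u" "\<And>r x. r \<in> C \<Longrightarrow> x \<in> carrier V \<Longrightarrow> AE \<omega> in M. val (u x) \<omega> \<le> val (r x) \<omega>"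
proof -
  obtain r0 where r0: "r0 \<in> C" using C(1) by auto
  define u where "u = (\<lambda>x\<in>carrier V. \<Sqinter>\<^bsub>barL0 M\<^esub> ((\<lambda>r. r x) ` C))"
  have bound: "AE \<omega> in M. - val (q (\<ominus>\<^bsub>V\<^esub> x)) \<omega> \<le> val (r x) \<omega>" if "x \<in> carrier V" "r \<in> C" for x r
    using sublinear_uminus[OF C(2)[OF that(2)] that(1)] le[OF that(2), of "\<ominus>\<^bsub>V\<^esub> x"] that by auto
  have bm: "(\<lambda>\<omega>. - val (q (\<ominus>\<^bsub>V\<^esub> x)) \<omega>) \<in> borel_measurable M" if "x \<in> carrier V" for x
    using that by (intro borel_measurable_uminus val_measurable sublinearD(2)[OF q]) auto
  have sub: "(\<lambda>r. r x) ` C \<subseteq> carrier (L0 M)" if "x \<in> carrier V" for x using sublinearD(2)[OF C(2)] that by auto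
  have uI: "u x \<in> carrier (L0 M)"
    and lower: "\<And>r. r \<in> C \<Longrightarrow> AE \<omega> in M. val (u x) \<omega> \<le> val (r x) \<omega>"
    and greatest: "\<And>k P. k \<in> borel_measurable M \<Longrightarrow> Measurable.pred M P \<Longrightarrow>
      (\<And>r. r \<in> C \<Longrightarrow> AE \<omega> in M. P \<omega> \<longrightarrow> k \<omega> \<le> val (r x) \<omega>) \<Longrightarrow> AE \<omega> in M. P \<omega> \<longrightarrow> k \<omega> \<le> val (u x) \<omega>"
    if x: "x \<in> carrier V" for x
  proof -
    have b: "AE \<omega> in M. - val (q (\<ominus>\<^bsub>V\<^esub> x)) \<omega> \<le> val c \<omega>" if "c \<in> (\<lambda>r. r x) ` C" for c
      using that bound[OF x] by auto
    note inf = L0_Inf[OF sub[OF x] imageI[OF r0] bm[OF x] b]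
    show "u x \<in> carrier (L0 M)" using inf(1) x by (simp add: u_def)
    show "AE \<omega> in M. val (u x) \<omega> \<le> val (r x) \<omega>" if "r \<in> C" for r
      using inf(2) x that by (simp add: u_def)
    show "AE \<omega> in M. P \<omega> \<longrightarrow> k \<omega> \<le> val (u x) \<omega>" if "k \<in> borel_measurable M" "Measurable.pred M P"
      "\<And>r. r \<in> C \<Longrightarrow> AE \<omega> in M. P \<omega> \<longrightarrow> k \<omega> \<le> val (r x) \<omega>" for k P
      using inf(3)[of k P] x that by (auto simp: u_def)
  qed
  have um: "val (u x) \<in> borel_measurable M" if "x \<in> carrier V" for x using uI[OF that] by simp
  show ?thesis
  proof
    show "sublinear M V u"
      unfolding sublinear_def
    proof (intro conjI ballI impI)
      show "u \<in> carrier V \<rightarrow>\<^sub>E carrier (L0 M)" using uI by (auto simp: u_def)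
    next
      fix x y assume x: "x \<in> carrier V" and y: "y \<in> carrier V"
      then have xy: "x \<oplus>\<^bsub>V\<^esub> y \<in> carrier V" by simp
      have *: "AE \<omega> in M. val (u (x \<oplus>\<^bsub>V\<^esub> y)) \<omega> \<le> val (r x) \<omega> + val (s y) \<omega>" if r: "r \<in> C" and s: "s \<in> C" for r s
        using chain[OF r s]
      proof
        assume "\<forall>x\<in>carrier V. AE \<omega> in M. val (r x) \<omega> \<le> val (s x) \<omega>"
        with y have "AE \<omega> in M. val (r y) \<omega> \<le> val (s y) \<omega>" by blast
        with lower[OF xy r] sublinearD(3)[OF C(2)[OF r] x y] show ?thesis by eventually_elim simp
      next
        assume "\<forall>x\<in>carrier V. AE \<omega> in M. val (s x) \<omega> \<le> val (r x) \<omega>"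
        with x have "AE \<omega> in M. val (s x) \<omega> \<le> val (r x) \<omega>" by blast
        with lower[OF xy s] sublinearD(3)[OF C(2)[OF s] x y] show ?thesis by eventually_elim simp
      qed
      have "AE \<omega> in M. True \<longrightarrow> val (u (x \<oplus>\<^bsub>V\<^esub> y)) \<omega> - val (u y) \<omega> \<le> val (u x) \<omega>"
      proof (rule greatest[OF x])
        fix r assume r: "r \<in> C"
        have "AE \<omega> in M. True \<longrightarrow> val (u (x \<oplus>\<^bsub>V\<^esub> y)) \<omega> - val (r x) \<omega> \<le> val (u y) \<omega>"
        proof (rule greatest[OF y])
          fix s assume "s \<in> C"
          from *[OF r this] show "AE \<omega> in M. True \<longrightarrow> val (u (x \<oplus>\<^bsub>V\<^esub> y)) \<omega> - val (r x) \<omega> \<le> val (s y) \<omega>"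
            by eventually_elim simp
        qed (use um[OF xy] sublinearD(2)[OF C(2)[OF r] x] in auto)
        then show "AE \<omega> in M. True \<longrightarrow> val (u (x \<oplus>\<^bsub>V\<^esub> y)) \<omega> - val (u y) \<omega> \<le> val (r x) \<omega>"
          by eventually_elim simp
      qed (use um[OF xy] um[OF y] in auto)
      then show "AE \<omega> in M. val (u (x \<oplus>\<^bsub>V\<^esub> y)) \<omega> \<le> val (u x) \<omega> + val (u y) \<omega>"
        by eventually_elim simp
    next
      fix \<mu> x assume \<mu>: "\<mu> \<in> carrier (L0 M)" and \<mu>0: "AE \<omega> in M. 0 \<le> val \<mu> \<omega>" and x: "x \<in> carrier V"
      have \<mu>x: "\<mu> \<odot>\<^bsub>V\<^esub> x \<in> carrier V" using \<mu> x by simp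
      have *: "AE \<omega> in M. val (u (\<mu> \<odot>\<^bsub>V\<^esub> x)) \<omega> \<le> val \<mu> \<omega> * val (r x) \<omega>" if r: "r \<in> C" for r
        using lower[OF \<mu>x r] sublinearD(4)[OF C(2)[OF r] \<mu> \<mu>0 x] by eventually_elim simp
      have [measurable]: "val \<mu> \<in> borel_measurable M" using \<mu> by simp
      have "AE \<omega> in M. 0 < val \<mu> \<omega> \<longrightarrow> val (u (\<mu> \<odot>\<^bsub>V\<^esub> x)) \<omega> / val \<mu> \<omega> \<le> val (u x) \<omega>"
      proof (rule greatest[OF x])
        fix r assume "r \<in> C"
        from *[OF this] show "AE \<omega> in M. 0 < val \<mu> \<omega> \<longrightarrow> val (u (\<mu> \<odot>\<^bsub>V\<^esub> x)) \<omega> / val \<mu> \<omega> \<le> val (r x) \<omega>"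
          by eventually_elim (simp add: field_simps)
      qed (use um[OF \<mu>x] in auto)
      with *[OF r0] \<mu>0 show "AE \<omega> in M. val (u (\<mu> \<odot>\<^bsub>V\<^esub> x)) \<omega> \<le> val \<mu> \<omega> * val (u x) \<omega>"
      proof eventually_elim
        case (elim \<omega>)
        then show ?case by (cases "val \<mu> \<omega> = 0") (auto simp: field_simps)
      qed
    qed
  qed (rule lower)
qed

text \<open>An odd sublinear functional is additive: apply subadditivity to
  \<open>x = (x + y) - y\<close>. A scalar of varying sign is split into its positive and negative
  parts, for which homogeneity is available.\<close>

lemma minimal_sublinear_linear:
  assumes q: "sublinear M V q"
    and neg: "\<And>x. x \<in> carrier V \<Longrightarrow> AE \<omega> in M. val (q (\<ominus>\<^bsub>V\<^esub> x)) \<omega> \<le> - val (q x) \<omega>"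
  shows "L0_linear M V q"
  unfolding L0_linear_def
proof (intro conjI ballI)
  note qc = sublinearD(2)[OF q]
  show "q \<in> carrier V \<rightarrow> carrier (L0 M)" using qc by auto
  have add: "AE \<omega> in M. val (q (x \<oplus>\<^bsub>V\<^esub> y)) \<omega> = val (q x) \<omega> + val (q y) \<omega>"
    if x: "x \<in> carrier V" and y: "y \<in> carrier V" for x y
  proof -
    have "x = (x \<oplus>\<^bsub>V\<^esub> y) \<oplus>\<^bsub>V\<^esub> \<ominus>\<^bsub>V\<^esub> y" using x y by (simp add: M.a_assoc M.r_neg)
    then have "AE \<omega> in M. val (q x) \<omega> \<le> val (q (x \<oplus>\<^bsub>V\<^esub> y)) \<omega> + val (q (\<ominus>\<^bsub>V\<^esub> y)) \<omega>"
      using sublinearD(3)[OF q, of "x \<oplus>\<^bsub>V\<^esub> y" "\<ominus>\<^bsub>V\<^esub> y"] x y by simp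
    with sublinearD(3)[OF q x y] neg[OF y] show ?thesis by eventually_elim simp
  qed
  fix x assume x: "x \<in> carrier V"
  show "q (x \<oplus>\<^bsub>V\<^esub> y) = q x \<oplus>\<^bsub>L0 M\<^esub> q y" if y: "y \<in> carrier V" for y
  proof (rule L0_eqI[where M=M])
    show "AE \<omega> in M. val (q (x \<oplus>\<^bsub>V\<^esub> y)) \<omega> = val (q x \<oplus>\<^bsub>L0 M\<^esub> q y) \<omega>"
      using add[OF x y] val_add[OF qc[OF x] qc[OF y]] by eventually_elim simp
  qed (use x y qc in auto)
  fix l assume l: "l \<in> carrier (L0 M)"
  let ?p = "rvar M (\<lambda>\<omega>. max (val l \<omega>) 0)" and ?n = "rvar M (\<lambda>\<omega>. max (- val l \<omega>) 0)"
  have m: "(\<lambda>\<omega>. max (val l \<omega>) 0) \<in> borel_measurable M" "(\<lambda>\<omega>. max (- val l \<omega>) 0) \<in> borel_measurable M"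
    using l by auto
  have pn: "?p \<in> carrier (L0 M)" "?n \<in> carrier (L0 M)" using m by auto
  have p0: "AE \<omega> in M. 0 \<le> val ?p \<omega>" using val_rvar[OF m(1)] by eventually_elim simp
  have n0: "AE \<omega> in M. 0 \<le> val ?n \<omega>" using val_rvar[OF m(2)] by eventually_elim simp
  have "(\<lambda>\<omega>. max (val l \<omega>) 0 - max (- val l \<omega>) 0) = val l" by (auto simp: max_def)
  with rvar_minus[OF m] have "?p \<ominus>\<^bsub>L0 M\<^esub> ?n = l" using l by simp
  moreover have "(?p \<ominus>\<^bsub>L0 M\<^esub> ?n) \<odot>\<^bsub>V\<^esub> x = ?p \<odot>\<^bsub>V\<^esub> x \<oplus>\<^bsub>V\<^esub> ?n \<odot>\<^bsub>V\<^esub> (\<ominus>\<^bsub>V\<^esub> x)"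
    using pn x by (simp add: a_minus_def smult_l_distr smult_l_minus smult_r_minus)
  ultimately have lx: "l \<odot>\<^bsub>V\<^esub> x = ?p \<odot>\<^bsub>V\<^esub> x \<oplus>\<^bsub>V\<^esub> ?n \<odot>\<^bsub>V\<^esub> (\<ominus>\<^bsub>V\<^esub> x)" by (simp only:)
  have "AE \<omega> in M. val (q (?p \<odot>\<^bsub>V\<^esub> x \<oplus>\<^bsub>V\<^esub> ?n \<odot>\<^bsub>V\<^esub> (\<ominus>\<^bsub>V\<^esub> x))) \<omega> =
      val (q (?p \<odot>\<^bsub>V\<^esub> x)) \<omega> + val (q (?n \<odot>\<^bsub>V\<^esub> (\<ominus>\<^bsub>V\<^esub> x))) \<omega>"
    using pn x by (intro add) auto
  moreover have x': "\<ominus>\<^bsub>V\<^esub> x \<in> carrier V" using x by simp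
  note sublinear_smult[OF q pn(1) p0 x] sublinear_smult[OF q pn(2) n0 x'] neg[OF x] sublinear_uminus[OF q x]
    val_rvar[OF m(1)] val_rvar[OF m(2)]
  ultimately have v: "AE \<omega> in M. val (q (l \<odot>\<^bsub>V\<^esub> x)) \<omega> = val l \<omega> * val (q x) \<omega>"
    unfolding lx
  proof eventually_elim
    case (elim \<omega>)
    then have "val (q (\<ominus>\<^bsub>V\<^esub> x)) \<omega> = - val (q x) \<omega>" by simp
    with elim show ?case by (auto simp: max_def)
  qed
  show "q (l \<odot>\<^bsub>V\<^esub> x) = l \<otimes>\<^bsub>L0 M\<^esub> q x"
  proof (rule L0_eqI[where M=M])
    show "AE \<omega> in M. val (q (l \<odot>\<^bsub>V\<^esub> x)) \<omega> = val (l \<otimes>\<^bsub>L0 M\<^esub> q x) \<omega>"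
      using v val_mult[OF l qc[OF x]] by eventually_elim simp
  qed (use x l qc in auto)
qed

text \<open>Lowering \<open>p\<close> once at \<open>z\<close> before Zorn's lemma forces every
  functional below the result to reach \<open>p\<close> at \<open>z\<close>. No functional has to be
  defined on the multiples of \<open>z\<close> and extended from there; such a definition would be
  delicate, since \<open>l z\<close> may vanish while \<open>l\<close> does not.\<close>

theorem Hahn_Banach_L0:
  assumes p: "sublinear M V p" and z: "z \<in> carrier V"
  obtains f where "L0_linear M V f" "\<And>x. x \<in> carrier V \<Longrightarrow> AE \<omega> in M. val (f x) \<omega> \<le> val (p x) \<omega>"
    "AE \<omega> in M. val (p z) \<omega> \<le> val (f z) \<omega>"
proof -
  obtain q where q: "sublinear M V q" "\<And>x. x \<in> carrier V \<Longrightarrow> AE \<omega> in M. val (q x) \<omega> \<le> val (p x) \<omega>"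
    "AE \<omega> in M. val (q (\<ominus>\<^bsub>V\<^esub> z)) \<omega> \<le> - val (p z) \<omega>"
    using sublinear_step[OF p z] by blast
  define A where "A = {r. sublinear M V r \<and> (\<forall>x\<in>carrier V. AE \<omega> in M. val (r x) \<omega> \<le> val (q x) \<omega>)}"
  \<comment> \<open>The order is reversed, so that a maximal element is a minimal sublinear
    functional.\<close>
  define P where "P r s \<longleftrightarrow> (\<forall>x\<in>carrier V. AE \<omega> in M. val (s x) \<omega> \<le> val (r x) \<omega>)"
    for r s :: "'x \<Rightarrow> 'w rv"
  have qA: "q \<in> A" using q(1) by (simp add: A_def)
  have trans: "P r t" if "P r s" "P s t" for r s t
    unfolding P_def
  proof
    fix x assume "x \<in> carrier V"
    with that have "AE \<omega> in M. val (s x) \<omega> \<le> val (r x) \<omega>" "AE \<omega> in M. val (t x) \<omega> \<le> val (s x) \<omega>"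
      by (auto simp: P_def)
    then show "AE \<omega> in M. val (t x) \<omega> \<le> val (r x) \<omega>" by eventually_elim simp
  qed
  have "\<exists>m\<in>A. \<forall>a\<in>A. P m a \<longrightarrow> a = m"
  proof (rule predicate_Zorn)
    show "partial_order_on A (relation_of P A)"
    proof (rule partial_order_on_relation_ofI)
      fix r s assume "r \<in> A" "s \<in> A" "P r s" "P s r"
      then show "r = s" by (intro sublinear_antisym) (auto simp: A_def P_def)
    qed (use trans in \<open>auto simp: P_def\<close>)
  next
    fix C assume "C \<in> Chains (relation_of P A)"
    then have C: "C \<subseteq> A" "\<And>r s. r \<in> C \<Longrightarrow> s \<in> C \<Longrightarrow> P r s \<or> P s r"
      by (auto simp: Chains_def relation_of_def)
    show "\<exists>u\<in>A. \<forall>a\<in>C. P a u"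
    proof (cases "C = {}")
      case False
      then obtain r0 where r0: "r0 \<in> C" by auto
      have 1: "sublinear M V r" if "r \<in> C" for r using that C(1) by (auto simp: A_def)
      have 2: "AE \<omega> in M. val (r x) \<omega> \<le> val (q x) \<omega>" if "r \<in> C" "x \<in> carrier V" for r x
        using that C(1) by (auto simp: A_def)
      have 3: "(\<forall>x\<in>carrier V. AE \<omega> in M. val (r x) \<omega> \<le> val (s x) \<omega>) \<or>
          (\<forall>x\<in>carrier V. AE \<omega> in M. val (s x) \<omega> \<le> val (r x) \<omega>)" if "r \<in> C" "s \<in> C" for r s
        using C(2)[OF that] by (auto simp: P_def)
      obtain u where u: "sublinear M V u"
        "\<And>r x. r \<in> C \<Longrightarrow> x \<in> carrier V \<Longrightarrow> AE \<omega> in M. val (u x) \<omega> \<le> val (r x) \<omega>"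
        by (rule sublinear_chain_Inf[of C q, OF False]) (use 1 2 3 q(1) in auto)
      have "P q r0" using r0 C(1) by (auto simp: A_def P_def)
      moreover have "P a u" if "a \<in> C" for a using u(2) that by (simp add: P_def)
      ultimately have "u \<in> A" using u(1) trans[of q r0 u] r0 by (auto simp: A_def P_def)
      then show ?thesis using \<open>\<And>a. a \<in> C \<Longrightarrow> P a u\<close> by blast
    qed (use qA in auto)
  qed
  then obtain f where f: "f \<in> A" "\<And>a. a \<in> A \<Longrightarrow> P f a \<Longrightarrow> a = f" by auto
  have fs: "sublinear M V f" and fq: "\<And>x. x \<in> carrier V \<Longrightarrow> AE \<omega> in M. val (f x) \<omega> \<le> val (q x) \<omega>"
    using f(1) by (auto simp: A_def)
  have neg: "AE \<omega> in M. val (f (\<ominus>\<^bsub>V\<^esub> x)) \<omega> \<le> - val (f x) \<omega>" if x: "x \<in> carrier V" for x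
  proof -
    obtain r where r: "sublinear M V r" "\<And>y. y \<in> carrier V \<Longrightarrow> AE \<omega> in M. val (r y) \<omega> \<le> val (f y) \<omega>"
      "AE \<omega> in M. val (r (\<ominus>\<^bsub>V\<^esub> x)) \<omega> \<le> - val (f x) \<omega>"
      using sublinear_step[OF fs x] by blast
    \<comment> \<open>The functional lowered at \<open>x\<close> still lies below \<open>q\<close>,
      so by minimality it is \<open>f\<close> itself.\<close>
    have "P f r" "P q f" using r(2) fq by (auto simp: P_def)
    with trans[OF this(2,1)] r(1) have "r = f" by (intro f(2)) (auto simp: A_def P_def)
    with r(3) show ?thesis by simp
  qed
  show ?thesis
  proof
    show lin: "L0_linear M V f" by (rule minimal_sublinear_linear[OF fs neg])
    show "AE \<omega> in M. val (f x) \<omega> \<le> val (p x) \<omega>" if "x \<in> carrier V" for x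
      using fq[OF that] q(2)[OF that] by eventually_elim simp
    have "\<ominus>\<^bsub>V\<^esub> z \<in> carrier V" using z by simp
    from fq[OF this] q(3) L0_linear_uminus_val[OF lin z] show "AE \<omega> in M. val (p z) \<omega> \<le> val (f z) \<omega>"
      by eventually_elim simp
  qed
qed

end

section \<open>Separation in modules\<close>

context L0_module
begin

lemma one_minus:
  assumes "l \<in> carrier (L0 M)"
  shows "\<one>\<^bsub>L0 M\<^esub> \<ominus>\<^bsub>L0 M\<^esub> l \<in> carrier (L0 M)"
    "AE \<omega> in M. val (\<one>\<^bsub>L0 M\<^esub> \<ominus>\<^bsub>L0 M\<^esub> l) \<omega> = 1 - val l \<omega>"
  using assms val_add[OF R.one_closed, of "\<ominus>\<^bsub>L0 M\<^esub> l"] val_uminus[OF assms] val_one[of M]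
  by (auto simp: a_minus_def)

lemma mod_comb_closed [simp]:
  assumes "l \<in> carrier (L0 M)" "x \<in> carrier V" "y \<in> carrier V"
  shows "mod_comb M V l x y \<in> carrier V"
  using assms one_minus(1)[OF assms(1)] by (simp add: mod_comb_def)

lemma mod_glue_closed [simp]:
  assumes "A \<in> sets M" "x \<in> carrier V" "y \<in> carrier V"
  shows "mod_glue M V A x y \<in> carrier V"
  using assms by (simp add: mod_glue_def)

lemma L0_linear_comb_val:
  assumes f: "L0_linear M V f" and lxy: "l \<in> carrier (L0 M)" "x \<in> carrier V" "y \<in> carrier V"
  shows "AE \<omega> in M. val (f (mod_comb M V l x y)) \<omega> = val l \<omega> * val (f x) \<omega> + (1 - val l \<omega>) * val (f y) \<omega>"
proof -
  note k = one_minus[OF lxy(1)]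
  have "AE \<omega> in M. val (f (mod_comb M V l x y)) \<omega> =
      val (f (l \<odot>\<^bsub>V\<^esub> x)) \<omega> + val (f ((\<one>\<^bsub>L0 M\<^esub> \<ominus>\<^bsub>L0 M\<^esub> l) \<odot>\<^bsub>V\<^esub> y)) \<omega>"
    unfolding mod_comb_def using lxy k by (intro L0_linear_add_val[OF f]) auto
  with L0_linear_smult_val[OF f lxy(1,2)] L0_linear_smult_val[OF f k(1) lxy(3)] k(2)
  show ?thesis by eventually_elim simp
qed

lemma L0_linear_glue_val:
  assumes f: "L0_linear M V f" and Axy: "A \<in> sets M" "x \<in> carrier V" "y \<in> carrier V"
  shows "AE \<omega> in M. val (f (mod_glue M V A x y)) \<omega> = (if \<omega> \<in> A then val (f x) \<omega> else val (f y) \<omega>)"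
proof -
  have A': "space M - A \<in> sets M" using Axy by auto
  have "AE \<omega> in M. val (f (mod_glue M V A x y)) \<omega> =
      val (f (ind M A \<odot>\<^bsub>V\<^esub> x)) \<omega> + val (f (ind M (space M - A) \<odot>\<^bsub>V\<^esub> y)) \<omega>"
    unfolding mod_glue_def using Axy A' by (intro L0_linear_add_val[OF f]) auto
  with L0_linear_smult_val[OF f ind_L0[OF Axy(1)] Axy(2)] L0_linear_smult_val[OF f ind_L0[OF A'] Axy(3)]
    val_ind[OF Axy(1)] val_ind[OF A'] AE_space
  show ?thesis by eventually_elim auto
qed

lemma ind_mult_ind:
  assumes "A \<in> sets M" "B \<in> sets M"
  shows "ind M A \<otimes>\<^bsub>L0 M\<^esub> ind M B = ind M (A \<inter> B)"
  using assms by (simp add: ind_rvar rvar_mult indicator_inter_arith[abs_def])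

lemma ind_add_compl:
  assumes "A \<in> sets M"
  shows "ind M A \<oplus>\<^bsub>L0 M\<^esub> ind M (space M - A) = \<one>\<^bsub>L0 M\<^esub>"
proof -
  have "ind M A \<oplus>\<^bsub>L0 M\<^esub> ind M (space M - A) = rvar M (\<lambda>\<omega>. indicator A \<omega> + indicator (space M - A) \<omega>)"
    using assms by (simp add: ind_rvar rvar_add)
  also have "\<dots> = \<one>\<^bsub>L0 M\<^esub>"
    unfolding one_rvar using assms by (intro rvar_cong AE_I2) (auto simp: indicator_def)
  finally show ?thesis .
qed

lemma mod_glue_cong:
  assumes "A \<in> sets M" "x \<in> carrier V" "y \<in> carrier V" "ind M A \<odot>\<^bsub>V\<^esub> x = ind M A \<odot>\<^bsub>V\<^esub> y"
  shows "mod_glue M V A x y = y"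
proof -
  have "mod_glue M V A x y = (ind M A \<oplus>\<^bsub>L0 M\<^esub> ind M (space M - A)) \<odot>\<^bsub>V\<^esub> y"
    using assms by (simp add: mod_glue_def smult_l_distr)
  then show ?thesis using assms by (simp add: ind_add_compl)
qed

lemma ind_empty: "ind M {} = \<zero>\<^bsub>L0 M\<^esub>"
proof -
  have "indicator {} = (\<lambda>\<omega>::'w. 0::real)" by (auto simp: indicator_def)
  then show ?thesis by (simp add: ind_rvar zero_rvar)
qed

lemma ind_smult_glue:
  assumes "A \<in> sets M" "x \<in> carrier V" "y \<in> carrier V"
  shows "ind M A \<odot>\<^bsub>V\<^esub> mod_glue M V A x y = ind M A \<odot>\<^bsub>V\<^esub> x"
    "ind M (space M - A) \<odot>\<^bsub>V\<^esub> mod_glue M V A x y = ind M (space M - A) \<odot>\<^bsub>V\<^esub> y"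
proof -
  have i: "ind M A \<in> carrier (L0 M)" "ind M (space M - A) \<in> carrier (L0 M)" using assms by auto
  have "(space M - A) \<inter> A = {}" "A \<inter> (space M - A) = {}" by auto
  then have "ind M A \<otimes>\<^bsub>L0 M\<^esub> ind M A = ind M A" "ind M A \<otimes>\<^bsub>L0 M\<^esub> ind M (space M - A) = \<zero>\<^bsub>L0 M\<^esub>"
    "ind M (space M - A) \<otimes>\<^bsub>L0 M\<^esub> ind M (space M - A) = ind M (space M - A)"
    "ind M (space M - A) \<otimes>\<^bsub>L0 M\<^esub> ind M A = \<zero>\<^bsub>L0 M\<^esub>"
    using assms by (simp_all add: ind_mult_ind ind_empty)
  then show "ind M A \<odot>\<^bsub>V\<^esub> mod_glue M V A x y = ind M A \<odot>\<^bsub>V\<^esub> x"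
    "ind M (space M - A) \<odot>\<^bsub>V\<^esub> mod_glue M V A x y = ind M (space M - A) \<odot>\<^bsub>V\<^esub> y"
    using assms i by (simp_all add: mod_glue_def smult_r_distr smult_assoc1[symmetric])
qed

lemma L0_linear_ind_cong:
  assumes f: "L0_linear M V f" and A: "A \<in> sets M" and xy: "x \<in> carrier V" "y \<in> carrier V"
    and eq: "ind M A \<odot>\<^bsub>V\<^esub> x = ind M A \<odot>\<^bsub>V\<^esub> y"
  shows "AE \<omega>\<in>A in M. val (f x) \<omega> = val (f y) \<omega>"
  using L0_linear_smult_val[OF f ind_L0[OF A] xy(1)] L0_linear_smult_val[OF f ind_L0[OF A] xy(2)] val_ind[OF A]
  unfolding eq by eventually_elim auto

text \<open>The Minkowski functional of \<open>E\<close>, the essential infimum of the positive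
  \<open>l\<close> with \<open>x\<close> in \<open>l E\<close>. Its lower bounds are provided on
  events, because in the separation argument the gauge is known to be at least 1 on an event
  only.\<close>

lemma gauge:
  assumes E: "L0_convex M V E" "\<zero>\<^bsub>V\<^esub> \<in> E" and absorb: "L0_absorbent M V E"
  obtains p where "sublinear M V p" "\<And>e. e \<in> E \<Longrightarrow> AE \<omega> in M. val (p e) \<omega> \<le> 1"
    "\<And>x k P. x \<in> carrier V \<Longrightarrow> k \<in> borel_measurable M \<Longrightarrow> Measurable.pred M P \<Longrightarrow>
      (\<And>l e. l \<in> L0_pos M \<Longrightarrow> e \<in> E \<Longrightarrow> x = l \<odot>\<^bsub>V\<^esub> e \<Longrightarrow> AE \<omega> in M. P \<omega> \<longrightarrow> k \<omega> \<le> val l \<omega>) \<Longrightarrow>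
      AE \<omega> in M. P \<omega> \<longrightarrow> k \<omega> \<le> val (p x) \<omega>"
proof -
  define S where "S x = {l \<in> L0_pos M. \<exists>e\<in>E. x = l \<odot>\<^bsub>V\<^esub> e}" for x
  define p where "p = (\<lambda>x\<in>carrier V. \<Sqinter>\<^bsub>barL0 M\<^esub> (S x))"
  have EV: "e \<in> carrier V" if "e \<in> E" for e using E(1) that by (auto simp: L0_convex_def)
  have SL: "S x \<subseteq> carrier (L0 M)" for x by (auto simp: S_def L0_pos_L0)
  have pI: "p x \<in> carrier (L0 M)"
    and lower: "\<And>l. l \<in> S x \<Longrightarrow> AE \<omega> in M. val (p x) \<omega> \<le> val l \<omega>"
    and greatest: "\<And>k P. k \<in> borel_measurable M \<Longrightarrow> Measurable.pred M P \<Longrightarrow>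
      (\<And>l. l \<in> S x \<Longrightarrow> AE \<omega> in M. P \<omega> \<longrightarrow> k \<omega> \<le> val l \<omega>) \<Longrightarrow> AE \<omega> in M. P \<omega> \<longrightarrow> k \<omega> \<le> val (p x) \<omega>"
    if x: "x \<in> carrier V" for x
  proof -
    obtain l0 where l0: "l0 \<in> S x" using absorb x unfolding L0_absorbent_def S_def by blast
    have b: "AE \<omega> in M. 0 \<le> val c \<omega>" if "c \<in> S x" for c
      using that L0_pos_val[of c M] by (auto simp: S_def)
    note inf = L0_Inf[OF SL l0 borel_measurable_const b]
    show "p x \<in> carrier (L0 M)" using inf(1) x by (simp add: p_def)
    show "AE \<omega> in M. val (p x) \<omega> \<le> val l \<omega>" if "l \<in> S x" for l using inf(2) x that by (simp add: p_def)
    show "AE \<omega> in M. P \<omega> \<longrightarrow> k \<omega> \<le> val (p x) \<omega>" if "k \<in> borel_measurable M" "Measurable.pred M P"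
      "\<And>l. l \<in> S x \<Longrightarrow> AE \<omega> in M. P \<omega> \<longrightarrow> k \<omega> \<le> val l \<omega>" for k P
      using inf(3)[of k P] x that by (auto simp: p_def)
  qed
  have pm: "val (p x) \<in> borel_measurable M" if "x \<in> carrier V" for x using pI[OF that] by simp
  show ?thesis
  proof
    show "sublinear M V p"
      unfolding sublinear_def
    proof (intro conjI ballI impI)
      show "p \<in> carrier V \<rightarrow>\<^sub>E carrier (L0 M)" using pI by (auto simp: p_def)
    next
      fix x y assume x: "x \<in> carrier V" and y: "y \<in> carrier V"
      then have xy: "x \<oplus>\<^bsub>V\<^esub> y \<in> carrier V" by simp
      have *: "AE \<omega> in M. val (p (x \<oplus>\<^bsub>V\<^esub> y)) \<omega> \<le> val l \<omega> + val k \<omega>" if l: "l \<in> S x" and k: "k \<in> S y" for l k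
      proof -
        obtain e d where ed: "e \<in> E" "x = l \<odot>\<^bsub>V\<^esub> e" "d \<in> E" "y = k \<odot>\<^bsub>V\<^esub> d" using l k by (auto simp: S_def)
        have lk: "l \<in> carrier (L0 M)" "k \<in> carrier (L0 M)" using l k SL by auto
        have lk0: "AE \<omega> in M. 0 < val l \<omega>" "AE \<omega> in M. 0 < val k \<omega>"
          using l k by (auto simp: S_def L0_pos_val)
        \<comment> \<open>The weight that writes \<open>l e + k d\<close> as \<open>l + k\<close>
          times a convex combination of \<open>e\<close> and \<open>d\<close>.\<close>
        let ?h = "\<lambda>\<omega>. val l \<omega> / (val l \<omega> + val k \<omega>)"
        let ?t = "rvar M ?h"
        have hm: "?h \<in> borel_measurable M" using lk by simp
        have "AE \<omega> in M. 0 \<le> ?h \<omega> \<and> ?h \<omega> \<le> 1" using lk0 by eventually_elim simp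
        then have t: "?t \<in> L0_unit_interval M" by (rule rvar_unit_interval[OF hm])
        have tL: "?t \<in> carrier (L0 M)" using hm by simp
        let ?s = "l \<oplus>\<^bsub>L0 M\<^esub> k"
        have sL: "?s \<in> carrier (L0 M)" using lk by simp
        have "AE \<omega> in M. 0 < val ?s \<omega>" using val_add[OF lk] lk0 by eventually_elim simp
        with sL have s: "?s \<in> L0_pos M" by (simp add: L0_pos_iff)
        have e1: "?s \<otimes>\<^bsub>L0 M\<^esub> ?t = l"
        proof (rule L0_eqI[OF _ lk(1)])
          show "AE \<omega> in M. val (?s \<otimes>\<^bsub>L0 M\<^esub> ?t) \<omega> = val l \<omega>"
            using val_mult[OF sL tL] val_add[OF lk] val_rvar[OF hm] lk0 by eventually_elim simp
        qed (use sL tL in simp)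
        note u = one_minus[OF tL]
        have e2: "?s \<otimes>\<^bsub>L0 M\<^esub> (\<one>\<^bsub>L0 M\<^esub> \<ominus>\<^bsub>L0 M\<^esub> ?t) = k"
        proof (rule L0_eqI[OF _ lk(2)])
          show "AE \<omega> in M. val (?s \<otimes>\<^bsub>L0 M\<^esub> (\<one>\<^bsub>L0 M\<^esub> \<ominus>\<^bsub>L0 M\<^esub> ?t)) \<omega> = val k \<omega>"
            using val_mult[OF sL u(1)] u(2) val_add[OF lk] val_rvar[OF hm] lk0
            by eventually_elim (simp add: right_diff_distrib)
        qed (use sL u in simp)
        have "x \<oplus>\<^bsub>V\<^esub> y = ?s \<odot>\<^bsub>V\<^esub> mod_comb M V ?t e d"
          using ed EV sL tL u e1 e2 by (simp add: mod_comb_def smult_r_distr smult_assoc1[symmetric])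
        moreover have "mod_comb M V ?t e d \<in> E" using E(1) ed t by (auto simp: L0_convex_def)
        ultimately have "?s \<in> S (x \<oplus>\<^bsub>V\<^esub> y)" using s by (auto simp: S_def)
        from lower[OF xy this] val_add[OF lk] show ?thesis by eventually_elim simp
      qed
      have "AE \<omega> in M. True \<longrightarrow> val (p (x \<oplus>\<^bsub>V\<^esub> y)) \<omega> - val (p y) \<omega> \<le> val (p x) \<omega>"
      proof (rule greatest[OF x])
        fix l assume l: "l \<in> S x"
        have "AE \<omega> in M. True \<longrightarrow> val (p (x \<oplus>\<^bsub>V\<^esub> y)) \<omega> - val l \<omega> \<le> val (p y) \<omega>"
        proof (rule greatest[OF y])
          fix k assume "k \<in> S y"
          from *[OF l this] show "AE \<omega> in M. True \<longrightarrow> val (p (x \<oplus>\<^bsub>V\<^esub> y)) \<omega> - val l \<omega> \<le> val k \<omega>"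
            by eventually_elim simp
        qed (use pm[OF xy] l SL[of x] in \<open>auto simp: subset_iff\<close>)
        then show "AE \<omega> in M. True \<longrightarrow> val (p (x \<oplus>\<^bsub>V\<^esub> y)) \<omega> - val (p y) \<omega> \<le> val l \<omega>"
          by eventually_elim simp
      qed (use pm[OF xy] pm[OF y] in auto)
      then show "AE \<omega> in M. val (p (x \<oplus>\<^bsub>V\<^esub> y)) \<omega> \<le> val (p x) \<omega> + val (p y) \<omega>"
        by eventually_elim simp
    next
      fix \<mu> x assume \<mu>: "\<mu> \<in> carrier (L0 M)" and \<mu>0: "AE \<omega> in M. 0 \<le> val \<mu> \<omega>" and x: "x \<in> carrier V"
      have \<mu>x: "\<mu> \<odot>\<^bsub>V\<^esub> x \<in> carrier V" using \<mu> x by simp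
      \<comment> \<open>The factor may vanish on an event, but members of \<open>S\<close> are
        strictly positive. So a constant is added, and the point is written as
        \<open>val \<mu> * val l + \<epsilon>\<close> times a convex combination of \<open>e\<close>
        and 0; the constant then tends to 0.\<close>
      have **: "AE \<omega> in M. val (p (\<mu> \<odot>\<^bsub>V\<^esub> x)) \<omega> \<le> val \<mu> \<omega> * val l \<omega> + \<epsilon>" if l: "l \<in> S x" and \<epsilon>: "0 < \<epsilon>" for l \<epsilon>
      proof -
        obtain e where e: "e \<in> E" "x = l \<odot>\<^bsub>V\<^esub> e" using l by (auto simp: S_def)
        have lL: "l \<in> carrier (L0 M)" using l SL by auto
        have l0: "AE \<omega> in M. 0 < val l \<omega>" using l by (auto simp: S_def L0_pos_val)
        let ?s = "rvar M (\<lambda>\<omega>. val \<mu> \<omega> * val l \<omega> + \<epsilon>)"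
        have sm: "(\<lambda>\<omega>. val \<mu> \<omega> * val l \<omega> + \<epsilon>) \<in> borel_measurable M" using \<mu> lL by simp
        have sL: "?s \<in> carrier (L0 M)" using sm by simp
        have pos: "AE \<omega> in M. 0 \<le> val \<mu> \<omega> * val l \<omega> \<and> 0 < val \<mu> \<omega> * val l \<omega> + \<epsilon>"
          using \<mu>0 l0
        proof eventually_elim
          case (elim \<omega>)
          then have "0 \<le> val \<mu> \<omega> * val l \<omega>" by simp
          with \<epsilon> show ?case by linarith
        qed
        then have "AE \<omega> in M. 0 < val \<mu> \<omega> * val l \<omega> + \<epsilon>" by eventually_elim simp
        then have s: "?s \<in> L0_pos M" by (rule rvar_pos[OF sm])
        let ?h = "\<lambda>\<omega>. (val \<mu> \<omega> * val l \<omega>) / (val \<mu> \<omega> * val l \<omega> + \<epsilon>)"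
        let ?t = "rvar M ?h"
        have hm: "?h \<in> borel_measurable M" using \<mu> lL by simp
        have "AE \<omega> in M. 0 \<le> ?h \<omega> \<and> ?h \<omega> \<le> 1" using pos by eventually_elim (use \<epsilon> in simp)
        then have t: "?t \<in> L0_unit_interval M" by (rule rvar_unit_interval[OF hm])
        have tL: "?t \<in> carrier (L0 M)" using hm by simp
        have e1: "?s \<otimes>\<^bsub>L0 M\<^esub> ?t = \<mu> \<otimes>\<^bsub>L0 M\<^esub> l"
        proof (rule L0_eqI[where M=M])
          show "AE \<omega> in M. val (?s \<otimes>\<^bsub>L0 M\<^esub> ?t) \<omega> = val (\<mu> \<otimes>\<^bsub>L0 M\<^esub> l) \<omega>"
            using val_mult[OF sL tL] val_mult[OF \<mu> lL] val_rvar[OF sm] val_rvar[OF hm] pos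
            by eventually_elim simp
        qed (use sL tL \<mu> lL in simp_all)
        note u = one_minus[OF tL]
        have "\<mu> \<odot>\<^bsub>V\<^esub> x = ?s \<odot>\<^bsub>V\<^esub> mod_comb M V ?t e \<zero>\<^bsub>V\<^esub>"
          using e EV sL tL u e1 \<mu> lL by (simp add: mod_comb_def smult_assoc1[symmetric])
        moreover have "mod_comb M V ?t e \<zero>\<^bsub>V\<^esub> \<in> E" using E e t by (auto simp: L0_convex_def)
        ultimately have "?s \<in> S (\<mu> \<odot>\<^bsub>V\<^esub> x)" using s by (auto simp: S_def)
        from lower[OF \<mu>x this] val_rvar[OF sm] show ?thesis by eventually_elim simp
      qed
      have *: "AE \<omega> in M. val (p (\<mu> \<odot>\<^bsub>V\<^esub> x)) \<omega> \<le> val \<mu> \<omega> * val l \<omega>" if l: "l \<in> S x" for l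
      proof -
        have "AE \<omega> in M. \<forall>n. val (p (\<mu> \<odot>\<^bsub>V\<^esub> x)) \<omega> \<le> val \<mu> \<omega> * val l \<omega> + 1 / real (Suc n)"
          using **[OF l] by (simp add: AE_all_countable)
        then show ?thesis
        proof eventually_elim
          case (elim \<omega>)
          show ?case
          proof (rule field_le_epsilon)
            fix e :: real assume "0 < e"
            then obtain n where "1 / real (Suc n) < e" using nat_approx_posE by blast
            with elim[rule_format, of n] show "val (p (\<mu> \<odot>\<^bsub>V\<^esub> x)) \<omega> \<le> val \<mu> \<omega> * val l \<omega> + e" by simp
          qed
        qed
      qed
      have [measurable]: "val \<mu> \<in> borel_measurable M" using \<mu> by simp
      have "AE \<omega> in M. 0 < val \<mu> \<omega> \<longrightarrow> val (p (\<mu> \<odot>\<^bsub>V\<^esub> x)) \<omega> / val \<mu> \<omega> \<le> val (p x) \<omega>"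
      proof (rule greatest[OF x])
        fix l assume "l \<in> S x"
        from *[OF this] show "AE \<omega> in M. 0 < val \<mu> \<omega> \<longrightarrow> val (p (\<mu> \<odot>\<^bsub>V\<^esub> x)) \<omega> / val \<mu> \<omega> \<le> val l \<omega>"
          by eventually_elim (simp add: field_simps)
      qed (use pm[OF \<mu>x] in auto)
      moreover obtain l0 where "l0 \<in> S x" using absorb x unfolding L0_absorbent_def S_def by blast
      note *[OF this] \<mu>0
      ultimately show "AE \<omega> in M. val (p (\<mu> \<odot>\<^bsub>V\<^esub> x)) \<omega> \<le> val \<mu> \<omega> * val (p x) \<omega>"
      proof eventually_elim
        case (elim \<omega>)
        then show ?case by (cases "val \<mu> \<omega> = 0") (auto simp: field_simps)
      qed
    qed
    show "AE \<omega> in M. val (p e) \<omega> \<le> 1" if e: "e \<in> E" for e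
    proof -
      have "\<one>\<^bsub>L0 M\<^esub> \<in> L0_pos M" unfolding one_rvar by (rule rvar_pos) auto
      then have "\<one>\<^bsub>L0 M\<^esub> \<in> S e" using e EV by (auto simp: S_def intro!: bexI[of _ e])
      from lower[OF EV[OF e] this] val_one[of M] show ?thesis by eventually_elim simp
    qed
    show "AE \<omega> in M. P \<omega> \<longrightarrow> k \<omega> \<le> val (p x) \<omega>" if "x \<in> carrier V" "k \<in> borel_measurable M" "Measurable.pred M P"
      "\<And>l e. l \<in> L0_pos M \<Longrightarrow> e \<in> E \<Longrightarrow> x = l \<odot>\<^bsub>V\<^esub> e \<Longrightarrow> AE \<omega> in M. P \<omega> \<longrightarrow> k \<omega> \<le> val l \<omega>" for x k P
      by (rule greatest) (use that in \<open>auto simp: S_def\<close>)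
  qed
qed

text \<open>Conditional form of separating \<open>x\<close> from \<open>C\<close> when
  \<open>x\<close> avoids \<open>C - U\<close>: the hypothesis says that \<open>x\<close> meets this
  set on no event of positive probability inside \<open>A\<close>. The gauge of
  \<open>(y0 - C) + U\<close> is then at least 1 at \<open>y0 - x\<close> on \<open>A\<close>. A
  functional below the gauge that reaches it there is at most 1 at \<open>y0 - y + u\<close> and at
  least 1 at \<open>y0 - x\<close>. No topology enters, so the result also serves for finite powers
  of the scalars.\<close>

theorem separation:
  assumes C: "L0_convex M V C" "y0 \<in> C"
    and U: "L0_convex M V U" "L0_absorbent M V U" "\<zero>\<^bsub>V\<^esub> \<in> U"
    and x: "x \<in> carrier V" and A: "A \<in> sets M"
    and disjoint: "\<And>D y u. D \<in> sets M \<Longrightarrow> D \<subseteq> A \<Longrightarrow> y \<in> C \<Longrightarrow> u \<in> U \<Longrightarrow>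
      ind M D \<odot>\<^bsub>V\<^esub> x = ind M D \<odot>\<^bsub>V\<^esub> (y \<ominus>\<^bsub>V\<^esub> u) \<Longrightarrow> AE \<omega> in M. \<omega> \<notin> D"
  obtains f \<delta> where "L0_linear M V f" "\<And>u. u \<in> U \<Longrightarrow> AE \<omega> in M. val (f u) \<omega> \<le> 1"
    "\<delta> \<in> carrier (L0 M)" "AE \<omega>\<in>A in M. 0 < val \<delta> \<omega>"
    "\<And>y. y \<in> C \<Longrightarrow> AE \<omega>\<in>A in M. val (f x) \<omega> + val \<delta> \<omega> \<le> val (f y) \<omega>"
proof -
  define E where "E = {(y0 \<ominus>\<^bsub>V\<^esub> y) \<oplus>\<^bsub>V\<^esub> u | y u. y \<in> C \<and> u \<in> U}"
  have CV: "y \<in> carrier V" if "y \<in> C" for y using C(1) that by (auto simp: L0_convex_def)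
  have UV: "u \<in> carrier V" if "u \<in> U" for u using U(1) that by (auto simp: L0_convex_def)
  have EI: "(y0 \<ominus>\<^bsub>V\<^esub> y) \<oplus>\<^bsub>V\<^esub> u \<in> E" if "y \<in> C" "u \<in> U" for y u using that by (auto simp: E_def)
  have UE: "u \<in> E" if "u \<in> U" for u
    using EI[OF C(2) that] CV[OF C(2)] UV[OF that] by (simp add: a_minus_def M.r_neg)
  have E0: "\<zero>\<^bsub>V\<^esub> \<in> E" by (rule UE[OF U(3)])
  have Eabs: "L0_absorbent M V E" using U(2) UE unfolding L0_absorbent_def by blast
  have Econv: "L0_convex M V E"
    unfolding L0_convex_def
  proof (intro conjI ballI)
    show "E \<subseteq> carrier V" using CV UV C(2) by (auto simp: E_def a_minus_def)
    fix a b l assume a: "a \<in> E" and b: "b \<in> E" and l: "l \<in> L0_unit_interval M"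
    obtain y u z v where yu: "y \<in> C" "u \<in> U" "a = (y0 \<ominus>\<^bsub>V\<^esub> y) \<oplus>\<^bsub>V\<^esub> u"
      and zv: "z \<in> C" "v \<in> U" "b = (y0 \<ominus>\<^bsub>V\<^esub> z) \<oplus>\<^bsub>V\<^esub> v" using a b by (auto simp: E_def)
    have lL: "l \<in> carrier (L0 M)" using l by (simp add: L0_unit_interval_L0)
    note k = one_minus[OF lL]
    let ?k = "\<one>\<^bsub>L0 M\<^esub> \<ominus>\<^bsub>L0 M\<^esub> l"
    have "l \<oplus>\<^bsub>L0 M\<^esub> ?k = \<one>\<^bsub>L0 M\<^esub>" using lL by (simp add: a_minus_def R.a_lcomm[of l] R.r_neg)
    then have y0: "y0 = l \<odot>\<^bsub>V\<^esub> y0 \<oplus>\<^bsub>V\<^esub> ?k \<odot>\<^bsub>V\<^esub> y0"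
      using lL k CV[OF C(2)] by (simp add: smult_l_distr[symmetric])
    have c: "y \<in> carrier V" "z \<in> carrier V" "u \<in> carrier V" "v \<in> carrier V" "y0 \<in> carrier V"
      using yu zv CV UV C(2) by auto
    have "mod_comb M V l a b = ((l \<odot>\<^bsub>V\<^esub> y0 \<oplus>\<^bsub>V\<^esub> ?k \<odot>\<^bsub>V\<^esub> y0) \<ominus>\<^bsub>V\<^esub> mod_comb M V l y z) \<oplus>\<^bsub>V\<^esub> mod_comb M V l u v"
      using c lL k yu zv
      by (simp add: mod_comb_def a_minus_def smult_r_distr smult_r_minus M.minus_add M.a_ac)
    then have "mod_comb M V l a b = (y0 \<ominus>\<^bsub>V\<^esub> mod_comb M V l y z) \<oplus>\<^bsub>V\<^esub> mod_comb M V l u v"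
      by (simp only: y0[symmetric])
    moreover have "mod_comb M V l y z \<in> C" "mod_comb M V l u v \<in> U"
      using C(1) U(1) l yu zv by (auto simp: L0_convex_def)
    ultimately show "mod_comb M V l a b \<in> E" using EI by simp
  qed
  obtain p where p: "sublinear M V p" "\<And>e. e \<in> E \<Longrightarrow> AE \<omega> in M. val (p e) \<omega> \<le> 1"
    "\<And>x k P. x \<in> carrier V \<Longrightarrow> k \<in> borel_measurable M \<Longrightarrow> Measurable.pred M P \<Longrightarrow>
      (\<And>l e. l \<in> L0_pos M \<Longrightarrow> e \<in> E \<Longrightarrow> x = l \<odot>\<^bsub>V\<^esub> e \<Longrightarrow> AE \<omega> in M. P \<omega> \<longrightarrow> k \<omega> \<le> val l \<omega>) \<Longrightarrow>
      AE \<omega> in M. P \<omega> \<longrightarrow> k \<omega> \<le> val (p x) \<omega>"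
    using gauge[OF Econv E0 Eabs] by blast
  have y0V: "y0 \<in> carrier V" using CV C(2) by simp
  let ?z = "y0 \<ominus>\<^bsub>V\<^esub> x"
  have zV: "?z \<in> carrier V" using y0V x by (simp add: a_minus_def)
  have [measurable]: "A \<in> sets M" by (rule A)
  have z1: "AE \<omega>\<in>A in M. 1 \<le> val (p ?z) \<omega>"
  proof (rule p(3)[OF zV])
    fix l e assume l: "l \<in> L0_pos M" and e: "e \<in> E" and z: "?z = l \<odot>\<^bsub>V\<^esub> e"
    have lL: "l \<in> carrier (L0 M)" using l by (simp add: L0_pos_L0)
    then have [measurable]: "val l \<in> borel_measurable M" by simp
    have eV: "e \<in> carrier V" using e Econv by (auto simp: L0_convex_def)
    \<comment> \<open>The event on which the gauge bound would fail. Cutting \<open>l\<close> off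
      outside \<open>D\<close> makes it at most 1, so the product with \<open>e\<close> stays in
      \<open>E\<close> by convexity with 0, and on \<open>D\<close> nothing has changed.\<close>
    define D where "D = {\<omega> \<in> space M. \<omega> \<in> A \<and> val l \<omega> < 1}"
    have D: "D \<in> sets M" unfolding D_def by measurable
    have DA: "D \<subseteq> A" by (auto simp: D_def)
    define t where "t = rvar M (\<lambda>\<omega>. indicator D \<omega> * val l \<omega>)"
    have tm: "(\<lambda>\<omega>. indicator D \<omega> * val l \<omega>) \<in> borel_measurable M" using D by measurable
    have "AE \<omega> in M. 0 \<le> indicator D \<omega> * val l \<omega> \<and> indicator D \<omega> * val l \<omega> \<le> 1"
      using L0_pos_val[OF l] by eventually_elim (auto simp: D_def indicator_def)
    then have t: "t \<in> L0_unit_interval M" unfolding t_def by (rule rvar_unit_interval[OF tm])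
    have tL: "t \<in> carrier (L0 M)" using t by (simp add: L0_unit_interval_L0)
    have "mod_comb M V t e \<zero>\<^bsub>V\<^esub> \<in> E" using Econv e E0 t by (auto simp: L0_convex_def)
    moreover have "mod_comb M V t e \<zero>\<^bsub>V\<^esub> = t \<odot>\<^bsub>V\<^esub> e"
      using eV tL one_minus[OF tL] by (simp add: mod_comb_def)
    ultimately obtain y u where yu: "y \<in> C" "u \<in> U" "t \<odot>\<^bsub>V\<^esub> e = (y0 \<ominus>\<^bsub>V\<^esub> y) \<oplus>\<^bsub>V\<^esub> u"
      by (auto simp: E_def)
    have yuV: "y \<in> carrier V" "u \<in> carrier V" using yu CV UV by auto
    have iL: "ind M D \<in> carrier (L0 M)" using D by simp
    have "ind M D \<otimes>\<^bsub>L0 M\<^esub> l = ind M D \<otimes>\<^bsub>L0 M\<^esub> t"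
    proof (rule L0_eqI[where M=M])
      have "AE \<omega> in M. val t \<omega> = indicator D \<omega> * val l \<omega>" unfolding t_def by (rule val_rvar[OF tm])
      with val_mult[OF iL lL] val_mult[OF iL tL] val_ind[OF D]
      show "AE \<omega> in M. val (ind M D \<otimes>\<^bsub>L0 M\<^esub> l) \<omega> = val (ind M D \<otimes>\<^bsub>L0 M\<^esub> t) \<omega>"
        by eventually_elim (auto simp: indicator_def)
    qed (use iL lL tL in auto)
    then have "ind M D \<odot>\<^bsub>V\<^esub> ?z = ind M D \<odot>\<^bsub>V\<^esub> ((y0 \<ominus>\<^bsub>V\<^esub> y) \<oplus>\<^bsub>V\<^esub> u)"
      unfolding z yu(3)[symmetric] using iL lL tL eV by (simp add: smult_assoc1[symmetric])
    then have eq: "ind M D \<odot>\<^bsub>V\<^esub> y0 \<ominus>\<^bsub>V\<^esub> ind M D \<odot>\<^bsub>V\<^esub> x =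
        ind M D \<odot>\<^bsub>V\<^esub> y0 \<oplus>\<^bsub>V\<^esub> \<ominus>\<^bsub>V\<^esub> (ind M D \<odot>\<^bsub>V\<^esub> (y \<ominus>\<^bsub>V\<^esub> u))"
      using iL y0V x yuV by (simp add: a_minus_def smult_r_distr smult_r_minus M.minus_add M.a_ac)
    have "\<ominus>\<^bsub>V\<^esub> (ind M D \<odot>\<^bsub>V\<^esub> x) = \<ominus>\<^bsub>V\<^esub> (ind M D \<odot>\<^bsub>V\<^esub> (y \<ominus>\<^bsub>V\<^esub> u))"
      using arg_cong[OF eq, of "\<lambda>v. \<ominus>\<^bsub>V\<^esub> (ind M D \<odot>\<^bsub>V\<^esub> y0) \<oplus>\<^bsub>V\<^esub> v"] iL y0V x yuV
      by (simp add: a_minus_def M.r_neg1)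
    then have "ind M D \<odot>\<^bsub>V\<^esub> x = ind M D \<odot>\<^bsub>V\<^esub> (y \<ominus>\<^bsub>V\<^esub> u)"
      using iL x yuV by (metis M.minus_closed M.minus_minus smult_closed)
    from disjoint[OF D DA yu(1,2) this] AE_space show "AE \<omega>\<in>A in M. 1 \<le> val l \<omega>"
      by eventually_elim (auto simp: D_def)
  qed auto
  obtain f where f: "L0_linear M V f" "\<And>x. x \<in> carrier V \<Longrightarrow> AE \<omega> in M. val (f x) \<omega> \<le> val (p x) \<omega>"
    "AE \<omega> in M. val (p ?z) \<omega> \<le> val (f ?z) \<omega>"
    using Hahn_Banach_L0[OF p(1) zV] by blast
  have fE: "AE \<omega> in M. val (f e) \<omega> \<le> 1" if e: "e \<in> E" for e
  proof -
    have "e \<in> carrier V" using e Econv by (auto simp: L0_convex_def)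
    from f(2)[OF this] p(2)[OF e] show ?thesis by eventually_elim simp
  qed
  \<comment> \<open>Absorbency writes \<open>y0 - x\<close> as a positive multiple of some
    \<open>u\<close> in \<open>U\<close>. The value \<open>f u\<close> is positive on
    \<open>A\<close> and serves as the gap, the same one for all points of \<open>C\<close>.\<close>
  obtain l u where lu: "l \<in> L0_pos M" "u \<in> U" "?z = l \<odot>\<^bsub>V\<^esub> u"
    using U(2) zV by (auto simp: L0_absorbent_def)
  have lL: "l \<in> carrier (L0 M)" using lu by (simp add: L0_pos_L0)
  have fz: "AE \<omega> in M. val (f ?z) \<omega> = val (f y0) \<omega> - val (f x) \<omega>"
    by (rule L0_linear_minus_val[OF f(1) y0V x])
  show ?thesis
  proof (rule that[OF f(1)])
    show "AE \<omega> in M. val (f v) \<omega> \<le> 1" if "v \<in> U" for v by (rule fE[OF UE[OF that]])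
    show "f u \<in> carrier (L0 M)" using f(1) UV[OF lu(2)] by (auto simp: L0_linear_def)
    have "AE \<omega> in M. val (f ?z) \<omega> = val l \<omega> * val (f u) \<omega>"
      unfolding lu(3) by (rule L0_linear_smult_val[OF f(1) lL UV[OF lu(2)]])
    with f(3) z1 L0_pos_val[OF lu(1)] show "AE \<omega>\<in>A in M. 0 < val (f u) \<omega>"
    proof eventually_elim
      case (elim \<omega>)
      show ?case
      proof
        assume "\<omega> \<in> A"
        with elim have "0 < val l \<omega> * val (f u) \<omega>" by linarith
        with elim(3) show "0 < val (f u) \<omega>" by (simp add: zero_less_mult_iff)
      qed
    qed
    fix y assume y: "y \<in> C"
    have "AE \<omega> in M. val (f ((y0 \<ominus>\<^bsub>V\<^esub> y) \<oplus>\<^bsub>V\<^esub> u)) \<omega> = val (f (y0 \<ominus>\<^bsub>V\<^esub> y)) \<omega> + val (f u) \<omega>"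
      using y0V CV[OF y] UV[OF lu(2)] by (intro L0_linear_add_val[OF f(1)]) (auto simp: a_minus_def)
    with fE[OF EI[OF y lu(2)]] L0_linear_minus_val[OF f(1) y0V CV[OF y]] z1 f(3) fz
    show "AE \<omega>\<in>A in M. val (f x) \<omega> + val (f u) \<omega> \<le> val (f y) \<omega>"
      by eventually_elim auto
  qed
qed

end

section \<open>The dual module and the polar cone\<close>

sublocale locally_L0_convex_module \<subseteq> L0_module M V by unfold_locales

context locally_L0_convex_module
begin

abbreviation "dual \<equiv> dual_module M V T"

lemma dual_iff:
  "f \<in> carrier dual \<longleftrightarrow>
    f \<in> carrier V \<rightarrow>\<^sub>E carrier (L0 M) \<and> L0_linear M V f \<and> continuous_map T (L0_topology M) f"
  by (auto simp: dual_module_def L0_linear_def)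

lemma dual_linear: "f \<in> carrier dual \<Longrightarrow> L0_linear M V f"
  by (simp add: dual_iff)

lemma dual_L0 [simp]: "f \<in> carrier dual \<Longrightarrow> x \<in> carrier V \<Longrightarrow> f x \<in> carrier (L0 M)"
  by (auto simp: dual_iff)

lemma continuous_map_affine:
  assumes "k \<in> carrier (L0 M)" "c \<in> carrier V"
  shows "continuous_map T T (\<lambda>v. k \<odot>\<^bsub>V\<^esub> (v \<oplus>\<^bsub>V\<^esub> c))"
proof -
  have "continuous_map T (prod_topology T T) (\<lambda>v. (v, c))"
    using assms by (auto simp: continuous_map_pairwise o_def topspace_T)
  from continuous_map_compose[OF this add_continuous]
  have "continuous_map T T (\<lambda>v. v \<oplus>\<^bsub>V\<^esub> c)" by (simp add: o_def)
  then have "continuous_map T (prod_topology (L0_topology M) T) (\<lambda>v. (k, v \<oplus>\<^bsub>V\<^esub> c))"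
    using assms by (auto simp: continuous_map_pairwise o_def)
  from continuous_map_compose[OF this smult_continuous] show ?thesis by (simp add: o_def)
qed

text \<open>A ball of random radius \<epsilon> around \<open>f x\<close> is reached by translating
  to \<open>x\<close> and rescaling by the inverse of \<epsilon>; both operations are continuous in
  the module, so a bound on one neighbourhood of zero is enough.\<close>

lemma L0_linear_continuousI:
  assumes f: "L0_linear M V f" and U: "U \<in> nbhds_zero V T"
    and bounded: "\<And>u. u \<in> U \<Longrightarrow> AE \<omega> in M. \<bar>val (f u) \<omega>\<bar> \<le> 1"
  shows "continuous_map T (L0_topology M) f"
  unfolding continuous_map_def
proof (intro conjI allI impI)
  have fL: "f x \<in> carrier (L0 M)" if "x \<in> carrier V" for x using f that by (auto simp: L0_linear_def)
  then show "f \<in> topspace T \<rightarrow> topspace (L0_topology M)" by (auto simp: topspace_T)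
  fix S assume S: "openin (L0_topology M) S"
  obtain W where W: "openin T W" "\<zero>\<^bsub>V\<^esub> \<in> W" "W \<subseteq> U" using U by (auto simp: nbhds_zero_def)
  show "openin T {x \<in> topspace T. f x \<in> S}"
  proof (subst openin_subopen, intro ballI)
    fix x assume "x \<in> {x \<in> topspace T. f x \<in> S}"
    then have x: "x \<in> carrier V" "f x \<in> S" by (auto simp: topspace_T)
    obtain \<epsilon> where \<epsilon>: "\<epsilon> \<in> L0_pos M" "L0_ball M \<epsilon> (f x) \<subseteq> S" using S x(2) by (auto simp: openin_L0_topology)
    have \<epsilon>L: "\<epsilon> \<in> carrier (L0 M)" using \<epsilon>(1) by (simp add: L0_pos_L0)
    define k where "k = rvar M (\<lambda>\<omega>. 1 / val \<epsilon> \<omega>)"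
    have km: "(\<lambda>\<omega>. 1 / val \<epsilon> \<omega>) \<in> borel_measurable M" using \<epsilon>L by simp
    have kL: "k \<in> carrier (L0 M)" unfolding k_def using km by simp
    have vk: "AE \<omega> in M. val k \<omega> = 1 / val \<epsilon> \<omega>" unfolding k_def by (rule val_rvar[OF km])
    let ?\<phi> = "\<lambda>v. k \<odot>\<^bsub>V\<^esub> (v \<oplus>\<^bsub>V\<^esub> \<ominus>\<^bsub>V\<^esub> x)"
    have "openin T {v \<in> topspace T. ?\<phi> v \<in> W}"
      using x(1) kL by (intro openin_continuous_map_preimage[OF continuous_map_affine W(1)]) auto
    moreover have "x \<in> {v \<in> topspace T. ?\<phi> v \<in> W}" using x(1) kL W(2) by (simp add: topspace_T M.r_neg)
    moreover have "{v \<in> topspace T. ?\<phi> v \<in> W} \<subseteq> {x \<in> topspace T. f x \<in> S}"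
    proof safe
      fix v assume v: "v \<in> topspace T" "?\<phi> v \<in> W"
      then have vV: "v \<in> carrier V" by (simp add: topspace_T)
      have "AE \<omega> in M. val (f (?\<phi> v)) \<omega> = val k \<omega> * val (f (v \<oplus>\<^bsub>V\<^esub> \<ominus>\<^bsub>V\<^esub> x)) \<omega>"
        using vV x(1) kL by (intro L0_linear_smult_val[OF f]) auto
      moreover have "AE \<omega> in M. val (f (v \<oplus>\<^bsub>V\<^esub> \<ominus>\<^bsub>V\<^esub> x)) \<omega> = val (f v) \<omega> - val (f x) \<omega>"
        using L0_linear_minus_val[OF f vV x(1)] by (simp add: a_minus_def)
      moreover have "AE \<omega> in M. \<bar>val (f (?\<phi> v)) \<omega>\<bar> \<le> 1" using bounded v(2) W(3) by blast
      ultimately have "AE \<omega> in M. \<bar>val (f x) \<omega> - val (f v) \<omega>\<bar> \<le> val \<epsilon> \<omega>"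
        using vk L0_pos_val[OF \<epsilon>(1)] by eventually_elim (simp add: abs_mult abs_minus_commute)
      then have "f v \<in> L0_ball M \<epsilon> (f x)" using L0_ball_iff[OF \<epsilon>L fL[OF x(1)]] fL[OF vV] by simp
      with \<epsilon>(2) show "f v \<in> S" by blast
    qed
    ultimately show "\<exists>U. openin T U \<and> x \<in> U \<and> U \<subseteq> {x \<in> topspace T. f x \<in> S}" by blast
  qed
qed

text \<open>Converse of \<open>L0_linear_continuousI\<close>. Neighbourhoods of this kind prove
  continuity of multiples, sums and concatenations of continuous functionals.\<close>

lemma dual_bounded_nbhd:
  assumes f: "f \<in> carrier dual" and \<epsilon>: "\<epsilon> \<in> L0_pos M"
  shows "{x \<in> carrier V. AE \<omega> in M. \<bar>val (f x) \<omega>\<bar> \<le> val \<epsilon> \<omega>} \<in> nbhds_zero V T"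
proof -
  have \<epsilon>L: "\<epsilon> \<in> carrier (L0 M)" using \<epsilon> by (simp add: L0_pos_L0)
  let ?S = "{n \<in> carrier (L0 M). AE \<omega> in M. \<bar>val n \<omega> - val \<zero>\<^bsub>L0 M\<^esub> \<omega>\<bar> < val \<epsilon> \<omega>}"
  have "openin (L0_topology M) ?S" using \<epsilon>L by (intro openin_L0_ball) auto
  moreover have "continuous_map T (L0_topology M) f" using f by (simp add: dual_iff)
  ultimately have "openin T {x \<in> topspace T. f x \<in> ?S}" by (rule openin_continuous_map_preimage[rotated])
  moreover have "f \<zero>\<^bsub>V\<^esub> = \<zero>\<^bsub>L0 M\<^esub>" using f by (intro L0_linear_zero dual_linear)
  then have "\<zero>\<^bsub>V\<^esub> \<in> {x \<in> topspace T. f x \<in> ?S}" using L0_pos_val[OF \<epsilon>] by (simp add: topspace_T)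
  moreover have "{x \<in> topspace T. f x \<in> ?S} \<subseteq> {x \<in> carrier V. AE \<omega> in M. \<bar>val (f x) \<omega>\<bar> \<le> val \<epsilon> \<omega>}"
  proof
    fix x assume "x \<in> {x \<in> topspace T. f x \<in> ?S}"
    then have x: "x \<in> carrier V" "AE \<omega> in M. \<bar>val (f x) \<omega> - val \<zero>\<^bsub>L0 M\<^esub> \<omega>\<bar> < val \<epsilon> \<omega>"
      by (auto simp: topspace_T)
    from x(2) val_zero[of M] have "AE \<omega> in M. \<bar>val (f x) \<omega>\<bar> \<le> val \<epsilon> \<omega>" by eventually_elim simp
    with x(1) show "x \<in> {x \<in> carrier V. AE \<omega> in M. \<bar>val (f x) \<omega>\<bar> \<le> val \<epsilon> \<omega>}" by simp
  qed
  ultimately show ?thesis unfolding nbhds_zero_def by blast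
qed

lemma nbhds_zero_Int:
  assumes "U \<in> nbhds_zero V T" "W \<in> nbhds_zero V T"
  shows "U \<inter> W \<in> nbhds_zero V T"
proof -
  obtain U' W' where *: "openin T U'" "\<zero>\<^bsub>V\<^esub> \<in> U'" "U' \<subseteq> U" "openin T W'" "\<zero>\<^bsub>V\<^esub> \<in> W'" "W' \<subseteq> W"
    using assms by (auto simp: nbhds_zero_def)
  have "openin T (U' \<inter> W')" using *(1,4) by (rule openin_Int)
  moreover have "U \<inter> W \<subseteq> carrier V" using assms by (auto simp: nbhds_zero_def)
  ultimately show ?thesis using * unfolding nbhds_zero_def by blast
qed

lemma dual_add_apply: "x \<in> carrier V \<Longrightarrow> (f \<oplus>\<^bsub>dual\<^esub> g) x = f x \<oplus>\<^bsub>L0 M\<^esub> g x"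
  by (simp add: dual_module_def)

lemma dual_smult_apply: "x \<in> carrier V \<Longrightarrow> (l \<odot>\<^bsub>dual\<^esub> f) x = l \<otimes>\<^bsub>L0 M\<^esub> f x"
  by (simp add: dual_module_def)

lemma dual_zero_apply: "x \<in> carrier V \<Longrightarrow> \<zero>\<^bsub>dual\<^esub> x = \<zero>\<^bsub>L0 M\<^esub>"
  by (simp add: dual_module_def)

lemma dual_glue_apply: "x \<in> carrier V \<Longrightarrow> mod_glue M dual A f g x = rv_glue M A (f x) (g x)"
  by (simp add: mod_glue_def rv_glue_def dual_add_apply dual_smult_apply)

lemma dual_comb_apply: "x \<in> carrier V \<Longrightarrow> mod_comb M dual l f g x = rv_comb M l (f x) (g x)"
  by (simp add: mod_comb_def rv_comb_def dual_add_apply dual_smult_apply)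

lemma dual_ext: "f \<in> carrier dual \<Longrightarrow> g \<in> carrier dual \<Longrightarrow> (\<And>x. x \<in> carrier V \<Longrightarrow> f x = g x) \<Longrightarrow> f = g"
  by (auto simp: dual_iff intro: PiE_ext)

lemma dual_smult_closed:
  assumes l: "l \<in> carrier (L0 M)" and f: "f \<in> carrier dual"
  shows "l \<odot>\<^bsub>dual\<^esub> f \<in> carrier dual"
  unfolding dual_iff
proof (intro conjI)
  note lin = dual_linear[OF f]
  show "l \<odot>\<^bsub>dual\<^esub> f \<in> carrier V \<rightarrow>\<^sub>E carrier (L0 M)" using f l by (auto simp: dual_module_def)
  show lin': "L0_linear M V (l \<odot>\<^bsub>dual\<^esub> f)"
    using lin l f by (auto simp: L0_linear_def dual_smult_apply Pi_iff R.r_distr R.m_lcomm)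
  \<comment> \<open>On the set where \<open>f\<close> is bounded by this radius the multiple is
    bounded by 1; the added 1 takes care of the points where \<open>l\<close> vanishes.\<close>
  let ?h = "\<lambda>\<omega>. 1 / (\<bar>val l \<omega>\<bar> + 1)"
  have m: "?h \<in> borel_measurable M" using l by simp
  have \<epsilon>: "rvar M ?h \<in> L0_pos M" by (rule rvar_pos[OF m]) (auto intro!: AE_I2 simp: add_nonneg_pos)
  show "continuous_map T (L0_topology M) (l \<odot>\<^bsub>dual\<^esub> f)"
  proof (rule L0_linear_continuousI[OF lin' dual_bounded_nbhd[OF f \<epsilon>]])
    fix u assume "u \<in> {x \<in> carrier V. AE \<omega> in M. \<bar>val (f x) \<omega>\<bar> \<le> val (rvar M ?h) \<omega>}"
    then have u: "u \<in> carrier V" "AE \<omega> in M. \<bar>val (f u) \<omega>\<bar> \<le> val (rvar M ?h) \<omega>" by auto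
    from u(2) val_rvar[OF m] val_mult[OF l dual_L0[OF f u(1)]]
    have "AE \<omega> in M. \<bar>val (l \<otimes>\<^bsub>L0 M\<^esub> f u) \<omega>\<bar> \<le> 1"
    proof eventually_elim
      case (elim \<omega>)
      have "\<bar>val l \<omega>\<bar> * \<bar>val (f u) \<omega>\<bar> \<le> \<bar>val l \<omega>\<bar> * ?h \<omega>" using elim by (intro mult_left_mono) auto
      also have "\<dots> \<le> 1" by (simp add: divide_simps)
      finally show ?case using elim by (simp add: abs_mult)
    qed
    then show "AE \<omega> in M. \<bar>val ((l \<odot>\<^bsub>dual\<^esub> f) u) \<omega>\<bar> \<le> 1" using u(1) by (simp add: dual_smult_apply)
  qed
qed

lemma dual_add_closed:
  assumes f: "f \<in> carrier dual" and g: "g \<in> carrier dual"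
  shows "f \<oplus>\<^bsub>dual\<^esub> g \<in> carrier dual"
  unfolding dual_iff
proof (intro conjI)
  note lin = dual_linear[OF f] dual_linear[OF g]
  show "f \<oplus>\<^bsub>dual\<^esub> g \<in> carrier V \<rightarrow>\<^sub>E carrier (L0 M)" using f g by (auto simp: dual_module_def)
  show lin': "L0_linear M V (f \<oplus>\<^bsub>dual\<^esub> g)"
    using lin by (auto simp: L0_linear_def dual_add_apply Pi_iff R.r_distr R.a_ac)
  have \<epsilon>: "rvar M (\<lambda>_. 1 / 2) \<in> L0_pos M" by (rule rvar_pos) auto
  show "continuous_map T (L0_topology M) (f \<oplus>\<^bsub>dual\<^esub> g)"
  proof (rule L0_linear_continuousI[OF lin' nbhds_zero_Int[OF dual_bounded_nbhd[OF f \<epsilon>] dual_bounded_nbhd[OF g \<epsilon>]]])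
    fix u assume "u \<in> {x \<in> carrier V. AE \<omega> in M. \<bar>val (f x) \<omega>\<bar> \<le> val (rvar M (\<lambda>_. 1 / 2)) \<omega>} \<inter>
      {x \<in> carrier V. AE \<omega> in M. \<bar>val (g x) \<omega>\<bar> \<le> val (rvar M (\<lambda>_. 1 / 2)) \<omega>}"
    then have u: "u \<in> carrier V" "AE \<omega> in M. \<bar>val (f u) \<omega>\<bar> \<le> val (rvar M (\<lambda>_. 1 / 2)) \<omega>"
      "AE \<omega> in M. \<bar>val (g u) \<omega>\<bar> \<le> val (rvar M (\<lambda>_. 1 / 2)) \<omega>" by auto
    from u(2,3) val_rvar[of "\<lambda>_. 1 / 2" M, simplified] val_add[OF dual_L0[OF f u(1)] dual_L0[OF g u(1)]]
    have "AE \<omega> in M. \<bar>val (f u \<oplus>\<^bsub>L0 M\<^esub> g u) \<omega>\<bar> \<le> 1" by eventually_elim auto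
    then show "AE \<omega> in M. \<bar>val ((f \<oplus>\<^bsub>dual\<^esub> g) u) \<omega>\<bar> \<le> 1" using u(1) by (simp add: dual_add_apply)
  qed
qed

lemma dual_zero_closed: "\<zero>\<^bsub>dual\<^esub> \<in> carrier dual"
  unfolding dual_iff
proof (intro conjI)
  show "\<zero>\<^bsub>dual\<^esub> \<in> carrier V \<rightarrow>\<^sub>E carrier (L0 M)" by (auto simp: dual_module_def)
  show lin: "L0_linear M V \<zero>\<^bsub>dual\<^esub>" by (auto simp: L0_linear_def dual_zero_apply)
  have "openin T (carrier V)" using openin_topspace[of T] by (simp add: topspace_T)
  then have "carrier V \<in> nbhds_zero V T" by (auto simp: nbhds_zero_def)
  then show "continuous_map T (L0_topology M) \<zero>\<^bsub>dual\<^esub>"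
  proof (rule L0_linear_continuousI[OF lin])
    fix u assume u: "u \<in> carrier V"
    show "AE \<omega> in M. \<bar>val (\<zero>\<^bsub>dual\<^esub> u) \<omega>\<bar> \<le> 1"
      unfolding dual_zero_apply[OF u] using val_zero[of M] by eventually_elim simp
  qed
qed

lemma dual_glue_closed:
  assumes "A \<in> sets M" "f \<in> carrier dual" "g \<in> carrier dual"
  shows "mod_glue M dual A f g \<in> carrier dual"
  unfolding mod_glue_def using assms by (intro dual_add_closed dual_smult_closed) auto

lemma dual_comb_closed:
  assumes "l \<in> carrier (L0 M)" "f \<in> carrier dual" "g \<in> carrier dual"
  shows "mod_comb M dual l f g \<in> carrier dual"
  unfolding mod_comb_def using assms one_minus(1)[of l] by (intro dual_add_closed dual_smult_closed) auto

text \<open>Through this identity joint locality of a risk function specializes to locality in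
  \<open>s\<close> for a fixed functional.\<close>

lemma dual_glue_self:
  assumes A: "A \<in> sets M" and f: "f \<in> carrier dual"
  shows "mod_glue M dual A f f = f"
proof (rule dual_ext[OF dual_glue_closed[OF A f f] f])
  fix x assume x: "x \<in> carrier V"
  have "f x \<in> carrier (barL0 M)" using f x by (simp add: L0_barL0)
  then show "mod_glue M dual A f f x = f x"
    unfolding dual_glue_apply[OF x] by (intro rv_glue_eqI[OF A]) simp_all
qed

lemma val_dual_glue:
  assumes "A \<in> sets M" "f \<in> carrier dual" "g \<in> carrier dual" "x \<in> carrier V"
  shows "AE \<omega> in M. val (mod_glue M dual A f g x) \<omega> = (if \<omega> \<in> A then val (f x) \<omega> else val (g x) \<omega>)"
  using assms by (simp add: dual_glue_apply val_rv_glue)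

lemma val_dual_comb:
  assumes "l \<in> carrier (L0 M)" "f \<in> carrier dual" "g \<in> carrier dual" "x \<in> carrier V"
  shows "AE \<omega> in M. val (mod_comb M dual l f g x) \<omega> = val l \<omega> * val (f x) \<omega> + (1 - val l \<omega>) * val (g x) \<omega>"
proof -
  have fg: "f x \<in> carrier (L0 M)" "g x \<in> carrier (L0 M)" using assms by auto
  from rep_rv_comb[OF assms(1) fg[THEN L0_barL0]] rep_val[OF fg(1)] rep_val[OF fg(2)]
  show ?thesis unfolding dual_comb_apply[OF assms(4)]
    by eventually_elim (simp add: val_def[of "rv_comb M l (f x) (g x)"])
qed

section \<open>The polar cone\<close>

lemma polar_iff:
  assumes "K \<subseteq> carrier V"
  shows "f \<in> polar M V T K \<longleftrightarrow> f \<in> carrier dual \<and> (\<forall>x\<in>K. AE \<omega> in M. 0 \<le> val (f x) \<omega>)"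
proof -
  have "(\<zero>\<^bsub>L0 M\<^esub> \<sqsubseteq>\<^bsub>barL0 M\<^esub> f x) = (AE \<omega> in M. 0 \<le> val (f x) \<omega>)" if "f \<in> carrier dual" "x \<in> K" for x
  proof -
    have fx: "f x \<in> carrier (L0 M)" using that assms by auto
    have "AE \<omega> in M. (rep \<zero>\<^bsub>L0 M\<^esub> \<omega> \<le> rep (f x) \<omega>) = (0 \<le> val (f x) \<omega>)"
      using rep_val[OF fx] rep_val[OF R.zero_closed] val_zero[of M] by eventually_elim simp
    then show ?thesis unfolding le_barL0 by (rule eventually_subst)
  qed
  then show ?thesis by (auto simp: polar_def)
qed

lemma polar_dual: "f \<in> polar M V T K \<Longrightarrow> f \<in> carrier dual"
  by (simp add: polar_def)

lemma polar_smult: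
  assumes K: "K \<subseteq> carrier V" and l: "l \<in> carrier (L0 M)" "AE \<omega> in M. 0 \<le> val l \<omega>" and f: "f \<in> polar M V T K"
  shows "l \<odot>\<^bsub>dual\<^esub> f \<in> polar M V T K"
  unfolding polar_iff[OF K]
proof (intro conjI ballI dual_smult_closed[OF l(1) polar_dual[OF f]])
  fix x assume x: "x \<in> K"
  then have xV: "x \<in> carrier V" using K by auto
  have "AE \<omega> in M. 0 \<le> val (f x) \<omega>" using f x polar_iff[OF K] by blast
  with val_mult[OF l(1) dual_L0[OF polar_dual[OF f] xV]] l(2)
  show "AE \<omega> in M. 0 \<le> val ((l \<odot>\<^bsub>dual\<^esub> f) x) \<omega>"
    unfolding dual_smult_apply[OF xV] by eventually_elim simp
qed

lemma polar_add:
  assumes K: "K \<subseteq> carrier V" and f: "f \<in> polar M V T K" and g: "g \<in> polar M V T K"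
  shows "f \<oplus>\<^bsub>dual\<^esub> g \<in> polar M V T K"
  unfolding polar_iff[OF K]
proof (intro conjI ballI dual_add_closed[OF f[THEN polar_dual] g[THEN polar_dual]])
  fix x assume x: "x \<in> K"
  then have xV: "x \<in> carrier V" using K by auto
  have "AE \<omega> in M. 0 \<le> val (f x) \<omega>" "AE \<omega> in M. 0 \<le> val (g x) \<omega>" using f g x polar_iff[OF K] by blast+
  with val_add[OF dual_L0[OF f[THEN polar_dual] xV] dual_L0[OF g[THEN polar_dual] xV]]
  show "AE \<omega> in M. 0 \<le> val ((f \<oplus>\<^bsub>dual\<^esub> g) x) \<omega>"
    unfolding dual_add_apply[OF xV] by eventually_elim simp
qed

lemma polar_glue:
  assumes K: "K \<subseteq> carrier V" and A: "A \<in> sets M" and f: "f \<in> polar M V T K" and g: "g \<in> polar M V T K"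
  shows "mod_glue M dual A f g \<in> polar M V T K"
proof -
  have i: "AE \<omega> in M. 0 \<le> val (ind M B) \<omega>" if "B \<in> sets M" for B
    using val_ind[OF that] by eventually_elim simp
  have "space M - A \<in> sets M" using A by auto
  with A show ?thesis unfolding mod_glue_def by (intro polar_add[OF K] polar_smult[OF K] i f g ind_L0)
qed

lemma polar_comb:
  assumes K: "K \<subseteq> carrier V" and l: "l \<in> L0_unit_interval M" and f: "f \<in> polar M V T K" and g: "g \<in> polar M V T K"
  shows "mod_comb M dual l f g \<in> polar M V T K"
proof -
  have lL: "l \<in> carrier (L0 M)" and l01: "AE \<omega> in M. 0 \<le> val l \<omega> \<and> val l \<omega> \<le> 1"
    using l by (auto simp: L0_unit_interval_iff)
  from l01 have l0: "AE \<omega> in M. 0 \<le> val l \<omega>" by eventually_elim simp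
  from l01 one_minus(2)[OF lL] have "AE \<omega> in M. 0 \<le> val (\<one>\<^bsub>L0 M\<^esub> \<ominus>\<^bsub>L0 M\<^esub> l) \<omega>" by eventually_elim simp
  then show ?thesis
    unfolding mod_comb_def using lL l0 one_minus(1)[OF lL] by (intro polar_add[OF K] polar_smult[OF K] f g)
qed

lemma polar_zero:
  assumes K: "K \<subseteq> carrier V"
  shows "\<zero>\<^bsub>dual\<^esub> \<in> polar M V T K"
  unfolding polar_iff[OF K]
proof (intro conjI ballI dual_zero_closed)
  fix x assume "x \<in> K"
  then have x: "x \<in> carrier V" using K by auto
  show "AE \<omega> in M. 0 \<le> val (\<zero>\<^bsub>dual\<^esub> x) \<omega>"
    unfolding dual_zero_apply[OF x] using val_zero[of M] by eventually_elim simp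
qed

section \<open>The weak topology of the dual\<close>

lemma openin_weak_dual_topology:
  "openin (weak_dual_topology M V T) W \<longleftrightarrow> W \<subseteq> carrier dual \<and>
     (\<forall>f\<in>W. \<exists>F \<epsilon>. finite F \<and> F \<subseteq> carrier V \<and> \<epsilon> \<in> L0_pos M \<and>
        {g \<in> carrier dual. \<forall>x\<in>F. g x \<in> L0_ball M \<epsilon> (f x)} \<subseteq> W)"
proof -
  have "istopology (\<lambda>W. W \<subseteq> carrier dual \<and>
     (\<forall>f\<in>W. \<exists>F \<epsilon>. finite F \<and> F \<subseteq> carrier V \<and> \<epsilon> \<in> L0_pos M \<and>
        {g \<in> carrier dual. \<forall>x\<in>F. g x \<in> L0_ball M \<epsilon> (f x)} \<subseteq> W))" (is "istopology ?P")
    unfolding istopology_def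
  proof (intro conjI allI impI ballI)
    fix S S' f assume S: "?P S" and S': "?P S'" and f: "f \<in> S \<inter> S'"
    have fD: "f \<in> carrier dual" using S f by blast
    obtain F \<delta> where F: "finite F" "F \<subseteq> carrier V" "\<delta> \<in> L0_pos M"
      "{g \<in> carrier dual. \<forall>x\<in>F. g x \<in> L0_ball M \<delta> (f x)} \<subseteq> S" using S f by (meson IntE)
    obtain F' \<epsilon> where F': "finite F'" "F' \<subseteq> carrier V" "\<epsilon> \<in> L0_pos M"
      "{g \<in> carrier dual. \<forall>x\<in>F'. g x \<in> L0_ball M \<epsilon> (f x)} \<subseteq> S'" using S' f by (meson IntE)
    obtain \<eta> where \<eta>: "\<eta> \<in> L0_pos M" "AE \<omega> in M. val \<eta> \<omega> \<le> val \<delta> \<omega> \<and> val \<eta> \<omega> \<le> val \<epsilon> \<omega>"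
      using L0_min_pos[OF F(3) F'(3)] by auto
    have "L0_ball M \<eta> (f x) \<subseteq> L0_ball M \<delta> (f x)" if "x \<in> F" for x
      using \<eta> F fD that by (intro L0_ball_mono) auto
    moreover have "L0_ball M \<eta> (f x) \<subseteq> L0_ball M \<epsilon> (f x)" if "x \<in> F'" for x
      using \<eta> F' fD that by (intro L0_ball_mono) auto
    ultimately have "{g \<in> carrier dual. \<forall>x\<in>F \<union> F'. g x \<in> L0_ball M \<eta> (f x)} \<subseteq> S \<inter> S'"
      using F(4) F'(4) by blast
    then show "\<exists>F \<epsilon>. finite F \<and> F \<subseteq> carrier V \<and> \<epsilon> \<in> L0_pos M \<and>
        {g \<in> carrier dual. \<forall>x\<in>F. g x \<in> L0_ball M \<epsilon> (f x)} \<subseteq> S \<inter> S'"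
      using F F' \<eta> by (intro exI[of _ "F \<union> F'"] exI[of _ \<eta>]) auto
  next
    fix \<K> f assume K: "\<forall>S\<in>\<K>. ?P S" and "f \<in> \<Union>\<K>"
    then obtain S where S: "S \<in> \<K>" "f \<in> S" by auto
    with K obtain F \<epsilon> where "finite F" "F \<subseteq> carrier V" "\<epsilon> \<in> L0_pos M"
      "{g \<in> carrier dual. \<forall>x\<in>F. g x \<in> L0_ball M \<epsilon> (f x)} \<subseteq> S" by meson
    with S show "\<exists>F \<epsilon>. finite F \<and> F \<subseteq> carrier V \<and> \<epsilon> \<in> L0_pos M \<and>
        {g \<in> carrier dual. \<forall>x\<in>F. g x \<in> L0_ball M \<epsilon> (f x)} \<subseteq> \<Union>\<K>" by blast
  next
    fix S S' assume "?P S" "?P S'"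
    then show "S \<inter> S' \<subseteq> carrier dual" by blast
  next
    fix \<K> assume "\<forall>S\<in>\<K>. ?P S"
    then show "\<Union>\<K> \<subseteq> carrier dual" by blast
  qed
  then show ?thesis unfolding weak_dual_topology_def by (simp add: topology_inverse')
qed

lemma topspace_weak_dual_topology: "topspace (weak_dual_topology M V T) = carrier dual"
proof
  have "rvar M (\<lambda>_. 1) \<in> L0_pos M" by (rule rvar_pos) auto
  then have "openin (weak_dual_topology M V T) (carrier dual)"
    unfolding openin_weak_dual_topology by blast
  then show "carrier dual \<subseteq> topspace (weak_dual_topology M V T)" by (rule openin_subset)
qed (metis openin_weak_dual_topology openin_topspace)

lemma openin_weak_dual_ball:
  assumes f: "f \<in> carrier dual" and x: "x \<in> carrier V" and \<epsilon>: "\<epsilon> \<in> carrier (L0 M)"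
  shows "openin (weak_dual_topology M V T) {g \<in> carrier dual. AE \<omega> in M. \<bar>val (g x) \<omega> - val (f x) \<omega>\<bar> < val \<epsilon> \<omega>}"
  unfolding openin_weak_dual_topology
proof (intro conjI ballI)
  fix g assume "g \<in> {g \<in> carrier dual. AE \<omega> in M. \<bar>val (g x) \<omega> - val (f x) \<omega>\<bar> < val \<epsilon> \<omega>}"
  then have g: "g \<in> carrier dual" "AE \<omega> in M. \<bar>val (g x) \<omega> - val (f x) \<omega>\<bar> < val \<epsilon> \<omega>" by auto
  obtain \<delta> where \<delta>: "\<delta> \<in> L0_pos M" "AE \<omega> in M. val \<delta> \<omega> < val \<epsilon> \<omega> - \<bar>val (g x) \<omega> - val (f x) \<omega>\<bar>"
    using AE_diff_pos[OF \<epsilon> dual_L0[OF g(1) x] dual_L0[OF f x] g(2)] by blast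
  have "{h \<in> carrier dual. \<forall>x\<in>{x}. h x \<in> L0_ball M \<delta> (g x)}
      \<subseteq> {g \<in> carrier dual. AE \<omega> in M. \<bar>val (g x) \<omega> - val (f x) \<omega>\<bar> < val \<epsilon> \<omega>}"
  proof safe
    fix h assume "h \<in> carrier dual" "\<forall>x\<in>{x}. h x \<in> L0_ball M \<delta> (g x)"
    then have "AE \<omega> in M. \<bar>val (g x) \<omega> - val (h x) \<omega>\<bar> \<le> val \<delta> \<omega>"
      using L0_ball_iff[of \<delta> M "g x" "h x"] \<delta>(1) g(1) x by (auto simp: L0_pos_L0)
    with \<delta>(2) show "AE \<omega> in M. \<bar>val (h x) \<omega> - val (f x) \<omega>\<bar> < val \<epsilon> \<omega>" by eventually_elim linarith
  qed
  then show "\<exists>F \<delta>. finite F \<and> F \<subseteq> carrier V \<and> \<delta> \<in> L0_pos M \<and>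
      {h \<in> carrier dual. \<forall>x\<in>F. h x \<in> L0_ball M \<delta> (g x)}
        \<subseteq> {g \<in> carrier dual. AE \<omega> in M. \<bar>val (g x) \<omega> - val (f x) \<omega>\<bar> < val \<epsilon> \<omega>}"
    using \<delta>(1) x by (intro exI[of _ "{x}"] exI[of _ \<delta>]) simp
qed auto

end

section \<open>Indices represented by risk functions\<close>

context locally_L0_convex_module
begin

lemma risk_functionD:
  assumes R: "risk_function M V T K R" and f: "f \<in> polar M V T K"
  shows "rv_local M (R f)" "rv_increasing M (R f)"
    "s \<in> carrier (barL0 M) \<Longrightarrow> R f s \<in> carrier (barL0 M)"
    "s \<in> carrier (barL0 M) \<Longrightarrow> right_version M (R f) s = R f s"
proof -
  have RE: "R f \<in> carrier (barL0 M) \<rightarrow> carrier (barL0 M)" using R f by (auto simp: risk_function_def)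
  then show "s \<in> carrier (barL0 M) \<Longrightarrow> R f s \<in> carrier (barL0 M)" by auto
  show "rv_increasing M (R f)" using R f unfolding risk_function_def rv_increasing_def by blast
  show "s \<in> carrier (barL0 M) \<Longrightarrow> right_version M (R f) s = R f s"
    using R f by (auto simp: risk_function_def)
  have "R f (rv_glue M A m n) = rv_glue M A (R f m) (R f n)"
    if "A \<in> sets M" "m \<in> carrier (barL0 M)" "n \<in> carrier (barL0 M)" for A m n
    using R f that dual_glue_self[OF that(1) polar_dual[OF f]] unfolding risk_function_def by metis
  with RE show "rv_local M (R f)" by (auto simp: rv_local_def)
qed

context
  fixes K R
  assumes R: "risk_function M V T K R" and K: "K \<subseteq> carrier V"
begin

lemma robust_family:
  assumes "x \<in> carrier V"
  shows "(\<lambda>f. R f (f x)) ` polar M V T K \<subseteq> carrier (barL0 M)"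
  using assms by (auto intro!: risk_functionD(3)[OF R] simp: polar_dual L0_barL0)

lemma robust_index_carrier:
  "x \<in> carrier V \<Longrightarrow> robust_index M V T K R x \<in> carrier (barL0 M)"
  unfolding robust_index_def by (intro barL0.inf_closed robust_family)

lemma robust_index_le:
  assumes "f \<in> polar M V T K" "x \<in> carrier V"
  shows "AE \<omega> in M. rep (robust_index M V T K R x) \<omega> \<le> rep (R f (f x)) \<omega>"
  unfolding robust_index_def using assms by (intro Inf_lower_AE robust_family) auto

lemma robust_index_greatest:
  assumes "x \<in> carrier V" "h \<in> borel_measurable M" "Measurable.pred M P"
    "\<And>f. f \<in> polar M V T K \<Longrightarrow> AE \<omega> in M. P \<omega> \<longrightarrow> h \<omega> \<le> rep (R f (f x)) \<omega>"
  shows "AE \<omega> in M. P \<omega> \<longrightarrow> h \<omega> \<le> rep (robust_index M V T K R x) \<omega>"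
  unfolding robust_index_def using assms by (intro Inf_greatest_AE robust_family) auto

text \<open>One comparison principle for several properties of the index: used with \<open>P\<close>
  an event or its complement it gives locality, with \<open>P\<close> everywhere true it gives
  monotonicity.\<close>

lemma robust_index_mono_on:
  assumes x: "x \<in> carrier V" and y: "y \<in> carrier V" and P: "Measurable.pred M P"
    and le: "\<And>f. f \<in> polar M V T K \<Longrightarrow> AE \<omega> in M. P \<omega> \<longrightarrow> val (f x) \<omega> \<le> val (f y) \<omega>"
  shows "AE \<omega> in M. P \<omega> \<longrightarrow> rep (robust_index M V T K R x) \<omega> \<le> rep (robust_index M V T K R y) \<omega>"
proof (rule robust_index_greatest[OF y _ P])
  show "rep (robust_index M V T K R x) \<in> borel_measurable M" using robust_index_carrier[OF x] by simp
  fix f assume f: "f \<in> polar M V T K"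
  have fL: "f x \<in> carrier (L0 M)" "f y \<in> carrier (L0 M)" using x y polar_dual[OF f] by auto
  from robust_index_le[OF f x] le[OF f] rep_val[OF fL(1)] rep_val[OF fL(2)]
    rv_local_mono[OF risk_functionD(1,2)[OF R f] fL[THEN L0_barL0]]
  show "AE \<omega> in M. P \<omega> \<longrightarrow> rep (robust_index M V T K R x) \<omega> \<le> rep (R f (f y)) \<omega>"
    by eventually_elim (auto intro: order_trans)
qed

lemma assessment_index_robust: "assessment_index M V K (robust_index M V T K R)"
  unfolding assessment_index_def
proof (intro conjI ballI impI)
  let ?\<alpha> = "robust_index M V T K R"
  show "?\<alpha> \<in> carrier V \<rightarrow> carrier (barL0 M)" using robust_index_carrier by auto
  fix x y assume x: "x \<in> carrier V" and y: "y \<in> carrier V"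
  show "?\<alpha> (mod_glue M V A x y) = rv_glue M A (?\<alpha> x) (?\<alpha> y)" if A: "A \<in> sets M" for A
  proof (rule rv_glue_eqI[symmetric, OF A robust_index_carrier[OF x] robust_index_carrier[OF y]])
    let ?g = "mod_glue M V A x y"
    have g: "?g \<in> carrier V" using A x y by simp
    have [measurable]: "A \<in> sets M" by (rule A)
    show "?\<alpha> ?g \<in> carrier (barL0 M)" by (rule robust_index_carrier[OF g])
    note v = L0_linear_glue_val[OF dual_linear[OF polar_dual] A x y]
    have "AE \<omega>\<in>A in M. rep (?\<alpha> ?g) \<omega> \<le> rep (?\<alpha> x) \<omega>"
    proof (rule robust_index_mono_on[OF g x])
      fix f assume "f \<in> polar M V T K"
      from v[OF this] show "AE \<omega>\<in>A in M. val (f ?g) \<omega> \<le> val (f x) \<omega>"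
        by eventually_elim simp
    qed measurable
    moreover have "AE \<omega>\<in>A in M. rep (?\<alpha> x) \<omega> \<le> rep (?\<alpha> ?g) \<omega>"
    proof (rule robust_index_mono_on[OF x g])
      fix f assume "f \<in> polar M V T K"
      from v[OF this] show "AE \<omega>\<in>A in M. val (f x) \<omega> \<le> val (f ?g) \<omega>"
        by eventually_elim simp
    qed measurable
    ultimately show "AE \<omega>\<in>A in M. rep (?\<alpha> ?g) \<omega> = rep (?\<alpha> x) \<omega>" by eventually_elim auto
    have "AE \<omega> in M. \<omega> \<notin> A \<longrightarrow> rep (?\<alpha> ?g) \<omega> \<le> rep (?\<alpha> y) \<omega>"
    proof (rule robust_index_mono_on[OF g y])
      fix f assume "f \<in> polar M V T K"
      from v[OF this] show "AE \<omega> in M. \<omega> \<notin> A \<longrightarrow> val (f ?g) \<omega> \<le> val (f y) \<omega>"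
        by eventually_elim simp
    qed measurable
    moreover have "AE \<omega> in M. \<omega> \<notin> A \<longrightarrow> rep (?\<alpha> y) \<omega> \<le> rep (?\<alpha> ?g) \<omega>"
    proof (rule robust_index_mono_on[OF y g])
      fix f assume "f \<in> polar M V T K"
      from v[OF this] show "AE \<omega> in M. \<omega> \<notin> A \<longrightarrow> val (f y) \<omega> \<le> val (f ?g) \<omega>"
        by eventually_elim simp
    qed measurable
    ultimately show "AE \<omega> in M. \<omega> \<notin> A \<longrightarrow> rep (?\<alpha> ?g) \<omega> = rep (?\<alpha> y) \<omega>" by eventually_elim auto
  qed
  show "?\<alpha> y \<sqsubseteq>\<^bsub>barL0 M\<^esub> ?\<alpha> x" if xy: "x \<ominus>\<^bsub>V\<^esub> y \<in> K"
  proof -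
    have "AE \<omega> in M. True \<longrightarrow> rep (?\<alpha> y) \<omega> \<le> rep (?\<alpha> x) \<omega>"
    proof (rule robust_index_mono_on[OF y x])
      fix f assume f: "f \<in> polar M V T K"
      then have "AE \<omega> in M. 0 \<le> val (f (x \<ominus>\<^bsub>V\<^esub> y)) \<omega>" using xy polar_iff[OF K] by blast
      with L0_linear_minus_val[OF dual_linear[OF polar_dual[OF f]] x y]
      show "AE \<omega> in M. True \<longrightarrow> val (f y) \<omega> \<le> val (f x) \<omega>" by eventually_elim simp
    qed simp
    then show ?thesis by simp
  qed
  fix l assume l: "l \<in> L0_unit_interval M"
  then have lL: "l \<in> carrier (L0 M)" and l01: "AE \<omega> in M. 0 \<le> val l \<omega> \<and> val l \<omega> \<le> 1"
    by (auto simp: L0_unit_interval_iff)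
  let ?c = "mod_comb M V l x y"
  have c: "?c \<in> carrier V" using lL x y by simp
  have [measurable]: "rep (?\<alpha> x) \<in> borel_measurable M" "rep (?\<alpha> y) \<in> borel_measurable M"
    using robust_index_carrier x y by auto
  have "AE \<omega> in M. True \<longrightarrow> min (rep (?\<alpha> x) \<omega>) (rep (?\<alpha> y) \<omega>) \<le> rep (?\<alpha> ?c) \<omega>"
  proof (rule robust_index_greatest[OF c])
    fix f assume f: "f \<in> polar M V T K"
    have fL: "f x \<in> carrier (L0 M)" "f y \<in> carrier (L0 M)" "f ?c \<in> carrier (L0 M)"
      using x y c polar_dual[OF f] by auto
    note mono = rv_local_mono[OF risk_functionD(1,2)[OF R f]]
    from robust_index_le[OF f x] robust_index_le[OF f y] l01
      L0_linear_comb_val[OF dual_linear[OF polar_dual[OF f]] lL x y]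
      rep_val[OF fL(1)] rep_val[OF fL(2)] rep_val[OF fL(3)]
      mono[OF fL(1)[THEN L0_barL0] fL(3)[THEN L0_barL0]] mono[OF fL(2)[THEN L0_barL0] fL(3)[THEN L0_barL0]]
    show "AE \<omega> in M. True \<longrightarrow> min (rep (?\<alpha> x) \<omega>) (rep (?\<alpha> y) \<omega>) \<le> rep (R f (f ?c)) \<omega>"
    proof eventually_elim
      case (elim \<omega>)
      \<comment> \<open>A convex combination cannot be smaller than both of its terms; which of the
        two it dominates depends on the point.\<close>
      have "val (f x) \<omega> \<le> val (f ?c) \<omega> \<or> val (f y) \<omega> \<le> val (f ?c) \<omega>"
      proof (rule ccontr)
        assume neg: "\<not> (val (f x) \<omega> \<le> val (f ?c) \<omega> \<or> val (f y) \<omega> \<le> val (f ?c) \<omega>)"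
        then have "val l \<omega> * val (f ?c) \<omega> + (1 - val l \<omega>) * val (f ?c) \<omega>
            < val l \<omega> * val (f x) \<omega> + (1 - val l \<omega>) * val (f y) \<omega>"
        proof (cases "val l \<omega> = 0")
          case False
          with neg elim show ?thesis
            by (intro add_less_le_mono mult_strict_left_mono mult_left_mono) auto
        qed auto
        then show False using elim(4) by (simp add: algebra_simps)
      qed
      then show ?case using elim by (auto simp: min_le_iff_disj intro: order_trans)
    qed
  qed auto
  with rep_meet[OF robust_index_carrier[OF x] robust_index_carrier[OF y]]
  show "?\<alpha> x \<sqinter>\<^bsub>barL0 M\<^esub> ?\<alpha> y \<sqsubseteq>\<^bsub>barL0 M\<^esub> ?\<alpha> ?c"
    unfolding le_barL0 by eventually_elim simp
qed

text \<open>Right-continuity is what makes this set closed. If every ball around \<open>s\<close>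
  meets it, then for each \<open>n\<close> above \<open>s\<close> it contains some \<open>t\<close>
  that is at most \<open>n\<close> there, so \<open>m\<close> is below \<open>R f n\<close>, and
  hence below the infimum over such \<open>n\<close>.\<close>

lemma closedin_superlevel:
  assumes f: "f \<in> polar M V T K" and m: "m \<in> carrier (barL0 M)"
  shows "closedin (L0_topology M) {s \<in> carrier (L0 M). m \<sqsubseteq>\<^bsub>barL0 M\<^esub> R f s}"
  unfolding closedin_def
proof (intro conjI)
  let ?S = "{s \<in> carrier (L0 M). m \<sqsubseteq>\<^bsub>barL0 M\<^esub> R f s}"
  show "?S \<subseteq> topspace (L0_topology M)" by auto
  show "openin (L0_topology M) (topspace (L0_topology M) - ?S)"
    unfolding openin_L0_topology
  proof (intro conjI ballI)
    fix s assume "s \<in> topspace (L0_topology M) - ?S"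
    then have s: "s \<in> carrier (L0 M)" "\<not> m \<sqsubseteq>\<^bsub>barL0 M\<^esub> R f s" by auto
    have sE: "s \<in> carrier (barL0 M)" using s by (simp add: L0_barL0)
    note Rf = risk_functionD[OF R f]
    show "\<exists>\<epsilon>\<in>L0_pos M. L0_ball M \<epsilon> s \<subseteq> topspace (L0_topology M) - ?S"
    proof (rule ccontr)
      assume neg: "\<not> ?thesis"
      have "AE \<omega> in M. True \<longrightarrow> rep m \<omega> \<le> rep (right_version M (R f) s) \<omega>"
      proof (rule right_version_greatest[OF Rf(1,2) sE])
        fix n assume n: "n \<in> carrier (L0 M)"
        have [measurable]: "val s \<in> borel_measurable M" "val n \<in> borel_measurable M" using s n by auto
        \<comment> \<open>A radius that keeps \<open>t\<close> below \<open>n\<close> wherever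
          \<open>s\<close> is below \<open>n\<close>; the value 1 elsewhere merely keeps it
          positive.\<close>
        let ?h = "\<lambda>\<omega>. if val s \<omega> < val n \<omega> then val n \<omega> - val s \<omega> else 1"
        have hm: "?h \<in> borel_measurable M" by measurable
        have \<epsilon>: "rvar M ?h \<in> L0_pos M" by (rule rvar_pos[OF hm]) simp
        then obtain t where t: "t \<in> L0_ball M (rvar M ?h) s" "t \<in> ?S"
          using neg by (fastforce simp: L0_ball_def)
        then have tL: "t \<in> carrier (L0 M)" "AE \<omega> in M. \<bar>val s \<omega> - val t \<omega>\<bar> \<le> val (rvar M ?h) \<omega>"
          using L0_ball_iff[of "rvar M ?h" M s t] hm s(1) by auto
        have "AE \<omega> in M. rep m \<omega> \<le> rep (R f t) \<omega>" using t(2) by simp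
        with tL(2) val_rvar[OF hm] rv_local_mono[OF Rf(1,2) tL(1)[THEN L0_barL0] n[THEN L0_barL0]]
          rep_val[OF tL(1)] rep_val[OF n] rep_val[OF s(1)]
        show "AE \<omega> in M. True \<and> rep s \<omega> < ereal (val n \<omega>) \<longrightarrow> rep m \<omega> \<le> rep (R f n) \<omega>"
          by eventually_elim (auto intro: order_trans split: if_splits)
      qed (use m in auto)
      with s(2) show False by (simp add: Rf(4)[OF sE])
    qed
  qed auto
qed

text \<open>A superlevel set of an essential infimum is the intersection of those of its terms, and
  each of these is the preimage of a closed set under a continuous functional.\<close>

lemma upper_semicont_robust: "upper_semicont M T (robust_index M V T K R)"
  unfolding upper_semicont_def
proof
  fix m assume m: "m \<in> carrier (barL0 M)"
  have "{x \<in> topspace T. m \<sqsubseteq>\<^bsub>barL0 M\<^esub> robust_index M V T K R x} =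
      (\<Inter>f\<in>polar M V T K. {x \<in> topspace T. f x \<in> {s \<in> carrier (L0 M). m \<sqsubseteq>\<^bsub>barL0 M\<^esub> R f s}})" (is "?l = ?r")
  proof (intro Set.set_eqI iffI)
    fix x assume "x \<in> ?l"
    then have x: "x \<in> carrier V" "AE \<omega> in M. rep m \<omega> \<le> rep (robust_index M V T K R x) \<omega>"
      by (auto simp: topspace_T)
    have "AE \<omega> in M. rep m \<omega> \<le> rep (R f (f x)) \<omega>" if f: "f \<in> polar M V T K" for f
      using robust_index_le[OF f x(1)] x(2) by eventually_elim simp
    with x(1) show "x \<in> ?r" by (auto simp: topspace_T polar_dual)
  next
    fix x assume x: "x \<in> ?r"
    then have xV: "x \<in> carrier V" using polar_zero[OF K] by (auto simp: topspace_T)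
    have "AE \<omega> in M. True \<longrightarrow> rep m \<omega> \<le> rep (robust_index M V T K R x) \<omega>"
      by (rule robust_index_greatest[OF xV]) (use x m in auto)
    with xV show "x \<in> ?l" by (simp add: topspace_T)
  qed
  also have "closedin T \<dots>"
  proof (rule closedin_INT)
    show "polar M V T K \<noteq> {}" using polar_zero[OF K] by auto
    fix f assume f: "f \<in> polar M V T K"
    then have "continuous_map T (L0_topology M) f" using polar_dual[OF f] by (simp add: dual_iff)
    then show "closedin T {x \<in> topspace T. f x \<in> {s \<in> carrier (L0 M). m \<sqsubseteq>\<^bsub>barL0 M\<^esub> R f s}}"
      by (rule closedin_continuous_map_preimage[OF _ closedin_superlevel[OF f m]])
  qed
  finally show "closedin T {x \<in> topspace T. m \<sqsubseteq>\<^bsub>barL0 M\<^esub> robust_index M V T K R x}" .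
qed

end

end

section \<open>The minimal risk function of an index\<close>

text \<open>
  \<open>lower_risk\<close> turns out to be the left-continuous version of the minimal risk function. It is
  \<open>esssup {\<alpha> x. f x < s}\<close> with the constraint localized, so that no \<open>x\<close> has to satisfy it globally.
\<close>

definition lower_risk ::
  "'w measure \<Rightarrow> ('w rv, 'x, 'e) module_scheme \<Rightarrow> ('x \<Rightarrow> 'w rv) \<Rightarrow> ('x \<Rightarrow> 'w rv) \<Rightarrow> 'w rv \<Rightarrow> 'w rv" where
  "lower_risk M V \<alpha> f s = \<Squnion>\<^bsub>barL0 M\<^esub>
     ((\<lambda>x. rv_glue M {\<omega> \<in> space M. rep (f x) \<omega> < rep s \<omega>} (\<alpha> x) (cls M (\<lambda>_. - \<infinity>))) ` carrier V)"

definition minimal_risk ::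
  "'w measure \<Rightarrow> ('w rv, 'x, 'e) module_scheme \<Rightarrow> ('x \<Rightarrow> 'w rv) \<Rightarrow> ('x \<Rightarrow> 'w rv) \<Rightarrow> 'w rv \<Rightarrow> 'w rv" where
  "minimal_risk M V \<alpha> f s = right_version M (lower_risk M V \<alpha> f) s"

text \<open>At the ends \<open>l = 0\<close> and \<open>l = 1\<close> one term is 0 even if its
  argument is - infinity, so these cases stand apart. In between, an argument - infinity makes the
  whole sum - infinity; the value infinity is excluded by the hypotheses.\<close>

lemma eplus_mult_less:
  assumes "0 \<le> l" "l \<le> 1" "s < ereal n" "t < ereal p"
  shows "eplus (ereal l * s) (ereal (1 - l) * t) < ereal (l * n + (1 - l) * p)"
proof -
  consider "l = 0" | "l = 1" | "0 < l" "l < 1" using assms by linarith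
  then show ?thesis
  proof cases
    case 3
    show ?thesis
    proof (cases "s = - \<infinity> \<or> t = - \<infinity>")
      case True
      then show ?thesis using 3 by (auto simp: eplus_def)
    next
      case False
      then obtain a b where ab: "s = ereal a" "t = ereal b" using assms by (cases s; cases t; auto)
      have "l * a + (1 - l) * b < l * n + (1 - l) * p"
        using 3 assms ab by (intro add_strict_mono mult_strict_left_mono) auto
      then show ?thesis by (simp add: ab)
    qed
  qed (use assms in \<open>auto simp: zero_ereal_def[symmetric] one_ereal_def[symmetric]\<close>)
qed

context locally_L0_convex_module
begin

context
  fixes \<alpha>
  assumes \<alpha>: "\<alpha> \<in> carrier V \<rightarrow> carrier (barL0 M)"
begin

lemma lower_risk_family:
  assumes f: "f \<in> carrier dual" and s: "s \<in> carrier (barL0 M)"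
  shows "(\<lambda>x. rv_glue M {\<omega> \<in> space M. rep (f x) \<omega> < rep s \<omega>} (\<alpha> x) (cls M (\<lambda>_. - \<infinity>))) ` carrier V
      \<subseteq> carrier (barL0 M)"
    "x \<in> carrier V \<Longrightarrow>
      AE \<omega> in M. rep (rv_glue M {\<omega> \<in> space M. rep (f x) \<omega> < rep s \<omega>} (\<alpha> x) (cls M (\<lambda>_. - \<infinity>))) \<omega> =
        (if rep (f x) \<omega> < rep s \<omega> then rep (\<alpha> x) \<omega> else - \<infinity>)"
proof -
  have [measurable]: "rep s \<in> borel_measurable M" using s by simp
  have A: "{\<omega> \<in> space M. rep (f x) \<omega> < rep s \<omega>} \<in> sets M" if "x \<in> carrier V" for x
  proof -
    have [measurable]: "rep (f x) \<in> borel_measurable M" using f that by (simp add: L0_barL0)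
    show ?thesis by measurable
  qed
  then show "(\<lambda>x. rv_glue M {\<omega> \<in> space M. rep (f x) \<omega> < rep s \<omega>} (\<alpha> x) (cls M (\<lambda>_. - \<infinity>))) ` carrier V
      \<subseteq> carrier (barL0 M)"
    using \<alpha> by auto
  assume x: "x \<in> carrier V"
  have "AE \<omega> in M. rep (cls M (\<lambda>_. - \<infinity>)) \<omega> = - \<infinity>" by (rule rep_cls) simp
  moreover have "AE \<omega> in M. rep (rv_glue M {\<omega> \<in> space M. rep (f x) \<omega> < rep s \<omega>} (\<alpha> x) (cls M (\<lambda>_. - \<infinity>))) \<omega> =
      (if \<omega> \<in> {\<omega> \<in> space M. rep (f x) \<omega> < rep s \<omega>} then rep (\<alpha> x) \<omega> else rep (cls M (\<lambda>_. - \<infinity>)) \<omega>)"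
    by (rule rep_rv_glue[OF A[OF x]]) (use \<alpha> x in auto)
  ultimately show "AE \<omega> in M. rep (rv_glue M {\<omega> \<in> space M. rep (f x) \<omega> < rep s \<omega>} (\<alpha> x) (cls M (\<lambda>_. - \<infinity>))) \<omega> =
        (if rep (f x) \<omega> < rep s \<omega> then rep (\<alpha> x) \<omega> else - \<infinity>)"
    using AE_space by eventually_elim auto
qed

lemma lower_risk_carrier:
  assumes "f \<in> carrier dual" "s \<in> carrier (barL0 M)"
  shows "lower_risk M V \<alpha> f s \<in> carrier (barL0 M)"
  unfolding lower_risk_def by (rule barL0.sup_closed[OF lower_risk_family(1)[OF assms]])

lemma lower_risk_ge:
  assumes "f \<in> carrier dual" "s \<in> carrier (barL0 M)" and x: "x \<in> carrier V"
  shows "AE \<omega> in M. rep (f x) \<omega> < rep s \<omega> \<longrightarrow> rep (\<alpha> x) \<omega> \<le> rep (lower_risk M V \<alpha> f s) \<omega>"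
  using Sup_upper_AE[OF lower_risk_family(1)[OF assms(1,2)] imageI[OF x]] lower_risk_family(2)[OF assms]
  unfolding lower_risk_def[symmetric] by eventually_elim (auto split: if_splits)

text \<open>Together with \<open>lower_risk_ge\<close> this characterizes the localized supremum;
  the padding by - infinity in its definition does not surface again.\<close>

lemma lower_risk_least:
  assumes fs: "f \<in> carrier dual" "s \<in> carrier (barL0 M)"
    and m: "h \<in> borel_measurable M" "Measurable.pred M P"
    and le: "\<And>x. x \<in> carrier V \<Longrightarrow> AE \<omega> in M. P \<omega> \<and> rep (f x) \<omega> < rep s \<omega> \<longrightarrow> rep (\<alpha> x) \<omega> \<le> h \<omega>"
  shows "AE \<omega> in M. P \<omega> \<longrightarrow> rep (lower_risk M V \<alpha> f s) \<omega> \<le> h \<omega>"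
  unfolding lower_risk_def
proof (rule Sup_least_AE[OF lower_risk_family(1)[OF fs] m])
  fix a assume "a \<in> (\<lambda>x. rv_glue M {\<omega> \<in> space M. rep (f x) \<omega> < rep s \<omega>} (\<alpha> x) (cls M (\<lambda>_. - \<infinity>))) ` carrier V"
  then obtain x where x: "x \<in> carrier V"
    and a: "a = rv_glue M {\<omega> \<in> space M. rep (f x) \<omega> < rep s \<omega>} (\<alpha> x) (cls M (\<lambda>_. - \<infinity>))" by auto
  from le[OF x] lower_risk_family(2)[OF fs x] show "AE \<omega> in M. P \<omega> \<longrightarrow> rep a \<omega> \<le> h \<omega>"
    unfolding a by eventually_elim auto
qed

text \<open>Functionals are compared only where they agree, which yields locality in the functional
  and monotonicity in the argument at once.\<close>

lemma lower_risk_mono_on: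
  assumes fs: "f \<in> carrier dual" "s \<in> carrier (barL0 M)" and gt: "g \<in> carrier dual" "t \<in> carrier (barL0 M)"
    and P: "Measurable.pred M P"
    and fg: "\<And>x. x \<in> carrier V \<Longrightarrow> AE \<omega> in M. P \<omega> \<longrightarrow> val (f x) \<omega> = val (g x) \<omega>"
    and st: "AE \<omega> in M. P \<omega> \<longrightarrow> rep s \<omega> \<le> rep t \<omega>"
  shows "AE \<omega> in M. P \<omega> \<longrightarrow> rep (lower_risk M V \<alpha> f s) \<omega> \<le> rep (lower_risk M V \<alpha> g t) \<omega>"
proof (rule lower_risk_least[OF fs _ P])
  show "rep (lower_risk M V \<alpha> g t) \<in> borel_measurable M" using lower_risk_carrier[OF gt] by simp
  fix x assume x: "x \<in> carrier V"
  from fg[OF x] st lower_risk_ge[OF gt x] rep_val[OF dual_L0[OF fs(1) x]] rep_val[OF dual_L0[OF gt(1) x]]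
  show "AE \<omega> in M. P \<omega> \<and> rep (f x) \<omega> < rep s \<omega> \<longrightarrow> rep (\<alpha> x) \<omega> \<le> rep (lower_risk M V \<alpha> g t) \<omega>"
    by eventually_elim auto
qed

lemma lower_risk_increasing: "f \<in> carrier dual \<Longrightarrow> rv_increasing M (lower_risk M V \<alpha> f)"
  unfolding rv_increasing_def
proof (intro ballI impI)
  fix m n assume *: "f \<in> carrier dual" "m \<in> carrier (barL0 M)" "n \<in> carrier (barL0 M)" "m \<sqsubseteq>\<^bsub>barL0 M\<^esub> n"
  have "AE \<omega> in M. True \<longrightarrow> rep (lower_risk M V \<alpha> f m) \<omega> \<le> rep (lower_risk M V \<alpha> f n) \<omega>"
    using * by (intro lower_risk_mono_on) auto
  then show "lower_risk M V \<alpha> f m \<sqsubseteq>\<^bsub>barL0 M\<^esub> lower_risk M V \<alpha> f n" by simp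
qed

text \<open>A comparison in both directions, on the event and on its complement, identifies the
  value at a glued argument.\<close>

lemma rv_localI:
  assumes F: "\<And>m. m \<in> carrier (barL0 M) \<Longrightarrow> F m \<in> carrier (barL0 M)"
    and mono: "\<And>m n P. m \<in> carrier (barL0 M) \<Longrightarrow> n \<in> carrier (barL0 M) \<Longrightarrow> Measurable.pred M P \<Longrightarrow>
      AE \<omega> in M. P \<omega> \<longrightarrow> rep m \<omega> = rep n \<omega> \<Longrightarrow> AE \<omega> in M. P \<omega> \<longrightarrow> rep (F m) \<omega> \<le> rep (F n) \<omega>"
  shows "rv_local M F"
  unfolding rv_local_def
proof (intro conjI ballI)
  show "F \<in> carrier (barL0 M) \<rightarrow> carrier (barL0 M)" using F by auto
  fix A m n assume A[measurable]: "A \<in> sets M" and m: "m \<in> carrier (barL0 M)" and n: "n \<in> carrier (barL0 M)"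
  let ?g = "rv_glue M A m n"
  have g: "?g \<in> carrier (barL0 M)" using A m n by simp
  note r = rep_rv_glue[OF A m n]
  from r have 1: "AE \<omega>\<in>A in M. rep ?g \<omega> = rep m \<omega>" by eventually_elim simp
  from r have 2: "AE \<omega>\<in>A in M. rep m \<omega> = rep ?g \<omega>" by eventually_elim simp
  from r have 3: "AE \<omega> in M. \<omega> \<notin> A \<longrightarrow> rep ?g \<omega> = rep n \<omega>" by eventually_elim simp
  from r have 4: "AE \<omega> in M. \<omega> \<notin> A \<longrightarrow> rep n \<omega> = rep ?g \<omega>" by eventually_elim simp
  show "F ?g = rv_glue M A (F m) (F n)"
  proof (rule rv_glue_eqI[symmetric, OF A F[OF m] F[OF n] F[OF g]])
    have [measurable]: "Measurable.pred M (\<lambda>\<omega>. \<omega> \<in> A)" "Measurable.pred M (\<lambda>\<omega>. \<omega> \<notin> A)" by measurable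
    show "AE \<omega>\<in>A in M. rep (F ?g) \<omega> = rep (F m) \<omega>"
      using mono[OF g m _ 1] mono[OF m g _ 2] by (auto intro: antisym)
    show "AE \<omega> in M. \<omega> \<notin> A \<longrightarrow> rep (F ?g) \<omega> = rep (F n) \<omega>"
      using mono[OF g n _ 3] mono[OF n g _ 4] by (auto intro: antisym)
  qed
qed

lemma lower_risk_local: "f \<in> carrier dual \<Longrightarrow> rv_local M (lower_risk M V \<alpha> f)"
proof (rule rv_localI)
  fix m n P assume *: "f \<in> carrier dual" "m \<in> carrier (barL0 M)" "n \<in> carrier (barL0 M)" "Measurable.pred M P"
    and "AE \<omega> in M. P \<omega> \<longrightarrow> rep m \<omega> = rep n \<omega>"
  from this(5) have "AE \<omega> in M. P \<omega> \<longrightarrow> rep m \<omega> \<le> rep n \<omega>" by eventually_elim simp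
  then show "AE \<omega> in M. P \<omega> \<longrightarrow> rep (lower_risk M V \<alpha> f m) \<omega> \<le> rep (lower_risk M V \<alpha> f n) \<omega>"
    by (intro lower_risk_mono_on[OF *(1,2) *(1,3,4)]) auto
qed (rule lower_risk_carrier)

lemma minimal_risk_carrier:
  assumes "f \<in> carrier dual" "s \<in> carrier (barL0 M)"
  shows "minimal_risk M V \<alpha> f s \<in> carrier (barL0 M)"
  unfolding minimal_risk_def using lower_risk_local[OF assms(1)] assms(2)
  by (intro right_version_carrier) (auto simp: rv_local_def)

lemma minimal_risk_le:
  assumes f: "f \<in> carrier dual" and s: "s \<in> carrier (barL0 M)" and n: "n \<in> carrier (barL0 M)"
  shows "AE \<omega> in M. rep s \<omega> < rep n \<omega> \<longrightarrow> rep (minimal_risk M V \<alpha> f s) \<omega> \<le> rep (lower_risk M V \<alpha> f n) \<omega>"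
  unfolding minimal_risk_def by (rule right_version_le[OF lower_risk_local[OF f] s n])

lemma minimal_risk_greatest:
  assumes f: "f \<in> carrier dual" and s: "s \<in> carrier (barL0 M)"
    and "h \<in> borel_measurable M" "Measurable.pred M P"
    and "\<And>n. n \<in> carrier (L0 M) \<Longrightarrow>
      AE \<omega> in M. P \<omega> \<and> rep s \<omega> < ereal (val n \<omega>) \<longrightarrow> h \<omega> \<le> rep (lower_risk M V \<alpha> f n) \<omega>"
  shows "AE \<omega> in M. P \<omega> \<longrightarrow> h \<omega> \<le> rep (minimal_risk M V \<alpha> f s) \<omega>"
  unfolding minimal_risk_def
  by (rule right_version_greatest[OF lower_risk_local[OF f] lower_risk_increasing[OF f]]) (use assms in auto)

lemma lower_risk_le_minimal_risk:
  assumes f: "f \<in> carrier dual" and s: "s \<in> carrier (barL0 M)"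
  shows "AE \<omega> in M. rep (lower_risk M V \<alpha> f s) \<omega> \<le> rep (minimal_risk M V \<alpha> f s) \<omega>"
  unfolding minimal_risk_def by (rule right_version_ge[OF lower_risk_local[OF f] lower_risk_increasing[OF f] s])

lemma minimal_risk_mono_on:
  assumes fs: "f \<in> carrier dual" "s \<in> carrier (barL0 M)" and gt: "g \<in> carrier dual" "t \<in> carrier (barL0 M)"
    and P[measurable]: "Measurable.pred M P"
    and fg: "\<And>x. x \<in> carrier V \<Longrightarrow> AE \<omega> in M. P \<omega> \<longrightarrow> val (f x) \<omega> = val (g x) \<omega>"
    and st: "AE \<omega> in M. P \<omega> \<longrightarrow> rep s \<omega> \<le> rep t \<omega>"
  shows "AE \<omega> in M. P \<omega> \<longrightarrow> rep (minimal_risk M V \<alpha> f s) \<omega> \<le> rep (minimal_risk M V \<alpha> g t) \<omega>"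
proof (rule minimal_risk_greatest[OF gt _ P])
  show "rep (minimal_risk M V \<alpha> f s) \<in> borel_measurable M" using minimal_risk_carrier[OF fs] by simp
  fix n assume n: "n \<in> carrier (L0 M)"
  then have nE: "n \<in> carrier (barL0 M)" by (rule L0_barL0)
  have "AE \<omega> in M. P \<omega> \<longrightarrow> rep (lower_risk M V \<alpha> f n) \<omega> \<le> rep (lower_risk M V \<alpha> g n) \<omega>"
    by (rule lower_risk_mono_on[OF fs(1) nE gt(1) nE P fg]) auto
  with minimal_risk_le[OF fs nE] st rep_val[OF n]
  show "AE \<omega> in M. P \<omega> \<and> rep t \<omega> < ereal (val n \<omega>) \<longrightarrow>
      rep (minimal_risk M V \<alpha> f s) \<omega> \<le> rep (lower_risk M V \<alpha> g n) \<omega>"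
    by eventually_elim (auto intro: order_trans)
qed

lemma minimal_risk_increasing: "f \<in> carrier dual \<Longrightarrow> rv_increasing M (minimal_risk M V \<alpha> f)"
  unfolding rv_increasing_def
proof (intro ballI impI)
  fix m n assume *: "f \<in> carrier dual" "m \<in> carrier (barL0 M)" "n \<in> carrier (barL0 M)" "m \<sqsubseteq>\<^bsub>barL0 M\<^esub> n"
  have "AE \<omega> in M. True \<longrightarrow> rep (minimal_risk M V \<alpha> f m) \<omega> \<le> rep (minimal_risk M V \<alpha> f n) \<omega>"
    using * by (intro minimal_risk_mono_on) auto
  then show "minimal_risk M V \<alpha> f m \<sqsubseteq>\<^bsub>barL0 M\<^esub> minimal_risk M V \<alpha> f n" by simp
qed

lemma minimal_risk_local: "f \<in> carrier dual \<Longrightarrow> rv_local M (minimal_risk M V \<alpha> f)"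
proof (rule rv_localI)
  fix m n P assume *: "f \<in> carrier dual" "m \<in> carrier (barL0 M)" "n \<in> carrier (barL0 M)" "Measurable.pred M P"
    and "AE \<omega> in M. P \<omega> \<longrightarrow> rep m \<omega> = rep n \<omega>"
  from this(5) have "AE \<omega> in M. P \<omega> \<longrightarrow> rep m \<omega> \<le> rep n \<omega>" by eventually_elim simp
  then show "AE \<omega> in M. P \<omega> \<longrightarrow> rep (minimal_risk M V \<alpha> f m) \<omega> \<le> rep (minimal_risk M V \<alpha> f n) \<omega>"
    by (intro minimal_risk_mono_on[OF *(1,2) *(1,3,4)]) auto
qed (rule minimal_risk_carrier)

text \<open>Taking right limits twice changes nothing: between \<open>s\<close> and a larger
  \<open>n\<close> there is room for a finite variable, at which \<open>minimal_risk\<close> is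
  already below the value of \<open>lower_risk\<close> at \<open>n\<close>.\<close>

lemma minimal_risk_right_continuous:
  assumes f: "f \<in> carrier dual" and s: "s \<in> carrier (barL0 M)"
  shows "right_version M (minimal_risk M V \<alpha> f) s = minimal_risk M V \<alpha> f s"
proof (rule barL0_eqI[where M=M])
  let ?R = "minimal_risk M V \<alpha> f"
  note loc = minimal_risk_local[OF f] minimal_risk_increasing[OF f]
  show c: "right_version M ?R s \<in> carrier (barL0 M)"
    using loc(1) s by (intro right_version_carrier) (auto simp: rv_local_def)
  show "?R s \<in> carrier (barL0 M)" by (rule minimal_risk_carrier[OF f s])
  have [measurable]: "rep s \<in> borel_measurable M" using s by simp
  have "AE \<omega> in M. True \<longrightarrow> rep (right_version M ?R s) \<omega> \<le> rep (?R s) \<omega>"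
  proof (rule minimal_risk_greatest[OF f s])
    fix n assume n: "n \<in> carrier (L0 M)"
    then have nE: "n \<in> carrier (barL0 M)" by (rule L0_barL0)
    then have [measurable]: "rep n \<in> borel_measurable M" by simp
    have pm: "(\<lambda>\<omega>. between (rep s \<omega>) (rep n \<omega>)) \<in> borel_measurable M" by measurable
    let ?p = "rvar M (\<lambda>\<omega>. between (rep s \<omega>) (rep n \<omega>))"
    have p: "?p \<in> carrier (barL0 M)" using pm by (intro L0_barL0 rvar_L0)
    from right_version_le[OF loc(1) s p] minimal_risk_le[OF f p nE] rep_rvar[OF pm] rep_val[OF n]
    show "AE \<omega> in M. True \<and> rep s \<omega> < ereal (val n \<omega>) \<longrightarrow>
        rep (right_version M ?R s) \<omega> \<le> rep (lower_risk M V \<alpha> f n) \<omega>"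
    proof eventually_elim
      case (elim \<omega>)
      then show ?case using between[of "rep s \<omega>" "rep n \<omega>"] by (auto intro: order_trans)
    qed
  qed (use c in auto)
  with right_version_ge[OF loc s]
  show "AE \<omega> in M. rep (right_version M ?R s) \<omega> = rep (?R s) \<omega>" by eventually_elim auto
qed

text \<open>\<open>lower_risk\<close> is left-continuous because its constraint is strict: an
  \<open>x\<close> with \<open>f x\<close> below \<open>s\<close> still satisfies the constraint for
  some variable between the two. On the other side, \<open>minimal_risk\<close> at any
  \<open>n\<close> below \<open>s\<close> is bounded by \<open>lower_risk\<close> at
  \<open>s\<close>.\<close>

lemma minimal_risk_left_version:
  assumes f: "f \<in> carrier dual" and s: "s \<in> carrier (L0 M)"
  shows "left_version M (minimal_risk M V \<alpha> f) s = lower_risk M V \<alpha> f s"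
proof (rule barL0_eqI[where M=M])
  let ?R = "minimal_risk M V \<alpha> f"
  note loc = minimal_risk_local[OF f] minimal_risk_increasing[OF f]
  have sE: "s \<in> carrier (barL0 M)" using s by (rule L0_barL0)
  show c: "left_version M ?R s \<in> carrier (barL0 M)"
    using loc(1) sE by (intro left_version_carrier) (auto simp: rv_local_def)
  show lc: "lower_risk M V \<alpha> f s \<in> carrier (barL0 M)" by (rule lower_risk_carrier[OF f sE])
  have "AE \<omega> in M. True \<longrightarrow> rep (left_version M ?R s) \<omega> \<le> rep (lower_risk M V \<alpha> f s) \<omega>"
  proof (rule left_version_least[OF loc sE])
    fix n assume n: "n \<in> carrier (L0 M)"
    from minimal_risk_le[OF f n[THEN L0_barL0] sE] rep_val[OF n]
    show "AE \<omega> in M. True \<and> ereal (val n \<omega>) < rep s \<omega> \<longrightarrow> rep (?R n) \<omega> \<le> rep (lower_risk M V \<alpha> f s) \<omega>"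
      by eventually_elim auto
  qed (use lc in auto)
  moreover have "AE \<omega> in M. True \<longrightarrow> rep (lower_risk M V \<alpha> f s) \<omega> \<le> rep (left_version M ?R s) \<omega>"
  proof (rule lower_risk_least[OF f sE])
    fix x assume x: "x \<in> carrier V"
    have fx: "f x \<in> carrier (barL0 M)" using f x by (simp add: L0_barL0)
    have [measurable]: "rep (f x) \<in> borel_measurable M" "rep s \<in> borel_measurable M" using fx sE by auto
    have pm: "(\<lambda>\<omega>. between (rep (f x) \<omega>) (rep s \<omega>)) \<in> borel_measurable M" by measurable
    let ?p = "rvar M (\<lambda>\<omega>. between (rep (f x) \<omega>) (rep s \<omega>))"
    have p: "?p \<in> carrier (barL0 M)" using pm by (intro L0_barL0 rvar_L0)
    from left_version_ge[OF loc(1) sE p] lower_risk_le_minimal_risk[OF f p] lower_risk_ge[OF f p x] rep_rvar[OF pm]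
    show "AE \<omega> in M. True \<and> rep (f x) \<omega> < rep s \<omega> \<longrightarrow> rep (\<alpha> x) \<omega> \<le> rep (left_version M ?R s) \<omega>"
    proof eventually_elim
      case (elim \<omega>)
      then show ?case using between[of "rep (f x) \<omega>" "rep s \<omega>"] by (auto intro: order_trans)
    qed
  qed (use c in auto)
  ultimately show "AE \<omega> in M. rep (left_version M ?R s) \<omega> = rep (lower_risk M V \<alpha> f s) \<omega>"
    by eventually_elim auto
qed

text \<open>If the combined functional at \<open>x\<close> is below the combination of
  \<open>n\<close> and \<open>p\<close>, then \<open>f x\<close> is below \<open>n\<close> or
  \<open>g x\<close> is below \<open>p\<close>. This bounds \<open>lower_risk\<close> of the
  combination by the maximum of the two values at \<open>n\<close> and \<open>p\<close>. It remains
  to let \<open>n\<close> and \<open>p\<close> decrease to \<open>s\<close> and \<open>t\<close>,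
  although the maximum may be attained by either side depending on the point.\<close>

lemma minimal_risk_quasiconvex:
  assumes f: "f \<in> carrier dual" and g: "g \<in> carrier dual"
    and s: "s \<in> carrier (barL0 M)" and t: "t \<in> carrier (barL0 M)" and l: "l \<in> L0_unit_interval M"
  shows "minimal_risk M V \<alpha> (mod_comb M dual l f g) (rv_comb M l s t)
    \<sqsubseteq>\<^bsub>barL0 M\<^esub> minimal_risk M V \<alpha> f s \<squnion>\<^bsub>barL0 M\<^esub> minimal_risk M V \<alpha> g t"
proof -
  have lL: "l \<in> carrier (L0 M)" and l01: "AE \<omega> in M. 0 \<le> val l \<omega> \<and> val l \<omega> \<le> 1"
    using l by (auto simp: L0_unit_interval_iff)
  let ?h = "mod_comb M dual l f g" and ?u = "rv_comb M l s t"
  let ?L = "lower_risk M V \<alpha>" and ?R = "minimal_risk M V \<alpha>"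
  have h: "?h \<in> carrier dual" by (rule dual_comb_closed[OF lL f g])
  have u: "?u \<in> carrier (barL0 M)" by (rule rv_comb_carrier[OF lL s t])
  have [measurable]: "rep (?R ?h ?u) \<in> borel_measurable M" "rep (?R f s) \<in> borel_measurable M"
    "rep s \<in> borel_measurable M" "rep t \<in> borel_measurable M"
    using minimal_risk_carrier[OF h u] minimal_risk_carrier[OF f s] s t by auto
  have L: "rep (?L k n) \<in> borel_measurable M" if "k \<in> carrier dual" "n \<in> carrier (L0 M)" for k n
    using lower_risk_carrier[OF that(1) L0_barL0[OF that(2)]] by simp
  have 1: "AE \<omega> in M. rep s \<omega> < ereal (val n \<omega>) \<and> rep t \<omega> < ereal (val p \<omega>) \<longrightarrow>
      rep (?R ?h ?u) \<omega> \<le> max (rep (?L f n) \<omega>) (rep (?L g p) \<omega>)"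
    if n: "n \<in> carrier (L0 M)" and p: "p \<in> carrier (L0 M)" for n p
  proof -
    let ?q = "rvar M (\<lambda>\<omega>. val l \<omega> * val n \<omega> + (1 - val l \<omega>) * val p \<omega>)"
    have qm: "(\<lambda>\<omega>. val l \<omega> * val n \<omega> + (1 - val l \<omega>) * val p \<omega>) \<in> borel_measurable M"
      using lL n p by simp
    have q: "?q \<in> carrier (barL0 M)" using qm by (intro L0_barL0 rvar_L0)
    have [measurable]: "rep (?L f n) \<in> borel_measurable M" "rep (?L g p) \<in> borel_measurable M"
      using L[OF f n] L[OF g p] by auto
    have "AE \<omega> in M. True \<longrightarrow> rep (?L ?h ?q) \<omega> \<le> max (rep (?L f n) \<omega>) (rep (?L g p) \<omega>)"
    proof (rule lower_risk_least[OF h q])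
      fix x assume x: "x \<in> carrier V"
      from val_dual_comb[OF lL f g x] rep_rvar[OF qm] l01 lower_risk_ge[OF f n[THEN L0_barL0] x]
        lower_risk_ge[OF g p[THEN L0_barL0] x] rep_val[OF n] rep_val[OF p]
        rep_val[OF dual_L0[OF f x]] rep_val[OF dual_L0[OF g x]] rep_val[OF dual_L0[OF h x]]
      show "AE \<omega> in M. True \<and> rep (?h x) \<omega> < rep ?q \<omega> \<longrightarrow>
          rep (\<alpha> x) \<omega> \<le> max (rep (?L f n) \<omega>) (rep (?L g p) \<omega>)"
      proof eventually_elim
        case (elim \<omega>)
        show ?case
        proof
          assume "True \<and> rep (?h x) \<omega> < rep ?q \<omega>"
          then have lt: "val l \<omega> * val (f x) \<omega> + (1 - val l \<omega>) * val (g x) \<omega>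
              < val l \<omega> * val n \<omega> + (1 - val l \<omega>) * val p \<omega>" using elim by simp
          have "val (f x) \<omega> < val n \<omega> \<or> val (g x) \<omega> < val p \<omega>"
          proof (rule ccontr)
            assume "\<not> (val (f x) \<omega> < val n \<omega> \<or> val (g x) \<omega> < val p \<omega>)"
            then have "val l \<omega> * val n \<omega> + (1 - val l \<omega>) * val p \<omega>
                \<le> val l \<omega> * val (f x) \<omega> + (1 - val l \<omega>) * val (g x) \<omega>"
              using elim by (intro add_mono mult_left_mono) auto
            with lt show False by simp
          qed
          then show "rep (\<alpha> x) \<omega> \<le> max (rep (?L f n) \<omega>) (rep (?L g p) \<omega>)"
            using elim by (auto simp: le_max_iff_disj)
        qed
      qed
    qed auto
    with minimal_risk_le[OF h u q] rep_rvar[OF qm] l01 rep_rv_comb[OF lL s t]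
    show ?thesis
    proof eventually_elim
      case (elim \<omega>)
      then show ?case using eplus_mult_less[of "val l \<omega>" "rep s \<omega>" "val n \<omega>" "rep t \<omega>" "val p \<omega>"]
        by (auto intro: order_trans)
    qed
  qed
  have 2: "AE \<omega> in M. rep t \<omega> < ereal (val p \<omega>) \<longrightarrow> rep (?R ?h ?u) \<omega> \<le> max (rep (?R f s) \<omega>) (rep (?L g p) \<omega>)"
    if p: "p \<in> carrier (L0 M)" for p
  proof -
    have [measurable]: "rep (?L g p) \<in> borel_measurable M" "val p \<in> borel_measurable M" using L[OF g p] p by auto
    \<comment> \<open>Where \<open>?L g p\<close> is below the left-hand side the maximum has to
      come from \<open>?L f n\<close>, so on this event the infimum over \<open>n\<close> can be
      taken; off it there is nothing to show. The infimum over \<open>p\<close> is taken in the same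
      way afterwards.\<close>
    have "AE \<omega> in M. rep t \<omega> < ereal (val p \<omega>) \<and> rep (?L g p) \<omega> < rep (?R ?h ?u) \<omega> \<longrightarrow>
        rep (?R ?h ?u) \<omega> \<le> rep (?R f s) \<omega>"
    proof (rule minimal_risk_greatest[OF f s])
      fix n assume n: "n \<in> carrier (L0 M)"
      from 1[OF n p] show "AE \<omega> in M. (rep t \<omega> < ereal (val p \<omega>) \<and> rep (?L g p) \<omega> < rep (?R ?h ?u) \<omega>) \<and>
          rep s \<omega> < ereal (val n \<omega>) \<longrightarrow> rep (?R ?h ?u) \<omega> \<le> rep (?L f n) \<omega>"
        by eventually_elim (auto simp: le_max_iff_disj)
    qed measurable
    then show ?thesis by eventually_elim (auto simp: le_max_iff_disj)
  qed
  have "AE \<omega> in M. rep (?R f s) \<omega> < rep (?R ?h ?u) \<omega> \<longrightarrow> rep (?R ?h ?u) \<omega> \<le> rep (?R g t) \<omega>"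
  proof (rule minimal_risk_greatest[OF g t])
    fix p assume p: "p \<in> carrier (L0 M)"
    from 2[OF p] show "AE \<omega> in M. rep (?R f s) \<omega> < rep (?R ?h ?u) \<omega> \<and> rep t \<omega> < ereal (val p \<omega>) \<longrightarrow>
        rep (?R ?h ?u) \<omega> \<le> rep (?L g p) \<omega>"
      by eventually_elim (auto simp: le_max_iff_disj)
  qed measurable
  with rep_join[OF minimal_risk_carrier[OF f s] minimal_risk_carrier[OF g t]]
  show ?thesis unfolding le_barL0 by eventually_elim (auto simp: le_max_iff_disj)
qed

text \<open>Multiplying the functional by a positive \<open>l\<close> turns the constraint with
  bound \<open>l n\<close> into the constraint on \<open>f\<close> with bound \<open>n\<close>. Each
  of the two inequalities uses one direction of this substitution.\<close>

lemma minimal_risk_scale: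
  assumes f: "f \<in> carrier dual" and s: "s \<in> carrier (barL0 M)" and l: "l \<in> L0_pos M"
  shows "minimal_risk M V \<alpha> (l \<odot>\<^bsub>dual\<^esub> f) s = minimal_risk M V \<alpha> f (lift2 M (/) s l)"
proof (rule barL0_eqI[where M=M])
  have lL: "l \<in> carrier (L0 M)" using l by (rule L0_pos_L0)
  let ?g = "l \<odot>\<^bsub>dual\<^esub> f" and ?s = "lift2 M (/) s l"
  let ?L = "lower_risk M V \<alpha>" and ?R = "minimal_risk M V \<alpha>"
  have g: "?g \<in> carrier dual" by (rule dual_smult_closed[OF lL f])
  note s' = rep_divide[OF s lL] and l0 = L0_pos_val[OF l]
  have vg: "AE \<omega> in M. val (?g x) \<omega> = val l \<omega> * val (f x) \<omega>" if "x \<in> carrier V" for x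
    unfolding dual_smult_apply[OF that] by (rule val_mult[OF lL dual_L0[OF f that]])
  show c: "?R ?g s \<in> carrier (barL0 M)" "?R f ?s \<in> carrier (barL0 M)"
    by (rule minimal_risk_carrier[OF g s] minimal_risk_carrier[OF f s'(1)])+
  have "AE \<omega> in M. True \<longrightarrow> rep (?R ?g s) \<omega> \<le> rep (?R f ?s) \<omega>"
  proof (rule minimal_risk_greatest[OF f s'(1)])
    fix n assume n: "n \<in> carrier (L0 M)"
    let ?n = "l \<otimes>\<^bsub>L0 M\<^esub> n"
    have nL: "?n \<in> carrier (L0 M)" using lL n by simp
    note nE = n[THEN L0_barL0] nL[THEN L0_barL0]
    have Lm: "rep (?L f n) \<in> borel_measurable M" using lower_risk_carrier[OF f nE(1)] by simp
    have "AE \<omega> in M. True \<longrightarrow> rep (?L ?g ?n) \<omega> \<le> rep (?L f n) \<omega>"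
    proof (rule lower_risk_least[OF g nE(2) Lm])
      fix x assume x: "x \<in> carrier V"
      from vg[OF x] lower_risk_ge[OF f nE(1) x] l0 val_mult[OF lL n] rep_val[OF n] rep_val[OF nL]
        rep_val[OF dual_L0[OF f x]] rep_val[OF dual_L0[OF g x]]
      show "AE \<omega> in M. True \<and> rep (?g x) \<omega> < rep ?n \<omega> \<longrightarrow> rep (\<alpha> x) \<omega> \<le> rep (?L f n) \<omega>"
        by eventually_elim auto
    qed simp
    with minimal_risk_le[OF g s nE(2)] s'(2) l0 val_mult[OF lL n] rep_val[OF nL]
    show "AE \<omega> in M. True \<and> rep ?s \<omega> < ereal (val n \<omega>) \<longrightarrow> rep (?R ?g s) \<omega> \<le> rep (?L f n) \<omega>"
    proof eventually_elim
      case (elim \<omega>)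
      have "rep s \<omega> < ereal (val l \<omega> * val n \<omega>)" if "rep s \<omega> / ereal (val l \<omega>) < ereal (val n \<omega>)"
        using that elim by (cases "rep s \<omega>") (auto simp: field_simps)
      with elim show ?case by (auto intro: order_trans)
    qed
  qed (use c in auto)
  moreover have "AE \<omega> in M. True \<longrightarrow> rep (?R f ?s) \<omega> \<le> rep (?R ?g s) \<omega>"
  proof (rule minimal_risk_greatest[OF g s])
    fix n assume n: "n \<in> carrier (L0 M)"
    let ?n = "rvar M (\<lambda>\<omega>. val n \<omega> / val l \<omega>)"
    have nm: "(\<lambda>\<omega>. val n \<omega> / val l \<omega>) \<in> borel_measurable M" using n lL by simp
    have nL: "?n \<in> carrier (L0 M)" using nm by simp
    note nE = n[THEN L0_barL0] nL[THEN L0_barL0]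
    have Lm: "rep (?L ?g n) \<in> borel_measurable M" using lower_risk_carrier[OF g nE(1)] by simp
    have "AE \<omega> in M. True \<longrightarrow> rep (?L f ?n) \<omega> \<le> rep (?L ?g n) \<omega>"
    proof (rule lower_risk_least[OF f nE(2) Lm])
      fix x assume x: "x \<in> carrier V"
      from vg[OF x] lower_risk_ge[OF g nE(1) x] l0 rep_rvar[OF nm] rep_val[OF n]
        rep_val[OF dual_L0[OF f x]] rep_val[OF dual_L0[OF g x]]
      show "AE \<omega> in M. True \<and> rep (f x) \<omega> < rep ?n \<omega> \<longrightarrow> rep (\<alpha> x) \<omega> \<le> rep (?L ?g n) \<omega>"
        by eventually_elim (auto simp: field_simps)
    qed simp
    with minimal_risk_le[OF f s'(1) nE(2)] s'(2) l0 rep_rvar[OF nm]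
    show "AE \<omega> in M. True \<and> rep s \<omega> < ereal (val n \<omega>) \<longrightarrow> rep (?R f ?s) \<omega> \<le> rep (?L ?g n) \<omega>"
    proof eventually_elim
      case (elim \<omega>)
      have "rep s \<omega> / ereal (val l \<omega>) < ereal (val n \<omega> / val l \<omega>)" if "rep s \<omega> < ereal (val n \<omega>)"
        using that elim by (cases "rep s \<omega>") (auto simp: field_simps)
      with elim show ?case by (auto intro: order_trans)
    qed
  qed (use c in auto)
  ultimately show "AE \<omega> in M. rep (?R ?g s) \<omega> = rep (?R f ?s) \<omega>" by eventually_elim auto
qed

text \<open>As \<open>s\<close> grows the constraint disappears, so the supremum over
  \<open>s\<close> is that of the index itself, whatever the functional. The comparison is carried
  out without naming this common value.\<close>

lemma minimal_risk_Sup_le: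
  assumes f: "f \<in> carrier dual" and g: "g \<in> carrier dual"
  shows "\<Squnion>\<^bsub>barL0 M\<^esub> (minimal_risk M V \<alpha> f ` carrier (L0 M))
    \<sqsubseteq>\<^bsub>barL0 M\<^esub> \<Squnion>\<^bsub>barL0 M\<^esub> (minimal_risk M V \<alpha> g ` carrier (L0 M))"
proof -
  let ?L = "lower_risk M V \<alpha>" and ?R = "minimal_risk M V \<alpha>"
  have sub: "?R k ` carrier (L0 M) \<subseteq> carrier (barL0 M)" if "k \<in> carrier dual" for k
    using minimal_risk_carrier[OF that L0_barL0] by auto
  let ?S = "\<Squnion>\<^bsub>barL0 M\<^esub> (?R g ` carrier (L0 M))"
  have Sm: "rep ?S \<in> borel_measurable M" using barL0.sup_closed[OF sub[OF g]] by simp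
  have "AE \<omega> in M. True \<longrightarrow> rep (\<Squnion>\<^bsub>barL0 M\<^esub> (?R f ` carrier (L0 M))) \<omega> \<le> rep ?S \<omega>"
  proof (rule Sup_least_AE[OF sub[OF f] Sm])
    fix a assume "a \<in> ?R f ` carrier (L0 M)"
    then obtain s where s: "s \<in> carrier (L0 M)" "a = ?R f s" by auto
    let ?n = "s \<oplus>\<^bsub>L0 M\<^esub> \<one>\<^bsub>L0 M\<^esub>"
    have n: "?n \<in> carrier (L0 M)" using s by simp
    have "AE \<omega> in M. True \<longrightarrow> rep (?L f ?n) \<omega> \<le> rep ?S \<omega>"
    proof (rule lower_risk_least[OF f L0_barL0[OF n] Sm])
      fix x assume x: "x \<in> carrier V"
      have gx: "g x \<in> carrier (L0 M)" using g x by simp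
      \<comment> \<open>Any finite bound strictly above \<open>g x\<close> admits
        \<open>x\<close>.\<close>
      let ?t = "g x \<oplus>\<^bsub>L0 M\<^esub> \<one>\<^bsub>L0 M\<^esub>"
      have t: "?t \<in> carrier (L0 M)" using gx by simp
      from lower_risk_ge[OF g L0_barL0[OF t] x] lower_risk_le_minimal_risk[OF g L0_barL0[OF t]]
        Sup_upper_AE[OF sub[OF g] imageI[OF t]] val_add[OF gx R.one_closed] val_one[of M] rep_val[OF t] rep_val[OF gx]
      show "AE \<omega> in M. True \<and> rep (f x) \<omega> < rep ?n \<omega> \<longrightarrow> rep (\<alpha> x) \<omega> \<le> rep ?S \<omega>"
        by eventually_elim (auto intro: order_trans)
    qed simp
    with minimal_risk_le[OF f L0_barL0[OF s(1)] L0_barL0[OF n]] val_add[OF s(1) R.one_closed] val_one[of M]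
      rep_val[OF n] rep_val[OF s(1)]
    show "AE \<omega> in M. True \<longrightarrow> rep a \<omega> \<le> rep ?S \<omega>"
      unfolding s(2) by eventually_elim (auto intro: order_trans)
  qed simp
  then show ?thesis by simp
qed

text \<open>If the supremum is not below \<open>m\<close>, some single \<open>x\<close> violates the
  bound where its constraint holds. Nearby pairs \<open>(g, t)\<close> still satisfy the constraint
  for this \<open>x\<close> there. Only one point of the module is evaluated, so the weak topology
  is fine enough.\<close>

lemma closedin_lower_risk:
  assumes K: "K \<subseteq> carrier V" and m: "m \<in> carrier (barL0 M)"
  shows "closedin (prod_topology (subtopology (weak_dual_topology M V T) (polar M V T K)) (L0_topology M))
    {(f, s). f \<in> polar M V T K \<and> s \<in> carrier (L0 M) \<and> lower_risk M V \<alpha> f s \<sqsubseteq>\<^bsub>barL0 M\<^esub> m}"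
    (is "closedin ?X ?S")
  unfolding closedin_def
proof (intro conjI)
  have top: "topspace ?X = polar M V T K \<times> carrier (L0 M)"
    using polar_dual by (auto simp: topspace_weak_dual_topology)
  show "?S \<subseteq> topspace ?X" unfolding top by auto
  show "openin ?X (topspace ?X - ?S)"
  proof (subst openin_subopen, intro ballI)
    fix z assume "z \<in> topspace ?X - ?S"
    then obtain f s where z: "z = (f, s)" and f: "f \<in> polar M V T K" and s: "s \<in> carrier (L0 M)"
      and n: "\<not> lower_risk M V \<alpha> f s \<sqsubseteq>\<^bsub>barL0 M\<^esub> m" unfolding top by auto
    note fD = polar_dual[OF f] and sE = L0_barL0[OF s]
    obtain x where x: "x \<in> carrier V" "\<not> (AE \<omega> in M. rep (f x) \<omega> < rep s \<omega> \<longrightarrow> rep (\<alpha> x) \<omega> \<le> rep m \<omega>)"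
    proof (rule ccontr)
      assume "\<not> thesis"
      with that have "AE \<omega> in M. True \<and> rep (f x) \<omega> < rep s \<omega> \<longrightarrow> rep (\<alpha> x) \<omega> \<le> rep m \<omega>"
        if "x \<in> carrier V" for x using that by auto
      then have "AE \<omega> in M. True \<longrightarrow> rep (lower_risk M V \<alpha> f s) \<omega> \<le> rep m \<omega>"
        by (intro lower_risk_least[OF fD sE]) (use m in auto)
      with n show False by simp
    qed
    have fx: "f x \<in> carrier (L0 M)" using fD x by simp
    have [measurable]: "val (f x) \<in> borel_measurable M" "val s \<in> borel_measurable M" using fx s by auto
    \<comment> \<open>Half of the gap: the values at \<open>x\<close> and the bounds may both move,
      each by less than this, and the strict inequality survives.\<close>
    let ?h = "\<lambda>\<omega>. if val (f x) \<omega> < val s \<omega> then (val s \<omega> - val (f x) \<omega>) / 2 else 1"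
    have hm: "?h \<in> borel_measurable M" by measurable
    define \<epsilon> where "\<epsilon> = rvar M ?h"
    have \<epsilon>: "\<epsilon> \<in> carrier (L0 M)" unfolding \<epsilon>_def by (rule rvar_L0[OF hm])
    have v\<epsilon>: "AE \<omega> in M. val \<epsilon> \<omega> = ?h \<omega>" unfolding \<epsilon>_def by (rule val_rvar[OF hm])
    then have \<epsilon>0: "AE \<omega> in M. 0 < val \<epsilon> \<omega>" by eventually_elim simp
    let ?W = "{g \<in> carrier dual. AE \<omega> in M. \<bar>val (g x) \<omega> - val (f x) \<omega>\<bar> < val \<epsilon> \<omega>}"
    let ?B = "{t \<in> carrier (L0 M). AE \<omega> in M. \<bar>val t \<omega> - val s \<omega>\<bar> < val \<epsilon> \<omega>}"
    have "openin ?X ((?W \<inter> polar M V T K) \<times> ?B)"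
      using openin_weak_dual_ball[OF fD x(1) \<epsilon>] openin_L0_ball[OF s \<epsilon>]
      by (simp add: openin_prod_Times_iff openin_subtopology) blast
    moreover have "z \<in> (?W \<inter> polar M V T K) \<times> ?B" unfolding z using f fD s \<epsilon>0 by auto
    moreover have "(?W \<inter> polar M V T K) \<times> ?B \<subseteq> topspace ?X - ?S"
    proof
      fix w assume "w \<in> (?W \<inter> polar M V T K) \<times> ?B"
      then obtain g t where w: "w = (g, t)" and g: "g \<in> polar M V T K" "AE \<omega> in M. \<bar>val (g x) \<omega> - val (f x) \<omega>\<bar> < val \<epsilon> \<omega>"
        and t: "t \<in> carrier (L0 M)" "AE \<omega> in M. \<bar>val t \<omega> - val s \<omega>\<bar> < val \<epsilon> \<omega>" by auto
      note gD = polar_dual[OF g(1)]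
      have "\<not> lower_risk M V \<alpha> g t \<sqsubseteq>\<^bsub>barL0 M\<^esub> m"
      proof
        assume "lower_risk M V \<alpha> g t \<sqsubseteq>\<^bsub>barL0 M\<^esub> m"
        then have "AE \<omega> in M. rep (lower_risk M V \<alpha> g t) \<omega> \<le> rep m \<omega>" by simp
        with lower_risk_ge[OF gD L0_barL0[OF t(1)] x(1)] g(2) t(2) v\<epsilon>
          rep_val[OF fx] rep_val[OF dual_L0[OF gD x(1)]] rep_val[OF s] rep_val[OF t(1)]
        have "AE \<omega> in M. rep (f x) \<omega> < rep s \<omega> \<longrightarrow> rep (\<alpha> x) \<omega> \<le> rep m \<omega>"
        proof eventually_elim
          case (elim \<omega>)
          have "val (g x) \<omega> < val t \<omega>" if "val (f x) \<omega> < val s \<omega>"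
          proof -
            have "val (g x) \<omega> - val (f x) \<omega> < val \<epsilon> \<omega>" "val s \<omega> - val t \<omega> < val \<epsilon> \<omega>" using elim(2,3) by linarith+
            moreover have "val \<epsilon> \<omega> = (val s \<omega> - val (f x) \<omega>) / 2" using elim(4) that by simp
            ultimately show ?thesis by argo
          qed
          with elim show ?case by (auto intro: order_trans)
        qed
        with x(2) show False by simp
      qed
      then show "w \<in> topspace ?X - ?S" unfolding top using g(1) t(1) by (simp add: w)
    qed
    ultimately show "\<exists>U. openin ?X U \<and> z \<in> U \<and> U \<subseteq> topspace ?X - ?S" by blast
  qed
qed

lemma minimal_risk_function_minimal_risk:
  assumes K: "K \<subseteq> carrier V"
  shows "minimal_risk_function M V T K (minimal_risk M V \<alpha>)"
  unfolding minimal_risk_function_def risk_function_def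
proof (intro conjI ballI impI)
  let ?R = "minimal_risk M V \<alpha>"
  show "?R \<in> polar M V T K \<rightarrow> carrier (barL0 M) \<rightarrow> carrier (barL0 M)"
    by (auto intro: minimal_risk_carrier polar_dual)
  fix f g assume f: "f \<in> polar M V T K" and g: "g \<in> polar M V T K"
  note fD = polar_dual[OF f] and gD = polar_dual[OF g]
  show "\<Squnion>\<^bsub>barL0 M\<^esub> (?R f ` carrier (L0 M)) = \<Squnion>\<^bsub>barL0 M\<^esub> (?R g ` carrier (L0 M))"
  proof (rule barL0.le_antisym[OF minimal_risk_Sup_le[OF fD gD] minimal_risk_Sup_le[OF gD fD]])
    show "\<Squnion>\<^bsub>barL0 M\<^esub> (?R f ` carrier (L0 M)) \<in> carrier (barL0 M)"
      "\<Squnion>\<^bsub>barL0 M\<^esub> (?R g ` carrier (L0 M)) \<in> carrier (barL0 M)"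
      using minimal_risk_carrier[OF fD L0_barL0] minimal_risk_carrier[OF gD L0_barL0]
      by (auto intro!: barL0.sup_closed)
  qed
  fix s t assume s: "s \<in> carrier (barL0 M)" and t: "t \<in> carrier (barL0 M)"
  show "?R (mod_comb M dual l f g) (rv_comb M l s t) \<sqsubseteq>\<^bsub>barL0 M\<^esub> ?R f s \<squnion>\<^bsub>barL0 M\<^esub> ?R g t"
    if "l \<in> L0_unit_interval M" for l by (rule minimal_risk_quasiconvex[OF fD gD s t that])
  show "?R (mod_glue M dual A f g) (rv_glue M A s t) = rv_glue M A (?R f s) (?R g t)" if A: "A \<in> sets M" for A
  proof (rule rv_glue_eqI[symmetric, OF A minimal_risk_carrier[OF fD s] minimal_risk_carrier[OF gD t]])
    have [measurable]: "A \<in> sets M" by (rule A)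
    let ?h = "mod_glue M dual A f g" and ?u = "rv_glue M A s t"
    have hD: "?h \<in> carrier dual" by (rule dual_glue_closed[OF A fD gD])
    have u: "?u \<in> carrier (barL0 M)" using A s t by simp
    show "?R ?h ?u \<in> carrier (barL0 M)" by (rule minimal_risk_carrier[OF hD u])
    have glue: "AE \<omega>\<in>A in M. val (?h x) \<omega> = val (f x) \<omega>" "AE \<omega>\<in>A in M. val (f x) \<omega> = val (?h x) \<omega>"
      "AE \<omega> in M. \<omega> \<notin> A \<longrightarrow> val (?h x) \<omega> = val (g x) \<omega>" "AE \<omega> in M. \<omega> \<notin> A \<longrightarrow> val (g x) \<omega> = val (?h x) \<omega>"
      if "x \<in> carrier V" for x
      using val_dual_glue[OF A fD gD that] by (auto elim!: eventually_mono)
    have glue': "AE \<omega>\<in>A in M. rep ?u \<omega> \<le> rep s \<omega>" "AE \<omega>\<in>A in M. rep s \<omega> \<le> rep ?u \<omega>"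
      "AE \<omega> in M. \<omega> \<notin> A \<longrightarrow> rep ?u \<omega> \<le> rep t \<omega>" "AE \<omega> in M. \<omega> \<notin> A \<longrightarrow> rep t \<omega> \<le> rep ?u \<omega>"
      using rep_rv_glue[OF A s t] by (auto elim!: eventually_mono)
    have "AE \<omega>\<in>A in M. rep (?R ?h ?u) \<omega> \<le> rep (?R f s) \<omega>"
      by (rule minimal_risk_mono_on[OF hD u fD s _ glue(1) glue'(1)]) measurable
    moreover have "AE \<omega>\<in>A in M. rep (?R f s) \<omega> \<le> rep (?R ?h ?u) \<omega>"
      by (rule minimal_risk_mono_on[OF fD s hD u _ glue(2) glue'(2)]) measurable
    ultimately show "AE \<omega>\<in>A in M. rep (?R ?h ?u) \<omega> = rep (?R f s) \<omega>" by eventually_elim auto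
    have "AE \<omega> in M. \<omega> \<notin> A \<longrightarrow> rep (?R ?h ?u) \<omega> \<le> rep (?R g t) \<omega>"
      by (rule minimal_risk_mono_on[OF hD u gD t _ glue(3) glue'(3)]) measurable
    moreover have "AE \<omega> in M. \<omega> \<notin> A \<longrightarrow> rep (?R g t) \<omega> \<le> rep (?R ?h ?u) \<omega>"
      by (rule minimal_risk_mono_on[OF gD t hD u _ glue(4) glue'(4)]) measurable
    ultimately show "AE \<omega> in M. \<omega> \<notin> A \<longrightarrow> rep (?R ?h ?u) \<omega> = rep (?R g t) \<omega>" by eventually_elim auto
  qed
next
  let ?R = "minimal_risk M V \<alpha>"
  fix f s t assume f: "f \<in> polar M V T K" and s: "s \<in> carrier (barL0 M)" and t: "t \<in> carrier (barL0 M)"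
    and st: "s \<sqsubseteq>\<^bsub>barL0 M\<^esub> t"
  then show "?R f s \<sqsubseteq>\<^bsub>barL0 M\<^esub> ?R f t"
    using minimal_risk_increasing[OF polar_dual[OF f]] unfolding rv_increasing_def by blast
next
  fix f s assume f: "f \<in> polar M V T K" and s: "s \<in> carrier (barL0 M)"
  show "minimal_risk M V \<alpha> f s = right_version M (minimal_risk M V \<alpha> f) s"
    by (rule minimal_risk_right_continuous[OF polar_dual[OF f] s, symmetric])
  show "minimal_risk M V \<alpha> (l \<odot>\<^bsub>dual\<^esub> f) s = minimal_risk M V \<alpha> f (lift2 M (/) s l)" if "l \<in> L0_pos M" for l
    by (rule minimal_risk_scale[OF polar_dual[OF f] s that])
next
  fix m assume m: "m \<in> carrier (barL0 M)"
  \<comment> \<open>The closedness condition concerns finite \<open>s\<close> only, and there the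
    left version has been identified with \<open>lower_risk\<close>.\<close>
  have "{(f, s). f \<in> polar M V T K \<and> s \<in> carrier (L0 M) \<and> left_version M (minimal_risk M V \<alpha> f) s \<sqsubseteq>\<^bsub>barL0 M\<^esub> m} =
      {(f, s). f \<in> polar M V T K \<and> s \<in> carrier (L0 M) \<and> lower_risk M V \<alpha> f s \<sqsubseteq>\<^bsub>barL0 M\<^esub> m}"
    using minimal_risk_left_version[OF polar_dual] by auto
  with closedin_lower_risk[OF K m]
  show "closedin (prod_topology (subtopology (weak_dual_topology M V T) (polar M V T K)) (L0_topology M))
    {(f, s). f \<in> polar M V T K \<and> s \<in> carrier (L0 M) \<and> left_version M (minimal_risk M V \<alpha> f) s \<sqsubseteq>\<^bsub>barL0 M\<^esub> m}"
    by simp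
qed

end

end

section \<open>The robust representation\<close>

lemma ereal_dense_Rats:
  fixes a b :: ereal
  assumes "a < b"
  obtains q where "q \<in> \<rat>" "a < ereal q" "ereal q < b"
proof -
  obtain x where x: "a < ereal x" "ereal x < b" using ereal_dense2[OF assms] by blast
  obtain y where y: "ereal x < ereal y" "ereal y < b" using ereal_dense2[OF x(2)] by blast
  obtain q where q: "q \<in> \<rat>" "x < q" "q < y" using Rats_dense_in_real[of x y] y(1) by auto
  have "a < ereal q" using x(1) q(2) by (meson less_ereal.simps(1) less_trans)
  moreover have "ereal q < b" using y(2) q(3) by (meson less_ereal.simps(1) less_trans)
  ultimately show ?thesis using q(1) that by blast
qed

text \<open>Countably many levels have a common null set. Later this turns an inequality into the
  task of refuting one fixed level between the two sides on an event of positive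
  probability.\<close>

lemma (in prob_space) AE_le_if_Rats:
  assumes "\<And>q. q \<in> \<rat> \<Longrightarrow> AE \<omega> in M. \<not> (f \<omega> < ereal q \<and> ereal q < g \<omega>)"
  shows "AE \<omega> in M. g \<omega> \<le> f \<omega>"
proof -
  have "AE \<omega> in M. \<forall>q\<in>\<rat>. \<not> (f \<omega> < ereal q \<and> ereal q < g \<omega>)"
    using assms by (subst AE_ball_countable) (auto simp: countable_rat)
  then show ?thesis
  proof eventually_elim
    case (elim \<omega>)
    show ?case
    proof (rule ccontr)
      assume "\<not> g \<omega> \<le> f \<omega>"
      then obtain q where "q \<in> \<rat>" "f \<omega> < ereal q" "ereal q < g \<omega>"
        using ereal_dense_Rats[of "f \<omega>" "g \<omega>"] by (auto simp: not_le)
      with elim show False by blast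
    qed
  qed
qed

section \<open>Restriction to events and gluing along partitions\<close>

context L0_module
begin

lemma ind_smult_subset:
  assumes A: "A \<in> sets M" "B \<in> sets M" "B \<subseteq> A" and xy: "x \<in> carrier V" "y \<in> carrier V"
    and eq: "ind M A \<odot>\<^bsub>V\<^esub> x = ind M A \<odot>\<^bsub>V\<^esub> y"
  shows "ind M B \<odot>\<^bsub>V\<^esub> x = ind M B \<odot>\<^bsub>V\<^esub> y"
proof -
  have "ind M B = ind M B \<otimes>\<^bsub>L0 M\<^esub> ind M A" using A by (simp add: ind_mult_ind Int_absorb2)
  then have "ind M B \<odot>\<^bsub>V\<^esub> v = ind M B \<odot>\<^bsub>V\<^esub> (ind M A \<odot>\<^bsub>V\<^esub> v)" if "v \<in> carrier V" for v
    using smult_assoc1[of "ind M B" "ind M A" v] A that by simp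
  with xy eq show ?thesis by metis
qed

lemma L0_linear_restrict: "L0_linear M V f \<Longrightarrow> L0_linear M V (restrict f (carrier V))"
  by (auto simp: L0_linear_def)

end

text \<open>The complement sits at index 0 and event \<open>n\<close> at index \<open>Suc n\<close>;
  when pieces are glued, the complement is filled with some fixed admissible element.\<close>

lemma countable_partition_complement:
  assumes "\<And>n. D n \<in> sets M" "disjoint_family D"
  shows "countable_partition M (case_nat (space M - (\<Union>n. D n)) D)"
  unfolding countable_partition_def
proof (intro conjI)
  show "range (case_nat (space M - (\<Union>n. D n)) D) \<subseteq> sets M"
    using assms(1) by (auto split: nat.split)
  show "disjoint_family (case_nat (space M - (\<Union>n. D n)) D)"
    using assms(2) by (auto simp: disjoint_family_on_def split: nat.split)
  show "(\<Union>n. case_nat (space M - (\<Union>n. D n)) D n) = space M"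
  proof
    show "(\<Union>n. case_nat (space M - (\<Union>n. D n)) D n) \<subseteq> space M"
      using assms(1)[THEN sets.sets_into_space] by (fastforce split: nat.splits)
    show "space M \<subseteq> (\<Union>n. case_nat (space M - (\<Union>n. D n)) D n)"
    proof
      fix \<omega> assume \<omega>: "\<omega> \<in> space M"
      show "\<omega> \<in> (\<Union>n. case_nat (space M - (\<Union>n. D n)) D n)"
      proof (cases "\<exists>n. \<omega> \<in> D n")
        case True
        then obtain n where "\<omega> \<in> D n" by auto
        then show ?thesis by (intro UN_I[of "Suc n"]) auto
      next
        case False
        with \<omega> show ?thesis by (intro UN_I[of 0]) auto
      qed
    qed
  qed
qed

context sigma_stable_module
begin

text \<open>Both are concatenations of the constant sequence \<open>x\<close>, and concatenations
  are unique.\<close>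

lemma eq_if_eq_on_partition:
  assumes A: "countable_partition M A" and xy: "x \<in> carrier V" "y \<in> carrier V"
    and eq: "\<And>j. ind M (A j) \<odot>\<^bsub>V\<^esub> x = ind M (A j) \<odot>\<^bsub>V\<^esub> y"
  shows "x = y"
proof -
  have "\<exists>!z. is_concat M V A (\<lambda>_. x) z" using A xy by (intro concat_ex1) auto
  moreover have "is_concat M V A (\<lambda>_. x) x" "is_concat M V A (\<lambda>_. x) y" using xy eq by (auto simp: is_concat_def)
  ultimately show ?thesis by blast
qed

text \<open>The base set is taken inside the complement of \<open>C\<close> translated by
  \<open>- x\<close>. Its closure under concatenation is the property that later allows countably
  many elements of \<open>U\<close> to be glued within \<open>U\<close>.\<close>

lemma separating_neighbourhood:
  assumes base: "has_sigma_stable_base M V T" and C: "closedin T C" and x: "x \<in> carrier V" "x \<notin> C"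
  obtains U where "U \<in> nbhds_zero V T" "L0_convex M V U" "L0_absorbent M V U" "L0_balanced M V U"
    "\<And>A. countable_partition M A \<Longrightarrow> concat_sets M V A (\<lambda>_. U) \<subseteq> U" "\<And>u. u \<in> U \<Longrightarrow> x \<oplus>\<^bsub>V\<^esub> u \<notin> C"
proof -
  let ?W = "{u \<in> topspace T. \<one>\<^bsub>L0 M\<^esub> \<odot>\<^bsub>V\<^esub> (u \<oplus>\<^bsub>V\<^esub> x) \<in> topspace T - C}"
  have "openin T ?W"
    using C by (intro openin_continuous_map_preimage[OF continuous_map_affine[OF R.one_closed x(1)]]) auto
  moreover have "\<zero>\<^bsub>V\<^esub> \<in> ?W" using x by (simp add: topspace_T)
  ultimately have "?W \<in> nbhds_zero V T" by (auto simp: nbhds_zero_def topspace_T)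
  with base obtain U where U: "U \<in> nbhds_zero V T" "U \<subseteq> ?W"
    "L0_convex M V U" "L0_absorbent M V U" "L0_balanced M V U"
    "\<forall>A. countable_partition M A \<longrightarrow> concat_sets M V A (\<lambda>_. U) \<subseteq> U"
    unfolding has_sigma_stable_base_def by meson
  have "x \<oplus>\<^bsub>V\<^esub> u \<notin> C" if "u \<in> U" for u
  proof -
    have "u \<in> ?W" using U(2) that by blast
    then have "u \<in> carrier V" "u \<oplus>\<^bsub>V\<^esub> x \<notin> C" using x(1) by (auto simp: topspace_T)
    then show ?thesis using x(1) by (simp add: M.a_comm)
  qed
  with U show ?thesis using that by blast
qed

context
  fixes K \<alpha>
  assumes cone: "closed_L0_convex_cone M V T K" and index: "assessment_index M V K \<alpha>"
begin

lemma cone_carrier: "K \<subseteq> carrier V"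
  using cone by (auto simp: closed_L0_convex_cone_def L0_convex_def)

lemma index_carrier: "\<alpha> \<in> carrier V \<rightarrow> carrier (barL0 M)"
  using index by (simp add: assessment_index_def)

lemma index_measurable [measurable (raw)]: "x \<in> carrier V \<Longrightarrow> rep (\<alpha> x) \<in> borel_measurable M"
  using index_carrier by (simp add: Pi_iff)

lemma index_glue:
  assumes "A \<in> sets M" "x \<in> carrier V" "y \<in> carrier V"
  shows "AE \<omega> in M. rep (\<alpha> (mod_glue M V A x y)) \<omega> = (if \<omega> \<in> A then rep (\<alpha> x) \<omega> else rep (\<alpha> y) \<omega>)"
proof -
  have "\<alpha> (mod_glue M V A x y) = rv_glue M A (\<alpha> x) (\<alpha> y)" using assms index by (simp add: assessment_index_def)
  with rep_rv_glue[of A M "\<alpha> x" "\<alpha> y"] assms index_carrier show ?thesis by (auto simp: Pi_iff)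
qed

lemma index_ind_cong:
  assumes A: "A \<in> sets M" and xy: "x \<in> carrier V" "y \<in> carrier V"
    and eq: "ind M A \<odot>\<^bsub>V\<^esub> x = ind M A \<odot>\<^bsub>V\<^esub> y"
  shows "AE \<omega>\<in>A in M. rep (\<alpha> x) \<omega> = rep (\<alpha> y) \<omega>"
  using index_glue[OF A xy] unfolding mod_glue_cong[OF A xy eq] by eventually_elim auto

lemma index_comb:
  assumes "l \<in> L0_unit_interval M" "x \<in> carrier V" "y \<in> carrier V"
  shows "AE \<omega> in M. min (rep (\<alpha> x) \<omega>) (rep (\<alpha> y) \<omega>) \<le> rep (\<alpha> (mod_comb M V l x y)) \<omega>"
proof -
  have "AE \<omega> in M. rep (\<alpha> x \<sqinter>\<^bsub>barL0 M\<^esub> \<alpha> y) \<omega> \<le> rep (\<alpha> (mod_comb M V l x y)) \<omega>"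
    using assms index by (simp add: assessment_index_def)
  moreover have "AE \<omega> in M. rep (\<alpha> x \<sqinter>\<^bsub>barL0 M\<^esub> \<alpha> y) \<omega> = min (rep (\<alpha> x) \<omega>) (rep (\<alpha> y) \<omega>)"
    using index_carrier assms by (intro rep_meet) auto
  ultimately show ?thesis by eventually_elim simp
qed

lemma index_mono:
  assumes "x \<in> carrier V" "k \<in> K"
  shows "AE \<omega> in M. rep (\<alpha> x) \<omega> \<le> rep (\<alpha> (x \<oplus>\<^bsub>V\<^esub> k)) \<omega>"
proof -
  have k: "k \<in> carrier V" using assms cone_carrier by auto
  have "(x \<oplus>\<^bsub>V\<^esub> k) \<ominus>\<^bsub>V\<^esub> x = k"
    using assms k by (simp add: a_minus_def M.a_comm[of x k] M.a_assoc M.r_neg)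
  then show ?thesis using assms k index by (simp add: assessment_index_def)
qed

lemma index_le_robust:
  assumes x: "x \<in> carrier V"
  shows "AE \<omega> in M. rep (\<alpha> x) \<omega> \<le> rep (robust_index M V T K (minimal_risk M V \<alpha>) x) \<omega>"
proof -
  have R: "risk_function M V T K (minimal_risk M V \<alpha>)"
    using minimal_risk_function_minimal_risk[OF index_carrier cone_carrier] by (simp add: minimal_risk_function_def)
  have "AE \<omega> in M. True \<longrightarrow> rep (\<alpha> x) \<omega> \<le> rep (robust_index M V T K (minimal_risk M V \<alpha>) x) \<omega>"
  proof (rule robust_index_greatest[OF R cone_carrier x])
    fix f assume "f \<in> polar M V T K"
    then have f: "f \<in> carrier dual" by (rule polar_dual)
    have fx: "f x \<in> carrier (barL0 M)" using f x by (simp add: L0_barL0)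
    show "AE \<omega> in M. True \<longrightarrow> rep (\<alpha> x) \<omega> \<le> rep (minimal_risk M V \<alpha> f (f x)) \<omega>"
    proof (rule minimal_risk_greatest[OF index_carrier f fx])
      fix n assume n: "n \<in> carrier (L0 M)"
      from lower_risk_ge[OF index_carrier f L0_barL0[OF n] x] rep_val[OF n]
      show "AE \<omega> in M. True \<and> rep (f x) \<omega> < ereal (val n \<omega>) \<longrightarrow> rep (\<alpha> x) \<omega> \<le> rep (lower_risk M V \<alpha> f n) \<omega>"
        by eventually_elim simp
    qed (use x in auto)
  qed (use x in auto)
  then show ?thesis by simp
qed

text \<open>Knowing that \<open>x\<close> avoids \<open>C - U\<close> globally does not prevent
  \<open>x\<close> from lying in that set on a part of \<open>A\<close>. The largest such part
  \<open>D\<close> is removed. If nothing were left, gluing over \<open>D\<close> would put a point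
  of the neighbourhood into \<open>C\<close>; so the rest \<open>B\<close> has positive probability,
  and there the separation theorem applies.\<close>

lemma index_separation:
  assumes base: "has_sigma_stable_base M V T" and usc: "upper_semicont M T \<alpha>"
    and x: "x \<in> carrier V" and y0: "y0 \<in> carrier V" and A: "A \<in> sets M" "\<not> (AE \<omega> in M. \<omega> \<notin> A)"
    and \<alpha>x: "AE \<omega>\<in>A in M. rep (\<alpha> x) \<omega> < ereal q"
    and \<alpha>y0: "AE \<omega>\<in>A in M. ereal q \<le> rep (\<alpha> y0) \<omega>"
  obtains B f \<delta> where "B \<in> sets M" "B \<subseteq> A" "\<not> (AE \<omega> in M. \<omega> \<notin> B)" "f \<in> carrier dual"
    "\<delta> \<in> carrier (L0 M)" "AE \<omega>\<in>B in M. 0 < val \<delta> \<omega>"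
    "\<And>y. y \<in> carrier V \<Longrightarrow> AE \<omega>\<in>A in M. ereal q \<le> rep (\<alpha> y) \<omega> \<Longrightarrow>
      AE \<omega>\<in>B in M. val (f x) \<omega> + val \<delta> \<omega> \<le> val (f y) \<omega>"
proof -
  have [measurable]: "A \<in> sets M" by (rule A(1))
  define C where "C = {y \<in> carrier V. AE \<omega>\<in>A in M. ereal q \<le> rep (\<alpha> y) \<omega>}"
  have C_closed: "closedin T C"
  proof -
    \<comment> \<open>The level is \<open>q\<close> on \<open>A\<close> and - infinity elsewhere,
      which makes \<open>C\<close> a superlevel set of the index and hence closed.\<close>
    let ?m = "rv_glue M A (cls M (\<lambda>_. ereal q)) (cls M (\<lambda>_. - \<infinity>))"
    have m: "?m \<in> carrier (barL0 M)" using A by auto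
    have q: "AE \<omega> in M. rep (cls M (\<lambda>_. ereal q)) \<omega> = ereal q" "AE \<omega> in M. rep (cls M (\<lambda>_. - \<infinity>)) \<omega> = - \<infinity>"
      by (rule rep_cls, simp)+
    have "AE \<omega> in M. rep ?m \<omega> = (if \<omega> \<in> A then rep (cls M (\<lambda>_. ereal q)) \<omega> else rep (cls M (\<lambda>_. - \<infinity>)) \<omega>)"
      using A by (intro rep_rv_glue) auto
    with q have vm: "AE \<omega> in M. rep ?m \<omega> = (if \<omega> \<in> A then ereal q else - \<infinity>)" by eventually_elim simp
    have "?m \<sqsubseteq>\<^bsub>barL0 M\<^esub> \<alpha> y \<longleftrightarrow> (AE \<omega>\<in>A in M. ereal q \<le> rep (\<alpha> y) \<omega>)" for y
      unfolding le_barL0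
    proof (rule eventually_subst)
      from vm show "AE \<omega> in M. (rep ?m \<omega> \<le> rep (\<alpha> y) \<omega>) = (\<omega> \<in> A \<longrightarrow> ereal q \<le> rep (\<alpha> y) \<omega>)"
        by eventually_elim simp
    qed
    then have "C = {y \<in> topspace T. ?m \<sqsubseteq>\<^bsub>barL0 M\<^esub> \<alpha> y}" unfolding C_def topspace_T by blast
    with usc m show ?thesis by (simp add: upper_semicont_def)
  qed
  have C_convex: "L0_convex M V C"
    unfolding L0_convex_def
  proof (intro conjI ballI)
    show "C \<subseteq> carrier V" by (auto simp: C_def)
    fix y z l assume y: "y \<in> C" and z: "z \<in> C" and l: "l \<in> L0_unit_interval M"
    then have yz: "y \<in> carrier V" "z \<in> carrier V" "AE \<omega>\<in>A in M. ereal q \<le> rep (\<alpha> y) \<omega>"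
      "AE \<omega>\<in>A in M. ereal q \<le> rep (\<alpha> z) \<omega>" by (auto simp: C_def)
    from index_comb[OF l yz(1,2)] yz(3,4)
    have "AE \<omega>\<in>A in M. ereal q \<le> rep (\<alpha> (mod_comb M V l y z)) \<omega>"
      by eventually_elim (auto simp: min_le_iff_disj intro: order_trans)
    then show "mod_comb M V l y z \<in> C" using yz l by (simp add: C_def L0_unit_interval_L0)
  qed
  have y0C: "y0 \<in> C" using y0 \<alpha>y0 by (simp add: C_def)
  let ?x = "mod_glue M V A x y0"
  have x'V: "?x \<in> carrier V" using A x y0 by simp
  have x'C: "?x \<notin> C"
  proof
    assume "?x \<in> C"
    then have "AE \<omega>\<in>A in M. ereal q \<le> rep (\<alpha> ?x) \<omega>" by (simp add: C_def)
    with index_glue[OF A(1) x y0] \<alpha>x have "AE \<omega> in M. \<omega> \<notin> A" by eventually_elim auto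
    with A(2) show False by simp
  qed
  obtain U where U: "U \<in> nbhds_zero V T" "L0_convex M V U" "L0_absorbent M V U" "L0_balanced M V U"
    "\<And>A. countable_partition M A \<Longrightarrow> concat_sets M V A (\<lambda>_. U) \<subseteq> U" "\<And>u. u \<in> U \<Longrightarrow> ?x \<oplus>\<^bsub>V\<^esub> u \<notin> C"
    using separating_neighbourhood[OF base C_closed x'V x'C] by blast
  have U0: "\<zero>\<^bsub>V\<^esub> \<in> U" using U(1) by (auto simp: nbhds_zero_def)
  have UV: "u \<in> carrier V" if "u \<in> U" for u using U(1) that by (auto simp: nbhds_zero_def)
  have CV: "y \<in> carrier V" if "y \<in> C" for y using that by (simp add: C_def)
  \<comment> \<open>The events on which \<open>x\<close> cannot be told apart from \<open>C\<close>
    with room \<open>U\<close>.\<close>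
  define \<A> where "\<A> = {D \<in> sets M. D \<subseteq> A \<and> (\<exists>y\<in>C. \<exists>u\<in>U. ind M D \<odot>\<^bsub>V\<^esub> x = ind M D \<odot>\<^bsub>V\<^esub> (y \<ominus>\<^bsub>V\<^esub> u))}"
  obtain D where D: "D \<in> \<A>" "\<And>E. E \<in> \<A> \<Longrightarrow> AE \<omega>\<in>E in M. \<omega> \<in> D"
  proof (rule maximal_event[of \<A>])
    show "\<A> \<subseteq> sets M" by (auto simp: \<A>_def)
    have "ind M {} \<odot>\<^bsub>V\<^esub> x = ind M {} \<odot>\<^bsub>V\<^esub> (y0 \<ominus>\<^bsub>V\<^esub> \<zero>\<^bsub>V\<^esub>)"
      using x y0 by (simp add: ind_empty a_minus_def)
    then show "{} \<in> \<A>" using y0C U0 by (auto simp: \<A>_def)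
  next
    fix D E assume D: "D \<in> \<A>" and E: "E \<in> sets M" "E \<subseteq> D"
    then obtain y u where yu: "D \<in> sets M" "D \<subseteq> A" "y \<in> C" "u \<in> U" "ind M D \<odot>\<^bsub>V\<^esub> x = ind M D \<odot>\<^bsub>V\<^esub> (y \<ominus>\<^bsub>V\<^esub> u)"
      by (auto simp: \<A>_def)
    have "y \<ominus>\<^bsub>V\<^esub> u \<in> carrier V" using yu CV UV by (simp add: a_minus_def)
    then have "ind M E \<odot>\<^bsub>V\<^esub> x = ind M E \<odot>\<^bsub>V\<^esub> (y \<ominus>\<^bsub>V\<^esub> u)" by (intro ind_smult_subset[OF yu(1) E x _ yu(5)])
    with yu E show "E \<in> \<A>" by (auto simp: \<A>_def)
  next
    fix D :: "nat \<Rightarrow> _" assume dis: "disjoint_family D" and D: "\<And>n. D n \<in> \<A>"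
    have DM: "D n \<in> sets M" "D n \<subseteq> A" for n using D[of n] by (auto simp: \<A>_def)
    have "\<forall>n. \<exists>y u. y \<in> C \<and> u \<in> U \<and> ind M (D n) \<odot>\<^bsub>V\<^esub> x = ind M (D n) \<odot>\<^bsub>V\<^esub> (y \<ominus>\<^bsub>V\<^esub> u)"
      using D unfolding \<A>_def by blast
    then obtain y u where yu: "\<And>n. y n \<in> C" "\<And>n. u n \<in> U"
      "\<And>n. ind M (D n) \<odot>\<^bsub>V\<^esub> x = ind M (D n) \<odot>\<^bsub>V\<^esub> (y n \<ominus>\<^bsub>V\<^esub> u n)" by metis
    define P where "P = case_nat (space M - (\<Union>n. D n)) D"
    have P: "countable_partition M P" unfolding P_def by (rule countable_partition_complement[OF DM(1) dis])
    have PM: "P n \<in> sets M" for n using P by (auto simp: countable_partition_def)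
    \<comment> \<open>On the complement of the union the pieces are \<open>y0\<close> and 0, which
      belong to \<open>C\<close> and \<open>U\<close>.\<close>
    let ?Y = "case_nat y0 y" and ?U = "case_nat \<zero>\<^bsub>V\<^esub> u"
    have YC: "?Y n \<in> C" and UU: "?U n \<in> U" for n using yu y0C U0 by (auto split: nat.split)
    obtain z where z: "is_concat M V P ?Y z" using concat_ex1[OF P, of ?Y] YC CV by blast
    obtain v where v: "is_concat M V P ?U v" using concat_ex1[OF P, of ?U] UU UV by blast
    have "v \<in> concat_sets M V P (\<lambda>_. U)" using v UU by (auto simp: concat_sets_def)
    \<comment> \<open>This is where the base set itself must be closed under countable
      concatenation. For \<open>C\<close> the corresponding fact follows from locality of the
      index.\<close>
    then have vU: "v \<in> U" using U(5)[OF P] by blast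
    have zV: "z \<in> carrier V" and vV: "v \<in> carrier V" using z v by (auto simp: is_concat_def)
    have zeq: "ind M (P n) \<odot>\<^bsub>V\<^esub> z = ind M (P n) \<odot>\<^bsub>V\<^esub> ?Y n" and veq: "ind M (P n) \<odot>\<^bsub>V\<^esub> v = ind M (P n) \<odot>\<^bsub>V\<^esub> ?U n" for n
      using z v by (auto simp: is_concat_def)
    have zC: "z \<in> C"
    proof -
      have "AE \<omega> in M. \<omega> \<in> P n \<longrightarrow> \<omega> \<in> A \<longrightarrow> ereal q \<le> rep (\<alpha> z) \<omega>" for n
      proof -
        have "AE \<omega>\<in>A in M. ereal q \<le> rep (\<alpha> (?Y n)) \<omega>" using YC[of n] by (simp add: C_def)
        with index_ind_cong[OF PM[of n] zV CV[OF YC[of n]] zeq[of n]] show ?thesis by eventually_elim auto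
      qed
      then have "AE \<omega> in M. \<forall>n. \<omega> \<in> P n \<longrightarrow> \<omega> \<in> A \<longrightarrow> ereal q \<le> rep (\<alpha> z) \<omega>"
        unfolding AE_all_countable by blast
      moreover have PS: "(\<Union>n. P n) = space M" using P by (simp add: countable_partition_def)
      note AE_space
      ultimately have "AE \<omega>\<in>A in M. ereal q \<le> rep (\<alpha> z) \<omega>"
        by eventually_elim (use PS in blast)
      with zV show ?thesis by (simp add: C_def)
    qed
    have UD: "(\<Union>n. D n) \<in> sets M" using DM by auto
    have wV: "z \<ominus>\<^bsub>V\<^esub> v \<in> carrier V" using zV vV by (simp add: a_minus_def)
    have "ind M (\<Union>n. D n) \<odot>\<^bsub>V\<^esub> x = ind M (\<Union>n. D n) \<odot>\<^bsub>V\<^esub> (z \<ominus>\<^bsub>V\<^esub> v)"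
    proof (rule eq_if_eq_on_partition[OF P])
      fix j
      have ii: "ind M (P j) \<odot>\<^bsub>V\<^esub> (ind M (\<Union>n. D n) \<odot>\<^bsub>V\<^esub> a) = ind M (P j \<inter> (\<Union>n. D n)) \<odot>\<^bsub>V\<^esub> a"
        if "a \<in> carrier V" for a
        using that PM UD by (simp add: smult_assoc1[symmetric] ind_mult_ind)
      show "ind M (P j) \<odot>\<^bsub>V\<^esub> (ind M (\<Union>n. D n) \<odot>\<^bsub>V\<^esub> x) = ind M (P j) \<odot>\<^bsub>V\<^esub> (ind M (\<Union>n. D n) \<odot>\<^bsub>V\<^esub> (z \<ominus>\<^bsub>V\<^esub> v))"
      proof (cases j)
        case 0
        have "P j \<inter> (\<Union>n. D n) = {}" by (auto simp: P_def 0)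
        then show ?thesis using x wV by (simp add: ii ind_empty)
      next
        case (Suc n)
        have Pn: "P j \<inter> (\<Union>n. D n) = D n" by (auto simp: P_def Suc)
        have "ind M (D n) \<odot>\<^bsub>V\<^esub> (y n \<ominus>\<^bsub>V\<^esub> u n) = ind M (D n) \<odot>\<^bsub>V\<^esub> (z \<ominus>\<^bsub>V\<^esub> v)"
          using zeq[of j] veq[of j] zV vV CV[OF yu(1)] UV[OF yu(2)] DM
          by (simp add: P_def Suc a_minus_def smult_r_distr smult_r_minus)
        then show ?thesis using x wV yu(3)[of n] by (simp add: ii Pn)
      qed
    qed (use x wV UD in auto)
    then show "(\<Union>n. D n) \<in> \<A>" using UD DM zC vU by (auto simp: \<A>_def)
  qed (rule that)
  have DM: "D \<in> sets M" "D \<subseteq> A" using D(1) by (auto simp: \<A>_def)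
  define B where "B = A - D"
  have B: "B \<in> sets M" "B \<subseteq> A" using A DM by (auto simp: B_def)
  have Bpos: "\<not> (AE \<omega> in M. \<omega> \<notin> B)"
  proof
    assume null: "AE \<omega> in M. \<omega> \<notin> B"
    obtain y u where yu: "y \<in> C" "u \<in> U" "ind M D \<odot>\<^bsub>V\<^esub> x = ind M D \<odot>\<^bsub>V\<^esub> (y \<ominus>\<^bsub>V\<^esub> u)"
      using D(1) by (auto simp: \<A>_def)
    have yuV: "y \<in> carrier V" "u \<in> carrier V" using yu CV UV by auto
    have iL: "ind M D \<in> carrier (L0 M)" using DM by simp
    let ?u = "ind M D \<odot>\<^bsub>V\<^esub> u"
    have "AE \<omega> in M. \<bar>rep (ind M D) \<omega>\<bar> \<le> 1" using rep_ind[OF DM(1)] by eventually_elim (simp add: indicator_def)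
    \<comment> \<open>The perturbation is cut off outside \<open>D\<close>; balancedness keeps it in
      \<open>U\<close>.\<close>
    then have uU: "?u \<in> U" using U(4) yu(2) iL by (auto simp: L0_balanced_def)
    let ?v = "?x \<oplus>\<^bsub>V\<^esub> ?u"
    have vV: "?v \<in> carrier V" using x'V yuV iL by simp
    have ii: "ind M D \<odot>\<^bsub>V\<^esub> ?u = ?u" using DM yuV iL by (simp add: smult_assoc1[symmetric] ind_mult_ind)
    have "ind M D \<odot>\<^bsub>V\<^esub> ?x = ind M D \<odot>\<^bsub>V\<^esub> x"
      by (rule ind_smult_subset[OF A(1) DM x'V x ind_smult_glue(1)[OF A(1) x y0]])
    then have "ind M D \<odot>\<^bsub>V\<^esub> ?v = ind M D \<odot>\<^bsub>V\<^esub> (y \<ominus>\<^bsub>V\<^esub> u) \<oplus>\<^bsub>V\<^esub> ind M D \<odot>\<^bsub>V\<^esub> u"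
      using x'V yuV iL yu(3) ii by (simp add: smult_r_distr)
    also have "\<dots> = ind M D \<odot>\<^bsub>V\<^esub> y"
      using yuV iL by (simp add: a_minus_def smult_r_distr smult_r_minus M.a_assoc M.l_neg)
    finally have "AE \<omega>\<in>D in M. rep (\<alpha> ?v) \<omega> = rep (\<alpha> y) \<omega>"
      by (rule index_ind_cong[OF DM(1) vV yuV(1)])
    moreover have "AE \<omega>\<in>A in M. ereal q \<le> rep (\<alpha> y) \<omega>" using yu(1) by (simp add: C_def)
    ultimately have "AE \<omega>\<in>A in M. ereal q \<le> rep (\<alpha> ?v) \<omega>"
      using null by eventually_elim (auto simp: B_def)
    then have "?v \<in> C" using vV by (simp add: C_def)
    with U(6)[OF uU] show False by simp
  qed
  obtain f \<delta> where f: "L0_linear M V f" "\<And>u. u \<in> U \<Longrightarrow> AE \<omega> in M. val (f u) \<omega> \<le> 1"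
    and \<delta>: "\<delta> \<in> carrier (L0 M)" "AE \<omega>\<in>B in M. 0 < val \<delta> \<omega>"
    and sep: "\<And>y. y \<in> C \<Longrightarrow> AE \<omega>\<in>B in M. val (f x) \<omega> + val \<delta> \<omega> \<le> val (f y) \<omega>"
  proof (rule separation[OF C_convex y0C U(2,3) U0 x B(1)])
    fix E y u assume E: "E \<in> sets M" "E \<subseteq> B" and "y \<in> C" "u \<in> U" "ind M E \<odot>\<^bsub>V\<^esub> x = ind M E \<odot>\<^bsub>V\<^esub> (y \<ominus>\<^bsub>V\<^esub> u)"
    then have "E \<in> \<A>" using B by (auto simp: \<A>_def)
    from D(2)[OF this] show "AE \<omega> in M. \<omega> \<notin> E" using E(2) by (auto simp: B_def)
  qed (rule that)
  let ?f = "restrict f (carrier V)"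
  have "continuous_map T (L0_topology M) ?f"
  proof (rule L0_linear_continuousI[OF L0_linear_restrict[OF f(1)] U(1)])
    fix u assume u: "u \<in> U"
    \<comment> \<open>Separation bounds the functional on \<open>U\<close> from above only.
      Balancedness puts \<open>- u\<close> into \<open>U\<close> too, which bounds the absolute
      value and gives continuity.\<close>
    have m1: "\<ominus>\<^bsub>L0 M\<^esub> \<one>\<^bsub>L0 M\<^esub> \<in> carrier (L0 M)" by simp
    have "AE \<omega> in M. \<bar>rep (\<ominus>\<^bsub>L0 M\<^esub> \<one>\<^bsub>L0 M\<^esub>) \<omega>\<bar> \<le> 1"
      using rep_val[OF m1] val_uminus[OF R.one_closed] val_one[of M] by eventually_elim simp
    then have "(\<ominus>\<^bsub>L0 M\<^esub> \<one>\<^bsub>L0 M\<^esub>) \<odot>\<^bsub>V\<^esub> u \<in> U" using U(4) u m1 by (auto simp: L0_balanced_def)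
    then have "\<ominus>\<^bsub>V\<^esub> u \<in> U" using UV[OF u] by (simp add: smult_l_minus)
    from f(2)[OF this] f(2)[OF u] L0_linear_uminus_val[OF f(1) UV[OF u]]
    show "AE \<omega> in M. \<bar>val (?f u) \<omega>\<bar> \<le> 1" using UV[OF u] by auto
  qed
  then have fD: "?f \<in> carrier dual" using f(1) L0_linear_restrict[OF f(1)] by (auto simp: dual_iff L0_linear_def)
  show ?thesis
  proof (rule that[OF B Bpos fD \<delta>])
    fix y assume "y \<in> carrier V" "AE \<omega>\<in>A in M. ereal q \<le> rep (\<alpha> y) \<omega>"
    then have "y \<in> C" "y \<in> carrier V" by (auto simp: C_def)
    with sep[of y] x show "AE \<omega>\<in>B in M. val (?f x) \<omega> + val \<delta> \<omega> \<le> val (?f y) \<omega>" by simp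
  qed
qed

theorem robust_representation:
  assumes base: "has_sigma_stable_base M V T" and usc: "upper_semicont M T \<alpha>" and x: "x \<in> carrier V"
  shows "\<alpha> x = robust_index M V T K (minimal_risk M V \<alpha>) x"
proof -
  let ?R = "minimal_risk M V \<alpha>"
  let ?c = "robust_index M V T K ?R x"
  have R: "risk_function M V T K ?R"
    using minimal_risk_function_minimal_risk[OF index_carrier cone_carrier] by (simp add: minimal_risk_function_def)
  have cE: "?c \<in> carrier (barL0 M)" by (rule robust_index_carrier[OF R cone_carrier x])
  have [measurable]: "rep ?c \<in> borel_measurable M" "rep (\<alpha> x) \<in> borel_measurable M" using cE x by auto
  have "AE \<omega> in M. \<not> (rep (\<alpha> x) \<omega> < ereal q \<and> ereal q < rep ?c \<omega>)" for q
  proof (rule ccontr)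
    assume neg: "\<not> (AE \<omega> in M. \<not> (rep (\<alpha> x) \<omega> < ereal q \<and> ereal q < rep ?c \<omega>))"
    \<comment> \<open>It suffices to find one functional whose risk stays below \<open>q\<close> on a part of positive probability.\<close>
    have contra: False if B: "B \<in> sets M" "\<not> (AE \<omega> in M. \<omega> \<notin> B)" "AE \<omega>\<in>B in M. ereal q < rep ?c \<omega>"
      and f: "f \<in> polar M V T K" and n: "n \<in> carrier (L0 M)" "AE \<omega>\<in>B in M. val (f x) \<omega> < val n \<omega>"
      and y: "\<And>y. y \<in> carrier V \<Longrightarrow>
        AE \<omega> in M. \<omega> \<in> B \<and> val (f y) \<omega> < val n \<omega> \<longrightarrow> rep (\<alpha> y) \<omega> \<le> ereal q" for B f n
    proof -
      have [measurable]: "B \<in> sets M" by (rule B(1))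
      note fD = polar_dual[OF f] and nE = L0_barL0[OF n(1)]
      have fx: "f x \<in> carrier (L0 M)" using fD x by simp
      have "AE \<omega>\<in>B in M. rep (lower_risk M V \<alpha> f n) \<omega> \<le> ereal q"
      proof (rule lower_risk_least[OF index_carrier fD nE])
        fix z assume z: "z \<in> carrier V"
        from y[OF z] rep_val[OF n(1)] rep_val[OF dual_L0[OF fD z]]
        show "AE \<omega> in M. \<omega> \<in> B \<and> rep (f z) \<omega> < rep n \<omega> \<longrightarrow> rep (\<alpha> z) \<omega> \<le> ereal q"
          by eventually_elim simp
      qed measurable
      with minimal_risk_le[OF index_carrier fD L0_barL0[OF fx] nE] robust_index_le[OF R cone_carrier f x] B(3) n(2)
        rep_val[OF fx] rep_val[OF n(1)]
      have "AE \<omega> in M. \<omega> \<notin> B"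
      proof eventually_elim
        case (elim \<omega>)
        show ?case
        proof
          assume "\<omega> \<in> B"
          with elim have "rep ?c \<omega> \<le> rep (minimal_risk M V \<alpha> f (f x)) \<omega>"
            "rep (minimal_risk M V \<alpha> f (f x)) \<omega> \<le> rep (lower_risk M V \<alpha> f n) \<omega>"
            "rep (lower_risk M V \<alpha> f n) \<omega> \<le> ereal q" "ereal q < rep ?c \<omega>" by auto
          then show False by (meson leD order_trans)
        qed
      qed
      with B(2) show False by simp
    qed
    let ?N = "{\<omega> \<in> space M. rep (\<alpha> x) \<omega> < ereal q \<and> ereal q < rep ?c \<omega>}"
    have A0: "?N \<in> sets M" by measurable
    have A0pos: "\<not> (AE \<omega> in M. \<omega> \<notin> ?N)"
    proof
      assume "AE \<omega> in M. \<omega> \<notin> ?N"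
      with AE_space have "AE \<omega> in M. \<not> (rep (\<alpha> x) \<omega> < ereal q \<and> ereal q < rep ?c \<omega>)" by eventually_elim auto
      with neg show False by simp
    qed
    \<comment> \<open>Separation needs a nonempty superlevel set. If the index stayed below
      \<open>q\<close> for every point on \<open>?N\<close>, then the zero functional would already
      have risk at most \<open>q\<close> there.\<close>
    obtain y0 where y0: "y0 \<in> carrier V" "\<not> (AE \<omega> in M. \<omega> \<in> ?N \<longrightarrow> rep (\<alpha> y0) \<omega> < ereal q)"
    proof (rule ccontr)
      assume no: "\<not> thesis"
      show False
      proof (rule contra[OF A0 A0pos _ polar_zero[OF cone_carrier] R.one_closed])
        show "AE \<omega> in M. \<omega> \<in> ?N \<longrightarrow> val (\<zero>\<^bsub>dual\<^esub> x) \<omega> < val \<one>\<^bsub>L0 M\<^esub> \<omega>"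
          unfolding dual_zero_apply[OF x] using val_zero[of M] val_one[of M] by eventually_elim simp
        fix y assume "y \<in> carrier V"
        with no that have "AE \<omega> in M. \<omega> \<in> ?N \<longrightarrow> rep (\<alpha> y) \<omega> < ereal q" by blast
        then show "AE \<omega> in M. \<omega> \<in> ?N \<and> val (\<zero>\<^bsub>dual\<^esub> y) \<omega> < val \<one>\<^bsub>L0 M\<^esub> \<omega> \<longrightarrow> rep (\<alpha> y) \<omega> \<le> ereal q"
          by eventually_elim auto
      qed auto
    qed
    have [measurable]: "rep (\<alpha> y0) \<in> borel_measurable M" using y0 by simp
    let ?A = "{\<omega> \<in> space M. \<omega> \<in> ?N \<and> ereal q \<le> rep (\<alpha> y0) \<omega>}"
    have A: "?A \<in> sets M" by measurable
    have Apos: "\<not> (AE \<omega> in M. \<omega> \<notin> ?A)"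
    proof
      assume "AE \<omega> in M. \<omega> \<notin> ?A"
      then have "AE \<omega> in M. \<omega> \<in> ?N \<longrightarrow> rep (\<alpha> y0) \<omega> < ereal q" by eventually_elim auto
      with y0(2) show False by blast
    qed
    obtain B f \<delta> where B: "B \<in> sets M" "B \<subseteq> ?A" "\<not> (AE \<omega> in M. \<omega> \<notin> B)" and f: "f \<in> carrier dual"
      and \<delta>: "\<delta> \<in> carrier (L0 M)" "AE \<omega>\<in>B in M. 0 < val \<delta> \<omega>"
      and sep: "\<And>y. y \<in> carrier V \<Longrightarrow> AE \<omega> in M. \<omega> \<in> ?A \<longrightarrow> ereal q \<le> rep (\<alpha> y) \<omega> \<Longrightarrow>
        AE \<omega>\<in>B in M. val (f x) \<omega> + val \<delta> \<omega> \<le> val (f y) \<omega>"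
      by (rule index_separation[OF base usc x y0(1) A Apos]) auto
    have [measurable]: "B \<in> sets M" by (rule B(1))
    have y0A: "AE \<omega> in M. \<omega> \<in> ?A \<longrightarrow> ereal q \<le> rep (\<alpha> y0) \<omega>" by (rule AE_I2) simp
    \<comment> \<open>Adding multiples of \<open>k\<close> to \<open>y0\<close> does not lower the
      index, so \<open>f\<close> stays bounded below along this ray. A negative value of
      \<open>f k\<close> would drive it to - infinity.\<close>
    have fK: "AE \<omega>\<in>B in M. 0 \<le> val (f k) \<omega>" if k: "k \<in> K" for k
    proof -
      have kV: "k \<in> carrier V" using k cone_carrier by auto
      have "AE \<omega>\<in>B in M. val (f x) \<omega> + val \<delta> \<omega> - val (f y0) \<omega> \<le> real (Suc n) * val (f k) \<omega>" for n
      proof -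
        let ?l = "rvar M (\<lambda>_. real (Suc n))"
        have l: "?l \<in> L0_pos M" by (rule rvar_pos) auto
        have lL: "?l \<in> carrier (L0 M)" by (rule L0_pos_L0[OF l])
        have lk: "?l \<odot>\<^bsub>V\<^esub> k \<in> K" using cone l k by (auto simp: closed_L0_convex_cone_def)
        have lkV: "?l \<odot>\<^bsub>V\<^esub> k \<in> carrier V" using lL kV by simp
        from index_mono[OF y0(1) lk] y0A
        have "AE \<omega> in M. \<omega> \<in> ?A \<longrightarrow> ereal q \<le> rep (\<alpha> (y0 \<oplus>\<^bsub>V\<^esub> ?l \<odot>\<^bsub>V\<^esub> k)) \<omega>"
          by eventually_elim (auto intro: order_trans)
        with sep[of "y0 \<oplus>\<^bsub>V\<^esub> ?l \<odot>\<^bsub>V\<^esub> k"] y0(1) lkV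
        have "AE \<omega>\<in>B in M. val (f x) \<omega> + val \<delta> \<omega> \<le> val (f (y0 \<oplus>\<^bsub>V\<^esub> ?l \<odot>\<^bsub>V\<^esub> k)) \<omega>" by simp
        moreover have "(\<lambda>_. real (Suc n)) \<in> borel_measurable M" by simp
        note val_rvar[OF this] L0_linear_add_val[OF dual_linear[OF f] y0(1) lkV]
          L0_linear_smult_val[OF dual_linear[OF f] lL kV]
        ultimately show ?thesis by eventually_elim auto
      qed
      then have "AE \<omega> in M. \<forall>n. \<omega> \<in> B \<longrightarrow> val (f x) \<omega> + val \<delta> \<omega> - val (f y0) \<omega> \<le> real (Suc n) * val (f k) \<omega>"
        unfolding AE_all_countable by blast
      then show ?thesis
      proof eventually_elim
        case (elim \<omega>)
        show ?case
        proof (intro impI, rule ccontr)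
          assume B: "\<omega> \<in> B" and "\<not> 0 \<le> val (f k) \<omega>"
          then have neg: "0 < - val (f k) \<omega>" by simp
          obtain n where n: "- (val (f x) \<omega> + val \<delta> \<omega> - val (f y0) \<omega>) < real n * (- val (f k) \<omega>)"
            using reals_Archimedean3[OF neg] by blast
          have "real (Suc n) * val (f k) \<omega> \<le> real n * val (f k) \<omega>" using neg by (simp add: algebra_simps)
          with n elim[rule_format, OF B, of n] show False by simp
        qed
      qed
    qed
    \<comment> \<open>Positivity on the cone is known on \<open>B\<close> only; multiplying by the
      indicator makes the functional an element of the polar cone.\<close>
    let ?f = "ind M B \<odot>\<^bsub>dual\<^esub> f"
    have iL: "ind M B \<in> carrier (L0 M)" using B by simp
    have f'D: "?f \<in> carrier dual" by (rule dual_smult_closed[OF iL f])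
    have vf: "AE \<omega> in M. val (?f y) \<omega> = indicator B \<omega> * val (f y) \<omega>" if y: "y \<in> carrier V" for y
      using val_mult[OF iL dual_L0[OF f y]] val_ind[OF B(1)] unfolding dual_smult_apply[OF y] by eventually_elim simp
    have f': "?f \<in> polar M V T K"
      unfolding polar_iff[OF cone_carrier]
    proof (intro conjI ballI f'D)
      fix k assume k: "k \<in> K"
      then have "k \<in> carrier V" using cone_carrier by auto
      from vf[OF this] fK[OF k] show "AE \<omega> in M. 0 \<le> val (?f k) \<omega>"
        by eventually_elim (auto simp: indicator_def)
    qed
    let ?n = "?f x \<oplus>\<^bsub>L0 M\<^esub> \<delta>"
    have fx: "?f x \<in> carrier (L0 M)" using f'D x by simp
    have n: "?n \<in> carrier (L0 M)" using fx \<delta> by simp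
    show False
    proof (rule contra[OF B(1,3) _ f' n])
      show "AE \<omega>\<in>B in M. ereal q < rep ?c \<omega>" using B(2) by (intro AE_I2) auto
      show "AE \<omega>\<in>B in M. val (?f x) \<omega> < val ?n \<omega>"
        using val_add[OF fx \<delta>(1)] \<delta>(2) by eventually_elim simp
      fix y assume y: "y \<in> carrier V"
      have f'y: "?f y \<in> carrier (L0 M)" using f'D y by simp
      have [measurable]: "val (?f y) \<in> borel_measurable M" "val ?n \<in> borel_measurable M" "rep (\<alpha> y) \<in> borel_measurable M"
        using f'y n y by auto
      \<comment> \<open>\<open>sep\<close> asks for an index of at least \<open>q\<close> on all of
        \<open>?A\<close>. So \<open>y\<close> is kept only where it would be a counterexample and
        replaced by \<open>y0\<close> elsewhere; on \<open>D\<close> the gap then contradicts the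
        bound by \<open>?n\<close>.\<close>
      define D where "D = {\<omega> \<in> space M. \<omega> \<in> B \<and> val (?f y) \<omega> < val ?n \<omega> \<and> ereal q < rep (\<alpha> y) \<omega>}"
      have D: "D \<in> sets M" unfolding D_def by measurable
      let ?y = "mod_glue M V D y y0"
      have y'V: "?y \<in> carrier V" using D y y0 by simp
      from index_glue[OF D y y0(1)] y0A have "AE \<omega> in M. \<omega> \<in> ?A \<longrightarrow> ereal q \<le> rep (\<alpha> ?y) \<omega>"
        by eventually_elim (auto simp: D_def)
      from sep[OF y'V this] L0_linear_glue_val[OF dual_linear[OF f] D y y0(1)] vf[OF x] vf[OF y] val_add[OF fx \<delta>(1)] AE_space
      show "AE \<omega> in M. \<omega> \<in> B \<and> val (?f y) \<omega> < val ?n \<omega> \<longrightarrow> rep (\<alpha> y) \<omega> \<le> ereal q"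
      proof eventually_elim
        case (elim \<omega>)
        then show ?case by (cases "\<omega> \<in> D") (auto simp: D_def)
      qed
    qed
  qed
  then have "AE \<omega> in M. rep ?c \<omega> \<le> rep (\<alpha> x) \<omega>" by (rule AE_le_if_Rats)
  with index_le_robust[OF x] have "AE \<omega> in M. rep (\<alpha> x) \<omega> = rep ?c \<omega>" by eventually_elim simp
  then show ?thesis using index_carrier x cE by (intro barL0_eqI[where M=M]) auto
qed

end

end

section \<open>Separation in the dual module\<close>

lemma AE_countable_partition:
  assumes P: "countable_partition M P" and Q: "\<And>n. AE \<omega> in M. \<omega> \<in> P n \<longrightarrow> Q \<omega>"
  shows "AE \<omega> in M. Q \<omega>"
proof -
  have "AE \<omega> in M. \<forall>n. \<omega> \<in> P n \<longrightarrow> Q \<omega>" using Q unfolding AE_all_countable by blast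
  moreover have PS: "(\<Union>n. P n) = space M" using P by (simp add: countable_partition_def)
  note AE_space
  ultimately show ?thesis by eventually_elim (use PS in blast)
qed

text \<open>At each point the series has at most one nonzero term, so convergence is no
  issue.\<close>

lemma L0_concat:
  assumes P: "countable_partition M P" and h: "\<And>n. h n \<in> borel_measurable M"
  obtains t where "t \<in> carrier (L0 M)" "\<And>n. AE \<omega> in M. \<omega> \<in> P n \<longrightarrow> val t \<omega> = h n \<omega>"
proof -
  have PM: "P n \<in> sets M" for n using P by (auto simp: countable_partition_def)
  have [measurable]: "\<And>n. P n \<in> sets M" "\<And>n. h n \<in> borel_measurable M" using PM h by auto
  let ?s = "\<lambda>\<omega>. \<Sum>i. indicator (P i) \<omega> * h i \<omega>"
  have m: "?s \<in> borel_measurable M" by measurable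
  show ?thesis
  proof
    show "rvar M ?s \<in> carrier (L0 M)" using m by simp
    fix n
    have "?s \<omega> = h n \<omega>" if "\<omega> \<in> P n" for \<omega>
    proof -
      have "indicator (P i) \<omega> * h i \<omega> = (if i = n then h i \<omega> else 0)" for i
        using P that by (auto simp: countable_partition_def disjoint_family_on_def indicator_def)
      then show ?thesis using sums_unique[OF sums_single[of n "\<lambda>i. h i \<omega>"]] by simp
    qed
    with val_rvar[OF m] show "AE \<omega> in M. \<omega> \<in> P n \<longrightarrow> val (rvar M ?s) \<omega> = h n \<omega>" by (auto elim!: eventually_mono)
  qed
qed

context sigma_stable_module
begin

text \<open>The values of the functionals are glued separately for each argument, and linearity is
  checked piece by piece. Continuity is the point where stability of the system of neighbourhoods is
  used.\<close>

lemma dual_concat: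
  assumes P: "countable_partition M P" and G: "\<And>n. G n \<in> carrier dual"
  obtains g where "g \<in> carrier dual"
    "\<And>n x. x \<in> carrier V \<Longrightarrow> AE \<omega> in M. \<omega> \<in> P n \<longrightarrow> val (g x) \<omega> = val (G n x) \<omega>"
proof -
  have "\<exists>t. t \<in> carrier (L0 M) \<and> (\<forall>n. AE \<omega> in M. \<omega> \<in> P n \<longrightarrow> val t \<omega> = val (G n x) \<omega>)" if x: "x \<in> carrier V" for x
  proof -
    obtain t where "t \<in> carrier (L0 M)" "\<And>n. AE \<omega> in M. \<omega> \<in> P n \<longrightarrow> val t \<omega> = val (G n x) \<omega>"
      by (rule L0_concat[OF P, of "\<lambda>n. val (G n x)"]) (use dual_L0[OF G x] in auto)
    then show ?thesis by blast
  qed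
  then have "\<forall>x\<in>carrier V. \<exists>t. t \<in> carrier (L0 M) \<and>
      (\<forall>n. AE \<omega> in M. \<omega> \<in> P n \<longrightarrow> val t \<omega> = val (G n x) \<omega>)" by blast
  from bchoice[OF this] obtain g0 where "\<forall>x\<in>carrier V. g0 x \<in> carrier (L0 M) \<and>
      (\<forall>n. AE \<omega> in M. \<omega> \<in> P n \<longrightarrow> val (g0 x) \<omega> = val (G n x) \<omega>)" ..
  then have g0: "\<And>x. x \<in> carrier V \<Longrightarrow> g0 x \<in> carrier (L0 M)"
    "\<And>n x. x \<in> carrier V \<Longrightarrow> AE \<omega> in M. \<omega> \<in> P n \<longrightarrow> val (g0 x) \<omega> = val (G n x) \<omega>"
    by blast+
  define g where "g = restrict g0 (carrier V)"
  have gL: "g x \<in> carrier (L0 M)" and gG: "\<And>n. AE \<omega> in M. \<omega> \<in> P n \<longrightarrow> val (g x) \<omega> = val (G n x) \<omega>"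
    if "x \<in> carrier V" for x using g0 that by (auto simp: g_def)
  have lin: "L0_linear M V g"
    unfolding L0_linear_def
  proof (intro conjI ballI)
    show "g \<in> carrier V \<rightarrow> carrier (L0 M)" using gL by auto
    fix x assume x: "x \<in> carrier V"
    show "g (x \<oplus>\<^bsub>V\<^esub> y) = g x \<oplus>\<^bsub>L0 M\<^esub> g y" if y: "y \<in> carrier V" for y
    proof (rule L0_eqI[where M=M])
      have xy: "x \<oplus>\<^bsub>V\<^esub> y \<in> carrier V" using x y by simp
      show "AE \<omega> in M. val (g (x \<oplus>\<^bsub>V\<^esub> y)) \<omega> = val (g x \<oplus>\<^bsub>L0 M\<^esub> g y) \<omega>"
      proof (rule AE_countable_partition[OF P])
        fix n
        from gG[OF x, of n] gG[OF y, of n] gG[OF xy, of n] L0_linear_add_val[OF dual_linear[OF G[of n]] x y]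
          val_add[OF gL[OF x] gL[OF y]]
        show "AE \<omega> in M. \<omega> \<in> P n \<longrightarrow> val (g (x \<oplus>\<^bsub>V\<^esub> y)) \<omega> = val (g x \<oplus>\<^bsub>L0 M\<^esub> g y) \<omega>"
          by eventually_elim simp
      qed
    qed (use x y gL in auto)
    show "g (l \<odot>\<^bsub>V\<^esub> x) = l \<otimes>\<^bsub>L0 M\<^esub> g x" if l: "l \<in> carrier (L0 M)" for l
    proof (rule L0_eqI[where M=M])
      have lx: "l \<odot>\<^bsub>V\<^esub> x \<in> carrier V" using l x by simp
      show "AE \<omega> in M. val (g (l \<odot>\<^bsub>V\<^esub> x)) \<omega> = val (l \<otimes>\<^bsub>L0 M\<^esub> g x) \<omega>"
      proof (rule AE_countable_partition[OF P])
        fix n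
        from gG[OF x, of n] gG[OF lx, of n] L0_linear_smult_val[OF dual_linear[OF G[of n]] l x]
          val_mult[OF l gL[OF x]]
        show "AE \<omega> in M. \<omega> \<in> P n \<longrightarrow> val (g (l \<odot>\<^bsub>V\<^esub> x)) \<omega> = val (l \<otimes>\<^bsub>L0 M\<^esub> g x) \<omega>"
          by eventually_elim simp
      qed
    qed (use x l gL in auto)
  qed
  have one: "\<one>\<^bsub>L0 M\<^esub> \<in> L0_pos M" unfolding one_rvar by (rule rvar_pos) auto
  \<comment> \<open>One neighbourhood for each functional, on which it is bounded by 1. Their
    concatenation is again a neighbourhood, and on each piece an element of it agrees with an
    element of the corresponding set.\<close>
  let ?U = "\<lambda>n. {x \<in> carrier V. AE \<omega> in M. \<bar>val (G n x) \<omega>\<bar> \<le> val \<one>\<^bsub>L0 M\<^esub> \<omega>}"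
  have PM: "P n \<in> sets M" for n using P by (auto simp: countable_partition_def)
  have "continuous_map T (L0_topology M) g"
  proof (rule L0_linear_continuousI[OF lin nbhds_concat[OF P, of ?U]])
    show "?U n \<in> nbhds_zero V T" for n by (rule dual_bounded_nbhd[OF G one])
    fix u assume "u \<in> concat_sets M V P ?U"
    then obtain X where X: "\<And>n. X n \<in> ?U n" "is_concat M V P X u" by (auto simp: concat_sets_def)
    have u: "u \<in> carrier V" "\<And>n. ind M (P n) \<odot>\<^bsub>V\<^esub> u = ind M (P n) \<odot>\<^bsub>V\<^esub> X n" using X(2) by (auto simp: is_concat_def)
    show "AE \<omega> in M. \<bar>val (g u) \<omega>\<bar> \<le> 1"
    proof (rule AE_countable_partition[OF P])
      fix n
      have Xn: "X n \<in> carrier V" "AE \<omega> in M. \<bar>val (G n (X n)) \<omega>\<bar> \<le> val \<one>\<^bsub>L0 M\<^esub> \<omega>" using X(1)[of n] by auto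
      from Xn(2) gG[OF u(1), of n] L0_linear_ind_cong[OF dual_linear[OF G[of n]] PM u(1) Xn(1) u(2)] val_one[of M]
      show "AE \<omega> in M. \<omega> \<in> P n \<longrightarrow> \<bar>val (g u) \<omega>\<bar> \<le> 1" by eventually_elim simp
    qed
  qed
  then have "g \<in> carrier dual" using lin gL by (auto simp: dual_iff g_def)
  with gG show ?thesis using that by blast
qed

lemma polar_concat:
  assumes K: "K \<subseteq> carrier V" and P: "countable_partition M P" and G: "\<And>n. G n \<in> polar M V T K"
  obtains g where "g \<in> polar M V T K"
    "\<And>n x. x \<in> carrier V \<Longrightarrow> AE \<omega> in M. \<omega> \<in> P n \<longrightarrow> val (g x) \<omega> = val (G n x) \<omega>"
proof -
  obtain g where g: "g \<in> carrier dual"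
    "\<And>n x. x \<in> carrier V \<Longrightarrow> AE \<omega> in M. \<omega> \<in> P n \<longrightarrow> val (g x) \<omega> = val (G n x) \<omega>"
    by (rule dual_concat[OF P, of G]) (use polar_dual[OF G] in auto)
  have "g \<in> polar M V T K"
    unfolding polar_iff[OF K]
  proof (intro conjI ballI g(1))
    fix k assume k: "k \<in> K"
    then have kV: "k \<in> carrier V" using K by auto
    show "AE \<omega> in M. 0 \<le> val (g k) \<omega>"
    proof (rule AE_countable_partition[OF P])
      fix n
      have "AE \<omega> in M. 0 \<le> val (G n k) \<omega>" using G[of n] k polar_iff[OF K] by blast
      with g(2)[OF kV, of n] show "AE \<omega> in M. \<omega> \<in> P n \<longrightarrow> 0 \<le> val (g k) \<omega>" by eventually_elim simp
    qed
  qed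
  with g(2) show ?thesis using that by blast
qed

end

section \<open>Finite powers of the scalars\<close>

definition L0_power :: "'w measure \<Rightarrow> 'i set \<Rightarrow> ('w rv, 'i \<Rightarrow> 'w rv) module" where
  "L0_power M I = \<lparr>carrier = I \<rightarrow>\<^sub>E carrier (L0 M), mult = undefined, one = undefined,
     zero = (\<lambda>i\<in>I. \<zero>\<^bsub>L0 M\<^esub>), add = (\<lambda>v w. \<lambda>i\<in>I. v i \<oplus>\<^bsub>L0 M\<^esub> w i),
     smult = (\<lambda>l v. \<lambda>i\<in>I. l \<otimes>\<^bsub>L0 M\<^esub> v i)\<rparr>"

lemma L0_power_carrier [simp]: "carrier (L0_power M I) = I \<rightarrow>\<^sub>E carrier (L0 M)"
  by (simp add: L0_power_def)

lemma L0_power_apply: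
  "i \<in> I \<Longrightarrow> (v \<oplus>\<^bsub>L0_power M I\<^esub> w) i = v i \<oplus>\<^bsub>L0 M\<^esub> w i"
  "i \<in> I \<Longrightarrow> (l \<odot>\<^bsub>L0_power M I\<^esub> v) i = l \<otimes>\<^bsub>L0 M\<^esub> v i"
  "i \<in> I \<Longrightarrow> \<zero>\<^bsub>L0_power M I\<^esub> i = \<zero>\<^bsub>L0 M\<^esub>"
  by (simp_all add: L0_power_def)

context prob_space
begin

lemma L0_module_L0_power: "L0_module M (L0_power M I)"
proof -
  interpret R: cring "L0 M" by (rule cring_L0)
  have "module (L0 M) (L0_power M I)"
  proof (rule moduleI[OF cring_L0])
    show "abelian_group (L0_power M I)"
    proof (rule abelian_groupI)
      fix x assume x: "x \<in> carrier (L0_power M I)"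
      show "\<exists>y\<in>carrier (L0_power M I). y \<oplus>\<^bsub>L0_power M I\<^esub> x = \<zero>\<^bsub>L0_power M I\<^esub>"
      proof
        show "(\<lambda>i\<in>I. \<ominus>\<^bsub>L0 M\<^esub> x i) \<in> carrier (L0_power M I)" using x by auto
        show "(\<lambda>i\<in>I. \<ominus>\<^bsub>L0 M\<^esub> x i) \<oplus>\<^bsub>L0_power M I\<^esub> x = \<zero>\<^bsub>L0_power M I\<^esub>"
        proof
          fix i
          have "x i \<in> carrier (L0 M)" if "i \<in> I" using x that by auto
          then show "((\<lambda>i\<in>I. \<ominus>\<^bsub>L0 M\<^esub> x i) \<oplus>\<^bsub>L0_power M I\<^esub> x) i = \<zero>\<^bsub>L0_power M I\<^esub> i"
            by (simp add: L0_power_def R.l_neg)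
        qed
      qed
    next
      fix x y z assume x: "x \<in> carrier (L0_power M I)" and y: "y \<in> carrier (L0_power M I)" and z: "z \<in> carrier (L0_power M I)"
      have L: "x i \<in> carrier (L0 M)" "y i \<in> carrier (L0 M)" "z i \<in> carrier (L0 M)" if "i \<in> I" for i
        using x y z that by auto
      show "x \<oplus>\<^bsub>L0_power M I\<^esub> y \<in> carrier (L0_power M I)" using L by (auto simp: L0_power_def)
      show "x \<oplus>\<^bsub>L0_power M I\<^esub> y \<oplus>\<^bsub>L0_power M I\<^esub> z = x \<oplus>\<^bsub>L0_power M I\<^esub> (y \<oplus>\<^bsub>L0_power M I\<^esub> z)"
        by (rule ext) (simp add: L0_power_def L R.a_assoc)
      show "x \<oplus>\<^bsub>L0_power M I\<^esub> y = y \<oplus>\<^bsub>L0_power M I\<^esub> x"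
        by (rule ext) (simp add: L0_power_def L R.a_comm)
      show "\<zero>\<^bsub>L0_power M I\<^esub> \<oplus>\<^bsub>L0_power M I\<^esub> x = x"
        using PiE_restrict[of x I "\<lambda>_. carrier (L0 M)"] x
        by (simp add: L0_power_def L R.l_zero cong: restrict_cong)
    qed (simp add: L0_power_def)
    fix a x assume a: "a \<in> carrier (L0 M)" and x: "x \<in> carrier (L0_power M I)"
    have xL: "x i \<in> carrier (L0 M)" if "i \<in> I" for i using x that by auto
    show "a \<odot>\<^bsub>L0_power M I\<^esub> x \<in> carrier (L0_power M I)" using a xL by (auto simp: L0_power_def)
    show "a \<odot>\<^bsub>L0_power M I\<^esub> (x \<oplus>\<^bsub>L0_power M I\<^esub> y) = a \<odot>\<^bsub>L0_power M I\<^esub> x \<oplus>\<^bsub>L0_power M I\<^esub> a \<odot>\<^bsub>L0_power M I\<^esub> y"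
      if y: "y \<in> carrier (L0_power M I)" for y
    proof
      fix i
      have "y i \<in> carrier (L0 M)" if "i \<in> I" using y that by auto
      then show "(a \<odot>\<^bsub>L0_power M I\<^esub> (x \<oplus>\<^bsub>L0_power M I\<^esub> y)) i = (a \<odot>\<^bsub>L0_power M I\<^esub> x \<oplus>\<^bsub>L0_power M I\<^esub> a \<odot>\<^bsub>L0_power M I\<^esub> y) i"
        using a xL by (simp add: L0_power_def R.r_distr)
    qed
    fix b assume b: "b \<in> carrier (L0 M)"
    show "(a \<oplus>\<^bsub>L0 M\<^esub> b) \<odot>\<^bsub>L0_power M I\<^esub> x = a \<odot>\<^bsub>L0_power M I\<^esub> x \<oplus>\<^bsub>L0_power M I\<^esub> b \<odot>\<^bsub>L0_power M I\<^esub> x"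
      by (rule ext) (simp add: L0_power_def xL a b R.l_distr)
    show "(a \<otimes>\<^bsub>L0 M\<^esub> b) \<odot>\<^bsub>L0_power M I\<^esub> x = a \<odot>\<^bsub>L0_power M I\<^esub> (b \<odot>\<^bsub>L0_power M I\<^esub> x)"
      by (rule ext) (simp add: L0_power_def xL a b R.m_assoc)
  next
    fix x assume x: "x \<in> carrier (L0_power M I)"
    have "x i \<in> carrier (L0 M)" if "i \<in> I" for i using x that by auto
    then show "\<one>\<^bsub>L0 M\<^esub> \<odot>\<^bsub>L0_power M I\<^esub> x = x"
      using PiE_restrict[of x I "\<lambda>_. carrier (L0 M)"] x
      by (simp add: L0_power_def cong: restrict_cong)
  qed
  then show ?thesis by (intro L0_module.intro prob_space_axioms)
qed

lemma L0_linear_projection: "i \<in> I \<Longrightarrow> L0_linear M (L0_power M I) (\<lambda>v. v i)"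
  by (auto simp: L0_linear_def L0_power_apply)

text \<open>The coefficients are the values at the unit vectors. The induction runs over the index
  set \<open>J\<close> outside which the vector is replaced by 0.\<close>

lemma L0_linear_power_coordinates:
  assumes I: "finite I" and \<phi>: "L0_linear M (L0_power M I) \<phi>"
  obtains c where "\<And>i. i \<in> I \<Longrightarrow> c i \<in> carrier (L0 M)"
    "\<And>v. v \<in> carrier (L0_power M I) \<Longrightarrow> AE \<omega> in M. val (\<phi> v) \<omega> = (\<Sum>i\<in>I. val (c i) \<omega> * val (v i) \<omega>)"
proof -
  interpret W: L0_module M "L0_power M I" by (rule L0_module_L0_power)
  define e where "e j = (\<lambda>i\<in>I. if i = j then \<one>\<^bsub>L0 M\<^esub> else \<zero>\<^bsub>L0 M\<^esub>)" for j
  have e: "e j \<in> carrier (L0_power M I)" for j by (auto simp: e_def)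
  have \<phi>L: "\<phi> v \<in> carrier (L0 M)" if "v \<in> carrier (L0_power M I)" for v
    using \<phi> that by (auto simp: L0_linear_def)
  have part: "AE \<omega> in M. val (\<phi> (\<lambda>i\<in>I. if i \<in> J then v i else \<zero>\<^bsub>L0 M\<^esub>)) \<omega> = (\<Sum>i\<in>J. val (\<phi> (e i)) \<omega> * val (v i) \<omega>)"
    if v: "v \<in> carrier (L0_power M I)" and J: "J \<subseteq> I" for v J
    using finite_subset[OF J I] J
  proof (induction J rule: finite_induct)
    case empty
    have "(\<lambda>i\<in>I. if i \<in> {} then v i else \<zero>\<^bsub>L0 M\<^esub>) = \<zero>\<^bsub>L0_power M I\<^esub>" by (simp add: L0_power_def)
    then show ?case using W.L0_linear_zero[OF \<phi>] val_zero[of M] by simp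
  next
    case (insert j J)
    let ?w = "\<lambda>J. \<lambda>i\<in>I. if i \<in> J then v i else \<zero>\<^bsub>L0 M\<^esub>"
    have vj: "v j \<in> carrier (L0 M)" using v insert.prems by auto
    have w: "?w J \<in> carrier (L0_power M I)" using v by auto
    have ve: "v j \<odot>\<^bsub>L0_power M I\<^esub> e j \<in> carrier (L0_power M I)" using vj e[of j] by (rule W.smult_closed)
    have "?w (insert j J) i = (?w J \<oplus>\<^bsub>L0_power M I\<^esub> v j \<odot>\<^bsub>L0_power M I\<^esub> e j) i" for i
    proof (cases "i \<in> I")
      case True
      with v have "v i \<in> carrier (L0 M)" by auto
      with True vj insert.hyps show ?thesis by (auto simp: L0_power_apply e_def)
    next
      case False
      then show ?thesis by (simp add: L0_power_def)
    qed
    then have "?w (insert j J) = ?w J \<oplus>\<^bsub>L0_power M I\<^esub> v j \<odot>\<^bsub>L0_power M I\<^esub> e j" by blast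
    moreover have "AE \<omega> in M. val (\<phi> (?w J)) \<omega> = (\<Sum>i\<in>J. val (\<phi> (e i)) \<omega> * val (v i) \<omega>)"
      using insert.prems by (intro insert.IH) simp
    with W.L0_linear_add_val[OF \<phi> w ve] W.L0_linear_smult_val[OF \<phi> vj e[of j]]
    have "AE \<omega> in M. val (\<phi> (?w J \<oplus>\<^bsub>L0_power M I\<^esub> v j \<odot>\<^bsub>L0_power M I\<^esub> e j)) \<omega> =
        (\<Sum>i\<in>insert j J. val (\<phi> (e i)) \<omega> * val (v i) \<omega>)"
      by eventually_elim (use insert.hyps in \<open>simp add: mult.commute\<close>)
    ultimately show ?case by simp
  qed
  show ?thesis
  proof
    show "\<phi> (e i) \<in> carrier (L0 M)" for i by (rule \<phi>L[OF e])
    fix v assume v: "v \<in> carrier (L0_power M I)"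
    then have "(\<lambda>i\<in>I. if i \<in> I then v i else \<zero>\<^bsub>L0 M\<^esub>) = v"
      using PiE_restrict[of v I "\<lambda>_. carrier (L0 M)"] by (simp cong: restrict_cong)
    with part[OF v order_refl] show "AE \<omega> in M. val (\<phi> v) \<omega> = (\<Sum>i\<in>I. val (\<phi> (e i)) \<omega> * val (v i) \<omega>)" by simp
  qed
qed

end

text \<open>The way back from coordinates to the module: a combination of evaluations at points of
  \<open>F\<close> is the evaluation at one point \<open>z\<close>, for all linear functionals
  simultaneously.\<close>

lemma (in L0_module) L0_linear_combination:
  assumes "finite F" "F \<subseteq> carrier V" "\<And>x. x \<in> F \<Longrightarrow> c x \<in> carrier (L0 M)"
  obtains z where "z \<in> carrier V"
    "\<And>g. L0_linear M V g \<Longrightarrow> AE \<omega> in M. val (g z) \<omega> = (\<Sum>x\<in>F. val (c x) \<omega> * val (g x) \<omega>)"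
proof -
  have "\<exists>z\<in>carrier V. \<forall>g. L0_linear M V g \<longrightarrow> (AE \<omega> in M. val (g z) \<omega> = (\<Sum>x\<in>F. val (c x) \<omega> * val (g x) \<omega>))"
    using assms
  proof (induction F rule: finite_induct)
    case empty
    show ?case using L0_linear_zero val_zero[of M] by (intro bexI[of _ "\<zero>\<^bsub>V\<^esub>"]) auto
  next
    case (insert y F)
    then obtain z where z: "z \<in> carrier V"
      "\<And>g. L0_linear M V g \<Longrightarrow> AE \<omega> in M. val (g z) \<omega> = (\<Sum>x\<in>F. val (c x) \<omega> * val (g x) \<omega>)" by auto
    have y: "y \<in> carrier V" "c y \<in> carrier (L0 M)" using insert.prems by auto
    have cy: "c y \<odot>\<^bsub>V\<^esub> y \<in> carrier V" using y by simp
    show ?case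
    proof (intro bexI[of _ "z \<oplus>\<^bsub>V\<^esub> c y \<odot>\<^bsub>V\<^esub> y"] allI impI)
      fix g assume g: "L0_linear M V g"
      from z(2)[OF g] L0_linear_add_val[OF g z(1) cy] L0_linear_smult_val[OF g y(2,1)]
      show "AE \<omega> in M. val (g (z \<oplus>\<^bsub>V\<^esub> c y \<odot>\<^bsub>V\<^esub> y)) \<omega> = (\<Sum>x\<in>insert y F. val (c x) \<omega> * val (g x) \<omega>)"
        by eventually_elim (use insert.hyps in simp)
    qed (use z y in auto)
  qed
  then show ?thesis using that by blast
qed

text \<open>The box replaces a neighbourhood in the weak topology: closeness at finitely many points
  means that the difference of the coordinate vectors lies in it.\<close>

lemma (in prob_space) L0_power_box:
  assumes I: "finite I" and \<epsilon>: "\<epsilon> \<in> L0_pos M"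
  defines "U \<equiv> {w \<in> carrier (L0_power M I). \<forall>i\<in>I. AE \<omega> in M. \<bar>val (w i) \<omega>\<bar> \<le> val \<epsilon> \<omega>}"
  shows "L0_convex M (L0_power M I) U" "L0_absorbent M (L0_power M I) U" "\<zero>\<^bsub>L0_power M I\<^esub> \<in> U"
proof -
  interpret W: L0_module M "L0_power M I" by (rule L0_module_L0_power)
  have \<epsilon>L: "\<epsilon> \<in> carrier (L0 M)" using \<epsilon> by (rule L0_pos_L0)
  show "L0_convex M (L0_power M I) U"
    unfolding L0_convex_def
  proof (intro conjI ballI)
    show "U \<subseteq> carrier (L0_power M I)" by (auto simp: U_def)
    fix v w l assume v: "v \<in> U" and w: "w \<in> U" and l: "l \<in> L0_unit_interval M"
    have lL: "l \<in> carrier (L0 M)" and l01: "AE \<omega> in M. 0 \<le> val l \<omega> \<and> val l \<omega> \<le> 1"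
      using l by (auto simp: L0_unit_interval_iff)
    have vw: "v \<in> carrier (L0_power M I)" "w \<in> carrier (L0_power M I)" using v w by (auto simp: U_def)
    have "AE \<omega> in M. \<bar>val (mod_comb M (L0_power M I) l v w i) \<omega>\<bar> \<le> val \<epsilon> \<omega>" if i: "i \<in> I" for i
    proof -
      have "AE \<omega> in M. \<bar>val (v i) \<omega>\<bar> \<le> val \<epsilon> \<omega>" "AE \<omega> in M. \<bar>val (w i) \<omega>\<bar> \<le> val \<epsilon> \<omega>"
        using v w i by (auto simp: U_def)
      with W.L0_linear_comb_val[OF L0_linear_projection[OF i] lL vw] l01
      show ?thesis
      proof eventually_elim
        case (elim \<omega>)
        have "\<bar>val l \<omega> * val (v i) \<omega> + (1 - val l \<omega>) * val (w i) \<omega>\<bar>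
            \<le> val l \<omega> * \<bar>val (v i) \<omega>\<bar> + (1 - val l \<omega>) * \<bar>val (w i) \<omega>\<bar>"
          using elim by (intro order_trans[OF abs_triangle_ineq]) (simp add: abs_mult)
        also have "\<dots> \<le> val l \<omega> * val \<epsilon> \<omega> + (1 - val l \<omega>) * val \<epsilon> \<omega>"
          using elim by (intro add_mono mult_left_mono) auto
        also have "\<dots> = val \<epsilon> \<omega>" by (simp add: algebra_simps)
        finally show ?case using elim by simp
      qed
    qed
    then show "mod_comb M (L0_power M I) l v w \<in> U"
      unfolding U_def using W.mod_comb_closed[OF lL vw] by blast
  qed
  show "L0_absorbent M (L0_power M I) U"
    unfolding L0_absorbent_def
  proof
    fix w assume w: "w \<in> carrier (L0_power M I)"
    then have wL: "w i \<in> carrier (L0 M)" if "i \<in> I" for i using that by auto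
    let ?S = "\<lambda>\<omega>. \<Sum>i\<in>I. \<bar>val (w i) \<omega>\<bar>"
    have Sm: "?S \<in> borel_measurable M" using wL by (intro borel_measurable_sum borel_measurable_abs) simp
    \<comment> \<open>The sum of the absolute coordinates over \<epsilon> would scale
      \<open>w\<close> into the box; the added 1 keeps the factor positive where \<open>w\<close>
      vanishes.\<close>
    let ?l = "\<lambda>\<omega>. 1 + ?S \<omega> / val \<epsilon> \<omega>" and ?k = "\<lambda>\<omega>. 1 / (1 + ?S \<omega> / val \<epsilon> \<omega>)"
    have lm: "?l \<in> borel_measurable M" "?k \<in> borel_measurable M" using Sm \<epsilon>L by auto
    have pos: "AE \<omega> in M. 1 \<le> ?l \<omega>" using L0_pos_val[OF \<epsilon>] by eventually_elim (simp add: sum_nonneg)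
    then have "AE \<omega> in M. 0 < ?l \<omega>" by eventually_elim simp
    then have l: "rvar M ?l \<in> L0_pos M" by (rule rvar_pos[OF lm(1)])
    have lk: "rvar M ?l \<in> carrier (L0 M)" "rvar M ?k \<in> carrier (L0 M)" using lm by auto
    let ?u = "rvar M ?k \<odot>\<^bsub>L0_power M I\<^esub> w"
    have "rvar M ?l \<otimes>\<^bsub>L0 M\<^esub> rvar M ?k = \<one>\<^bsub>L0 M\<^esub>"
      unfolding rvar_mult[OF lm] one_rvar
    proof (rule rvar_cong)
      from pos show "AE \<omega> in M. ?l \<omega> * ?k \<omega> = 1" by eventually_elim simp
    qed (use lm in auto)
    then have "w = rvar M ?l \<odot>\<^bsub>L0_power M I\<^esub> ?u"
      using lk w W.smult_one[OF w] by (simp add: W.smult_assoc1[symmetric])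
    moreover have "?u \<in> U"
      unfolding U_def
    proof (intro CollectI conjI ballI)
      show "?u \<in> carrier (L0_power M I)" using lk w by (intro W.smult_closed)
      fix i assume i: "i \<in> I"
      from W.L0_linear_smult_val[OF L0_linear_projection[OF i] lk(2) w] val_rvar[OF lm(2)] L0_pos_val[OF \<epsilon>] pos
      show "AE \<omega> in M. \<bar>val (?u i) \<omega>\<bar> \<le> val \<epsilon> \<omega>"
      proof eventually_elim
        case (elim \<omega>)
        have "\<bar>val (w i) \<omega>\<bar> \<le> ?S \<omega>" using i I by (intro member_le_sum) auto
        also have "\<dots> \<le> val \<epsilon> \<omega> * ?l \<omega>" using elim by (simp add: distrib_left)
        finally have "\<bar>val (w i) \<omega>\<bar> / ?l \<omega> \<le> val \<epsilon> \<omega>"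
          by (subst pos_divide_le_eq) (use elim(4) in linarith)
        then show ?case using elim by (simp add: abs_mult)
      qed
    qed
    ultimately show "\<exists>l\<in>L0_pos M. \<exists>u\<in>U. w = l \<odot>\<^bsub>L0_power M I\<^esub> u" using l by blast
  qed
  show "\<zero>\<^bsub>L0_power M I\<^esub> \<in> U"
    unfolding U_def
  proof (intro CollectI conjI ballI W.M.zero_closed)
    fix i assume "i \<in> I"
    then show "AE \<omega> in M. \<bar>val (\<zero>\<^bsub>L0_power M I\<^esub> i) \<omega>\<bar> \<le> val \<epsilon> \<omega>"
      using val_zero[of M] L0_pos_val[OF \<epsilon>] by (auto simp: L0_power_apply)
  qed
qed

section \<open>Uniqueness\<close>

context sigma_stable_module
begin

context
  fixes K R
  assumes min: "minimal_risk_function M V T K R" and K: "K \<subseteq> carrier V"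
begin

lemma minimal_risk_functionD:
  shows "risk_function M V T K R"
    "f \<in> polar M V T K \<Longrightarrow> g \<in> polar M V T K \<Longrightarrow> s \<in> carrier (barL0 M) \<Longrightarrow> t \<in> carrier (barL0 M) \<Longrightarrow>
      l \<in> L0_unit_interval M \<Longrightarrow>
      R (mod_comb M dual l f g) (rv_comb M l s t) \<sqsubseteq>\<^bsub>barL0 M\<^esub> R f s \<squnion>\<^bsub>barL0 M\<^esub> R g t"
    "f \<in> polar M V T K \<Longrightarrow> s \<in> carrier (barL0 M) \<Longrightarrow> l \<in> L0_pos M \<Longrightarrow>
      R (l \<odot>\<^bsub>dual\<^esub> f) s = R f (lift2 M (/) s l)"
    "f \<in> polar M V T K \<Longrightarrow> g \<in> polar M V T K \<Longrightarrow>
      \<Squnion>\<^bsub>barL0 M\<^esub> (R f ` carrier (L0 M)) = \<Squnion>\<^bsub>barL0 M\<^esub> (R g ` carrier (L0 M))"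
    "m \<in> carrier (barL0 M) \<Longrightarrow>
      closedin (prod_topology (subtopology (weak_dual_topology M V T) (polar M V T K)) (L0_topology M))
        {(f, s). f \<in> polar M V T K \<and> s \<in> carrier (L0 M) \<and> left_version M (R f) s \<sqsubseteq>\<^bsub>barL0 M\<^esub> m}"
  using min unfolding minimal_risk_function_def by blast+

lemmas risk = risk_functionD[OF minimal_risk_functionD(1)]

text \<open>Gluing \<open>f\<close> onto \<open>g\<close> along \<open>A\<close> gives back
  \<open>g\<close>, so joint locality compares the two values on \<open>A\<close>.\<close>

lemma risk_eq_on:
  assumes f: "f \<in> polar M V T K" and g: "g \<in> polar M V T K" and s: "s \<in> carrier (barL0 M)"
    and A: "A \<in> sets M" and fg: "\<And>x. x \<in> carrier V \<Longrightarrow> AE \<omega>\<in>A in M. val (f x) \<omega> = val (g x) \<omega>"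
  shows "AE \<omega>\<in>A in M. rep (R f s) \<omega> = rep (R g s) \<omega>"
proof -
  note D = polar_dual[OF f] polar_dual[OF g]
  have "mod_glue M dual A f g = g"
  proof (rule dual_ext[OF dual_glue_closed[OF A D] D(2)])
    fix x assume x: "x \<in> carrier V"
    show "mod_glue M dual A f g x = g x"
    proof (rule L0_eqI[where M=M])
      from val_dual_glue[OF A D x] fg[OF x] show "AE \<omega> in M. val (mod_glue M dual A f g x) \<omega> = val (g x) \<omega>"
        by eventually_elim auto
    qed (use x D dual_glue_closed[OF A D] in auto)
  qed
  moreover have "rv_glue M A s s = s" using s by (intro rv_glue_eqI[OF A]) auto
  moreover have "R (mod_glue M dual A f g) (rv_glue M A s s) = rv_glue M A (R f s) (R g s)"
    using minimal_risk_functionD(1) A f g s unfolding risk_function_def by blast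
  ultimately have "R g s = rv_glue M A (R f s) (R g s)" by simp
  with rep_rv_glue[OF A risk(3)[OF f s] risk(3)[OF g s]]
  have "AE \<omega> in M. rep (R g s) \<omega> = (if \<omega> \<in> A then rep (R f s) \<omega> else rep (R g s) \<omega>)" by simp
  then show ?thesis by eventually_elim (auto split: if_splits)
qed

lemma left_carrier:
  assumes "f \<in> polar M V T K" "s \<in> carrier (barL0 M)"
  shows "left_version M (R f) s \<in> carrier (barL0 M)"
  using risk(1)[OF assms(1)] assms(2) by (intro left_version_carrier) (auto simp: rv_local_def)

lemma left_measurable [measurable (raw)]:
  "f \<in> polar M V T K \<Longrightarrow> s \<in> carrier (L0 M) \<Longrightarrow> rep (left_version M (R f) s) \<in> borel_measurable M"
  using left_carrier[OF _ L0_barL0] by simp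

text \<open>Serves two purposes below: to splice pairs of functionals and arguments along events,
  and to lower the argument for a fixed functional.\<close>

lemma left_mono_on:
  assumes f: "f \<in> polar M V T K" and g: "g \<in> polar M V T K" and s: "s \<in> carrier (L0 M)" and t: "t \<in> carrier (L0 M)"
    and A[measurable]: "A \<in> sets M" and fg: "\<And>x. x \<in> carrier V \<Longrightarrow> AE \<omega>\<in>A in M. val (f x) \<omega> = val (g x) \<omega>"
    and st: "AE \<omega>\<in>A in M. val s \<omega> \<le> val t \<omega>"
  shows "AE \<omega>\<in>A in M. rep (left_version M (R f) s) \<omega> \<le> rep (left_version M (R g) t) \<omega>"
proof (rule left_version_least[OF risk(1,2)[OF f] L0_barL0[OF s] left_measurable[OF g t]])
  fix n assume n: "n \<in> carrier (L0 M)"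
  note nE = L0_barL0[OF n]
  have "AE \<omega>\<in>A in M. rep (R f n) \<omega> = rep (R g n) \<omega>" by (rule risk_eq_on[OF f g nE A fg])
  with left_version_ge[OF risk(1)[OF g] L0_barL0[OF t] nE] st
    rep_val[OF n] rep_val[OF s] rep_val[OF t]
  show "AE \<omega> in M. \<omega> \<in> A \<and> ereal (val n \<omega>) < rep s \<omega> \<longrightarrow> rep (R f n) \<omega> \<le> rep (left_version M (R g) t) \<omega>"
    by eventually_elim auto
qed measurable

text \<open>Given \<open>n\<close> below the combined argument, both \<open>s\<close> and
  \<open>t\<close> are shifted down by the same distance. The combination of the shifted arguments
  is then exactly \<open>n\<close>, so quasiconvexity of \<open>R\<close> applies, and where the
  shift is positive the two values are bounded by the left versions at \<open>s\<close> and
  \<open>t\<close>.\<close>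

lemma left_comb:
  assumes f: "f \<in> polar M V T K" and g: "g \<in> polar M V T K" and s: "s \<in> carrier (L0 M)" and t: "t \<in> carrier (L0 M)"
    and l: "l \<in> L0_unit_interval M"
  shows "AE \<omega> in M. rep (left_version M (R (mod_comb M dual l f g)) (rv_comb M l s t)) \<omega>
    \<le> max (rep (left_version M (R f) s) \<omega>) (rep (left_version M (R g) t) \<omega>)"
proof -
  have lL: "l \<in> carrier (L0 M)" using l by (rule L0_unit_interval_L0)
  let ?h = "mod_comb M dual l f g" and ?u = "rv_comb M l s t"
  have h: "?h \<in> polar M V T K" by (rule polar_comb[OF K l f g])
  have u: "?u \<in> carrier (L0 M)" using lL s t one_minus(1)[OF lL] by (simp add: rv_comb_def)
  have [measurable]: "rep (left_version M (R f) s) \<in> borel_measurable M" "rep (left_version M (R g) t) \<in> borel_measurable M"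
    using left_measurable f g s t by auto
  have "AE \<omega> in M. True \<longrightarrow> rep (left_version M (R ?h) ?u) \<omega>
      \<le> max (rep (left_version M (R f) s) \<omega>) (rep (left_version M (R g) t) \<omega>)"
  proof (rule left_version_least[OF risk(1,2)[OF h] L0_barL0[OF u]])
    fix n assume n: "n \<in> carrier (L0 M)"
    have [measurable]: "val s \<in> borel_measurable M" "val t \<in> borel_measurable M" "val ?u \<in> borel_measurable M"
      "val n \<in> borel_measurable M" using s t u n by auto
    have m: "(\<lambda>\<omega>. val s \<omega> - (val ?u \<omega> - val n \<omega>)) \<in> borel_measurable M"
      "(\<lambda>\<omega>. val t \<omega> - (val ?u \<omega> - val n \<omega>)) \<in> borel_measurable M" by measurable
    let ?s = "rvar M (\<lambda>\<omega>. val s \<omega> - (val ?u \<omega> - val n \<omega>))" and ?t = "rvar M (\<lambda>\<omega>. val t \<omega> - (val ?u \<omega> - val n \<omega>))"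
    have st': "?s \<in> carrier (barL0 M)" "?t \<in> carrier (barL0 M)" using m by (auto intro: L0_barL0)
    have "AE \<omega> in M. rep (rv_comb M l ?s ?t) \<omega> = rep n \<omega>"
      using rep_rv_comb[OF lL st'] rep_rvar[OF m(1)] rep_rvar[OF m(2)] rep_val[OF n]
        rep_rv_comb[OF lL s[THEN L0_barL0] t[THEN L0_barL0]] rep_val[OF s] rep_val[OF t] rep_val[OF u]
      by eventually_elim (simp add: algebra_simps)
    then have "rv_comb M l ?s ?t = n" by (rule barL0_eqI[OF rv_comb_carrier[OF lL st'] L0_barL0[OF n]])
    with minimal_risk_functionD(2)[OF f g st' l]
    have "AE \<omega> in M. rep (R ?h n) \<omega> \<le> rep (R f ?s \<squnion>\<^bsub>barL0 M\<^esub> R g ?t) \<omega>" by simp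
    with rep_join[OF risk(3)[OF f st'(1)] risk(3)[OF g st'(2)]] rep_rvar[OF m(1)] rep_rvar[OF m(2)]
      left_version_ge[OF risk(1)[OF f] L0_barL0[OF s] st'(1)] left_version_ge[OF risk(1)[OF g] L0_barL0[OF t] st'(2)]
      rep_val[OF n] rep_val[OF s] rep_val[OF t] rep_val[OF u]
    show "AE \<omega> in M. True \<and> ereal (val n \<omega>) < rep ?u \<omega> \<longrightarrow>
        rep (R ?h n) \<omega> \<le> max (rep (left_version M (R f) s) \<omega>) (rep (left_version M (R g) t) \<omega>)"
    proof eventually_elim
      case (elim \<omega>)
      show ?case
      proof
        assume "True \<and> ereal (val n \<omega>) < rep ?u \<omega>"
        with elim have "rep (R f ?s) \<omega> \<le> rep (left_version M (R f) s) \<omega>" "rep (R g ?t) \<omega> \<le> rep (left_version M (R g) t) \<omega>"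
          by auto
        then have "max (rep (R f ?s) \<omega>) (rep (R g ?t) \<omega>) \<le> max (rep (left_version M (R f) s) \<omega>) (rep (left_version M (R g) t) \<omega>)"
          by (rule max.mono)
        moreover have "rep (R ?h n) \<omega> \<le> max (rep (R f ?s) \<omega>) (rep (R g ?t) \<omega>)" using elim by simp
        ultimately show "rep (R ?h n) \<omega> \<le> max (rep (left_version M (R f) s) \<omega>) (rep (left_version M (R g) t) \<omega>)"
          by (rule order_trans[rotated])
      qed
    qed
  qed measurable
  then show ?thesis by simp
qed

text \<open>An \<open>n\<close> below \<open>l s\<close> corresponds to \<open>n / l\<close> below
  \<open>s\<close>. This makes sublevel sets of the left version stable under positive scalars, so
  that they are cones.\<close>

lemma left_scale:
  assumes f: "f \<in> polar M V T K" and s: "s \<in> carrier (L0 M)" and l: "l \<in> L0_pos M"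
  shows "AE \<omega> in M. rep (left_version M (R (l \<odot>\<^bsub>dual\<^esub> f)) (l \<otimes>\<^bsub>L0 M\<^esub> s)) \<omega> \<le> rep (left_version M (R f) s) \<omega>"
proof -
  have lL: "l \<in> carrier (L0 M)" using l by (rule L0_pos_L0)
  have l0: "AE \<omega> in M. 0 \<le> val l \<omega>" using L0_pos_val[OF l] by eventually_elim simp
  have h: "l \<odot>\<^bsub>dual\<^esub> f \<in> polar M V T K" by (rule polar_smult[OF K lL l0 f])
  have ls: "l \<otimes>\<^bsub>L0 M\<^esub> s \<in> carrier (L0 M)" using lL s by simp
  have "AE \<omega> in M. True \<longrightarrow> rep (left_version M (R (l \<odot>\<^bsub>dual\<^esub> f)) (l \<otimes>\<^bsub>L0 M\<^esub> s)) \<omega> \<le> rep (left_version M (R f) s) \<omega>"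
  proof (rule left_version_least[OF risk(1,2)[OF h] L0_barL0[OF ls] left_measurable[OF f s]])
    fix n assume n: "n \<in> carrier (L0 M)"
    note nE = L0_barL0[OF n]
    note d = rep_divide[OF nE lL]
    from minimal_risk_functionD(3)[OF f nE l] left_version_ge[OF risk(1)[OF f] L0_barL0[OF s] d(1)]
    have "AE \<omega> in M. rep (lift2 M (/) n l) \<omega> < rep s \<omega> \<longrightarrow> rep (R (l \<odot>\<^bsub>dual\<^esub> f) n) \<omega> \<le> rep (left_version M (R f) s) \<omega>"
      by simp
    with d(2) rep_val[OF n] rep_val[OF s] rep_val[OF ls] val_mult[OF lL s] L0_pos_val[OF l]
    show "AE \<omega> in M. True \<and> ereal (val n \<omega>) < rep (l \<otimes>\<^bsub>L0 M\<^esub> s) \<omega> \<longrightarrow>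
        rep (R (l \<odot>\<^bsub>dual\<^esub> f) n) \<omega> \<le> rep (left_version M (R f) s) \<omega>"
      by eventually_elim (auto simp: divide_less_eq mult.commute)
  qed measurable
  then show ?thesis by simp
qed

text \<open>The exhaustion argument of \<open>index_separation\<close>, now for pairs. The set
  \<open>N\<close> of pairs with left version at most \<open>q\<close> on \<open>B\<close> is closed
  and convex, and a neighbourhood of \<open>(f0, s0)\<close> that avoids it is described by finitely
  many points \<open>F\<close> and a radius. The coordinates at \<open>F\<close>, together with the
  argument, embed the situation into a finite power, where the box plays the role of
  \<open>U\<close>. Since \<open>N\<close> is a cone, the separating level can be taken to be 0. The
  pair \<open>(g0, t0)\<close> makes \<open>N\<close> nonempty and fills in wherever a piece is
  missing.\<close>

lemma dual_separation:
  assumes B: "B \<in> sets M" "\<not> (AE \<omega> in M. \<omega> \<notin> B)"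
    and f0: "f0 \<in> polar M V T K" and s0: "s0 \<in> carrier (L0 M)"
    and gt: "AE \<omega>\<in>B in M. ereal q < rep (left_version M (R f0) s0) \<omega>"
    and g0: "g0 \<in> polar M V T K" and t0: "t0 \<in> carrier (L0 M)"
    and le: "AE \<omega>\<in>B in M. rep (left_version M (R g0) t0) \<omega> \<le> ereal q"
  obtains C z r where "C \<in> sets M" "C \<subseteq> B" "\<not> (AE \<omega> in M. \<omega> \<notin> C)" "z \<in> carrier V" "r \<in> carrier (L0 M)"
    "AE \<omega>\<in>C in M. val (f0 z) \<omega> + val r \<omega> * val s0 \<omega> < 0"
    "\<And>g t. g \<in> polar M V T K \<Longrightarrow> t \<in> carrier (L0 M) \<Longrightarrow>
      AE \<omega> in M. \<omega> \<in> C \<and> rep (left_version M (R g) t) \<omega> \<le> ereal q \<longrightarrow> 0 \<le> val (g z) \<omega> + val r \<omega> * val t \<omega>"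
proof -
  let ?L = "\<lambda>g t. left_version M (R g) t"
  have [measurable]: "B \<in> sets M" by (rule B(1))
  define N where "N = {(g, t). g \<in> polar M V T K \<and> t \<in> carrier (L0 M) \<and>
    (AE \<omega>\<in>B in M. rep (?L g t) \<omega> \<le> ereal q)}"
  let ?X = "prod_topology (subtopology (weak_dual_topology M V T) (polar M V T K)) (L0_topology M)"
  have N_closed: "closedin ?X N"
  proof -
    \<comment> \<open>The level is \<open>q\<close> on \<open>B\<close> and infinity elsewhere, so
      that the closedness hypothesis covers \<open>N\<close>.\<close>
    let ?m = "rv_glue M B (cls M (\<lambda>_. ereal q)) (cls M (\<lambda>_. \<infinity>))"
    have m: "?m \<in> carrier (barL0 M)" using B by auto
    have q: "AE \<omega> in M. rep (cls M (\<lambda>_. ereal q)) \<omega> = ereal q" "AE \<omega> in M. rep (cls M (\<lambda>_. \<infinity>)) \<omega> = \<infinity>"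
      by (rule rep_cls, simp)+
    have "AE \<omega> in M. rep ?m \<omega> = (if \<omega> \<in> B then rep (cls M (\<lambda>_. ereal q)) \<omega> else rep (cls M (\<lambda>_. \<infinity>)) \<omega>)"
      using B by (intro rep_rv_glue) auto
    with q have vm: "AE \<omega> in M. rep ?m \<omega> = (if \<omega> \<in> B then ereal q else \<infinity>)" by eventually_elim simp
    have "y \<sqsubseteq>\<^bsub>barL0 M\<^esub> ?m \<longleftrightarrow> (AE \<omega>\<in>B in M. rep y \<omega> \<le> ereal q)" for y
      unfolding le_barL0
    proof (rule eventually_subst)
      from vm show "AE \<omega> in M. (rep y \<omega> \<le> rep ?m \<omega>) = (\<omega> \<in> B \<longrightarrow> rep y \<omega> \<le> ereal q)"
        by eventually_elim simp
    qed
    then show ?thesis using minimal_risk_functionD(5)[OF m] unfolding N_def by simp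
  qed
  have "(f0, s0) \<notin> N"
  proof
    assume "(f0, s0) \<in> N"
    then have "AE \<omega>\<in>B in M. rep (?L f0 s0) \<omega> \<le> ereal q" by (simp add: N_def)
    with gt have "AE \<omega> in M. \<omega> \<notin> B" by eventually_elim auto
    with B(2) show False by simp
  qed
  moreover have "topspace ?X = polar M V T K \<times> carrier (L0 M)"
    using polar_dual by (auto simp: topspace_weak_dual_topology)
  ultimately have mem: "(f0, s0) \<in> topspace ?X - N" using f0 s0 by simp
  have "openin ?X (topspace ?X - N)" using N_closed by (simp only: closedin_def)
  from this[unfolded openin_prod_topology_alt, rule_format, OF mem] obtain S S' where S: "openin (subtopology (weak_dual_topology M V T) (polar M V T K)) S"
    "openin (L0_topology M) S'" "f0 \<in> S" "s0 \<in> S'" "S \<times> S' \<subseteq> topspace ?X - N"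
    by (elim exE conjE) (rule that)
  obtain W where W: "openin (weak_dual_topology M V T) W" "S = W \<inter> polar M V T K"
    using S(1) by (auto simp: openin_subtopology)
  obtain F \<epsilon>1 where F: "finite F" "F \<subseteq> carrier V" "\<epsilon>1 \<in> L0_pos M"
    "{g \<in> carrier dual. \<forall>x\<in>F. g x \<in> L0_ball M \<epsilon>1 (f0 x)} \<subseteq> W"
    using W S(3) unfolding openin_weak_dual_topology by blast
  obtain \<epsilon>2 where \<epsilon>2: "\<epsilon>2 \<in> L0_pos M" "L0_ball M \<epsilon>2 s0 \<subseteq> S'" using S(2,4) unfolding openin_L0_topology by blast
  obtain \<epsilon> where \<epsilon>: "\<epsilon> \<in> L0_pos M" "AE \<omega> in M. val \<epsilon> \<omega> \<le> val \<epsilon>1 \<omega> \<and> val \<epsilon> \<omega> \<le> val \<epsilon>2 \<omega>"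
    using L0_min_pos[OF F(3) \<epsilon>2(1)] by auto
  have \<epsilon>L: "\<epsilon> \<in> carrier (L0 M)" using \<epsilon>(1) by (rule L0_pos_L0)
  note f0D = polar_dual[OF f0]
  \<comment> \<open>What remains of the topology: no pair in \<open>N\<close> is close to
    \<open>(f0, s0)\<close> at all points of \<open>F\<close> and in the argument.\<close>
  have far: False if g: "g \<in> polar M V T K" and t: "t \<in> carrier (L0 M)" and N: "(g, t) \<in> N"
    and gF: "\<And>x. x \<in> F \<Longrightarrow> AE \<omega> in M. \<bar>val (f0 x) \<omega> - val (g x) \<omega>\<bar> \<le> val \<epsilon> \<omega>"
    and ts: "AE \<omega> in M. \<bar>val s0 \<omega> - val t \<omega>\<bar> \<le> val \<epsilon> \<omega>" for g t
  proof -
    note gD = polar_dual[OF g]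
    have "g x \<in> L0_ball M \<epsilon>1 (f0 x)" if x: "x \<in> F" for x
    proof -
      have xV: "x \<in> carrier V" using x F by auto
      have "AE \<omega> in M. \<bar>val (f0 x) \<omega> - val (g x) \<omega>\<bar> \<le> val \<epsilon>1 \<omega>" using gF[OF x] \<epsilon>(2) by eventually_elim simp
      then show ?thesis
        using L0_ball_iff[OF L0_pos_L0[OF F(3)] dual_L0[OF f0D xV]] dual_L0[OF gD xV] by simp
    qed
    then have "g \<in> S" using F(4) gD g W(2) by auto
    moreover have "AE \<omega> in M. \<bar>val s0 \<omega> - val t \<omega>\<bar> \<le> val \<epsilon>2 \<omega>" using ts \<epsilon>(2) by eventually_elim simp
    then have "t \<in> S'" using L0_ball_iff[OF L0_pos_L0[OF \<epsilon>2(1)] s0] t \<epsilon>2(2) by auto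
    ultimately show False using S(5) N by blast
  qed
  \<comment> \<open>Membership in \<open>N\<close> is a condition point by point on
    \<open>B\<close>, so pairs can be spliced along an event if each satisfies the bound on its own
    part.\<close>
  have glue: "(mod_glue M dual D g g', rv_glue M D t t') \<in> N"
    if D: "D \<in> sets M" and g: "g \<in> polar M V T K" "t \<in> carrier (L0 M)" and g': "g' \<in> polar M V T K" "t' \<in> carrier (L0 M)"
      and 1: "AE \<omega> in M. \<omega> \<in> B \<and> \<omega> \<in> D \<longrightarrow> rep (?L g t) \<omega> \<le> ereal q"
      and 2: "AE \<omega> in M. \<omega> \<in> B \<and> \<omega> \<notin> D \<longrightarrow> rep (?L g' t') \<omega> \<le> ereal q" for D g t g' t'
  proof -
    let ?g = "mod_glue M dual D g g'" and ?t = "rv_glue M D t t'"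
    have gl: "?g \<in> polar M V T K" "?t \<in> carrier (L0 M)" using polar_glue[OF K D g(1) g'(1)] D g g' by auto
    have D': "space M - D \<in> sets M" using D by auto
    note vg = val_dual_glue[OF D polar_dual[OF g(1)] polar_dual[OF g'(1)]] and vt = val_rv_glue[OF D g(2) g'(2)]
    have "AE \<omega>\<in>D in M. rep (?L ?g ?t) \<omega> \<le> rep (?L g t) \<omega>"
    proof (rule left_mono_on[OF gl(1) g(1) gl(2) g(2) D])
      show "AE \<omega>\<in>D in M. val (?g x) \<omega> = val (g x) \<omega>" if "x \<in> carrier V" for x
        using vg[OF that] by eventually_elim simp
      show "AE \<omega>\<in>D in M. val ?t \<omega> \<le> val t \<omega>" using vt by eventually_elim simp
    qed
    moreover have "AE \<omega> in M. \<omega> \<in> space M - D \<longrightarrow> rep (?L ?g ?t) \<omega> \<le> rep (?L g' t') \<omega>"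
    proof (rule left_mono_on[OF gl(1) g'(1) gl(2) g'(2) D'])
      show "AE \<omega> in M. \<omega> \<in> space M - D \<longrightarrow> val (?g x) \<omega> = val (g' x) \<omega>" if "x \<in> carrier V" for x
        using vg[OF that] by eventually_elim simp
      show "AE \<omega> in M. \<omega> \<in> space M - D \<longrightarrow> val ?t \<omega> \<le> val t' \<omega>" using vt by eventually_elim simp
    qed
    ultimately have "AE \<omega>\<in>B in M. rep (?L ?g ?t) \<omega> \<le> ereal q"
      using 1 2 AE_space
    proof eventually_elim
      case (elim \<omega>)
      then show ?case by (cases "\<omega> \<in> D") (auto intro: order_trans)
    qed
    with gl show ?thesis by (simp add: N_def)
  qed
  \<comment> \<open>The events on which some pair within the sublevel set comes close to
    \<open>(f0, s0)\<close>.\<close>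
  define \<A> where "\<A> = {D \<in> sets M. D \<subseteq> B \<and> (\<exists>g\<in>polar M V T K. \<exists>t\<in>carrier (L0 M).
    (AE \<omega>\<in>D in M. rep (?L g t) \<omega> \<le> ereal q) \<and>
    (\<forall>x\<in>F. AE \<omega>\<in>D in M. \<bar>val (f0 x) \<omega> - val (g x) \<omega>\<bar> \<le> val \<epsilon> \<omega>) \<and>
    (AE \<omega>\<in>D in M. \<bar>val s0 \<omega> - val t \<omega>\<bar> \<le> val \<epsilon> \<omega>))}"
  have \<A>I: "D \<in> \<A>" if "D \<in> sets M" "D \<subseteq> B" "g \<in> polar M V T K" "t \<in> carrier (L0 M)"
    "AE \<omega>\<in>D in M. rep (?L g t) \<omega> \<le> ereal q"
    "\<And>x. x \<in> F \<Longrightarrow> AE \<omega>\<in>D in M. \<bar>val (f0 x) \<omega> - val (g x) \<omega>\<bar> \<le> val \<epsilon> \<omega>"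
    "AE \<omega>\<in>D in M. \<bar>val s0 \<omega> - val t \<omega>\<bar> \<le> val \<epsilon> \<omega>" for D g t
    unfolding \<A>_def using that by blast
  have \<A>E: thesis' if "D \<in> \<A>" "\<And>g t. g \<in> polar M V T K \<Longrightarrow> t \<in> carrier (L0 M) \<Longrightarrow>
    AE \<omega>\<in>D in M. rep (?L g t) \<omega> \<le> ereal q \<Longrightarrow>
    (\<And>x. x \<in> F \<Longrightarrow> AE \<omega>\<in>D in M. \<bar>val (f0 x) \<omega> - val (g x) \<omega>\<bar> \<le> val \<epsilon> \<omega>) \<Longrightarrow>
    AE \<omega>\<in>D in M. \<bar>val s0 \<omega> - val t \<omega>\<bar> \<le> val \<epsilon> \<omega> \<Longrightarrow> thesis'" for D thesis'
    using that unfolding \<A>_def by blast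
  obtain D where D: "D \<in> \<A>" "\<And>E. E \<in> \<A> \<Longrightarrow> AE \<omega>\<in>E in M. \<omega> \<in> D"
  proof (rule maximal_event[of \<A>])
    show "\<A> \<subseteq> sets M" by (auto simp: \<A>_def)
    show "{} \<in> \<A>" by (rule \<A>I[OF _ _ g0 t0]) auto
  next
    fix D E assume D: "D \<in> \<A>" and E: "E \<in> sets M" "E \<subseteq> D"
    have DB: "D \<subseteq> B" using D by (auto simp: \<A>_def)
    show "E \<in> \<A>"
    proof (rule \<A>E[OF D])
      fix g t assume *: "g \<in> polar M V T K" "t \<in> carrier (L0 M)" "AE \<omega>\<in>D in M. rep (?L g t) \<omega> \<le> ereal q"
        "\<And>x. x \<in> F \<Longrightarrow> AE \<omega>\<in>D in M. \<bar>val (f0 x) \<omega> - val (g x) \<omega>\<bar> \<le> val \<epsilon> \<omega>"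
        "AE \<omega>\<in>D in M. \<bar>val s0 \<omega> - val t \<omega>\<bar> \<le> val \<epsilon> \<omega>"
      show "E \<in> \<A>"
      proof (rule \<A>I[OF E(1) _ *(1,2)])
        show "E \<subseteq> B" using E DB by auto
        show "AE \<omega>\<in>E in M. rep (?L g t) \<omega> \<le> ereal q" using *(3) by eventually_elim (use E in auto)
        show "AE \<omega>\<in>E in M. \<bar>val (f0 x) \<omega> - val (g x) \<omega>\<bar> \<le> val \<epsilon> \<omega>" if "x \<in> F" for x
          using *(4)[OF that] by eventually_elim (use E in auto)
        show "AE \<omega>\<in>E in M. \<bar>val s0 \<omega> - val t \<omega>\<bar> \<le> val \<epsilon> \<omega>" using *(5) by eventually_elim (use E in auto)
      qed
    qed
  next
    fix D :: "nat \<Rightarrow> _" assume dis: "disjoint_family D" and D: "\<And>n. D n \<in> \<A>"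
    have DM: "D n \<in> sets M" "D n \<subseteq> B" for n using D[of n] by (auto simp: \<A>_def)
    have "\<forall>n. \<exists>p. fst p \<in> polar M V T K \<and> snd p \<in> carrier (L0 M) \<and>
        (AE \<omega> in M. \<omega> \<in> D n \<longrightarrow> rep (?L (fst p) (snd p)) \<omega> \<le> ereal q) \<and>
        (\<forall>x\<in>F. AE \<omega> in M. \<omega> \<in> D n \<longrightarrow> \<bar>val (f0 x) \<omega> - val (fst p x) \<omega>\<bar> \<le> val \<epsilon> \<omega>) \<and>
        (AE \<omega> in M. \<omega> \<in> D n \<longrightarrow> \<bar>val s0 \<omega> - val (snd p) \<omega>\<bar> \<le> val \<epsilon> \<omega>)" (is "\<forall>n. \<exists>p. ?Q n p")
    proof
      fix n
      show "\<exists>p. ?Q n p"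
      proof (rule \<A>E[OF D[of n]])
        fix g t assume "g \<in> polar M V T K" "t \<in> carrier (L0 M)" "AE \<omega> in M. \<omega> \<in> D n \<longrightarrow> rep (?L g t) \<omega> \<le> ereal q"
          "\<And>x. x \<in> F \<Longrightarrow> AE \<omega> in M. \<omega> \<in> D n \<longrightarrow> \<bar>val (f0 x) \<omega> - val (g x) \<omega>\<bar> \<le> val \<epsilon> \<omega>"
          "AE \<omega> in M. \<omega> \<in> D n \<longrightarrow> \<bar>val s0 \<omega> - val t \<omega>\<bar> \<le> val \<epsilon> \<omega>"
        then show "\<exists>p. ?Q n p" by (intro exI[of _ "(g, t)"]) simp
      qed
    qed
    from choice[OF this] obtain p where p: "\<forall>n. ?Q n (p n)" ..
    define P where "P = case_nat (space M - (\<Union>n. D n)) D"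
    have P: "countable_partition M P" unfolding P_def by (rule countable_partition_complement[OF DM(1) dis])
    let ?G = "case_nat g0 (\<lambda>n. fst (p n))" and ?T = "case_nat t0 (\<lambda>n. snd (p n))"
    have G: "?G n \<in> polar M V T K" and Tn: "?T n \<in> carrier (L0 M)" for n using p g0 t0 by (auto split: nat.split)
    obtain g where g: "g \<in> polar M V T K"
      "\<And>n x. x \<in> carrier V \<Longrightarrow> AE \<omega> in M. \<omega> \<in> P n \<longrightarrow> val (g x) \<omega> = val (?G n x) \<omega>"
      by (rule polar_concat[OF K P, of ?G]) (use G in auto)
    obtain t where t: "t \<in> carrier (L0 M)" "\<And>n. AE \<omega> in M. \<omega> \<in> P n \<longrightarrow> val t \<omega> = val (?T n) \<omega>"
      by (rule L0_concat[OF P, of "\<lambda>n. val (?T n)"]) (use Tn in auto)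
    have gn: "AE \<omega> in M. \<omega> \<in> D n \<longrightarrow> val (g x) \<omega> = val (fst (p n) x) \<omega>" if "x \<in> carrier V" for n x
      using g(2)[OF that, of "Suc n"] by (simp add: P_def)
    have tn: "AE \<omega> in M. \<omega> \<in> D n \<longrightarrow> val t \<omega> = val (snd (p n)) \<omega>" for n
      using t(2)[of "Suc n"] by (simp add: P_def)
    have all: "AE \<omega> in M. \<omega> \<in> (\<Union>n. D n) \<longrightarrow> Q \<omega>" if "\<And>n. AE \<omega> in M. \<omega> \<in> D n \<longrightarrow> Q \<omega>" for Q
    proof -
      have "AE \<omega> in M. \<forall>n. \<omega> \<in> D n \<longrightarrow> Q \<omega>" using that unfolding AE_all_countable by blast
      then show ?thesis by eventually_elim auto
    qed
    show "(\<Union>n. D n) \<in> \<A>"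
    proof (rule \<A>I[OF _ _ g(1) t(1)])
      show "(\<Union>n. D n) \<in> sets M" "(\<Union>n. D n) \<subseteq> B" using DM by auto
      show "AE \<omega> in M. \<omega> \<in> (\<Union>n. D n) \<longrightarrow> rep (?L g t) \<omega> \<le> ereal q"
      proof (rule all)
        fix n
        have pn: "fst (p n) \<in> polar M V T K" "snd (p n) \<in> carrier (L0 M)"
          "AE \<omega> in M. \<omega> \<in> D n \<longrightarrow> rep (?L (fst (p n)) (snd (p n))) \<omega> \<le> ereal q" using p by auto
        have "AE \<omega> in M. \<omega> \<in> D n \<longrightarrow> rep (?L g t) \<omega> \<le> rep (?L (fst (p n)) (snd (p n))) \<omega>"
        proof (rule left_mono_on[OF g(1) pn(1) t(1) pn(2) DM(1) gn])
          show "AE \<omega> in M. \<omega> \<in> D n \<longrightarrow> val t \<omega> \<le> val (snd (p n)) \<omega>" using tn[of n] by eventually_elim simp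
        qed
        with pn(3) show "AE \<omega> in M. \<omega> \<in> D n \<longrightarrow> rep (?L g t) \<omega> \<le> ereal q"
          by eventually_elim (auto intro: order_trans)
      qed
      show "AE \<omega> in M. \<omega> \<in> (\<Union>n. D n) \<longrightarrow> \<bar>val (f0 x) \<omega> - val (g x) \<omega>\<bar> \<le> val \<epsilon> \<omega>" if x: "x \<in> F" for x
      proof (rule all)
        fix n
        have "AE \<omega> in M. \<omega> \<in> D n \<longrightarrow> \<bar>val (f0 x) \<omega> - val (fst (p n) x) \<omega>\<bar> \<le> val \<epsilon> \<omega>" using p x by blast
        moreover have "x \<in> carrier V" using x F by auto
        note gn[OF this, of n]
        ultimately show "AE \<omega> in M. \<omega> \<in> D n \<longrightarrow> \<bar>val (f0 x) \<omega> - val (g x) \<omega>\<bar> \<le> val \<epsilon> \<omega>" by eventually_elim simp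
      qed
      show "AE \<omega> in M. \<omega> \<in> (\<Union>n. D n) \<longrightarrow> \<bar>val s0 \<omega> - val t \<omega>\<bar> \<le> val \<epsilon> \<omega>"
      proof (rule all)
        fix n
        have "AE \<omega> in M. \<omega> \<in> D n \<longrightarrow> \<bar>val s0 \<omega> - val (snd (p n)) \<omega>\<bar> \<le> val \<epsilon> \<omega>" using p by blast
        with tn[of n] show "AE \<omega> in M. \<omega> \<in> D n \<longrightarrow> \<bar>val s0 \<omega> - val t \<omega>\<bar> \<le> val \<epsilon> \<omega>" by eventually_elim simp
      qed
    qed
  qed (rule that)
  have DM: "D \<in> sets M" "D \<subseteq> B" using D(1) by (auto simp: \<A>_def)
  define C where "C = B - D"
  have C: "C \<in> sets M" "C \<subseteq> B" using B DM by (auto simp: C_def)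
  have Cpos: "\<not> (AE \<omega> in M. \<omega> \<notin> C)"
  proof
    assume null: "AE \<omega> in M. \<omega> \<notin> C"
    show False
    proof (rule \<A>E[OF D(1)])
      fix g t assume g: "g \<in> polar M V T K" and t: "t \<in> carrier (L0 M)"
        and 1: "AE \<omega>\<in>D in M. rep (?L g t) \<omega> \<le> ereal q"
        and 2: "\<And>x. x \<in> F \<Longrightarrow> AE \<omega>\<in>D in M. \<bar>val (f0 x) \<omega> - val (g x) \<omega>\<bar> \<le> val \<epsilon> \<omega>"
        and 3: "AE \<omega>\<in>D in M. \<bar>val s0 \<omega> - val t \<omega>\<bar> \<le> val \<epsilon> \<omega>"
      \<comment> \<open>If \<open>C\<close> were null, \<open>D\<close> would be almost all of
        \<open>B\<close>. The close pair on \<open>D\<close>, continued by \<open>(f0, s0)\<close>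
        itself, would then lie in \<open>N\<close> and be close everywhere.\<close>
      let ?g = "mod_glue M dual D g f0" and ?t = "rv_glue M D t s0"
      note vg = val_dual_glue[OF DM(1) polar_dual[OF g] f0D] and vt = val_rv_glue[OF DM(1) t s0]
      show False
      proof (rule far)
        show "?g \<in> polar M V T K" "?t \<in> carrier (L0 M)" using polar_glue[OF K DM(1) g f0] DM t s0 by auto
        show "(?g, ?t) \<in> N"
        proof (rule glue[OF DM(1) g t f0 s0])
          show "AE \<omega> in M. \<omega> \<in> B \<and> \<omega> \<in> D \<longrightarrow> rep (?L g t) \<omega> \<le> ereal q" using 1 by eventually_elim simp
          show "AE \<omega> in M. \<omega> \<in> B \<and> \<omega> \<notin> D \<longrightarrow> rep (?L f0 s0) \<omega> \<le> ereal q"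
            using null by eventually_elim (auto simp: C_def)
        qed
        show "AE \<omega> in M. \<bar>val (f0 x) \<omega> - val (?g x) \<omega>\<bar> \<le> val \<epsilon> \<omega>" if x: "x \<in> F" for x
        proof -
          have "x \<in> carrier V" using x F by auto
          from vg[OF this] 2[OF x] L0_pos_val[OF \<epsilon>(1)] show ?thesis by eventually_elim auto
        qed
        show "AE \<omega> in M. \<bar>val s0 \<omega> - val ?t \<omega>\<bar> \<le> val \<epsilon> \<omega>"
          using vt 3 L0_pos_val[OF \<epsilon>(1)] by eventually_elim auto
      qed
    qed
  qed
  \<comment> \<open>\<open>None\<close> is the coordinate of the argument, \<open>Some x\<close> the
    coordinate of the value at \<open>x\<close>.\<close>
  define I where "I = insert None (Some ` F)"
  have I: "finite I" using F by (simp add: I_def)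
  interpret W: L0_module M "L0_power M I" by (rule L0_module_L0_power)
  define \<Phi> where "\<Phi> g t = (\<lambda>i\<in>I. case i of None \<Rightarrow> t | Some x \<Rightarrow> g x)" for g :: "'b \<Rightarrow> 'a rv" and t
  have \<Phi>: "\<Phi> g t \<in> carrier (L0_power M I)" if "g \<in> polar M V T K" "t \<in> carrier (L0 M)" for g t
    using that F(2) by (auto simp: \<Phi>_def I_def polar_dual subset_iff)
  have \<Phi>None: "None \<in> I" "\<Phi> g t None = t" for g t by (auto simp: \<Phi>_def I_def)
  have \<Phi>Some: "Some x \<in> I" "\<Phi> g t (Some x) = g x" if "x \<in> F" for g t x using that by (auto simp: \<Phi>_def I_def)
  let ?C = "(\<lambda>(g, t). \<Phi> g t) ` N"
  have Cconv: "L0_convex M (L0_power M I) ?C"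
    unfolding L0_convex_def
  proof (intro conjI ballI)
    show "?C \<subseteq> carrier (L0_power M I)" using \<Phi> by (auto simp: N_def)
    fix v w l assume v: "v \<in> ?C" and w: "w \<in> ?C" and l: "l \<in> L0_unit_interval M"
    obtain g t where gt: "v = \<Phi> g t" "(g, t) \<in> N" using v by auto
    obtain h u where hu: "w = \<Phi> h u" "(h, u) \<in> N" using w by auto
    have gt': "g \<in> polar M V T K" "t \<in> carrier (L0 M)" "AE \<omega>\<in>B in M. rep (?L g t) \<omega> \<le> ereal q"
      using gt by (auto simp: N_def)
    have hu': "h \<in> polar M V T K" "u \<in> carrier (L0 M)" "AE \<omega>\<in>B in M. rep (?L h u) \<omega> \<le> ereal q"
      using hu by (auto simp: N_def)
    have lL: "l \<in> carrier (L0 M)" using l by (rule L0_unit_interval_L0)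
    have "mod_comb M (L0_power M I) l v w = \<Phi> (mod_comb M dual l g h) (rv_comb M l t u)"
    proof
      fix i
      show "mod_comb M (L0_power M I) l v w i = \<Phi> (mod_comb M dual l g h) (rv_comb M l t u) i"
      proof (cases "i \<in> I")
        case True
        then have e: "mod_comb M (L0_power M I) l v w i = rv_comb M l (v i) (w i)"
          by (simp add: mod_comb_def rv_comb_def L0_power_apply)
        show ?thesis
        proof (cases i)
          case None
          then show ?thesis using e gt hu \<Phi>None by simp
        next
          case (Some x)
          then have x: "x \<in> F" "x \<in> carrier V" using True F by (auto simp: I_def)
          then show ?thesis using e gt hu \<Phi>Some[OF x(1)] Some by (simp add: dual_comb_apply)
        qed
      qed (simp add: mod_comb_def L0_power_def \<Phi>_def)
    qed
    moreover have "(mod_comb M dual l g h, rv_comb M l t u) \<in> N"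
    proof -
      have "rv_comb M l t u \<in> carrier (L0 M)" using lL gt' hu' one_minus(1)[OF lL] by (simp add: rv_comb_def)
      moreover from left_comb[OF gt'(1) hu'(1) gt'(2) hu'(2) l] gt'(3) hu'(3)
      have "AE \<omega>\<in>B in M. rep (?L (mod_comb M dual l g h) (rv_comb M l t u)) \<omega> \<le> ereal q"
        by eventually_elim (auto intro: order_trans)
      ultimately show ?thesis using polar_comb[OF K l gt'(1) hu'(1)] by (simp add: N_def)
    qed
    ultimately show "mod_comb M (L0_power M I) l v w \<in> ?C" by force
  qed
  have g0N: "(g0, t0) \<in> N" using g0 t0 le by (simp add: N_def)
  let ?U = "{w \<in> carrier (L0_power M I). \<forall>i\<in>I. AE \<omega> in M. \<bar>val (w i) \<omega>\<bar> \<le> val \<epsilon> \<omega>}"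
  note U = L0_power_box[OF I \<epsilon>(1)]
  obtain \<phi> \<delta> where \<phi>: "L0_linear M (L0_power M I) \<phi>"
    and \<delta>: "\<delta> \<in> carrier (L0 M)" "AE \<omega>\<in>C in M. 0 < val \<delta> \<omega>"
    and sep: "\<And>y. y \<in> ?C \<Longrightarrow> AE \<omega>\<in>C in M. val (\<phi> (\<Phi> f0 s0)) \<omega> + val \<delta> \<omega> \<le> val (\<phi> y) \<omega>"
  proof (rule W.separation[OF Cconv _ U \<Phi>[OF f0 s0] C(1)])
    show "\<Phi> g0 t0 \<in> ?C" using g0N by force
    fix E y u assume E: "E \<in> sets M" "E \<subseteq> C" and y: "y \<in> ?C" and u: "u \<in> ?U"
      and eq: "ind M E \<odot>\<^bsub>L0_power M I\<^esub> \<Phi> f0 s0 = ind M E \<odot>\<^bsub>L0_power M I\<^esub> (y \<ominus>\<^bsub>L0_power M I\<^esub> u)"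
    obtain g t where gt: "y = \<Phi> g t" "(g, t) \<in> N" using y by auto
    have gt': "g \<in> polar M V T K" "t \<in> carrier (L0 M)" "AE \<omega>\<in>B in M. rep (?L g t) \<omega> \<le> ereal q"
      using gt by (auto simp: N_def)
    have yW: "y \<in> carrier (L0_power M I)" using gt' gt \<Phi> by simp
    have uW: "u \<in> carrier (L0_power M I)" using u by blast
    have yuW: "y \<ominus>\<^bsub>L0_power M I\<^esub> u \<in> carrier (L0_power M I)" using yW uW by (rule W.M.minus_closed)
    have near: "AE \<omega>\<in>E in M. \<bar>val (\<Phi> f0 s0 i) \<omega> - val (y i) \<omega>\<bar> \<le> val \<epsilon> \<omega>" if i: "i \<in> I" for i
    proof -
      have "AE \<omega> in M. \<bar>val (u i) \<omega>\<bar> \<le> val \<epsilon> \<omega>" using u i by blast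
      with W.L0_linear_ind_cong[OF L0_linear_projection[OF i] E(1) \<Phi>[OF f0 s0] yuW eq]
        W.L0_linear_minus_val[OF L0_linear_projection[OF i] yW uW]
      show ?thesis by eventually_elim auto
    qed
    have "E \<in> \<A>"
    proof (rule \<A>I[OF E(1) _ gt'(1,2)])
      show "E \<subseteq> B" using E C by auto
      show "AE \<omega>\<in>E in M. rep (?L g t) \<omega> \<le> ereal q"
        using gt'(3) by eventually_elim (use E C in auto)
      show "AE \<omega>\<in>E in M. \<bar>val (f0 x) \<omega> - val (g x) \<omega>\<bar> \<le> val \<epsilon> \<omega>" if "x \<in> F" for x
        using near[OF \<Phi>Some(1)[OF that]] by (simp add: gt \<Phi>Some(2)[OF that])
      show "AE \<omega>\<in>E in M. \<bar>val s0 \<omega> - val t \<omega>\<bar> \<le> val \<epsilon> \<omega>"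
        using near[OF \<Phi>None(1)] by (simp add: gt \<Phi>None(2))
    qed
    from D(2)[OF this] show "AE \<omega> in M. \<omega> \<notin> E" by eventually_elim (use E(2) in \<open>auto simp: C_def\<close>)
  qed (rule that)
  obtain c where c: "\<And>i. i \<in> I \<Longrightarrow> c i \<in> carrier (L0 M)"
    "\<And>v. v \<in> carrier (L0_power M I) \<Longrightarrow> AE \<omega> in M. val (\<phi> v) \<omega> = (\<Sum>i\<in>I. val (c i) \<omega> * val (v i) \<omega>)"
    by (rule L0_linear_power_coordinates[OF I \<phi>]) auto
  have cF: "c (Some x) \<in> carrier (L0 M)" if "x \<in> F" for x using c(1) \<Phi>Some(1)[OF that] by blast
  obtain z where z: "z \<in> carrier V"
    "\<And>g. L0_linear M V g \<Longrightarrow> AE \<omega> in M. val (g z) \<omega> = (\<Sum>x\<in>F. val (c (Some x)) \<omega> * val (g x) \<omega>)"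
    by (rule L0_linear_combination[OF F(1,2), of "\<lambda>x. c (Some x)"]) (use cF in auto)
  define r where "r = c None"
  have r: "r \<in> carrier (L0 M)" using c(1) \<Phi>None(1) by (simp add: r_def)
  have \<phi>\<Phi>: "AE \<omega> in M. val (\<phi> (\<Phi> g t)) \<omega> = val (g z) \<omega> + val r \<omega> * val t \<omega>"
    if g: "g \<in> polar M V T K" and t: "t \<in> carrier (L0 M)" for g t
    using c(2)[OF \<Phi>[OF g t]] z(2)[OF dual_linear[OF polar_dual[OF g]]]
  proof eventually_elim
    case (elim \<omega>)
    have "(\<Sum>i\<in>I. val (c i) \<omega> * val (\<Phi> g t i) \<omega>) =
        val r \<omega> * val t \<omega> + (\<Sum>i\<in>Some ` F. val (c i) \<omega> * val (\<Phi> g t i) \<omega>)"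
      unfolding I_def using F(1) by (subst sum.insert) (auto simp: r_def \<Phi>None)
    also have "(\<Sum>i\<in>Some ` F. val (c i) \<omega> * val (\<Phi> g t i) \<omega>) = (\<Sum>x\<in>F. val (c (Some x)) \<omega> * val (g x) \<omega>)"
      by (subst sum.reindex) (auto simp: \<Phi>Some intro!: sum.cong)
    finally show ?case using elim by simp
  qed
  \<comment> \<open>Every positive multiple of a pair in \<open>N\<close> is in \<open>N\<close>, so
    the separating inequality holds with any factor \<open>k\<close> on the right. Small factors
    show that the left-hand side is at most 0, large ones that the functional is nonnegative on
    \<open>N\<close>.\<close>
  have scaled: "AE \<omega>\<in>C in M. val (f0 z) \<omega> + val r \<omega> * val s0 \<omega> + val \<delta> \<omega> \<le> k * (val (g z) \<omega> + val r \<omega> * val t \<omega>)"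
    if N: "(g, t) \<in> N" and k: "0 < k" for g t k
  proof -
    let ?k = "rvar M (\<lambda>_. k)"
    have kp: "?k \<in> L0_pos M" using k by (intro rvar_pos) auto
    have kL: "?k \<in> carrier (L0 M)" by (rule L0_pos_L0[OF kp])
    have vk: "AE \<omega> in M. val ?k \<omega> = k" by (rule val_rvar) simp
    have k0: "AE \<omega> in M. 0 \<le> val ?k \<omega>" using vk by eventually_elim (use k in simp)
    have gt: "g \<in> polar M V T K" "t \<in> carrier (L0 M)" "AE \<omega>\<in>B in M. rep (?L g t) \<omega> \<le> ereal q"
      using N by (auto simp: N_def)
    let ?g = "?k \<odot>\<^bsub>dual\<^esub> g" and ?t = "?k \<otimes>\<^bsub>L0 M\<^esub> t"
    have kg: "?g \<in> polar M V T K" "?t \<in> carrier (L0 M)" using polar_smult[OF K kL k0 gt(1)] kL gt by auto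
    from left_scale[OF gt(1,2) kp] gt(3) have "AE \<omega>\<in>B in M. rep (?L ?g ?t) \<omega> \<le> ereal q"
      by eventually_elim (auto intro: order_trans)
    with kg have "(?g, ?t) \<in> N" by (simp add: N_def)
    then have "\<Phi> ?g ?t \<in> ?C" by force
    from sep[OF this] \<phi>\<Phi>[OF kg] \<phi>\<Phi>[OF f0 s0] val_mult[OF kL gt(2)] val_mult[OF kL dual_L0[OF polar_dual[OF gt(1)] z(1)]] vk
    show ?thesis unfolding dual_smult_apply[OF z(1)]
      by eventually_elim (simp add: algebra_simps)
  qed
  show ?thesis
  proof (rule that[OF C Cpos z(1) r])
    have "AE \<omega> in M. \<forall>n. \<omega> \<in> C \<longrightarrow> val (f0 z) \<omega> + val r \<omega> * val s0 \<omega> + val \<delta> \<omega>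
        \<le> (1 / real (Suc n)) * (val (g0 z) \<omega> + val r \<omega> * val t0 \<omega>)"
      unfolding AE_all_countable by (intro allI scaled[OF g0N]) simp
    with \<delta>(2) show "AE \<omega>\<in>C in M. val (f0 z) \<omega> + val r \<omega> * val s0 \<omega> < 0"
    proof eventually_elim
      case (elim \<omega>)
      show ?case
      proof
        assume "\<omega> \<in> C"
        with elim have \<delta>: "0 < val \<delta> \<omega>" and le: "\<And>n. val (f0 z) \<omega> + val r \<omega> * val s0 \<omega> + val \<delta> \<omega>
            \<le> (1 / real (Suc n)) * (val (g0 z) \<omega> + val r \<omega> * val t0 \<omega>)" by auto
        have "(\<lambda>n. (1 / real (Suc n)) * (val (g0 z) \<omega> + val r \<omega> * val t0 \<omega>)) \<longlonglongrightarrow> 0 * (val (g0 z) \<omega> + val r \<omega> * val t0 \<omega>)"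
          using LIMSEQ_inverse_real_of_nat by (intro tendsto_mult tendsto_const) (simp add: inverse_eq_divide)
        then have "val (f0 z) \<omega> + val r \<omega> * val s0 \<omega> + val \<delta> \<omega> \<le> 0"
          using le by (intro LIMSEQ_le_const[where X="\<lambda>n. (1 / real (Suc n)) * (val (g0 z) \<omega> + val r \<omega> * val t0 \<omega>)"]) auto
        with \<delta> show "val (f0 z) \<omega> + val r \<omega> * val s0 \<omega> < 0" by simp
      qed
    qed
    fix g t assume g: "g \<in> polar M V T K" and t: "t \<in> carrier (L0 M)"
    have [measurable]: "rep (?L g t) \<in> borel_measurable M" using left_measurable[OF g t] .
    \<comment> \<open>The given pair is used only where it satisfies the bound, and
      \<open>(g0, t0)\<close> is spliced in elsewhere, to obtain a pair in \<open>N\<close>.\<close>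
    define D' where "D' = {\<omega> \<in> space M. \<omega> \<in> B \<and> rep (?L g t) \<omega> \<le> ereal q}"
    have D': "D' \<in> sets M" unfolding D'_def by measurable
    let ?g = "mod_glue M dual D' g g0" and ?t = "rv_glue M D' t t0"
    have N': "(?g, ?t) \<in> N"
    proof (rule glue[OF D' g t g0 t0])
      show "AE \<omega> in M. \<omega> \<in> B \<and> \<omega> \<in> D' \<longrightarrow> rep (?L g t) \<omega> \<le> ereal q" by (rule AE_I2) (simp add: D'_def)
      show "AE \<omega> in M. \<omega> \<in> B \<and> \<omega> \<notin> D' \<longrightarrow> rep (?L g0 t0) \<omega> \<le> ereal q" using le by eventually_elim simp
    qed
    have "AE \<omega> in M. \<forall>n. \<omega> \<in> C \<longrightarrow> val (f0 z) \<omega> + val r \<omega> * val s0 \<omega> + val \<delta> \<omega>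
        \<le> real (Suc n) * (val (?g z) \<omega> + val r \<omega> * val ?t \<omega>)"
      unfolding AE_all_countable by (intro allI scaled[OF N']) simp
    with val_dual_glue[OF D' polar_dual[OF g] polar_dual[OF g0] z(1)] val_rv_glue[OF D' t t0] AE_space
    show "AE \<omega> in M. \<omega> \<in> C \<and> rep (?L g t) \<omega> \<le> ereal q \<longrightarrow> 0 \<le> val (g z) \<omega> + val r \<omega> * val t \<omega>"
    proof eventually_elim
      case (elim \<omega>)
      show ?case
      proof (intro impI, rule ccontr)
        assume \<omega>: "\<omega> \<in> C \<and> rep (?L g t) \<omega> \<le> ereal q" and "\<not> 0 \<le> val (g z) \<omega> + val r \<omega> * val t \<omega>"
        then have neg: "0 < - (val (g z) \<omega> + val r \<omega> * val t \<omega>)" by simp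
        have "\<omega> \<in> D'" using \<omega> elim(3) C by (auto simp: D'_def)
        with elim(1,2,4) \<omega> have le: "val (f0 z) \<omega> + val r \<omega> * val s0 \<omega> + val \<delta> \<omega>
            \<le> real (Suc n) * (val (g z) \<omega> + val r \<omega> * val t \<omega>)" for n by auto
        obtain n where n: "- (val (f0 z) \<omega> + val r \<omega> * val s0 \<omega> + val \<delta> \<omega>) < real n * - (val (g z) \<omega> + val r \<omega> * val t \<omega>)"
          using reals_Archimedean3[OF neg] by blast
        have "real (Suc n) * (val (g z) \<omega> + val r \<omega> * val t \<omega>) \<le> real n * (val (g z) \<omega> + val r \<omega> * val t \<omega>)"
          using neg by (intro mult_right_mono_neg) auto
        with n le[of n] show False unfolding mult_minus_right by linarith
      qed
    qed
  qed
qed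

end

end

lemma (in locally_L0_convex_module) nondegenerate_onD:
  assumes "nondegenerate_on M V T A f s" "B \<in> sets M" "B \<subseteq> A" and f: "f \<in> carrier dual"
    and "\<And>x. x \<in> carrier V \<Longrightarrow> AE \<omega>\<in>B in M. val (f x) \<omega> = 0"
  shows "AE \<omega>\<in>B in M. 0 \<le> rep s \<omega>"
proof -
  have iL: "ind M B \<in> carrier (L0 M)" using assms(2) by simp
  have "ind M B \<odot>\<^bsub>dual\<^esub> f = \<zero>\<^bsub>dual\<^esub>"
  proof (rule dual_ext[OF dual_smult_closed[OF iL f] dual_zero_closed])
    fix x assume x: "x \<in> carrier V"
    have "ind M B \<otimes>\<^bsub>L0 M\<^esub> f x = \<zero>\<^bsub>L0 M\<^esub>"
    proof (rule L0_eqI[where M=M])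
      from val_mult[OF iL dual_L0[OF f x]] val_ind[OF assms(2)] assms(5)[OF x] val_zero[of M]
      show "AE \<omega> in M. val (ind M B \<otimes>\<^bsub>L0 M\<^esub> f x) \<omega> = val \<zero>\<^bsub>L0 M\<^esub> \<omega>"
        by eventually_elim (auto simp: indicator_def)
    qed (use iL f x in auto)
    then show "(ind M B \<odot>\<^bsub>dual\<^esub> f) x = \<zero>\<^bsub>dual\<^esub> x" using x by (simp add: dual_smult_apply dual_zero_apply)
  qed
  with assms(1-3) show ?thesis unfolding nondegenerate_on_def by blast
qed

section \<open>Comparison of a representing risk function with the minimal one\<close>

context sigma_stable_module
begin

context
  fixes K R \<alpha>
  assumes min: "minimal_risk_function M V T K R" and K: "K \<subseteq> carrier V"
    and repr: "\<And>x. x \<in> carrier V \<Longrightarrow> \<alpha> x = robust_index M V T K R x"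
begin

lemmas R_risk = risk_functionD[OF minimal_risk_functionD(1)[OF min K]]

lemma represented_index: "\<alpha> \<in> carrier V \<rightarrow> carrier (barL0 M)"
  using robust_index_carrier[OF minimal_risk_functionD(1)[OF min K] K] repr by simp

lemma represented_le:
  assumes "f \<in> polar M V T K" "x \<in> carrier V"
  shows "AE \<omega> in M. rep (\<alpha> x) \<omega> \<le> rep (R f (f x)) \<omega>"
  using robust_index_le[OF minimal_risk_functionD(1)[OF min K] K assms] repr[OF assms(2)] by simp

text \<open>Any \<open>x\<close> with \<open>f x\<close> below \<open>n\<close> has index at most
  \<open>R f (f x)\<close>, hence at most \<open>R f n\<close>; so \<open>lower_risk\<close> lies
  below \<open>R\<close>, and right-continuity of \<open>R\<close> passes this on to its right
  version. In this sense the constructed function is the smallest one.\<close>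

lemma minimal_risk_le_represented:
  assumes f: "f \<in> polar M V T K" and s: "s \<in> carrier (barL0 M)"
  shows "AE \<omega> in M. rep (minimal_risk M V \<alpha> f s) \<omega> \<le> rep (R f s) \<omega>"
proof -
  note fD = polar_dual[OF f] and \<alpha> = represented_index
  have Rm: "rep (minimal_risk M V \<alpha> f s) \<in> borel_measurable M" using minimal_risk_carrier[OF \<alpha> fD s] by simp
  have "AE \<omega> in M. True \<longrightarrow> rep (minimal_risk M V \<alpha> f s) \<omega> \<le> rep (right_version M (R f) s) \<omega>"
  proof (rule right_version_greatest[OF R_risk(1,2)[OF f] s Rm])
    fix n assume n: "n \<in> carrier (L0 M)"
    note nE = L0_barL0[OF n]
    have "rep (R f n) \<in> borel_measurable M" using R_risk(3)[OF f nE] by simp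
    then have "AE \<omega> in M. True \<longrightarrow> rep (lower_risk M V \<alpha> f n) \<omega> \<le> rep (R f n) \<omega>"
    proof (rule lower_risk_least[OF \<alpha> fD nE])
      fix x assume x: "x \<in> carrier V"
      have fx: "f x \<in> carrier (barL0 M)" using fD x by (simp add: L0_barL0)
      from represented_le[OF f x] rv_local_mono[OF R_risk(1,2)[OF f] fx nE]
      show "AE \<omega> in M. True \<and> rep (f x) \<omega> < rep n \<omega> \<longrightarrow> rep (\<alpha> x) \<omega> \<le> rep (R f n) \<omega>"
        by eventually_elim (auto intro: order_trans)
    qed simp
    with minimal_risk_le[OF \<alpha> fD s nE] rep_val[OF n]
    show "AE \<omega> in M. True \<and> rep s \<omega> < ereal (val n \<omega>) \<longrightarrow> rep (minimal_risk M V \<alpha> f s) \<omega> \<le> rep (R f n) \<omega>"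
      by eventually_elim (auto intro: order_trans)
  qed simp
  then show ?thesis using R_risk(4)[OF f s] by simp
qed

text \<open>By right-continuity \<open>R g (g x)\<close> is the infimum of \<open>R g n\<close> over
  \<open>n\<close> above \<open>g x\<close>, and each of these dominates the left version at
  \<open>n\<close>. A bound on left versions, as separation provides it, therefore bounds the
  index.\<close>

lemma represented_ge:
  assumes x: "x \<in> carrier V" and B: "B \<in> sets M"
    and le: "\<And>g n. g \<in> polar M V T K \<Longrightarrow> n \<in> carrier (L0 M) \<Longrightarrow>
      AE \<omega> in M. \<omega> \<in> B \<and> val (g x) \<omega> < val n \<omega> \<longrightarrow> ereal q \<le> rep (left_version M (R g) n) \<omega>"
  shows "AE \<omega>\<in>B in M. ereal q \<le> rep (\<alpha> x) \<omega>"
proof -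
  have [measurable]: "B \<in> sets M" by (rule B)
  have "AE \<omega>\<in>B in M. ereal q \<le> rep (robust_index M V T K R x) \<omega>"
  proof (rule robust_index_greatest[OF minimal_risk_functionD(1)[OF min K] K x])
    fix g assume g: "g \<in> polar M V T K"
    have gx: "g x \<in> carrier (L0 M)" using polar_dual[OF g] x by simp
    have "AE \<omega>\<in>B in M. ereal q \<le> rep (right_version M (R g) (g x)) \<omega>"
    proof (rule right_version_greatest[OF R_risk(1,2)[OF g] L0_barL0[OF gx]])
      fix n assume n: "n \<in> carrier (L0 M)"
      from le[OF g n] left_version_le[OF R_risk(1,2)[OF g] L0_barL0[OF n]] rep_val[OF gx]
      show "AE \<omega> in M. \<omega> \<in> B \<and> rep (g x) \<omega> < ereal (val n \<omega>) \<longrightarrow> ereal q \<le> rep (R g n) \<omega>"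
        by eventually_elim (auto intro: order_trans)
    qed measurable
    then show "AE \<omega>\<in>B in M. ereal q \<le> rep (R g (g x)) \<omega>" using R_risk(4)[OF g L0_barL0[OF gx]] by simp
  qed measurable
  then show ?thesis using repr[OF x] by simp
qed

text \<open>A positive multiple of the zero functional is zero, so by the scaling rule its risk
  takes the same value at all positive arguments. This value is the supremum over all finite
  arguments, and that supremum is common to all functionals.\<close>

lemma risk_le_left_at_zero:
  assumes f: "f \<in> polar M V T K" and s: "s \<in> carrier (L0 M)"
  shows "AE \<omega> in M. rep (R f s) \<omega> \<le> rep (left_version M (R \<zero>\<^bsub>dual\<^esub>) \<one>\<^bsub>L0 M\<^esub>) \<omega>"
proof -
  let ?o = "\<zero>\<^bsub>dual\<^esub>"
  have o: "?o \<in> polar M V T K" by (rule polar_zero[OF K])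
  let ?h = "rvar M (\<lambda>_. 1 / 2)"
  have hL: "?h \<in> carrier (L0 M)" by simp
  have vh: "AE \<omega> in M. rep ?h \<omega> = ereal (1 / 2)" by (rule rep_rvar) simp
  have sub: "R g ` carrier (L0 M) \<subseteq> carrier (barL0 M)" if "g \<in> polar M V T K" for g
    using R_risk(3)[OF that L0_barL0] by auto
  have Rh: "rep (R ?o ?h) \<in> borel_measurable M" using R_risk(3)[OF o L0_barL0[OF hL]] by simp
  have "AE \<omega> in M. True \<longrightarrow> rep (\<Squnion>\<^bsub>barL0 M\<^esub> (R ?o ` carrier (L0 M))) \<omega> \<le> rep (R ?o ?h) \<omega>"
  proof (rule Sup_least_AE[OF sub[OF o] Rh])
    fix a assume "a \<in> R ?o ` carrier (L0 M)"
    then obtain t where t: "t \<in> carrier (L0 M)" "a = R ?o t" by auto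
    have [measurable]: "val t \<in> borel_measurable M" using t by simp
    \<comment> \<open>The argument is raised to at least 1, so that dividing it by twice itself
      gives 1 / 2. This is strictly below 1, as a comparison with the left version at 1
      requires.\<close>
    let ?t = "rvar M (\<lambda>\<omega>. max (val t \<omega>) 1)" and ?l = "rvar M (\<lambda>\<omega>. 2 * max (val t \<omega>) 1)"
    have tm: "(\<lambda>\<omega>. max (val t \<omega>) 1) \<in> borel_measurable M" "(\<lambda>\<omega>. 2 * max (val t \<omega>) 1) \<in> borel_measurable M"
      by measurable
    have l: "?l \<in> L0_pos M" by (rule rvar_pos[OF tm(2)]) (auto intro!: AE_I2 simp: less_max_iff_disj)
    have lL: "?l \<in> carrier (L0 M)" and tE: "?t \<in> carrier (barL0 M)" using tm by (auto intro: L0_barL0)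
    note d = rep_divide[OF tE lL]
    have "AE \<omega> in M. rep (lift2 M (/) ?t ?l) \<omega> = rep ?h \<omega>"
      using d(2) rep_rvar[OF tm(1)] val_rvar[OF tm(2)] vh
    proof eventually_elim
      case (elim \<omega>)
      have "max (val t \<omega>) 1 / (2 * max (val t \<omega>) 1) = 1 / 2" by (simp add: max_def)
      with elim show ?case by (simp del: ereal_max)
    qed
    then have e: "lift2 M (/) ?t ?l = ?h" by (rule barL0_eqI[OF d(1) L0_barL0[OF hL]])
    have "?l \<odot>\<^bsub>dual\<^esub> ?o = ?o"
    proof (rule dual_ext[OF dual_smult_closed[OF lL dual_zero_closed] dual_zero_closed])
      fix x assume "x \<in> carrier V"
      then show "(?l \<odot>\<^bsub>dual\<^esub> ?o) x = ?o x" using lL by (simp add: dual_smult_apply dual_zero_apply)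
    qed
    with minimal_risk_functionD(3)[OF min K o tE l] e have Req: "R ?o ?t = R ?o ?h" by simp
    from rv_local_mono[OF R_risk(1,2)[OF o] L0_barL0[OF t(1)] tE] rep_rvar[OF tm(1)] rep_val[OF t(1)]
    show "AE \<omega> in M. True \<longrightarrow> rep a \<omega> \<le> rep (R ?o ?h) \<omega>"
      unfolding t(2) Req by eventually_elim simp
  qed simp
  moreover have "AE \<omega> in M. rep (R f s) \<omega> \<le> rep (\<Squnion>\<^bsub>barL0 M\<^esub> (R f ` carrier (L0 M))) \<omega>"
    using s by (intro Sup_upper_AE[OF sub[OF f]]) auto
  moreover have "AE \<omega> in M. rep ?h \<omega> < rep \<one>\<^bsub>L0 M\<^esub> \<omega> \<longrightarrow>
      rep (R ?o ?h) \<omega> \<le> rep (left_version M (R ?o) \<one>\<^bsub>L0 M\<^esub>) \<omega>"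
    by (rule left_version_ge[OF R_risk(1)[OF o] L0_barL0[OF R.one_closed] L0_barL0[OF hL]])
  moreover note vh rep_val[OF R.one_closed] val_one[of M]
  ultimately show ?thesis
    unfolding minimal_risk_functionD(4)[OF min K f o] by eventually_elim (auto intro: order_trans)
qed

text \<open>
  If the assertion failed, \<open>(f, s')\<close> and \<open>(0, 1)\<close> would lie outside the sublevel set
  \<open>{R\<^sup>- \<le> q}\<close>, which is a closed convex cone. Separating both points and adding the functionals
  yields \<open>x\<close> and \<open>r < 0\<close> with \<open>g x + r t \<ge> 0\<close> on this set. Then \<open>- x / r\<close> has index at least \<open>q\<close>,
  although \<open>f\<close> is small there.
\<close>

lemma represented_le_minimal_risk:
  assumes f: "f \<in> polar M V T K" and s: "s \<in> carrier (barL0 M)" and A: "A \<in> sets M"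
    and nondeg: "nondegenerate_on M V T A f s"
  shows "AE \<omega>\<in>A in M. rep (R f s) \<omega> \<le> rep (minimal_risk M V \<alpha> f s) \<omega>"
proof -
  note fD = polar_dual[OF f] and \<alpha> = represented_index
  have [measurable]: "A \<in> sets M" "rep s \<in> borel_measurable M" "rep (R f s) \<in> borel_measurable M"
    "rep (minimal_risk M V \<alpha> f s) \<in> borel_measurable M"
    using A s R_risk(3)[OF f s] minimal_risk_carrier[OF \<alpha> fD s] by auto
  let ?L = "\<lambda>g t. left_version M (R g) t"
  have posI: False if "\<not> (AE \<omega> in M. \<omega> \<notin> B)" "AE \<omega>\<in>B in M. False" for B using that by simp
  \<comment> \<open>Both sides are set to 0 off \<open>A\<close>, so that a level strictly between
    them can occur on \<open>A\<close> only.\<close>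
  have "AE \<omega> in M. \<not> ((if \<omega> \<in> A then rep (minimal_risk M V \<alpha> f s) \<omega> else 0) < ereal q \<and>
      ereal q < (if \<omega> \<in> A then rep (R f s) \<omega> else 0))" for q
  proof (rule ccontr)
    assume neg: "\<not> ?thesis"
    define B0 where "B0 = {\<omega> \<in> space M. \<omega> \<in> A \<and> rep (minimal_risk M V \<alpha> f s) \<omega> < ereal q \<and> ereal q < rep (R f s) \<omega>}"
    have B0[measurable]: "B0 \<in> sets M" unfolding B0_def by measurable
    have B0pos: "\<not> (AE \<omega> in M. \<omega> \<notin> B0)"
    proof
      assume "AE \<omega> in M. \<omega> \<notin> B0"
      with AE_space have "AE \<omega> in M. \<not> ((if \<omega> \<in> A then rep (minimal_risk M V \<alpha> f s) \<omega> else 0) < ereal q \<and>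
          ereal q < (if \<omega> \<in> A then rep (R f s) \<omega> else 0))" by eventually_elim (auto simp: B0_def)
      with neg show False by contradiction
    qed
    \<comment> \<open>\<open>minimal_risk\<close> below \<open>q\<close> at \<open>s\<close> means
      that \<open>lower_risk\<close> is still below \<open>q\<close> at some larger
      \<open>n\<close>, on a part of the event. This gives the room to the right of \<open>s\<close>
      used below.\<close>
    obtain n where n: "n \<in> carrier (L0 M)"
      "\<not> (AE \<omega> in M. \<omega> \<in> B0 \<and> rep s \<omega> < ereal (val n \<omega>) \<longrightarrow> ereal q \<le> rep (lower_risk M V \<alpha> f n) \<omega>)"
    proof (rule ccontr)
      assume no: "\<not> thesis"
      have "AE \<omega>\<in>B0 in M. ereal q \<le> rep (minimal_risk M V \<alpha> f s) \<omega>"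
      proof (rule minimal_risk_greatest[OF \<alpha> fD s])
        fix n assume "n \<in> carrier (L0 M)"
        with no that show "AE \<omega> in M. \<omega> \<in> B0 \<and> rep s \<omega> < ereal (val n \<omega>) \<longrightarrow> ereal q \<le> rep (lower_risk M V \<alpha> f n) \<omega>"
          by blast
      qed measurable
      then have "AE \<omega> in M. \<omega> \<notin> B0" by eventually_elim (auto simp: B0_def)
      with B0pos show False by contradiction
    qed
    note nE = L0_barL0[OF n(1)]
    have [measurable]: "val n \<in> borel_measurable M" "rep (lower_risk M V \<alpha> f n) \<in> borel_measurable M"
      using n(1) lower_risk_carrier[OF \<alpha> fD nE] by auto
    define B1 where "B1 = {\<omega> \<in> space M. \<omega> \<in> B0 \<and> rep s \<omega> < ereal (val n \<omega>) \<and> rep (lower_risk M V \<alpha> f n) \<omega> < ereal q}"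
    have B1[measurable]: "B1 \<in> sets M" unfolding B1_def by measurable
    have B1A: "B1 \<subseteq> A" by (auto simp: B1_def B0_def)
    have B1pos: "\<not> (AE \<omega> in M. \<omega> \<notin> B1)"
    proof
      assume "AE \<omega> in M. \<omega> \<notin> B1"
      with AE_space have "AE \<omega> in M. \<omega> \<in> B0 \<and> rep s \<omega> < ereal (val n \<omega>) \<longrightarrow> ereal q \<le> rep (lower_risk M V \<alpha> f n) \<omega>"
        by eventually_elim (auto simp: B1_def)
      with n(2) show False by contradiction
    qed
    \<comment> \<open>Contrapositive of the supremum: a point with index at least \<open>q\<close>
      cannot satisfy the constraint with bound \<open>n\<close>.\<close>
    have large: "AE \<omega> in M. \<omega> \<in> B1 \<and> ereal q \<le> rep (\<alpha> x) \<omega> \<longrightarrow> val n \<omega> \<le> val (f x) \<omega>" if x: "x \<in> carrier V" for x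
      using lower_risk_ge[OF \<alpha> fD nE x] rep_val[OF n(1)] rep_val[OF dual_L0[OF fD x]]
    proof eventually_elim
      case (elim \<omega>)
      show ?case
      proof (intro impI, rule ccontr)
        assume "\<omega> \<in> B1 \<and> ereal q \<le> rep (\<alpha> x) \<omega>" "\<not> val n \<omega> \<le> val (f x) \<omega>"
        with elim have "ereal q \<le> rep (\<alpha> x) \<omega>" "rep (\<alpha> x) \<omega> \<le> rep (lower_risk M V \<alpha> f n) \<omega>"
          "rep (lower_risk M V \<alpha> f n) \<omega> < ereal q" by (auto simp: B1_def)
        then show False by (meson leD order_trans)
      qed
    qed
    have "(\<lambda>\<omega>. between (rep s \<omega>) (ereal (val n \<omega>))) \<in> borel_measurable M" by measurable
    note pm = this
    \<comment> \<open>An argument strictly between \<open>s\<close> and \<open>n\<close>. Being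
      above \<open>s\<close>, it makes the left version of \<open>R f\<close> exceed
      \<open>q\<close>; being below \<open>n\<close>, it leaves room for the final
      contradiction.\<close>
    define p where "p = rvar M (\<lambda>\<omega>. between (rep s \<omega>) (ereal (val n \<omega>)))"
    have p: "p \<in> carrier (L0 M)" unfolding p_def using pm by simp
    have "AE \<omega> in M. val p \<omega> = between (rep s \<omega>) (ereal (val n \<omega>))" unfolding p_def by (rule val_rvar[OF pm])
    then have vp: "AE \<omega>\<in>B1 in M. rep s \<omega> < ereal (val p \<omega>) \<and> val p \<omega> < val n \<omega>"
    proof eventually_elim
      case (elim \<omega>)
      then show ?case using between[of "rep s \<omega>" "ereal (val n \<omega>)"] by (auto simp: B1_def)
    qed
    \<comment> \<open>Without such a pair the index would be at least \<open>q\<close> at every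
      point on \<open>B1\<close>, so \<open>f\<close> would be bounded below by \<open>n\<close>
      there. A linear functional bounded below vanishes, which gives \<open>n \<le> 0\<close>, while
      nondegeneracy gives \<open>0 \<le> s\<close> and \<open>s\<close> is below
      \<open>n\<close>.\<close>
    obtain g0 t0 where g0: "g0 \<in> polar M V T K" and t0: "t0 \<in> carrier (L0 M)"
      and g0t0: "\<not> (AE \<omega>\<in>B1 in M. ereal q < rep (?L g0 t0) \<omega>)"
    proof (rule ccontr)
      assume no: "\<not> thesis"
      note witness = that
      have ge: "AE \<omega>\<in>B1 in M. val n \<omega> \<le> val (f x) \<omega>" if x: "x \<in> carrier V" for x
      proof -
        have "AE \<omega>\<in>B1 in M. ereal q \<le> rep (\<alpha> x) \<omega>"
        proof (rule represented_ge[OF x B1])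
          fix g m assume "g \<in> polar M V T K" "m \<in> carrier (L0 M)"
          with no witness have "AE \<omega>\<in>B1 in M. ereal q < rep (?L g m) \<omega>" by blast
          then show "AE \<omega> in M. \<omega> \<in> B1 \<and> val (g x) \<omega> < val m \<omega> \<longrightarrow> ereal q \<le> rep (?L g m) \<omega>"
            by eventually_elim auto
        qed
        with large[OF x] show ?thesis by eventually_elim auto
      qed
      have nonneg: "AE \<omega>\<in>B1 in M. 0 \<le> val (f x) \<omega>" if x: "x \<in> carrier V" for x
      proof -
        have "AE \<omega>\<in>B1 in M. val n \<omega> \<le> real k * val (f x) \<omega>" for k
        proof -
          let ?k = "rvar M (\<lambda>_. real k)"
          have kL: "?k \<in> carrier (L0 M)" by simp
          have "AE \<omega> in M. val ?k \<omega> = real k" by (rule val_rvar) simp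
          moreover have "?k \<odot>\<^bsub>V\<^esub> x \<in> carrier V" using kL x by simp
          note ge[OF this] L0_linear_smult_val[OF dual_linear[OF fD] kL x]
          ultimately show ?thesis by eventually_elim simp
        qed
        then have "AE \<omega> in M. \<forall>k. \<omega> \<in> B1 \<longrightarrow> val n \<omega> \<le> real k * val (f x) \<omega>" unfolding AE_all_countable by blast
        then show ?thesis
        proof eventually_elim
          case (elim \<omega>)
          show ?case
          proof (intro impI, rule ccontr)
            assume \<omega>: "\<omega> \<in> B1" and "\<not> 0 \<le> val (f x) \<omega>"
            then have "0 < - val (f x) \<omega>" by simp
            then obtain k where "- val n \<omega> < real k * - val (f x) \<omega>" using reals_Archimedean3 by blast
            with elim[rule_format, OF \<omega>, of k] show False unfolding mult_minus_right by linarith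
          qed
        qed
      qed
      have zero: "AE \<omega>\<in>B1 in M. val (f x) \<omega> = 0" if x: "x \<in> carrier V" for x
      proof -
        have "\<ominus>\<^bsub>V\<^esub> x \<in> carrier V" using x by simp
        from nonneg[OF x] nonneg[OF this] L0_linear_uminus_val[OF dual_linear[OF fD] x]
        show ?thesis by eventually_elim auto
      qed
      have "AE \<omega>\<in>B1 in M. 0 \<le> rep s \<omega>" by (rule nondegenerate_onD[OF nondeg B1 B1A fD zero])
      with ge[OF M.zero_closed] zero[OF M.zero_closed] have "AE \<omega> in M. \<omega> \<notin> B1"
      proof eventually_elim
        case (elim \<omega>)
        show ?case
        proof
          assume "\<omega> \<in> B1"
          with elim have "val n \<omega> \<le> 0" "0 \<le> rep s \<omega>" "rep s \<omega> < ereal (val n \<omega>)" by (auto simp: B1_def)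
          then have "0 < ereal (val n \<omega>)" by (meson le_less_trans)
          with \<open>val n \<omega> \<le> 0\<close> show False by simp
        qed
      qed
      with B1pos show False by contradiction
    qed
    have [measurable]: "rep (?L g0 t0) \<in> borel_measurable M" by (rule left_measurable[OF min K g0 t0])
    define B2 where "B2 = {\<omega> \<in> space M. \<omega> \<in> B1 \<and> rep (?L g0 t0) \<omega> \<le> ereal q}"
    have B2: "B2 \<in> sets M" "B2 \<subseteq> B1" unfolding B2_def by measurable auto
    have B2pos: "\<not> (AE \<omega> in M. \<omega> \<notin> B2)"
    proof
      assume "AE \<omega> in M. \<omega> \<notin> B2"
      with AE_space have "AE \<omega>\<in>B1 in M. ereal q < rep (?L g0 t0) \<omega>"
        by eventually_elim (auto simp: B2_def)
      with g0t0 show False by contradiction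
    qed
    have g0B2: "AE \<omega>\<in>B in M. rep (?L g0 t0) \<omega> \<le> ereal q" if "B \<subseteq> B2" for B
      using that by (intro AE_I2) (auto simp: B2_def)
    have qL: "AE \<omega>\<in>B1 in M. ereal q < rep (?L f p) \<omega>"
      using left_version_ge[OF R_risk(1)[OF f] L0_barL0[OF p] s] vp rep_val[OF p]
    proof eventually_elim
      case (elim \<omega>)
      show ?case
      proof
        assume "\<omega> \<in> B1"
        with elim have "rep (R f s) \<omega> \<le> rep (?L f p) \<omega>" "ereal q < rep (R f s) \<omega>" by (auto simp: B1_def B0_def)
        then show "ereal q < rep (?L f p) \<omega>" by (rule less_le_trans[rotated])
      qed
    qed
    have o: "\<zero>\<^bsub>dual\<^esub> \<in> polar M V T K" by (rule polar_zero[OF K])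
    \<comment> \<open>The point (0, 1) lies outside the sublevel set, since the risk there dominates
      that of \<open>f\<close> at \<open>p\<close>.\<close>
    have qL0: "AE \<omega>\<in>B2 in M. ereal q < rep (?L \<zero>\<^bsub>dual\<^esub> \<one>\<^bsub>L0 M\<^esub>) \<omega>"
      using risk_le_left_at_zero[OF f p] qL left_version_le[OF R_risk(1,2)[OF f] L0_barL0[OF p]]
    proof eventually_elim
      case (elim \<omega>)
      then show ?case using B2 by (auto dest: less_le_trans)
    qed
    obtain B3 x1 r1 where B3: "B3 \<in> sets M" "B3 \<subseteq> B2" "\<not> (AE \<omega> in M. \<omega> \<notin> B3)" and x1: "x1 \<in> carrier V" "r1 \<in> carrier (L0 M)"
      and neg1: "AE \<omega>\<in>B3 in M. val (\<zero>\<^bsub>dual\<^esub> x1) \<omega> + val r1 \<omega> * val \<one>\<^bsub>L0 M\<^esub> \<omega> < 0"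
      and sep1: "\<And>g t. g \<in> polar M V T K \<Longrightarrow> t \<in> carrier (L0 M) \<Longrightarrow>
        AE \<omega> in M. \<omega> \<in> B3 \<and> rep (?L g t) \<omega> \<le> ereal q \<longrightarrow> 0 \<le> val (g x1) \<omega> + val r1 \<omega> * val t \<omega>"
      by (rule dual_separation[OF min K B2(1) B2pos o R.one_closed qL0 g0 t0 g0B2[OF order_refl]]) (rule that)
    have "AE \<omega>\<in>B3 in M. ereal q < rep (?L f p) \<omega>"
      using qL by eventually_elim (use B2 B3 in auto)
    then obtain B4 x2 r2 where B4: "B4 \<in> sets M" "B4 \<subseteq> B3" "\<not> (AE \<omega> in M. \<omega> \<notin> B4)" and x2: "x2 \<in> carrier V" "r2 \<in> carrier (L0 M)"
      and neg2: "AE \<omega>\<in>B4 in M. val (f x2) \<omega> + val r2 \<omega> * val p \<omega> < 0"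
      and sep2: "\<And>g t. g \<in> polar M V T K \<Longrightarrow> t \<in> carrier (L0 M) \<Longrightarrow>
        AE \<omega> in M. \<omega> \<in> B4 \<and> rep (?L g t) \<omega> \<le> ereal q \<longrightarrow> 0 \<le> val (g x2) \<omega> + val r2 \<omega> * val t \<omega>"
      by (rule dual_separation[OF min K B3(1,3) f p _ g0 t0 g0B2[OF B3(2)]]) (rule that)
    have r1neg: "AE \<omega>\<in>B4 in M. val r1 \<omega> < 0"
      using neg1 val_zero[of M] val_one[of M] unfolding dual_zero_apply[OF x1(1)]
      by eventually_elim (use B4 in auto)
    \<comment> \<open>The left version is increasing, so lowering \<open>t0\<close> keeps the pair
      in the sublevel set. A positive coefficient of the argument would make the functional
      unbounded below there. The coefficient may still be zero.\<close>
    have r2neg: "AE \<omega>\<in>B4 in M. val r2 \<omega> \<le> 0"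
    proof -
      have "AE \<omega>\<in>B4 in M. real k * val r2 \<omega> \<le> val (g0 x2) \<omega> + val r2 \<omega> * val t0 \<omega>" for k
      proof -
        let ?t = "rvar M (\<lambda>\<omega>. val t0 \<omega> - real k)"
        have tm: "(\<lambda>\<omega>. val t0 \<omega> - real k) \<in> borel_measurable M" using t0 by simp
        have t: "?t \<in> carrier (L0 M)" using tm by simp
        have "AE \<omega>\<in>B4 in M. rep (?L g0 ?t) \<omega> \<le> rep (?L g0 t0) \<omega>"
        proof (rule left_mono_on[OF min K g0 g0 t t0 B4(1)])
          show "AE \<omega>\<in>B4 in M. val ?t \<omega> \<le> val t0 \<omega>" using val_rvar[OF tm] by eventually_elim simp
        qed simp
        moreover have "AE \<omega>\<in>B4 in M. rep (?L g0 t0) \<omega> \<le> ereal q" by (rule g0B2) (use B3 B4 in auto)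
        moreover note sep2[OF g0 t] val_rvar[OF tm]
        ultimately show ?thesis
        proof eventually_elim
          case (elim \<omega>)
          show ?case
          proof
            assume "\<omega> \<in> B4"
            with elim have "0 \<le> val (g0 x2) \<omega> + val r2 \<omega> * (val t0 \<omega> - real k)" by (auto intro: order_trans)
            then show "real k * val r2 \<omega> \<le> val (g0 x2) \<omega> + val r2 \<omega> * val t0 \<omega>" by (simp add: algebra_simps)
          qed
        qed
      qed
      then have "AE \<omega> in M. \<forall>k. \<omega> \<in> B4 \<longrightarrow> real k * val r2 \<omega> \<le> val (g0 x2) \<omega> + val r2 \<omega> * val t0 \<omega>"
        unfolding AE_all_countable by blast
      then show ?thesis
      proof eventually_elim
        case (elim \<omega>)
        show ?case
        proof (intro impI, rule ccontr)
          assume \<omega>: "\<omega> \<in> B4" and "\<not> val r2 \<omega> \<le> 0"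
          then obtain k where "val (g0 x2) \<omega> + val r2 \<omega> * val t0 \<omega> < real k * val r2 \<omega>"
            using reals_Archimedean3[of "val r2 \<omega>"] by auto
          with elim \<omega> show False by (auto simp: not_less[symmetric])
        qed
      qed
    qed
    have [measurable]: "val (f x1) \<in> borel_measurable M" "val (f x2) \<in> borel_measurable M" "val r1 \<in> borel_measurable M"
      "val r2 \<in> borel_measurable M" "val p \<in> borel_measurable M" "B4 \<in> sets M"
      using fD x1 x2 p B4 by auto
    let ?F1 = "\<lambda>\<omega>. val (f x1) \<omega> + val r1 \<omega> * val p \<omega>" and ?F2 = "\<lambda>\<omega>. val (f x2) \<omega> + val r2 \<omega> * val p \<omega>"
    \<comment> \<open>So small that adding this multiple of the first functional keeps the value at
      \<open>(f, p)\<close> negative, whatever the sign of \<open>?F1\<close>. Being positive, it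
      also makes the combined coefficient \<open>?r\<close> strictly negative.\<close>
    let ?e = "\<lambda>\<omega>. if ?F2 \<omega> < 0 then - ?F2 \<omega> / (1 + \<bar>?F1 \<omega>\<bar>) else 1"
    have em: "?e \<in> borel_measurable M" by measurable
    define \<epsilon> where "\<epsilon> = rvar M ?e"
    have \<epsilon>: "\<epsilon> \<in> carrier (L0 M)" unfolding \<epsilon>_def using em by simp
    have v\<epsilon>: "AE \<omega> in M. val \<epsilon> \<omega> = ?e \<omega>" unfolding \<epsilon>_def by (rule val_rvar[OF em])
    let ?r = "\<lambda>\<omega>. val r2 \<omega> + val \<epsilon> \<omega> * val r1 \<omega>"
    have [measurable]: "val \<epsilon> \<in> borel_measurable M" using \<epsilon> by simp
    have key: "AE \<omega>\<in>B4 in M. 0 < val \<epsilon> \<omega> \<and> ?F2 \<omega> + val \<epsilon> \<omega> * ?F1 \<omega> < 0 \<and> ?r \<omega> < 0"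
      using v\<epsilon> neg2 r1neg r2neg
    proof eventually_elim
      case (elim \<omega>)
      show ?case
      proof
        assume "\<omega> \<in> B4"
        with elim have *: "?F2 \<omega> < 0" "val r1 \<omega> < 0" "val r2 \<omega> \<le> 0" "val \<epsilon> \<omega> = - ?F2 \<omega> / (1 + \<bar>?F1 \<omega>\<bar>)" by auto
        have pos: "0 < val \<epsilon> \<omega>" unfolding *(4) using *(1) by (intro divide_pos_pos) auto
        have "val \<epsilon> \<omega> * ?F1 \<omega> < val \<epsilon> \<omega> * (1 + \<bar>?F1 \<omega>\<bar>)" using pos by (intro mult_strict_left_mono) auto
        also have "\<dots> = - ?F2 \<omega>" unfolding *(4) by simp
        finally have "?F2 \<omega> + val \<epsilon> \<omega> * ?F1 \<omega> < 0" by simp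
        moreover have "val \<epsilon> \<omega> * val r1 \<omega> < 0" using pos *(2) by (rule mult_pos_neg)
        then have "?r \<omega> < 0" using *(3) by simp
        ultimately show "0 < val \<epsilon> \<omega> \<and> ?F2 \<omega> + val \<epsilon> \<omega> * ?F1 \<omega> < 0 \<and> ?r \<omega> < 0" using pos by simp
      qed
    qed
    have km: "(\<lambda>\<omega>. - 1 / ?r \<omega>) \<in> borel_measurable M" by measurable
    \<comment> \<open>Normalizes the coefficient of the argument to -1, so that on the sublevel set
      the condition reads \<open>g ?x \<ge> t\<close>.\<close>
    define k where "k = rvar M (\<lambda>\<omega>. - 1 / ?r \<omega>)"
    have k: "k \<in> carrier (L0 M)" unfolding k_def using km by simp
    have vk: "AE \<omega> in M. val k \<omega> = - 1 / ?r \<omega>" unfolding k_def by (rule val_rvar[OF km])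
    let ?x = "k \<odot>\<^bsub>V\<^esub> (x2 \<oplus>\<^bsub>V\<^esub> \<epsilon> \<odot>\<^bsub>V\<^esub> x1)"
    have x: "?x \<in> carrier V" "x2 \<oplus>\<^bsub>V\<^esub> \<epsilon> \<odot>\<^bsub>V\<^esub> x1 \<in> carrier V" "\<epsilon> \<odot>\<^bsub>V\<^esub> x1 \<in> carrier V" using k \<epsilon> x1 x2 by auto
    have vx: "AE \<omega> in M. val (g ?x) \<omega> = (val (g x2) \<omega> + val \<epsilon> \<omega> * val (g x1) \<omega>) / (- ?r \<omega>)" if g: "g \<in> polar M V T K" for g
    proof -
      note lin = dual_linear[OF polar_dual[OF g]]
      from L0_linear_smult_val[OF lin k x(2)] L0_linear_add_val[OF lin x2(1) x(3)] L0_linear_smult_val[OF lin \<epsilon> x1(1)] vk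
      show ?thesis by eventually_elim (simp only: minus_divide_left[symmetric] minus_divide_right[symmetric] mult_minus_left mult_1_left times_divide_eq_left)
    qed
    \<comment> \<open>A pair with left version below \<open>q\<close> satisfies
      \<open>m \<le> g ?x\<close>, so every \<open>m\<close> above \<open>g ?x\<close> has left
      version at least \<open>q\<close>. Yet \<open>f ?x\<close> is below \<open>p\<close> and hence
      below \<open>n\<close>, against \<open>large\<close>.\<close>
    have "AE \<omega>\<in>B4 in M. ereal q \<le> rep (\<alpha> ?x) \<omega>"
    proof (rule represented_ge[OF x(1) B4(1)])
      fix g m assume g: "g \<in> polar M V T K" and m: "m \<in> carrier (L0 M)"
      from vx[OF g] sep1[OF g m] sep2[OF g m] key
      show "AE \<omega> in M. \<omega> \<in> B4 \<and> val (g ?x) \<omega> < val m \<omega> \<longrightarrow> ereal q \<le> rep (?L g m) \<omega>"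
      proof eventually_elim
        case (elim \<omega>)
        show ?case
        proof (intro impI, rule ccontr)
          assume \<omega>: "\<omega> \<in> B4 \<and> val (g ?x) \<omega> < val m \<omega>" and "\<not> ereal q \<le> rep (?L g m) \<omega>"
          with elim B4 have *: "0 \<le> val (g x1) \<omega> + val r1 \<omega> * val m \<omega>" "0 \<le> val (g x2) \<omega> + val r2 \<omega> * val m \<omega>"
            "0 < val \<epsilon> \<omega>" "?r \<omega> < 0" by auto
          then have "0 \<le> (val (g x2) \<omega> + val r2 \<omega> * val m \<omega>) + val \<epsilon> \<omega> * (val (g x1) \<omega> + val r1 \<omega> * val m \<omega>)"
            by (simp only: add_nonneg_nonneg mult_nonneg_nonneg less_imp_le)
          then have "val m \<omega> * (- ?r \<omega>) \<le> val (g x2) \<omega> + val \<epsilon> \<omega> * val (g x1) \<omega>" by (simp add: algebra_simps)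
          then have "val m \<omega> \<le> val (g ?x) \<omega>" unfolding elim(1) using *(4) by (subst pos_le_divide_eq) auto
          with \<omega> show False by simp
        qed
      qed
    qed
    with large[OF x(1)] vx[OF f] key vp have "AE \<omega> in M. \<omega> \<notin> B4"
    proof eventually_elim
      case (elim \<omega>)
      show ?case
      proof
        assume \<omega>: "\<omega> \<in> B4"
        then have "\<omega> \<in> B1" using B4 B3 B2 by auto
        with elim \<omega> have *: "val n \<omega> \<le> val (f ?x) \<omega>" "?F2 \<omega> + val \<epsilon> \<omega> * ?F1 \<omega> < 0" "?r \<omega> < 0" "val p \<omega> < val n \<omega>" by auto
        then have "val (f x2) \<omega> + val \<epsilon> \<omega> * val (f x1) \<omega> < val p \<omega> * (- ?r \<omega>)" by (simp add: algebra_simps)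
        then have "val (f ?x) \<omega> < val p \<omega>" unfolding elim(2) using *(3) by (subst pos_divide_less_eq) auto
        with *(1,4) show False by simp
      qed
    qed
    with B4(3) show False by contradiction
  qed
  then have "AE \<omega> in M. (if \<omega> \<in> A then rep (R f s) \<omega> else 0) \<le> (if \<omega> \<in> A then rep (minimal_risk M V \<alpha> f s) \<omega> else 0)"
    by (rule AE_le_if_Rats)
  then show ?thesis by eventually_elim auto
qed

text \<open>The product with the indicator expresses equality on \<open>A\<close> also for infinite
  values, since 0 times infinity is 0.\<close>

theorem minimal_risk_unique:
  assumes f: "f \<in> polar M V T K" and s: "s \<in> carrier (barL0 M)" and A: "A \<in> sets M"
    and nondeg: "nondegenerate_on M V T A f s"
  shows "ind M A \<otimes>\<^bsub>L0 M\<^esub> R f s = ind M A \<otimes>\<^bsub>L0 M\<^esub> minimal_risk M V \<alpha> f s"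
proof (rule barL0_eqI[where M=M])
  have c: "ind M A \<in> carrier (barL0 M)" "R f s \<in> carrier (barL0 M)" "minimal_risk M V \<alpha> f s \<in> carrier (barL0 M)"
    using A R_risk(3)[OF f s] minimal_risk_carrier[OF represented_index polar_dual[OF f] s] by (auto intro: L0_barL0)
  then show "ind M A \<otimes>\<^bsub>L0 M\<^esub> R f s \<in> carrier (barL0 M)" "ind M A \<otimes>\<^bsub>L0 M\<^esub> minimal_risk M V \<alpha> f s \<in> carrier (barL0 M)"
    by auto
  from rep_mult[OF c(1,2)] rep_mult[OF c(1,3)] rep_ind[OF A] minimal_risk_le_represented[OF f s]
    represented_le_minimal_risk[OF f s A nondeg]
  show "AE \<omega> in M. rep (ind M A \<otimes>\<^bsub>L0 M\<^esub> R f s) \<omega> = rep (ind M A \<otimes>\<^bsub>L0 M\<^esub> minimal_risk M V \<alpha> f s) \<omega>"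
  proof eventually_elim
    case (elim \<omega>)
    then show ?case by (cases "\<omega> \<in> A") auto
  qed
qed

end

end

theorem theorem2p12:
  fixes M :: "'w measure"
    and V :: "('w rv, 'x, 'e) module_scheme"
    and T :: "'x topology"
    and K :: "'x set"
  assumes "sigma_stable_module M V T"
    and "closed_L0_convex_cone M V T K"
  shows
    "(has_sigma_stable_base M V T \<longrightarrow>
       (\<forall>\<alpha>. assessment_index M V K \<alpha> \<and> upper_semicont M T \<alpha> \<longrightarrow>
         (\<exists>R. minimal_risk_function M V T K R \<and>
           (\<forall>x\<in>carrier V. \<alpha> x = robust_index M V T K R x) \<and>
           (\<forall>R'. minimal_risk_function M V T K R' \<and>
              (\<forall>x\<in>carrier V. \<alpha> x = robust_index M V T K R' x) \<longrightarrow>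
              (\<forall>f\<in>polar M V T K. \<forall>s\<in>carrier (barL0 M). \<forall>A\<in>sets M.
                 nondegenerate_on M V T A f s \<longrightarrow>
                 ind M A \<otimes>\<^bsub>L0 M\<^esub> R' f s = ind M A \<otimes>\<^bsub>L0 M\<^esub> R f s))))) \<and>
     (\<forall>R. risk_function M V T K R \<longrightarrow>
        assessment_index M V K (robust_index M V T K R) \<and>
        upper_semicont M T (robust_index M V T K R))"
proof (intro conjI impI allI)
  interpret sigma_stable_module M V T by (rule assms(1))
  have K: "K \<subseteq> carrier V" using assms(2) by (auto simp: closed_L0_convex_cone_def L0_convex_def)
  fix \<alpha> assume base: "has_sigma_stable_base M V T" and "assessment_index M V K \<alpha> \<and> upper_semicont M T \<alpha>"
  then have index: "assessment_index M V K \<alpha>" and usc: "upper_semicont M T \<alpha>" by auto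
  show "\<exists>R. minimal_risk_function M V T K R \<and>
           (\<forall>x\<in>carrier V. \<alpha> x = robust_index M V T K R x) \<and>
           (\<forall>R'. minimal_risk_function M V T K R' \<and>
              (\<forall>x\<in>carrier V. \<alpha> x = robust_index M V T K R' x) \<longrightarrow>
              (\<forall>f\<in>polar M V T K. \<forall>s\<in>carrier (barL0 M). \<forall>A\<in>sets M.
                 nondegenerate_on M V T A f s \<longrightarrow>
                 ind M A \<otimes>\<^bsub>L0 M\<^esub> R' f s = ind M A \<otimes>\<^bsub>L0 M\<^esub> R f s))"
  proof (intro exI[of _ "minimal_risk M V \<alpha>"] conjI ballI allI impI)
    show "minimal_risk_function M V T K (minimal_risk M V \<alpha>)"
      using index by (intro minimal_risk_function_minimal_risk[OF _ K]) (simp add: assessment_index_def)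
    show "\<alpha> x = robust_index M V T K (minimal_risk M V \<alpha>) x" if "x \<in> carrier V" for x
      by (rule robust_representation[OF assms(2) index base usc that])
    fix R' f s A assume "minimal_risk_function M V T K R' \<and> (\<forall>x\<in>carrier V. \<alpha> x = robust_index M V T K R' x)"
      and "f \<in> polar M V T K" "s \<in> carrier (barL0 M)" "A \<in> sets M" "nondegenerate_on M V T A f s"
    then show "ind M A \<otimes>\<^bsub>L0 M\<^esub> R' f s = ind M A \<otimes>\<^bsub>L0 M\<^esub> minimal_risk M V \<alpha> f s"
      by (intro minimal_risk_unique[OF _ K]) auto
  qed
next
  interpret sigma_stable_module M V T by (rule assms(1))
  have K: "K \<subseteq> carrier V" using assms(2) by (auto simp: closed_L0_convex_cone_def L0_convex_def)
  fix R assume R: "risk_function M V T K R"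
  show "assessment_index M V K (robust_index M V T K R)" by (rule assessment_index_robust[OF R K])
  show "upper_semicont M T (robust_index M V T K R)" by (rule upper_semicont_robust[OF R K])
qed

end
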